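(* Let $z\in\mathbb{Q}(\sqrt{\Delta})$ have input length $\ell$, and suppose $\mu=O(\sqrt{|\Delta|})$. For any $\delta\geq2$, the continued fraction algorithm can be executed in $O(\sqrt{|\Delta|}\log|\Delta|\log\delta)$ operations on integers of length $O(\ell+\log\delta|\Delta|)$ to find $p,q\in\mathcal{O}$ with $q\neq0$ and $|qz-p|\leq1/\delta$.
   Context: Let $\mathcal{O}=\mathbb{Z}[\tau]$ be the ring of discriminant $\Delta$ in an imaginary quadratic field $K$. An ideal is reduced if it is integral and has minimal norm among integral ideals in its class; $D(z,r)$ is the closed disc of radius $r$ centered at $z$. A nonempty finite $B\subset\mathcal{O}\setminus\{0\}$ is admissible with $\varepsilon\in(0,1)$ if for every reduced ideal $\mathfrak{b}$ with $\mathfrak{b}\cap B\neq\emptyset$, $\mathbb{C}=\bigcup D(a/b,\varepsilon/|b|)$ over $a\in\mathfrak{b}^{-1}$, $b\in\mathfrak{b}\cap B$ with $(a\mathfrak{b},b/\mathfrak{b})$ reduced. Fix such $B,\varepsilon$ and let $\mu=\max_{b\in B}|b|$. Let $S(a,b)=\begin{bmatrix}a&1\\ b&0\end{bmatrix}$, $(M)_1$ the ideal generated by the first-column entries of $M$; matrices act as Möbius transformations. Given $z\in\mathbb{C}$, the continued fraction algorithm sets $M_0=I$, $b_0=1$, and for $n\ge1$ chooses $b_n\in B$ and $a_n\in\mathcal{O}\cap D(b_nM_{n-1}^{-1}(z),\varepsilon|b_{n-1}|)$ with $(M_{n-1}S(a_n/b_{n-1},b_n/b_{n-1}))_1$ reduced,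 sets $M_n=M_{n-1}S(a_n/b_{n-1},b_n/b_{n-1})$, and outputs the left-column entries $p_n,q_n$ of $M_n$. "Can be executed" means that the suitable $a$ for each $b\in B$ are found via lattice reduction rather than exhaustive search. *)

theory Defs
  imports "HOL-Analysis.Analysis" "HOL-Library.Log_Nat"
begin

section \<open>The imaginary quadratic ring of discriminant \<open>\<Delta>\<close> and its ideals\<close>

definition imag_quad_discriminant :: "int \<Rightarrow> bool" where
  "imag_quad_discriminant \<Delta> \<longleftrightarrow> \<Delta> < 0 \<and> (\<Delta> mod 4 = 0 \<or> \<Delta> mod 4 = 1)"

definition tau :: "int \<Rightarrow> complex" where
  "tau \<Delta> = (of_int \<Delta> + csqrt (of_int \<Delta>)) / 2"

fun elt :: "int \<Rightarrow> int \<times> int \<Rightarrow> complex" where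
  "elt \<Delta> (u, v) = of_int u + of_int v * tau \<Delta>"

definition quad_ring :: "int \<Rightarrow> complex set" where
  "quad_ring \<Delta> = range (elt \<Delta>)"

definition quad_field :: "int \<Rightarrow> complex set" where
  "quad_field \<Delta> = {of_rat r + of_rat s * csqrt (of_int \<Delta>) | r s. True}"

definition submodule :: "int \<Rightarrow> complex set \<Rightarrow> bool" where
  "submodule \<Delta> I \<longleftrightarrow> 0 \<in> I \<and> (\<forall>x\<in>I. \<forall>y\<in>I. x + y \<in> I) \<and> (\<forall>r\<in>quad_ring \<Delta>. \<forall>x\<in>I. r * x \<in> I)"

definition fractional_ideal :: "int \<Rightarrow> complex set \<Rightarrow> bool" where
  "fractional_ideal \<Delta> I \<longleftrightarrow> submodule \<Delta> I \<and> I \<noteq> {0} \<and>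
     (\<exists>d\<in>quad_ring \<Delta> - {0}. \<forall>x\<in>I. d * x \<in> quad_ring \<Delta>)"

definition ideal_inverse :: "int \<Rightarrow> complex set \<Rightarrow> complex set" where
  "ideal_inverse \<Delta> I = {x. \<forall>y\<in>I. x * y \<in> quad_ring \<Delta>}"

definition ideal_product :: "int \<Rightarrow> complex set \<Rightarrow> complex set \<Rightarrow> complex set" where
  "ideal_product \<Delta> I J = submodule \<Delta> hull {x * y | x y. x \<in> I \<and> y \<in> J}"

definition invertible_ideal :: "int \<Rightarrow> complex set \<Rightarrow> bool" where
  "invertible_ideal \<Delta> I \<longleftrightarrow> fractional_ideal \<Delta> I \<and>
     ideal_product \<Delta> I (ideal_inverse \<Delta> I) = quad_ring \<Delta>"

definition same_class :: "int \<Rightarrow> complex set \<Rightarrow> complex set \<Rightarrow> bool" where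
  "same_class \<Delta> I J \<longleftrightarrow> (\<exists>x\<in>quad_field \<Delta> - {0}. J = (*) x ` I)"

definition integral_ideal :: "int \<Rightarrow> complex set \<Rightarrow> bool" where
  "integral_ideal \<Delta> I \<longleftrightarrow> fractional_ideal \<Delta> I \<and> I \<subseteq> quad_ring \<Delta>"

text \<open>The number of cosets of \<open>I\<close> in the ring; used for integral ideals only.\<close>

definition ideal_norm :: "int \<Rightarrow> complex set \<Rightarrow> nat" where
  "ideal_norm \<Delta> I = card ((\<lambda>x. (+) x ` I) ` quad_ring \<Delta>)"

text \<open>Ideal classes are elements of the class group, so ideals are taken to be invertible. This is
  automatic in a maximal order, and is a genuine restriction only if \<open>\<Delta>\<close> is not fundamental.\<close>

definition reduced_ideal :: "int \<Rightarrow> complex set \<Rightarrow> bool" where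
  "reduced_ideal \<Delta> I \<longleftrightarrow> invertible_ideal \<Delta> I \<and> integral_ideal \<Delta> I \<and>
     (\<forall>J. integral_ideal \<Delta> J \<and> same_class \<Delta> I J \<longrightarrow> ideal_norm \<Delta> I \<le> ideal_norm \<Delta> J)"

definition admissible :: "int \<Rightarrow> complex set \<Rightarrow> real \<Rightarrow> bool" where
  "admissible \<Delta> B \<epsilon> \<longleftrightarrow>
     finite B \<and> B \<noteq> {} \<and> B \<subseteq> quad_ring \<Delta> - {0} \<and> 0 < \<epsilon> \<and> \<epsilon> < 1 \<and>
     (\<forall>I. reduced_ideal \<Delta> I \<and> I \<inter> B \<noteq> {} \<longrightarrow>
        (\<Union>(a, b) \<in> {(a, b). a \<in> ideal_inverse \<Delta> I \<and> b \<in> I \<inter> B \<and>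
             reduced_ideal \<Delta> (submodule \<Delta> hull ((*) a ` I \<union> (*) b ` ideal_inverse \<Delta> I))}.
           cball (a / b) (\<epsilon> / cmod b)) = UNIV)"

section \<open>The continued fraction algorithm\<close>

definition S_mat :: "complex \<Rightarrow> complex \<Rightarrow> complex^2^2" where
  "S_mat a b = vector [vector [a, 1], vector [b, 0]]"

definition column_ideal :: "int \<Rightarrow> complex^2^2 \<Rightarrow> complex set" where
  "column_ideal \<Delta> M = submodule \<Delta> hull {M $ 1 $ 1, M $ 2 $ 1}"

text \<open>\<open>moebius_act M z\<close> is the value of the Moebius transformation only if \<open>\<not> moebius_pole M z\<close>;
  at a pole the transformation takes the value infinity.\<close>

definition moebius_act :: "complex^2^2 \<Rightarrow> complex \<Rightarrow> complex" where
  "moebius_act M = moebius (M $ 1 $ 1) (M $ 1 $ 2) (M $ 2 $ 1) (M $ 2 $ 2)"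

definition moebius_pole :: "complex^2^2 \<Rightarrow> complex \<Rightarrow> bool" where
  "moebius_pole M z \<longleftrightarrow> M $ 2 $ 1 * z + M $ 2 $ 2 = 0"

primrec cf_mat :: "(nat \<Rightarrow> complex) \<Rightarrow> (nat \<Rightarrow> complex) \<Rightarrow> nat \<Rightarrow> complex^2^2" where
  "cf_mat a b 0 = mat 1"
| "cf_mat a b (Suc n) = cf_mat a b n ** S_mat (a (Suc n) / b n) (b (Suc n) / b n)"

definition cf_p :: "(nat \<Rightarrow> complex) \<Rightarrow> (nat \<Rightarrow> complex) \<Rightarrow> nat \<Rightarrow> complex" where
  "cf_p a b n = cf_mat a b n $ 1 $ 1"

definition cf_q :: "(nat \<Rightarrow> complex) \<Rightarrow> (nat \<Rightarrow> complex) \<Rightarrow> nat \<Rightarrow> complex" where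
  "cf_q a b n = cf_mat a b n $ 2 $ 1"

text \<open>The choices \<open>a 1, b 1, \<dots>, a N, b N\<close> are legal for the first \<open>N\<close> steps of the algorithm on
  input \<open>z\<close>. A further step is possible only while \<open>M\<^sub>n\<inverse>(z)\<close> is finite.\<close>

definition cf_run ::
  "int \<Rightarrow> complex set \<Rightarrow> real \<Rightarrow> complex \<Rightarrow> nat \<Rightarrow> (nat \<Rightarrow> complex) \<Rightarrow> (nat \<Rightarrow> complex) \<Rightarrow> bool" where
  "cf_run \<Delta> B \<epsilon> z N a b \<longleftrightarrow> b 0 = 1 \<and>
     (\<forall>n<N. \<not> moebius_pole (matrix_inv (cf_mat a b n)) z \<and>
        b (Suc n) \<in> B \<and>
        a (Suc n) \<in> quad_ring \<Delta> \<inter>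
          cball (b (Suc n) * moebius_act (matrix_inv (cf_mat a b n)) z) (\<epsilon> * cmod (b n)) \<and>
        reduced_ideal \<Delta> (column_ideal \<Delta> (cf_mat a b (Suc n))))"

section \<open>Programs operating on integers\<close>

text \<open>Deterministic while-programs over finitely many integer variables, with random access to a
  read-only input sequence and a write-only output sequence. \<open>Div\<close> is floor division.\<close>

datatype expr =
    Const int
  | Var string
  | Input expr
  | Add expr expr
  | Sub expr expr
  | Mul expr expr
  | Div expr expr

datatype prog =
    Skip
  | Assign string expr
  | Output expr
  | Seq prog prog
  | IfLe expr expr prog prog
  | WhileLe expr expr prog

type_synonym store = "string \<Rightarrow> int"

definition read_input :: "int list \<Rightarrow> int \<Rightarrow> int" where
  "read_input inp i = (if 0 \<le> i \<and> i < int (length inp) then inp ! nat i else 0)"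

primrec eval_expr :: "int list \<Rightarrow> store \<Rightarrow> expr \<Rightarrow> int" where
  "eval_expr inp s (Const c) = c"
| "eval_expr inp s (Var x) = s x"
| "eval_expr inp s (Input e) = read_input inp (eval_expr inp s e)"
| "eval_expr inp s (Add e f) = eval_expr inp s e + eval_expr inp s f"
| "eval_expr inp s (Sub e f) = eval_expr inp s e - eval_expr inp s f"
| "eval_expr inp s (Mul e f) = eval_expr inp s e * eval_expr inp s f"
| "eval_expr inp s (Div e f) = eval_expr inp s e div eval_expr inp s f"

primrec subexprs :: "expr \<Rightarrow> expr set" where
  "subexprs (Const c) = {Const c}"
| "subexprs (Var x) = {Var x}"
| "subexprs (Input e) = insert (Input e) (subexprs e)"
| "subexprs (Add e f) = insert (Add e f) (subexprs e \<union> subexprs f)"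
| "subexprs (Sub e f) = insert (Sub e f) (subexprs e \<union> subexprs f)"
| "subexprs (Mul e f) = insert (Mul e f) (subexprs e \<union> subexprs f)"
| "subexprs (Div e f) = insert (Div e f) (subexprs e \<union> subexprs f)"

primrec expr_cost :: "expr \<Rightarrow> nat" where
  "expr_cost (Const c) = 1"
| "expr_cost (Var x) = 1"
| "expr_cost (Input e) = 1 + expr_cost e"
| "expr_cost (Add e f) = 1 + expr_cost e + expr_cost f"
| "expr_cost (Sub e f) = 1 + expr_cost e + expr_cost f"
| "expr_cost (Mul e f) = 1 + expr_cost e + expr_cost f"
| "expr_cost (Div e f) = 1 + expr_cost e + expr_cost f"

definition int_length :: "int \<Rightarrow> nat" where
  "int_length k = nat (bitlen \<bar>k\<bar>) + 1"

definition within_length :: "real \<Rightarrow> int list \<Rightarrow> store \<Rightarrow> expr \<Rightarrow> bool" where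
  "within_length L inp s e \<longleftrightarrow> (\<forall>f\<in>subexprs e. real (int_length (eval_expr inp s f)) \<le> L)"

text \<open>\<open>exec L inp c s k out t\<close>: on input \<open>inp\<close>, the program \<open>c\<close> started in store \<open>s\<close> halts in store \<open>t\<close>
  after \<open>k\<close> operations, having written \<open>out\<close>, and every integer occurring on the way has length at
  most \<open>L\<close>.\<close>

inductive exec :: "real \<Rightarrow> int list \<Rightarrow> prog \<Rightarrow> store \<Rightarrow> nat \<Rightarrow> int list \<Rightarrow> store \<Rightarrow> bool"
  for L :: real and inp :: "int list" where
  Skip: "exec L inp Skip s 1 [] s"
| Assign: "within_length L inp s e \<Longrightarrow>
    exec L inp (Assign x e) s (1 + expr_cost e) [] (s(x := eval_expr inp s e))"
| Output: "within_length L inp s e \<Longrightarrow>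
    exec L inp (Output e) s (1 + expr_cost e) [eval_expr inp s e] s"
| Seq: "exec L inp c s k out t \<Longrightarrow> exec L inp d t k' out' u \<Longrightarrow>
    exec L inp (Seq c d) s (k + k') (out @ out') u"
| IfTrue: "within_length L inp s e \<Longrightarrow> within_length L inp s f \<Longrightarrow>
    eval_expr inp s e \<le> eval_expr inp s f \<Longrightarrow> exec L inp c s k out t \<Longrightarrow>
    exec L inp (IfLe e f c d) s (1 + expr_cost e + expr_cost f + k) out t"
| IfFalse: "within_length L inp s e \<Longrightarrow> within_length L inp s f \<Longrightarrow>
    \<not> eval_expr inp s e \<le> eval_expr inp s f \<Longrightarrow> exec L inp d s k out t \<Longrightarrow>
    exec L inp (IfLe e f c d) s (1 + expr_cost e + expr_cost f + k) out t"
| WhileFalse: "within_length L inp s e \<Longrightarrow> within_length L inp s f \<Longrightarrow>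
    \<not> eval_expr inp s e \<le> eval_expr inp s f \<Longrightarrow>
    exec L inp (WhileLe e f c) s (1 + expr_cost e + expr_cost f) [] s"
| WhileTrue: "within_length L inp s e \<Longrightarrow> within_length L inp s f \<Longrightarrow>
    eval_expr inp s e \<le> eval_expr inp s f \<Longrightarrow>
    exec L inp c s k out t \<Longrightarrow> exec L inp (WhileLe e f c) t k' out' u \<Longrightarrow>
    exec L inp (WhileLe e f c) s (1 + expr_cost e + expr_cost f + k + k') (out @ out') u"

definition flatten :: "(int \<times> int) list \<Rightarrow> int list" where
  "flatten ps = concat (map (\<lambda>(u, v). [u, v]) ps)"

text \<open>The input for \<open>z = (x + y \<surd>\<Delta>) / w\<close>, a bound \<open>\<delta>\<close> and a set \<open>B\<close> enumerated by \<open>bs\<close> in coordinates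
  with respect to \<open>1, \<tau>\<close>. A real \<open>\<delta>\<close> is passed as \<open>\<lceil>\<delta>\<rceil>\<close>, which has length \<open>O(log \<delta>)\<close>.\<close>

definition cf_input :: "int \<Rightarrow> (int \<times> int) list \<Rightarrow> int \<Rightarrow> int \<Rightarrow> int \<Rightarrow> real \<Rightarrow> int list" where
  "cf_input \<Delta> bs x y w \<delta> = [\<Delta>, x, y, w, \<lceil>\<delta>\<rceil>, int (length bs)] @ flatten bs"

end

theory Submission
  imports Defs
begin

text \<open>
  Write \<open>e\<^sub>n = q\<^sub>n z - p\<^sub>n\<close>. A legal step satisfies \<open>|e\<^sub>n\<^sub>+\<^sub>1| \<le> \<epsilon> |e\<^sub>n|\<close>, and admissibility provides one whenever
  \<open>e\<^sub>n \<noteq> 0\<close>: since \<open>\<bb> = (p\<^sub>n, q\<^sub>n)\<close> is invertible there are \<open>r, s \<in> \<bb>\<inverse>\<close> with \<open>p\<^sub>n s - q\<^sub>n r = 1\<close>, and a pair \<open>(a, b)\<close>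
  from the covering property yields the column \<open>a (p\<^sub>n, q\<^sub>n) + b (r, s)\<close>, which generates \<open>(a \<bb>, b \<bb>\<inverse>)\<close>. Hence
  \<open>O(log \<delta>)\<close> steps suffice, and \<open>p\<^sub>n q\<^sub>n\<^sub>-\<^sub>1 - q\<^sub>n p\<^sub>n\<^sub>-\<^sub>1 = \<plusminus>b\<^sub>n\<close> bounds \<open>|q\<^sub>n|\<close> by \<open>O(\<mu> / |e\<^sub>n\<^sub>-\<^sub>1|)\<close>.

  The program does not know \<open>\<epsilon>\<close>; it takes the legal successor of least error. The columns with
  a given \<open>b\<close> form a coset of \<open>\<bb>\<inverse> (p\<^sub>n, q\<^sub>n)\<close>, and \<open>\<bb>\<close> being reduced means that \<open>1\<close> is a shortest vector of
  \<open>\<bb>\<inverse>\<close>, so at most 16 of them have smaller error than \<open>e\<^sub>n\<close>. The basis of \<open>\<bb>\<close>, the lift of its elements to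
  columns, and the test whether a candidate ideal is reduced only depend on the columns modulo
  \<open>b\<^sub>n\<close>; Euclid's algorithm modulo the norm of \<open>b\<^sub>n\<close> therefore needs \<open>O(log |\<Delta>|)\<close> operations. As \<open>B\<close> has \<open>O(\<surd>|\<Delta>|)\<close>
  elements, this gives the bound on the number of operations.
\<close>

section \<open>Arithmetic of the quadratic ring\<close>

definition tau_norm :: "int \<Rightarrow> int" where
  "tau_norm D = (D * D - D) div 4"

fun qmul :: "int \<Rightarrow> int \<times> int \<Rightarrow> int \<times> int \<Rightarrow> int \<times> int" where
  "qmul D (a, b) (c, d) = (a * c - b * d * tau_norm D, a * d + b * c + b * d * D)"

fun qconj :: "int \<Rightarrow> int \<times> int \<Rightarrow> int \<times> int" where
  "qconj D (a, b) = (a + b * D, - b)"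

fun qnorm :: "int \<Rightarrow> int \<times> int \<Rightarrow> int" where
  "qnorm D (a, b) = a * a + a * b * D + b * b * tau_norm D"

fun qsc :: "int \<Rightarrow> int \<times> int \<Rightarrow> int \<times> int" where
  "qsc k (a, b) = (k * a, k * b)"

fun qdiv :: "int \<times> int \<Rightarrow> int \<Rightarrow> int \<times> int" where
  "qdiv (a, b) k = (a div k, b div k)"

definition zspan :: "complex \<Rightarrow> complex \<Rightarrow> complex set" where
  "zspan x y = {of_int i * x + of_int j * y | i j. True}"

lemma zspanI: "z = of_int i * x + of_int j * y \<Longrightarrow> z \<in> zspan x y"
  unfolding zspan_def by blast

lemma zspanE: "z \<in> zspan x y \<Longrightarrow> (\<And>i j. z = of_int i * x + of_int j * y \<Longrightarrow> P) \<Longrightarrow> P"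
  unfolding zspan_def by blast

lemma zspan_left: "x \<in> zspan x y"
  by (rule zspanI[of _ 1 _ 0]) simp

lemma zspan_right: "y \<in> zspan x y"
  by (rule zspanI[of _ 0 _ 1]) simp

lemma zspan_add: "u \<in> zspan x y \<Longrightarrow> v \<in> zspan x y \<Longrightarrow> u + v \<in> zspan x y"
proof -
  assume "u \<in> zspan x y" "v \<in> zspan x y"
  then obtain i j k l where "u = of_int i * x + of_int j * y" "v = of_int k * x + of_int l * y"
    unfolding zspan_def by blast
  then show ?thesis
    by (intro zspanI[of _ "i + k" _ "j + l"]) (simp add: algebra_simps)
qed

lemma zspan_scale: "u \<in> zspan x y \<Longrightarrow> of_int k * u \<in> zspan x y"
proof -
  assume "u \<in> zspan x y"
  then obtain i j where "u = of_int i * x + of_int j * y"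
    unfolding zspan_def by blast
  then show ?thesis
    by (intro zspanI[of _ "k * i" _ "k * j"]) (simp add: algebra_simps)
qed

lemma zspan_diff: "u \<in> zspan x y \<Longrightarrow> v \<in> zspan x y \<Longrightarrow> u - v \<in> zspan x y"
  using zspan_add[of u x y "of_int (-1) * v"] zspan_scale[of v x y "-1"] by simp

lemma zspan_subset: "x \<in> zspan x' y' \<Longrightarrow> y \<in> zspan x' y' \<Longrightarrow> zspan x y \<subseteq> zspan x' y'"
  unfolding zspan_def[of x y] by (auto intro!: zspan_add zspan_scale)

lemma zspan_times: "(*) c ` zspan x y = zspan (c * x) (c * y)"
proof (intro equalityI subsetI)
  fix z assume "z \<in> (*) c ` zspan x y"
  then obtain i j where "z = c * (of_int i * x + of_int j * y)" unfolding zspan_def by auto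
  then show "z \<in> zspan (c * x) (c * y)" by (intro zspanI[of _ i _ j]) (simp add: algebra_simps)
next
  fix z assume "z \<in> zspan (c * x) (c * y)"
  then obtain i j where "z = of_int i * (c * x) + of_int j * (c * y)" unfolding zspan_def by auto
  then have "z = c * (of_int i * x + of_int j * y)" by (simp add: algebra_simps)
  then show "z \<in> (*) c ` zspan x y" using zspanI by blast
qed

locale imag_quad =
  fixes \<Delta> :: int
  assumes disc: "imag_quad_discriminant \<Delta>"
begin

abbreviation \<O> :: "complex set" where "\<O> \<equiv> quad_ring \<Delta>"
abbreviation \<tau> :: complex where "\<tau> \<equiv> tau \<Delta>"

lemma disc_neg: "\<Delta> < 0"
  using disc by (simp add: imag_quad_discriminant_def)

lemma disc_le: "\<Delta> \<le> -3"
  using disc unfolding imag_quad_discriminant_def by presburger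

lemma four_tau_norm: "4 * tau_norm \<Delta> = \<Delta> * \<Delta> - \<Delta>"
proof -
  have "\<Delta> mod 4 = 0 \<or> \<Delta> mod 4 = 1"
    using disc by (simp add: imag_quad_discriminant_def)
  then have "(\<Delta> * \<Delta> - \<Delta>) mod 4 = 0"
  proof
    assume "\<Delta> mod 4 = 0"
    then obtain k where "\<Delta> = 4 * k" by (metis mod_0_imp_dvd dvdE)
    then have "\<Delta> * \<Delta> - \<Delta> = 4 * (4 * k * k - k)" by (simp add: algebra_simps)
    then show ?thesis by simp
  next
    assume "\<Delta> mod 4 = 1"
    then obtain k where "\<Delta> = 4 * k + 1" by (metis mult_div_mod_eq)
    then have "\<Delta> * \<Delta> - \<Delta> = 4 * (4 * k * k + k)" by (simp add: algebra_simps)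
    then show ?thesis by simp
  qed
  then show ?thesis unfolding tau_norm_def by presburger
qed

lemma Re_tau: "Re \<tau> = of_int \<Delta> / 2" and Im_tau: "Im \<tau> = sqrt \<bar>of_int \<Delta>\<bar> / 2"
proof -
  have "csqrt (of_int \<Delta>) = \<i> * sqrt \<bar>of_int \<Delta>\<bar>"
    using disc_neg by (subst csqrt_of_real_nonpos) auto
  then have "\<tau> = (of_int \<Delta> + \<i> * sqrt \<bar>of_int \<Delta>\<bar>) / 2"
    unfolding tau_def by simp
  then show "Re \<tau> = of_int \<Delta> / 2" "Im \<tau> = sqrt \<bar>of_int \<Delta>\<bar> / 2"
    by (simp_all only:) simp_all
qed

lemma csqrt_eq: "csqrt (of_int \<Delta>) = 2 * \<tau> - of_int \<Delta>"
  unfolding tau_def by (simp add: field_simps)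

lemma Im_tau_pos: "Im \<tau> > 0"
  using disc_neg by (simp add: Im_tau)

lemma tau_cnj_add: "cnj \<tau> = of_int \<Delta> - \<tau>"
  by (rule complex_eqI) (simp_all add: Re_tau Im_tau)

lemma tau_cnj_mult: "\<tau> * cnj \<tau> = of_int (tau_norm \<Delta>)"
proof -
  have "Re \<tau> ^ 2 + Im \<tau> ^ 2 = (real_of_int (\<Delta> * \<Delta> - \<Delta>)) / 4"
    using disc_neg by (simp add: Re_tau Im_tau power2_eq_square field_simps)
  also have "\<dots> = of_int (tau_norm \<Delta>)"
    using arg_cong[OF four_tau_norm, of real_of_int] by simp
  finally have "complex_of_real ((Re \<tau>)\<^sup>2 + (Im \<tau>)\<^sup>2) = of_int (tau_norm \<Delta>)"
    by (simp only: of_real_of_int_eq)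
  then show ?thesis
    by (simp only: complex_mult_cnj)
qed

lemma tau_sq: "\<tau> * \<tau> = of_int \<Delta> * \<tau> - of_int (tau_norm \<Delta>)"
  using tau_cnj_mult unfolding tau_cnj_add by (simp add: algebra_simps)

lemma elt_mul: "elt \<Delta> (qmul \<Delta> x y) = elt \<Delta> x * elt \<Delta> y"
proof (cases x; cases y)
  fix a b c d assume [simp]: "x = (a, b)" "y = (c, d)"
  have "elt \<Delta> x * elt \<Delta> y
      = of_int a * of_int c + (of_int a * of_int d + of_int b * of_int c) * \<tau> + of_int b * of_int d * (\<tau> * \<tau>)"
    by (simp add: algebra_simps)
  also have "\<dots> = elt \<Delta> (qmul \<Delta> x y)"
    unfolding tau_sq by (simp add: algebra_simps)
  finally show ?thesis by simp
qed

lemma elt_conj: "elt \<Delta> (qconj \<Delta> x) = cnj (elt \<Delta> x)"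
  by (cases x) (simp add: tau_cnj_add algebra_simps)

lemma elt_add: "elt \<Delta> (x + y) = elt \<Delta> x + elt \<Delta> y"
  by (cases x; cases y) (simp add: algebra_simps)

lemma elt_diff: "elt \<Delta> (x - y) = elt \<Delta> x - elt \<Delta> y"
  by (cases x; cases y) (simp add: algebra_simps)

lemma elt_uminus: "elt \<Delta> (- x) = - elt \<Delta> x"
  by (cases x) (simp add: algebra_simps)

lemma elt_sc: "elt \<Delta> (qsc k x) = of_int k * elt \<Delta> x"
  by (cases x) (simp add: algebra_simps)

lemma elt_norm: "of_int (qnorm \<Delta> x) = elt \<Delta> x * cnj (elt \<Delta> x)"
proof (cases x)
  case [simp]: (Pair a b)
  have "elt \<Delta> x * cnj (elt \<Delta> x)
      = of_int a * of_int a + of_int a * of_int b * (\<tau> + cnj \<tau>) + of_int b * of_int b * (\<tau> * cnj \<tau>)"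
    by (simp add: algebra_simps)
  also have "\<dots> = of_int (qnorm \<Delta> x)"
    unfolding tau_cnj_mult by (simp add: tau_cnj_add)
  finally show ?thesis by simp
qed

lemma cmod_elt_sq: "cmod (elt \<Delta> x) ^ 2 = of_int (qnorm \<Delta> x)"
proof -
  have "complex_of_real (cmod (elt \<Delta> x) ^ 2) = complex_of_real (of_int (qnorm \<Delta> x))"
    using elt_norm[of x] complex_norm_square[of "elt \<Delta> x"] by simp
  then show ?thesis by (simp only: of_real_eq_iff)
qed

lemma qnorm_nonneg: "qnorm \<Delta> x \<ge> 0"
  using cmod_elt_sq[of x] zero_le_power2[of "cmod (elt \<Delta> x)"] by linarith

lemma elt_eq_0: "elt \<Delta> x = 0 \<longleftrightarrow> x = (0, 0)"
proof
  assume *: "elt \<Delta> x = 0"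
  obtain a b where [simp]: "x = (a, b)" by (cases x)
  from * have "Im (elt \<Delta> x) = 0" by simp
  then have "b = 0" using Im_tau_pos by simp
  with * show "x = (0, 0)" by simp
qed simp

lemma elt_inj: "elt \<Delta> x = elt \<Delta> y \<longleftrightarrow> x = y"
  using elt_eq_0[of "x - y"] by (simp add: elt_diff zero_prod_def[symmetric])

lemma qnorm_eq_0: "qnorm \<Delta> x = 0 \<longleftrightarrow> x = (0, 0)"
  using cmod_elt_sq[of x] elt_eq_0[of x] by auto

lemma qnorm_pos: "elt \<Delta> x \<noteq> 0 \<Longrightarrow> qnorm \<Delta> x > 0"
  using qnorm_nonneg[of x] qnorm_eq_0[of x] elt_eq_0[of x] by linarith

lemma ring_elt [simp, intro]: "elt \<Delta> x \<in> \<O>"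
  unfolding quad_ring_def by simp

lemma ringE: "x \<in> \<O> \<Longrightarrow> (\<And>u. x = elt \<Delta> u \<Longrightarrow> P) \<Longrightarrow> P"
  unfolding quad_ring_def by blast

lemma ring_add [intro]: "x \<in> \<O> \<Longrightarrow> y \<in> \<O> \<Longrightarrow> x + y \<in> \<O>"
  by (auto elim!: ringE simp: elt_add[symmetric] simp del: elt.simps)

lemma ring_diff [intro]: "x \<in> \<O> \<Longrightarrow> y \<in> \<O> \<Longrightarrow> x - y \<in> \<O>"
  by (auto elim!: ringE simp: elt_diff[symmetric] simp del: elt.simps)

lemma ring_mult [intro]: "x \<in> \<O> \<Longrightarrow> y \<in> \<O> \<Longrightarrow> x * y \<in> \<O>"
  by (auto elim!: ringE simp: elt_mul[symmetric] simp del: elt.simps)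

lemma ring_uminus [intro]: "x \<in> \<O> \<Longrightarrow> - x \<in> \<O>"
  by (auto elim!: ringE simp: elt_uminus[symmetric] simp del: elt.simps)

lemma ring_cnj [intro]: "x \<in> \<O> \<Longrightarrow> cnj x \<in> \<O>"
  by (auto elim!: ringE simp: elt_conj[symmetric] simp del: elt.simps)

lemma ring_of_int [simp, intro]: "of_int k \<in> \<O>"
  using ring_elt[of "(k, 0)"] by simp

lemma ring_0 [simp, intro]: "0 \<in> \<O>" and ring_1 [simp, intro]: "1 \<in> \<O>"
  using ring_of_int[of 0] ring_of_int[of 1] by simp_all

lemma ring_tau [simp, intro]: "\<tau> \<in> \<O>"
  using ring_elt[of "(0, 1)"] by simp

lemma ring_small_eq_0: "x \<in> \<O> \<Longrightarrow> cmod x < 1 \<Longrightarrow> x = 0"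
proof -
  assume "x \<in> \<O>" and x: "cmod x < 1"
  then obtain u where u: "x = elt \<Delta> u" by (auto elim!: ringE)
  have "cmod x ^ 2 < 1" using x by (simp add: power_less_one_iff)
  then have "real_of_int (qnorm \<Delta> u) < 1" using cmod_elt_sq[of u] u by simp
  then have "qnorm \<Delta> u < 1" by simp
  then show "x = 0" using qnorm_nonneg[of u] qnorm_eq_0[of u] u elt_eq_0[of u] by force
qed

lemma elt_qdiv:
  assumes "elt \<Delta> x = of_int k * y" "y \<in> \<O>" "k \<noteq> 0"
  shows "elt \<Delta> (qdiv x k) = y"
proof -
  obtain u where u: "y = elt \<Delta> u" using assms(2) by (auto elim!: ringE)
  then have "x = qsc k u" using assms(1) elt_inj elt_sc by metis
  then have "qdiv x k = u" using \<open>k \<noteq> 0\<close> by (cases u) simp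
  then show ?thesis using u by simp
qed

lemma ring_submodule: "submodule \<Delta> \<O>"
  unfolding submodule_def by auto

lemma submodule_Inter: "(\<And>I. I \<in> T \<Longrightarrow> submodule \<Delta> I) \<Longrightarrow> submodule \<Delta> (\<Inter>T)"
  unfolding submodule_def by blast

lemma submodule_hull: "submodule \<Delta> (submodule \<Delta> hull X)"
  by (rule hull_in) (auto intro: submodule_Inter)

lemma submodule_uminus: "submodule \<Delta> I \<Longrightarrow> x \<in> I \<Longrightarrow> - x \<in> I"
  using ring_of_int[of "-1"] unfolding submodule_def by fastforce

lemma submodule_diff: "submodule \<Delta> I \<Longrightarrow> x \<in> I \<Longrightarrow> y \<in> I \<Longrightarrow> x - y \<in> I"
  using submodule_uminus[of I y] unfolding submodule_def by (metis diff_conv_add_uminus)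

lemma submodule_add: "submodule \<Delta> I \<Longrightarrow> x \<in> I \<Longrightarrow> y \<in> I \<Longrightarrow> x + y \<in> I"
  unfolding submodule_def by blast

lemma submodule_mult: "submodule \<Delta> I \<Longrightarrow> r \<in> \<O> \<Longrightarrow> x \<in> I \<Longrightarrow> r * x \<in> I"
  unfolding submodule_def by blast

lemma submodule_zspan: "submodule \<Delta> I \<Longrightarrow> x \<in> I \<Longrightarrow> y \<in> I \<Longrightarrow> zspan x y \<subseteq> I"
  unfolding zspan_def by (auto intro!: submodule_add submodule_mult)

definition gen2 :: "complex \<Rightarrow> complex \<Rightarrow> complex set" where
  "gen2 p q = {x * p + y * q | x y. x \<in> \<O> \<and> y \<in> \<O>}"

lemma gen2I: "x \<in> \<O> \<Longrightarrow> y \<in> \<O> \<Longrightarrow> z = x * p + y * q \<Longrightarrow> z \<in> gen2 p q"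
  unfolding gen2_def by blast

lemma gen2_submodule: "submodule \<Delta> (gen2 p q)"
  unfolding submodule_def
proof (intro conjI ballI)
  show "0 \<in> gen2 p q" by (rule gen2I[of 0 0]) auto
next
  fix x y assume "x \<in> gen2 p q" "y \<in> gen2 p q"
  then obtain a b c d where "a \<in> \<O>" "b \<in> \<O>" "c \<in> \<O>" "d \<in> \<O>" "x = a * p + b * q" "y = c * p + d * q"
    unfolding gen2_def by blast
  then show "x + y \<in> gen2 p q"
    by (intro gen2I[of "a + c" "b + d"]) (auto simp: algebra_simps)
next
  fix r x assume "r \<in> \<O>" "x \<in> gen2 p q"
  then obtain a b where "a \<in> \<O>" "b \<in> \<O>" "x = a * p + b * q"
    unfolding gen2_def by blast
  with \<open>r \<in> \<O>\<close> show "r * x \<in> gen2 p q"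
    by (intro gen2I[of "r * a" "r * b"]) (auto simp: algebra_simps)
qed

lemma gen2_left: "p \<in> gen2 p q" and gen2_right: "q \<in> gen2 p q"
  by (rule gen2I[of 1 0], simp_all) (rule gen2I[of 0 1], simp_all)

lemma gen2_least: "submodule \<Delta> I \<Longrightarrow> p \<in> I \<Longrightarrow> q \<in> I \<Longrightarrow> gen2 p q \<subseteq> I"
  unfolding gen2_def by (auto intro!: submodule_add submodule_mult)

lemma hull_gen2: "submodule \<Delta> hull {p, q} = gen2 p q"
  by (rule hull_unique) (auto simp: gen2_left gen2_right gen2_submodule dest: gen2_least)

lemma gen2_integral: "p \<in> \<O> \<Longrightarrow> q \<in> \<O> \<Longrightarrow> gen2 p q \<subseteq> \<O>"
  by (rule gen2_least[OF ring_submodule])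

subsection \<open>Norms as determinants\<close>

lemma coset_eq_iff:
  assumes "0 \<in> I" "\<And>x y. x \<in> I \<Longrightarrow> y \<in> I \<Longrightarrow> x - y \<in> I"
  shows "(+) x ` I = (+) y ` I \<longleftrightarrow> x - y \<in> (I :: complex set)"
proof
  assume "(+) x ` I = (+) y ` I"
  then have "x \<in> (+) y ` I" using assms(1) by (metis add.right_neutral imageI)
  then show "x - y \<in> I" by auto
next
  assume *: "x - y \<in> I"
  have neg: "- u \<in> I" if "u \<in> I" for u using assms(2)[OF assms(1) that] by simp
  have add: "u + v \<in> I" if "u \<in> I" "v \<in> I" for u v using assms(2)[OF that(1) neg[OF that(2)]] by simp
  show "(+) x ` I = (+) y ` I"
  proof (intro equalityI subsetI)
    fix z assume "z \<in> (+) x ` I"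
    then obtain u where "u \<in> I" "z = x + u" by auto
    then have "z = y + ((x - y) + u)" "(x - y) + u \<in> I" using add * by auto
    then show "z \<in> (+) y ` I" by blast
  next
    fix z assume "z \<in> (+) y ` I"
    then obtain u where "u \<in> I" "z = y + u" by auto
    then have "z = x + (u - (x - y))" "u - (x - y) \<in> I" using assms(2) * by auto
    then show "z \<in> (+) x ` I" by blast
  qed
qed

lemma zspan_0: "0 \<in> zspan x y"
  by (rule zspanI[of _ 0 _ 0]) simp

lemma elt_zspan_iff:
  "elt \<Delta> x \<in> zspan (elt \<Delta> y) (elt \<Delta> z) \<longleftrightarrow> (\<exists>i j. x = qsc i y + qsc j z)"
proof -
  have "elt \<Delta> x = of_int i * elt \<Delta> y + of_int j * elt \<Delta> z \<longleftrightarrow> x = qsc i y + qsc j z" for i j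
    using elt_inj[of x "qsc i y + qsc j z"] by (simp add: elt_add elt_sc)
  then show ?thesis unfolding zspan_def by auto
qed

lemma ideal_norm_triangular:
  assumes "u2 \<noteq> 0" "v1 \<noteq> 0"
  shows "ideal_norm \<Delta> (zspan (elt \<Delta> (u1, v1)) (elt \<Delta> (u2, 0))) = nat \<bar>u2 * v1\<bar>"
proof -
  let ?I = "zspan (elt \<Delta> (u1, v1)) (elt \<Delta> (u2, 0))"
  let ?c = "\<lambda>x. (+) x ` ?I"
  let ?R = "{0..<\<bar>u2\<bar>} \<times> {0..<\<bar>v1\<bar>}"
  have eq: "?c (elt \<Delta> x) = ?c (elt \<Delta> y) \<longleftrightarrow> (\<exists>i j. x - y = qsc i (u1, v1) + qsc j (u2, 0))" for x y
    using coset_eq_iff[of ?I "elt \<Delta> x" "elt \<Delta> y"] zspan_0 zspan_diff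
    by (simp add: elt_diff[symmetric] elt_zspan_iff del: elt.simps)
  have "?c ` \<O> = (?c \<circ> elt \<Delta>) ` ?R"
  proof (intro equalityI subsetI)
    fix C assume "C \<in> ?c ` \<O>"
    then obtain a b where C: "C = ?c (elt \<Delta> (a, b))" by (auto elim!: ringE)
    define i where "i = sgn v1 * (b div \<bar>v1\<bar>)"
    define j where "j = sgn u2 * ((a - i * u1) div \<bar>u2\<bar>)"
    have vi: "b = b mod \<bar>v1\<bar> + i * v1"
      unfolding i_def using mod_div_mult_eq[of b "\<bar>v1\<bar>"] by (simp add: abs_sgn algebra_simps)
    have uj: "a - i * u1 = (a - i * u1) mod \<bar>u2\<bar> + j * u2"
      unfolding j_def using mod_div_mult_eq[of "a - i * u1" "\<bar>u2\<bar>"] by (simp add: abs_sgn algebra_simps)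
    have "C = ?c (elt \<Delta> ((a - i * u1) mod \<bar>u2\<bar>, b mod \<bar>v1\<bar>))"
      unfolding C eq by (rule exI[of _ i], rule exI[of _ j]) (use vi uj in simp)
    moreover have "((a - i * u1) mod \<bar>u2\<bar>, b mod \<bar>v1\<bar>) \<in> ?R" using assms by auto
    ultimately show "C \<in> (?c \<circ> elt \<Delta>) ` ?R" by (auto simp del: elt.simps)
  qed (auto simp del: elt.simps)
  moreover have "inj_on (?c \<circ> elt \<Delta>) ?R"
  proof (rule inj_onI)
    fix x y assume xy: "x \<in> ?R" "y \<in> ?R" and "(?c \<circ> elt \<Delta>) x = (?c \<circ> elt \<Delta>) y"
    then obtain i j where ij: "x - y = qsc i (u1, v1) + qsc j (u2, 0)" using eq by auto
    obtain a b c d where [simp]: "x = (a, b)" "y = (c, d)" by (cases x; cases y)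
    have small: "k = 0" if "\<bar>k * n\<bar> < \<bar>n\<bar>" for k n :: int
    proof (rule ccontr)
      assume "k \<noteq> 0" then have "1 * \<bar>n\<bar> \<le> \<bar>k\<bar> * \<bar>n\<bar>" by (intro mult_right_mono) auto
      then show False using that by (simp add: abs_mult)
    qed
    have "\<bar>i * v1\<bar> < \<bar>v1\<bar>" using ij xy by auto
    then have [simp]: "i = 0" by (rule small)
    have "\<bar>j * u2\<bar> < \<bar>u2\<bar>" using ij xy by auto
    then have [simp]: "j = 0" by (rule small)
    show "x = y" using ij by simp
  qed
  ultimately have "ideal_norm \<Delta> ?I = card ?R"
    unfolding ideal_norm_def by (metis card_image)
  also have "\<dots> = nat \<bar>u2 * v1\<bar>" by (simp add: abs_mult nat_mult_distrib)
  finally show ?thesis .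
qed

lemma zspan_swap_reduce: "zspan x y = zspan y (x - of_int t * y)"
  by (intro equalityI zspan_subset)
    (auto intro: zspanI[of _ t _ 1] zspanI[of _ 0 _ 1] zspanI[of _ 1 _ 0] zspanI[of _ 1 _ "-t"] zspan_left
      zspan_right zspan_diff zspan_scale)

lemma ideal_norm_zspan:
  assumes "u1 * v2 - u2 * v1 \<noteq> 0"
  shows "ideal_norm \<Delta> (zspan (elt \<Delta> (u1, v1)) (elt \<Delta> (u2, v2))) = nat \<bar>u1 * v2 - u2 * v1\<bar>"
  using assms
proof (induction "nat \<bar>v2\<bar>" arbitrary: u1 v1 u2 v2 rule: less_induct)
  case less
  show ?case
  proof (cases "v2 = 0")
    case True
    then have "u2 \<noteq> 0" "v1 \<noteq> 0" using less.prems by auto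
    then show ?thesis using ideal_norm_triangular[of u2 v1 u1] True by simp
  next
    case False
    define t where "t = v1 div v2"
    have r: "v1 - t * v2 = v1 mod v2" unfolding t_def by (simp add: minus_div_mult_eq_mod)
    have lt: "\<bar>v1 - t * v2\<bar> < \<bar>v2\<bar>" unfolding r using False abs_mod_less by blast
    have e: "elt \<Delta> (u1, v1) - of_int t * elt \<Delta> (u2, v2) = elt \<Delta> (u1 - t * u2, v1 - t * v2)"
      by (simp add: algebra_simps)
    have d: "u2 * (v1 - t * v2) - (u1 - t * u2) * v2 = - (u1 * v2 - u2 * v1)"
      by (simp add: algebra_simps)
    have "ideal_norm \<Delta> (zspan (elt \<Delta> (u2, v2)) (elt \<Delta> (u1 - t * u2, v1 - t * v2)))
        = nat \<bar>u2 * (v1 - t * v2) - (u1 - t * u2) * v2\<bar>"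
      by (rule less.hyps) (use lt less.prems d in auto)
    then show ?thesis
      unfolding d zspan_swap_reduce[of "elt \<Delta> (u1, v1)" _ t] e by simp
  qed
qed

lemma ideal_norm_zspan_Im:
  assumes "w1 \<in> \<O>" "w2 \<in> \<O>" "Im (cnj w1 * w2) \<noteq> 0"
  shows "real (ideal_norm \<Delta> (zspan w1 w2)) = \<bar>Im (cnj w1 * w2)\<bar> / Im \<tau>"
proof -
  obtain u1 v1 u2 v2 where w: "w1 = elt \<Delta> (u1, v1)" "w2 = elt \<Delta> (u2, v2)"
    using assms(1,2) by (metis prod.collapse quad_ring_def rangeE)
  have Im: "Im (cnj w1 * w2) = of_int (u1 * v2 - u2 * v1) * Im \<tau>"
    unfolding w by (simp add: algebra_simps)
  with assms(3) have "u1 * v2 - u2 * v1 \<noteq> 0" by (metis mult_zero_left of_int_0)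
  then show ?thesis
    unfolding Im using Im_tau_pos ideal_norm_zspan[of u1 v2 u2 v1] w by (simp add: abs_mult)
qed

end

section \<open>Reduced ideals\<close>

lemma reduced_form_min:
  fixes a b c i j :: int
  assumes "\<bar>b\<bar> \<le> a" "a \<le> c" "i \<noteq> 0 \<or> j \<noteq> 0" "0 < a"
  shows "a \<le> a * i * i + b * i * j + c * j * j"
proof (cases "i * j = 0")
  case True
  then consider "i = 0" "j \<noteq> 0" | "j = 0" "i \<noteq> 0" using assms(3) by auto
  then show ?thesis
  proof cases
    case 1
    then have "1 \<le> j * j" by (metis int_one_le_iff_zero_less not_square_less_zero linorder_neqE_linordered_idom mult_eq_0_iff)
    then have "c * 1 \<le> c * (j * j)" using assms by (intro mult_left_mono) auto
    then have "a \<le> c * (j * j)" using assms(2) by linarith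
    then show ?thesis using 1 by (simp add: mult.assoc)
  next
    case 2
    then have "1 \<le> i * i" by (metis int_one_le_iff_zero_less not_square_less_zero linorder_neqE_linordered_idom mult_eq_0_iff)
    then have "a * 1 \<le> a * (i * i)" using assms by (intro mult_left_mono) auto
    then show ?thesis using 2 assms by (simp add: mult.assoc)
  qed
next
  case False
  then have ij: "1 \<le> \<bar>i * j\<bar>" by linarith
  have "\<bar>i * j\<bar> \<le> i * i + j * j - \<bar>i * j\<bar>"
    using zero_le_square[of "\<bar>i\<bar> - \<bar>j\<bar>"] by (simp add: algebra_simps abs_mult)
  then have "a * 1 \<le> a * (i * i + j * j - \<bar>i * j\<bar>)"
    using ij assms(4) by (intro mult_left_mono) auto
  moreover have "\<bar>b * (i * j)\<bar> \<le> a * \<bar>i * j\<bar>"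
    unfolding abs_mult[of b] using assms(1) by (intro mult_right_mono) auto
  then have "- (a * \<bar>i * j\<bar>) \<le> b * (i * j)" by linarith
  moreover have "a * (j * j) \<le> c * (j * j)" using assms(2) by (intro mult_right_mono) auto
  ultimately show ?thesis by (simp add: algebra_simps)
qed

context imag_quad
begin

abbreviation std :: "int \<Rightarrow> int \<Rightarrow> complex set" where
  "std \<alpha> h \<equiv> zspan (of_int \<alpha>) (of_int h + \<tau>)"

definition conorm :: "int \<Rightarrow> int \<Rightarrow> int" where
  "conorm \<alpha> h = qnorm \<Delta> (h, 1) div \<alpha>"

definition omega :: "int \<Rightarrow> int \<Rightarrow> complex" where
  "omega \<alpha> h = (of_int h + cnj \<tau>) / of_int \<alpha>"

lemma std_mem: "elt \<Delta> (u, v) \<in> std \<alpha> h \<longleftrightarrow> \<alpha> dvd u - v * h"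
proof -
  have "std \<alpha> h = zspan (elt \<Delta> (\<alpha>, 0)) (elt \<Delta> (h, 1))" by simp
  then have "elt \<Delta> (u, v) \<in> std \<alpha> h \<longleftrightarrow> (\<exists>i j. (u, v) = qsc i (\<alpha>, 0) + qsc j (h, 1))"
    using elt_zspan_iff by presburger
  also have "\<dots> \<longleftrightarrow> (\<exists>i. u = i * \<alpha> + v * h)" by auto
  also have "\<dots> \<longleftrightarrow> \<alpha> dvd u - v * h"
    by (auto simp: dvd_def algebra_simps)
  finally show ?thesis .
qed

lemma std_subset: "std \<alpha> h \<subseteq> \<O>"
  by (rule submodule_zspan[OF ring_submodule]) auto

lemma four_qnorm: "4 * qnorm \<Delta> (h, 1) = (2 * h + \<Delta>) * (2 * h + \<Delta>) - \<Delta>"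
  using four_tau_norm by (simp add: algebra_simps)

lemma omega_identities:
  shows "(of_int h + \<tau>) * (of_int h + cnj \<tau>) = of_int (qnorm \<Delta> (h, 1))"
    and "(of_int h + \<tau>) + (of_int h + cnj \<tau>) = of_int (2 * h + \<Delta>)"
  using elt_norm[of "(h, 1)"] by (simp_all add: tau_cnj_add)

lemma std_norm_dvd: "submodule \<Delta> (std \<alpha> h) \<Longrightarrow> \<alpha> dvd qnorm \<Delta> (h, 1)"
proof -
  assume "submodule \<Delta> (std \<alpha> h)"
  then have "(of_int h + cnj \<tau>) * (of_int h + \<tau>) \<in> std \<alpha> h"
    by (rule submodule_mult) (auto intro: zspan_right)
  then have "elt \<Delta> (qnorm \<Delta> (h, 1), 0) \<in> std \<alpha> h"
    using omega_identities(1)[of h] by (simp add: mult.commute del: qnorm.simps)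
  then show ?thesis by (simp only: std_mem) simp
qed

context
  fixes \<alpha> h :: int
  assumes sub: "submodule \<Delta> (std \<alpha> h)" and \<alpha>: "\<alpha> > 0"
begin

lemma conorm_mult: "\<alpha> * conorm \<alpha> h = qnorm \<Delta> (h, 1)"
  using std_norm_dvd[OF sub] unfolding conorm_def by simp

lemma four_conorm: "4 * \<alpha> * conorm \<alpha> h = (2 * h + \<Delta>) * (2 * h + \<Delta>) - \<Delta>"
  using four_qnorm[of h] unfolding conorm_mult[symmetric] by simp

lemma omega_mult: "of_int \<alpha> * omega \<alpha> h = of_int h + cnj \<tau>"
  using \<alpha> unfolding omega_def by simp

lemma omega_mult_gen: "(of_int h + \<tau>) * omega \<alpha> h = of_int (conorm \<alpha> h)"
proof -
  have "(of_int h + \<tau>) * omega \<alpha> h = of_int (qnorm \<Delta> (h, 1)) / of_int \<alpha>"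
    unfolding omega_def by (simp only: times_divide_eq_right omega_identities)
  then show ?thesis using \<alpha> unfolding conorm_mult[symmetric] by simp
qed

lemma one_inverse: "1 \<in> ideal_inverse \<Delta> (std \<alpha> h)"
  using std_subset unfolding ideal_inverse_def by auto

lemma omega_inverse: "omega \<alpha> h \<in> ideal_inverse \<Delta> (std \<alpha> h)"
proof -
  have "omega \<alpha> h * (of_int i * of_int \<alpha> + of_int j * (of_int h + \<tau>)) \<in> \<O>" for i j
  proof -
    have "omega \<alpha> h * (of_int i * of_int \<alpha> + of_int j * (of_int h + \<tau>))
        = of_int i * (of_int \<alpha> * omega \<alpha> h) + of_int j * ((of_int h + \<tau>) * omega \<alpha> h)"
      by (simp add: algebra_simps)
    also have "\<dots> \<in> \<O>" unfolding omega_mult omega_mult_gen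
      by (intro ring_add ring_mult ring_of_int ring_cnj ring_tau)
    finally show ?thesis .
  qed
  then show ?thesis unfolding ideal_inverse_def by (auto elim!: zspanE)
qed

lemma inverse_omega_form:
  assumes g: "gcd \<alpha> (gcd (2 * h + \<Delta>) (conorm \<alpha> h)) = 1" and x: "x \<in> ideal_inverse \<Delta> (std \<alpha> h)"
  obtains k l where "x = of_int k + of_int l * omega \<alpha> h"
proof -
  obtain a b where ab: "a * \<alpha> + b * gcd (2 * h + \<Delta>) (conorm \<alpha> h) = 1" using g bezout_int by metis
  obtain c d where cd: "c * (2 * h + \<Delta>) + d * conorm \<alpha> h = gcd (2 * h + \<Delta>) (conorm \<alpha> h)"
    using bezout_int by metis
  have bez: "a * \<alpha> + (b * c) * (2 * h + \<Delta>) + (b * d) * conorm \<alpha> h = 1"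
    using ab unfolding cd[symmetric] by (simp add: algebra_simps)
  have y1: "x * of_int \<alpha> \<in> \<O>" and y2: "x * (of_int h + \<tau>) \<in> \<O>"
    using x zspan_left zspan_right unfolding ideal_inverse_def by blast+
  obtain u1 v1 where u1: "x * of_int \<alpha> = elt \<Delta> (u1, v1)" using y1 by (auto elim!: ringE)
  obtain u2 v2 where u2: "x * (of_int h + \<tau>) = elt \<Delta> (u2, v2)" using y2 by (auto elim!: ringE)
  let ?J' = "cnj ` std \<alpha> h"
  have sub': "submodule \<Delta> ?J'"
    unfolding submodule_def
  proof (intro conjI ballI)
    show "0 \<in> ?J'" using zspan_0 by force
  next
    fix x y assume "x \<in> ?J'" "y \<in> ?J'"
    then show "x + y \<in> ?J'" using submodule_add[OF sub] by (auto simp flip: complex_cnj_add)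
  next
    fix r x assume "r \<in> \<O>" "x \<in> ?J'"
    then have "cnj r * cnj x \<in> std \<alpha> h" using submodule_mult[OF sub ring_cnj] by fastforce
    then show "r * x \<in> ?J'" by (metis complex_cnj_cnj complex_cnj_mult imageI)
  qed
  have a': "of_int \<alpha> \<in> ?J'" using zspan_left by (metis complex_cnj_of_int imageI)
  have h': "of_int h + cnj \<tau> \<in> ?J'" using zspan_right[of "of_int h + \<tau>"] by force
  have "x * of_int \<alpha> = x * of_int \<alpha> * of_int (a * \<alpha> + (b * c) * (2 * h + \<Delta>) + (b * d) * conorm \<alpha> h)"
    unfolding bez by simp
  also have "\<dots> = (of_int a * (x * of_int \<alpha>)) * of_int \<alpha>
      + (of_int (b * c) * (x * of_int \<alpha>)) * of_int (2 * h + \<Delta>)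
      + of_int (b * d) * x * of_int (\<alpha> * conorm \<alpha> h)"
    by (simp add: algebra_simps)
  also have "\<dots> = (of_int a * (x * of_int \<alpha>)) * of_int \<alpha>
      + ((of_int (b * c) * (x * of_int \<alpha>)) * (of_int h + cnj \<tau>)
         + (of_int (b * c) * (x * (of_int h + \<tau>))) * of_int \<alpha>)
      + (of_int (b * d) * (x * (of_int h + \<tau>))) * (of_int h + cnj \<tau>)"
    unfolding conorm_mult omega_identities[symmetric] by (simp add: algebra_simps)
  also have "\<dots> \<in> ?J'"
    by (intro submodule_add[OF sub'] submodule_mult[OF sub'] ring_mult ring_of_int y1 y2 a' h')
  finally obtain i j where "x * of_int \<alpha> = cnj (of_int i * of_int \<alpha> + of_int j * (of_int h + \<tau>))"
    by (auto elim!: zspanE)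
  then have "x * of_int \<alpha> = of_int i * of_int \<alpha> + of_int j * (of_int \<alpha> * omega \<alpha> h)"
    unfolding omega_mult by simp
  then have "x * of_int \<alpha> = (of_int i + of_int j * omega \<alpha> h) * of_int \<alpha>"
    by (simp add: algebra_simps)
  then show ?thesis using \<alpha> that by auto
qed

lemma cmod_omega_form:
  "of_int \<alpha> * cmod (of_int k + of_int l * omega \<alpha> h) ^ 2
    = of_int (\<alpha> * k * k + (2 * h + \<Delta>) * k * l + conorm \<alpha> h * l * l)"
proof -
  let ?w = "omega \<alpha> h"
  have cw: "of_int \<alpha> * cnj ?w = of_int h + \<tau>" using \<alpha> unfolding omega_def by simp
  have "of_int \<alpha> * complex_of_real (cmod (of_int k + of_int l * ?w) ^ 2)
     = of_int \<alpha> * ((of_int k + of_int l * ?w) * cnj (of_int k + of_int l * ?w))"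
    by (simp only: complex_norm_square)
  also have "\<dots> = of_int \<alpha> * of_int k * of_int k
      + of_int k * of_int l * (of_int \<alpha> * cnj ?w + of_int \<alpha> * ?w) + of_int l * of_int l * ((of_int \<alpha> * cnj ?w) * ?w)"
    by (simp add: algebra_simps)
  also have "\<dots> = of_int (\<alpha> * k * k + (2 * h + \<Delta>) * k * l + conorm \<alpha> h * l * l)"
    unfolding cw omega_mult omega_mult_gen omega_identities(2) by (simp add: algebra_simps)
  finally have "complex_of_real (of_int \<alpha> * cmod (of_int k + of_int l * ?w) ^ 2)
      = complex_of_real (of_int (\<alpha> * k * k + (2 * h + \<Delta>) * k * l + conorm \<alpha> h * l * l))"
    by simp
  then show ?thesis by (simp only: of_real_eq_iff)
qed

lemma std_nonzero: "std \<alpha> h \<noteq> {0}"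
proof
  assume "std \<alpha> h = {0}"
  moreover have "of_int \<alpha> \<in> std \<alpha> h" by (rule zspan_left)
  ultimately show False using \<alpha> by simp
qed

lemma std_fractional: "fractional_ideal \<Delta> (std \<alpha> h)"
  unfolding fractional_ideal_def using sub std_nonzero std_subset
  by (intro conjI bexI[of _ 1]) auto

lemma std_integral: "integral_ideal \<Delta> (std \<alpha> h)"
  unfolding integral_ideal_def using std_fractional std_subset by auto

lemma ideal_norm_times_std:
  assumes "x \<noteq> 0" "(*) x ` std \<alpha> h \<subseteq> \<O>"
  shows "real (ideal_norm \<Delta> ((*) x ` std \<alpha> h)) = cmod x ^ 2 * of_int \<alpha>"
proof -
  have mem: "x * of_int \<alpha> \<in> \<O>" "x * (of_int h + \<tau>) \<in> \<O>"
    using assms(2) zspan_left zspan_right by blast+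
  have "cnj (x * of_int \<alpha>) * (x * (of_int h + \<tau>)) = (x * cnj x) * (of_int \<alpha> * (of_int h + \<tau>))"
    by (simp add: algebra_simps)
  also have "x * cnj x = complex_of_real (cmod x ^ 2)" by (simp only: complex_norm_square)
  finally have Im: "Im (cnj (x * of_int \<alpha>) * (x * (of_int h + \<tau>))) = cmod x ^ 2 * of_int \<alpha> * Im \<tau>"
    by (simp add: algebra_simps)
  have pos: "cmod x ^ 2 * of_int \<alpha> * Im \<tau> > 0"
    using assms(1) \<alpha> Im_tau_pos by simp
  have "real (ideal_norm \<Delta> (zspan (x * of_int \<alpha>) (x * (of_int h + \<tau>))))
      = \<bar>Im (cnj (x * of_int \<alpha>) * (x * (of_int h + \<tau>)))\<bar> / Im \<tau>"
    by (rule ideal_norm_zspan_Im[OF mem]) (unfold Im, use pos in linarith)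
  then show ?thesis
    unfolding zspan_times Im using pos Im_tau_pos assms(1) \<alpha> by (simp add: abs_mult)
qed

lemma ideal_norm_std: "real (ideal_norm \<Delta> (std \<alpha> h)) = of_int \<alpha>"
  using ideal_norm_times_std[of 1] std_subset by simp

lemma invertible_gcd:
  assumes "ideal_product \<Delta> (std \<alpha> h) (ideal_inverse \<Delta> (std \<alpha> h)) = \<O>"
  shows "gcd \<alpha> (gcd (2 * h + \<Delta>) (conorm \<alpha> h)) = 1"
proof -
  define g where "g = gcd \<alpha> (gcd (2 * h + \<Delta>) (conorm \<alpha> h))"
  have g: "g > 0" "g dvd \<alpha>" "g dvd 2 * h + \<Delta>" "g dvd conorm \<alpha> h"
    unfolding g_def using \<alpha> by (auto simp: gcd_pos_int intro: dvd_trans)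
  obtain a b c where abc: "\<alpha> = g * a" "2 * h + \<Delta> = g * b" "conorm \<alpha> h = g * c"
    using g by (auto elim!: dvdE)
  \<comment> \<open>\<open>\<theta>\<close> maps the ideal into itself, so it lies in the ring if the ideal is invertible.\<close>
  define \<theta> where "\<theta> = (of_int h + \<tau>) / of_int g"
  have \<theta>g: "of_int g * \<theta> = of_int h + \<tau>" unfolding \<theta>_def using g by simp
  have t1: "\<theta> * of_int \<alpha> = of_int a * (of_int h + \<tau>)"
    unfolding \<theta>_def abc using g by simp
  have sq: "(of_int h + \<tau>) * (of_int h + \<tau>)
      = of_int (2 * h + \<Delta>) * (of_int h + \<tau>) - of_int \<alpha> * of_int (conorm \<alpha> h)"
    unfolding of_int_mult[symmetric] conorm_mult omega_identities[symmetric] by (simp add: algebra_simps)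
  have "of_int g * (\<theta> * (of_int h + \<tau>)) = of_int g * (of_int b * (of_int h + \<tau>) - of_int c * of_int \<alpha>)"
  proof -
    have "of_int g * (\<theta> * (of_int h + \<tau>)) = (of_int h + \<tau>) * (of_int h + \<tau>)"
      by (simp only: \<theta>g mult.assoc[symmetric])
    also have "\<dots> = of_int g * (of_int b * (of_int h + \<tau>) - of_int c * of_int \<alpha>)"
      unfolding sq abc(2,3) by (simp add: algebra_simps)
    finally show ?thesis .
  qed
  then have t2: "\<theta> * (of_int h + \<tau>) = of_int b * (of_int h + \<tau>) - of_int c * of_int \<alpha>"
    using g by simp
  have stable: "\<theta> * y \<in> std \<alpha> h" if y: "y \<in> std \<alpha> h" for y
  proof -
    obtain i j where "y = of_int i * of_int \<alpha> + of_int j * (of_int h + \<tau>)"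
      using y by (rule zspanE)
    then have "\<theta> * y = of_int i * (\<theta> * of_int \<alpha>) + of_int j * (\<theta> * (of_int h + \<tau>))"
      by (simp add: algebra_simps)
    then show ?thesis unfolding t1 t2
      by (auto intro!: zspan_add zspan_scale zspan_diff zspan_left zspan_right)
  qed
  let ?T = "{y. \<theta> * y \<in> \<O>}"
  have "submodule \<Delta> ?T"
    unfolding submodule_def
    by (auto simp: distrib_left ring_add) (metis mult.left_commute ring_mult)
  moreover have "{x * y |x y. x \<in> std \<alpha> h \<and> y \<in> ideal_inverse \<Delta> (std \<alpha> h)} \<subseteq> ?T"
    using stable by (auto simp: ideal_inverse_def) (metis mult.assoc mult.commute)
  ultimately have "ideal_product \<Delta> (std \<alpha> h) (ideal_inverse \<Delta> (std \<alpha> h)) \<subseteq> ?T"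
    unfolding ideal_product_def by (intro hull_minimal)
  then have "1 \<in> ?T" using assms ring_1 by blast
  then obtain u v where "\<theta> = elt \<Delta> (u, v)" by (auto elim!: ringE)
  then have "elt \<Delta> (h, 1) = elt \<Delta> (g * u, g * v)" using \<theta>g by (simp add: algebra_simps)
  then have "g * v = 1" using elt_inj[of "(h, 1)" "(g * u, g * v)"] by simp
  then have "g = 1 \<or> g = -1" using zmult_eq_1_iff by auto
  then show ?thesis using g(1) unfolding g_def[symmetric] by auto
qed

lemma gcd_invertible:
  assumes "gcd \<alpha> (gcd (2 * h + \<Delta>) (conorm \<alpha> h)) = 1"
  shows "invertible_ideal \<Delta> (std \<alpha> h)"
proof -
  let ?J = "std \<alpha> h" and ?I = "ideal_inverse \<Delta> (std \<alpha> h)"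
  let ?X = "{x * y |x y. x \<in> ?J \<and> y \<in> ?I}"
  have "ideal_product \<Delta> ?J ?I \<subseteq> \<O>"
    unfolding ideal_product_def
    by (rule hull_minimal) (auto simp: ideal_inverse_def mult.commute ring_submodule)
  moreover have "\<O> \<subseteq> ideal_product \<Delta> ?J ?I"
  proof -
    let ?H = "submodule \<Delta> hull ?X"
    have prod: "x * y \<in> ?H" if "x \<in> ?J" "y \<in> ?I" for x y
      by (rule hull_inc) (use that in blast)
    have "of_int \<alpha> * 1 \<in> ?H" by (intro prod zspan_left one_inverse)
    then have A: "of_int \<alpha> \<in> ?H" by simp
    have "(of_int h + \<tau>) * omega \<alpha> h \<in> ?H" by (intro prod zspan_right omega_inverse)
    then have C: "of_int (conorm \<alpha> h) \<in> ?H" by (simp only: omega_mult_gen)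
    have "(of_int h + \<tau>) * 1 + of_int \<alpha> * omega \<alpha> h \<in> ?H"
      by (intro submodule_add[OF submodule_hull] prod zspan_right zspan_left one_inverse omega_inverse)
    then have B: "of_int (2 * h + \<Delta>) \<in> ?H" by (simp only: omega_mult mult_1_right omega_identities)
    obtain a b where ab: "a * \<alpha> + b * gcd (2 * h + \<Delta>) (conorm \<alpha> h) = 1" using assms bezout_int by metis
    obtain c d where cd: "c * (2 * h + \<Delta>) + d * conorm \<alpha> h = gcd (2 * h + \<Delta>) (conorm \<alpha> h)"
      using bezout_int by metis
    have "of_int a * of_int \<alpha> + of_int b * (of_int c * of_int (2 * h + \<Delta>) + of_int d * of_int (conorm \<alpha> h)) \<in> ?H"
      by (intro submodule_add[OF submodule_hull] submodule_mult[OF submodule_hull] A B C ring_of_int)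
    moreover have "of_int a * of_int \<alpha> + of_int b * (of_int c * of_int (2 * h + \<Delta>) + of_int d * of_int (conorm \<alpha> h))
        = (1 :: complex)"
      by (simp only: of_int_mult[symmetric] of_int_add[symmetric] cd ab) simp
    ultimately have "1 \<in> ?H" by simp
    then show ?thesis unfolding ideal_product_def
      using submodule_mult[OF submodule_hull, of _ 1] by fastforce
  qed
  ultimately show ?thesis unfolding invertible_ideal_def using std_fractional by auto
qed

lemma omega_field: "omega \<alpha> h \<in> quad_field \<Delta>"
proof -
  have "omega \<alpha> h = of_rat (of_int (2 * h + \<Delta>) / of_int (2 * \<alpha>)) + of_rat (- 1 / of_int (2 * \<alpha>)) * csqrt (of_int \<Delta>)"
    unfolding omega_def csqrt_eq tau_cnj_add using \<alpha>
    by (simp add: of_rat_divide of_rat_minus of_rat_add of_rat_mult field_simps)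
  then show ?thesis unfolding quad_field_def by blast
qed

lemma conorm_pos: "conorm \<alpha> h > 0"
proof -
  have "qnorm \<Delta> (h, 1) > 0" using elt_eq_0[of "(h, 1)"] by (intro qnorm_pos) simp
  then show ?thesis unfolding conorm_mult[symmetric] using \<alpha> by (simp add: zero_less_mult_iff)
qed

lemma reduced_std_iff:
  assumes B: "\<bar>2 * h + \<Delta>\<bar> \<le> \<alpha>"
  shows "reduced_ideal \<Delta> (std \<alpha> h) \<longleftrightarrow>
    \<alpha> \<le> conorm \<alpha> h \<and> gcd \<alpha> (gcd (2 * h + \<Delta>) (conorm \<alpha> h)) = 1"
proof
  assume red: "reduced_ideal \<Delta> (std \<alpha> h)"
  then have g: "gcd \<alpha> (gcd (2 * h + \<Delta>) (conorm \<alpha> h)) = 1"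
    unfolding reduced_ideal_def invertible_ideal_def by (intro invertible_gcd) auto
  let ?x = "omega \<alpha> h" let ?J' = "(*) ?x ` std \<alpha> h"
  have x0: "?x \<noteq> 0" using omega_mult_gen conorm_pos by auto
  have int: "?J' \<subseteq> \<O>" using omega_inverse unfolding ideal_inverse_def by auto
  have sub': "submodule \<Delta> ?J'"
    unfolding submodule_def
  proof (intro conjI ballI)
    show "0 \<in> ?J'" using zspan_0 by force
  next
    fix x y assume "x \<in> ?J'" "y \<in> ?J'"
    then show "x + y \<in> ?J'" using submodule_add[OF sub] by (auto simp flip: distrib_left)
  next
    fix r x assume "r \<in> \<O>" "x \<in> ?J'"
    then show "r * x \<in> ?J'" using submodule_mult[OF sub, of r] by (auto simp: mult.left_commute)
  qed
  have "?x * of_int \<alpha> \<in> ?J'" "?x * of_int \<alpha> \<noteq> 0" using zspan_left x0 \<alpha> by auto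
  then have "?J' \<noteq> {0}" by blast
  then have "integral_ideal \<Delta> ?J'"
    unfolding integral_ideal_def fractional_ideal_def using sub' int by (intro conjI bexI[of _ 1]) auto
  moreover have "same_class \<Delta> (std \<alpha> h) ?J'"
    unfolding same_class_def using omega_field x0 by blast
  ultimately have "ideal_norm \<Delta> (std \<alpha> h) \<le> ideal_norm \<Delta> ?J'"
    using red unfolding reduced_ideal_def by blast
  then have "real (ideal_norm \<Delta> (std \<alpha> h)) \<le> real (ideal_norm \<Delta> ?J')" by simp
  then have "of_int \<alpha> \<le> cmod ?x ^ 2 * of_int \<alpha>"
    unfolding ideal_norm_std ideal_norm_times_std[OF x0 int] .
  also have "cmod ?x ^ 2 * of_int \<alpha> = of_int (conorm \<alpha> h)"
    using cmod_omega_form[of 0 1] by (simp add: mult.commute)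
  finally show "\<alpha> \<le> conorm \<alpha> h \<and> gcd \<alpha> (gcd (2 * h + \<Delta>) (conorm \<alpha> h)) = 1" using g by simp
next
  assume *: "\<alpha> \<le> conorm \<alpha> h \<and> gcd \<alpha> (gcd (2 * h + \<Delta>) (conorm \<alpha> h)) = 1"
  have "ideal_norm \<Delta> (std \<alpha> h) \<le> ideal_norm \<Delta> J"
    if J: "integral_ideal \<Delta> J" "same_class \<Delta> (std \<alpha> h) J" for J
  proof -
    obtain x where x: "x \<noteq> 0" "J = (*) x ` std \<alpha> h" using J(2) unfolding same_class_def by blast
    have int: "(*) x ` std \<alpha> h \<subseteq> \<O>" using J(1) x unfolding integral_ideal_def by simp
    then have "x \<in> ideal_inverse \<Delta> (std \<alpha> h)" unfolding ideal_inverse_def by auto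
    then obtain k l where kl: "x = of_int k + of_int l * omega \<alpha> h"
      using inverse_omega_form[of x] * by metis
    then have "k \<noteq> 0 \<or> l \<noteq> 0" using x by auto
    then have "\<alpha> \<le> \<alpha> * k * k + (2 * h + \<Delta>) * k * l + conorm \<alpha> h * l * l"
      using reduced_form_min[OF B] * \<alpha> by blast
    then have "of_int \<alpha> \<le> of_int \<alpha> * cmod x ^ 2"
      unfolding kl cmod_omega_form by (simp only: of_int_le_iff)
    then have "real (ideal_norm \<Delta> (std \<alpha> h)) \<le> real (ideal_norm \<Delta> J)"
      unfolding x(2) ideal_norm_std ideal_norm_times_std[OF x(1) int] by (simp add: mult.commute)
    then show ?thesis by simp
  qed
  then show "reduced_ideal \<Delta> (std \<alpha> h)"
    unfolding reduced_ideal_def using gcd_invertible std_integral * by blast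
qed

lemma reduced_enumeration_bounds:
  assumes B: "\<bar>2 * h + \<Delta>\<bar> \<le> \<alpha>" "\<alpha> \<le> conorm \<alpha> h"
    and small: "cmod (of_real s + of_real t * omega \<alpha> h + (of_int k + of_int l * omega \<alpha> h)) < 1"
  shows "\<bar>s + of_int k\<bar> < 2" "\<bar>t + of_int l\<bar> < 2"
proof -
  let ?y = "of_real s + of_real t * omega \<alpha> h + (of_int k + of_int l * omega \<alpha> h)"
  have Imw: "Im (omega \<alpha> h) = - Im \<tau> / of_int \<alpha>" and Rew: "Re (omega \<alpha> h) = of_int (2 * h + \<Delta>) / (2 * of_int \<alpha>)"
  proof -
    show "Im (omega \<alpha> h) = - Im \<tau> / of_int \<alpha>" "Re (omega \<alpha> h) = of_int (2 * h + \<Delta>) / (2 * of_int \<alpha>)"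
      using \<alpha> arg_cong[OF omega_mult, of Im] arg_cong[OF omega_mult, of Re]
      by (simp_all add: Re_tau field_simps)
  qed
  have "4 * \<alpha> * \<alpha> \<le> 4 * \<alpha> * conorm \<alpha> h" using B(2) \<alpha> by simp
  moreover have "(2 * h + \<Delta>) * (2 * h + \<Delta>) \<le> \<alpha> * \<alpha>"
    using mult_mono[OF B(1) B(1)] \<alpha> by (simp add: abs_mult_self_eq)
  ultimately have "3 * (\<alpha> * \<alpha>) \<le> - \<Delta>" using four_conorm by linarith
  then have "\<alpha> * \<alpha> < - \<Delta>" using \<alpha> mult_pos_pos[of \<alpha> \<alpha>] by linarith
  then have "real_of_int (\<alpha> * \<alpha>) < real_of_int (- \<Delta>)" by (simp only: of_int_less_iff)
  then have "(of_int \<alpha>)\<^sup>2 < \<bar>real_of_int \<Delta>\<bar>" using disc_neg by (simp add: power2_eq_square)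
  then have "of_int \<alpha> < sqrt \<bar>real_of_int \<Delta>\<bar>" using real_less_rsqrt by blast
  then have Im1: "1 / 2 < Im \<tau> / of_int \<alpha>" unfolding Im_tau using \<alpha> by (simp add: field_simps)
  have "Im ?y = - ((t + of_int l) * (Im \<tau> / of_int \<alpha>))" by (simp add: Imw algebra_simps add_divide_distrib)
  then have "\<bar>t + of_int l\<bar> * (Im \<tau> / of_int \<alpha>) = \<bar>Im ?y\<bar>" using Im_tau_pos \<alpha> by (simp add: abs_mult)
  also have "\<dots> < 1" using abs_Im_le_cmod[of ?y] small by linarith
  finally have lt1: "\<bar>t + of_int l\<bar> * (Im \<tau> / of_int \<alpha>) < 1" .
  have "\<bar>t + of_int l\<bar> * (1 / 2) \<le> \<bar>t + of_int l\<bar> * (Im \<tau> / of_int \<alpha>)"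
    using Im1 by (intro mult_left_mono) auto
  then have lt2: "\<bar>t + of_int l\<bar> * (1 / 2) < 1" using lt1 by (rule le_less_trans)
  then show t: "\<bar>t + of_int l\<bar> < 2" by simp
  define X where "X = (t + of_int l) * Re (omega \<alpha> h)"
  have Re: "Re ?y = s + of_int k + X" unfolding X_def by (simp add: algebra_simps)
  have "\<bar>Re ?y\<bar> < 1" by (rule le_less_trans[OF abs_Re_le_cmod small])
  then have "\<bar>s + of_int k + X\<bar> < 1" unfolding Re .
  moreover have "\<bar>Re (omega \<alpha> h)\<bar> \<le> 1 / 2"
  proof -
    have "\<bar>real_of_int (2 * h + \<Delta>)\<bar> \<le> of_int \<alpha>" using B(1) by linarith
    then show ?thesis unfolding Rew using \<alpha> by (simp add: abs_divide field_simps)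
  qed
  then have "\<bar>X\<bar> \<le> \<bar>t + of_int l\<bar> * (1 / 2)"
    unfolding X_def abs_mult by (intro mult_left_mono) auto
  then have "\<bar>X\<bar> < 1" using lt2 by (rule le_less_trans)
  ultimately show "\<bar>s + of_int k\<bar> < 2"
    by linarith
qed

end

end

section \<open>Legal steps\<close>

lemma vec2_mult:
  fixes M :: "complex^2^2"
  shows "(M ** S_mat x y) $ 1 $ 1 = M $ 1 $ 1 * x + M $ 1 $ 2 * y"
    and "(M ** S_mat x y) $ 2 $ 1 = M $ 2 $ 1 * x + M $ 2 $ 2 * y"
    and "(M ** S_mat x y) $ 1 $ 2 = M $ 1 $ 1"
    and "(M ** S_mat x y) $ 2 $ 2 = M $ 2 $ 1"
  by (simp_all add: matrix_matrix_mult_def S_mat_def sum_2)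

lemma matrix_inv_2:
  fixes M :: "complex^2^2"
  assumes d: "M $ 1 $ 1 * M $ 2 $ 2 - M $ 1 $ 2 * M $ 2 $ 1 = d" "d \<noteq> 0"
  shows "matrix_inv M = vector [vector [M $ 2 $ 2 / d, - M $ 1 $ 2 / d], vector [- M $ 2 $ 1 / d, M $ 1 $ 1 / d]]"
    (is "_ = ?N")
proof -
  have 1: "M ** ?N = mat 1"
    using d by (simp add: vec_eq_iff matrix_matrix_mult_def sum_2 forall_2 mat_def field_simps)
  have 2: "?N ** M = mat 1"
    using d by (simp add: vec_eq_iff matrix_matrix_mult_def sum_2 forall_2 mat_def field_simps)
  have 3: "M ** matrix_inv M = mat 1 \<and> matrix_inv M ** M = mat 1"
    unfolding matrix_inv_def by (rule someI[of _ ?N]) (use 1 2 in simp)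
  have "matrix_inv M = (?N ** M) ** matrix_inv M" unfolding 2 by simp
  also have "\<dots> = ?N" using 3 by (simp only: matrix_mul_assoc[symmetric] matrix_mul_rid)
  finally show ?thesis .
qed

lemma cf_mat_cong: "(\<And>n. n \<le> N \<Longrightarrow> a n = a' n \<and> b n = b' n) \<Longrightarrow> cf_mat a b N = cf_mat a' b' N"
  by (induction N) auto

lemma cf_mat_det:
  assumes "b 0 = 1" "\<And>n. n \<le> N \<Longrightarrow> b n \<noteq> 0"
  shows "cf_mat a b N $ 1 $ 1 * cf_mat a b N $ 2 $ 2 - cf_mat a b N $ 1 $ 2 * cf_mat a b N $ 2 $ 1 = (-1) ^ N * b N"
  using assms(2)
proof (induction N)
  case 0
  then show ?case using assms(1) by (simp add: mat_def)
next
  case (Suc N)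
  let ?M = "cf_mat a b N"
  have b: "b N \<noteq> 0" using Suc.prems by simp
  have "b N * (cf_mat a b (Suc N) $ 1 $ 1 * cf_mat a b (Suc N) $ 2 $ 2 - cf_mat a b (Suc N) $ 1 $ 2 * cf_mat a b (Suc N) $ 2 $ 1)
    = - b (Suc N) * (?M $ 1 $ 1 * ?M $ 2 $ 2 - ?M $ 1 $ 2 * ?M $ 2 $ 1)"
    using b by (simp add: vec2_mult field_simps)
  also have "\<dots> = b N * ((-1) ^ Suc N * b (Suc N))" using Suc by simp
  finally show ?case using b by (simp only: mult_cancel_left) simp
qed

definition cf_state ::
  "int \<Rightarrow> complex set \<Rightarrow> real \<Rightarrow> complex \<Rightarrow> nat \<Rightarrow> (nat \<Rightarrow> complex) \<Rightarrow> (nat \<Rightarrow> complex) \<Rightarrow>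
    complex \<Rightarrow> complex \<Rightarrow> complex \<Rightarrow> complex \<Rightarrow> bool" where
  "cf_state \<Delta> B \<epsilon> z N a b p q p' q' \<longleftrightarrow> cf_run \<Delta> B \<epsilon> z N a b \<and>
     cf_mat a b N $ 1 $ 1 = p \<and> cf_mat a b N $ 2 $ 1 = q \<and>
     cf_mat a b N $ 1 $ 2 = p' \<and> cf_mat a b N $ 2 $ 2 = q'"

context imag_quad
begin

lemma column_ideal_gen2: "column_ideal \<Delta> M = gen2 (M $ 1 $ 1) (M $ 2 $ 1)"
  unfolding column_ideal_def hull_gen2 ..

lemma cf_state_det:
  assumes "cf_state \<Delta> B \<epsilon> z N a b p q p' q'" "0 \<notin> B"
  shows "p * q' - q * p' = (-1) ^ N * b N" "b N \<noteq> 0"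
proof -
  have run: "cf_run \<Delta> B \<epsilon> z N a b" using assms by (simp add: cf_state_def)
  have nz: "b n \<noteq> 0" if "n \<le> N" for n
  proof (cases n)
    case 0 then show ?thesis using run by (simp add: cf_run_def)
  next
    case (Suc m) then show ?thesis using run that assms(2) by (auto simp: cf_run_def Suc_le_eq)
  qed
  then show "b N \<noteq> 0" by simp
  show "p * q' - q * p' = (-1) ^ N * b N"
    using cf_mat_det[of b N a] nz run assms(1) by (simp add: cf_run_def cf_state_def mult.commute)
qed

lemma cf_state_step:
  assumes st: "cf_state \<Delta> B \<epsilon> z N a b p q p' q'" and B: "0 \<notin> B"
    and ring: "p' \<in> \<O>" "q' \<in> \<O>" "P \<in> \<O>" "Q \<in> \<O>"
    and b: "\<beta> \<in> B" "p * Q - q * P = (-1) ^ N * \<beta>"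
    and red: "reduced_ideal \<Delta> (gen2 P Q)"
    and e: "q * z - p \<noteq> 0" "cmod (Q * z - P) \<le> \<epsilon> * cmod (q * z - p)"
  obtains a' b' where "cf_state \<Delta> B \<epsilon> z (Suc N) a' b' P Q p q" "b' (Suc N) = \<beta>"
    "\<And>n. n \<le> N \<Longrightarrow> cf_mat a' b' n = cf_mat a b n"
proof -
  define \<alpha> where "\<alpha> = (-1) ^ N * (P * q' - Q * p')"
  define a' where "a' = a(Suc N := \<alpha>)"
  define b' where "b' = b(Suc N := \<beta>)"
  note det = cf_state_det[OF st B]
  have run: "cf_run \<Delta> B \<epsilon> z N a b" and M: "cf_mat a b N $ 1 $ 1 = p" "cf_mat a b N $ 2 $ 1 = q"
     "cf_mat a b N $ 1 $ 2 = p'" "cf_mat a b N $ 2 $ 2 = q'"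
    using st by (simp_all add: cf_state_def)
  have cong: "cf_mat a' b' n = cf_mat a b n" if "n \<le> N" for n
    by (rule cf_mat_cong) (use that in \<open>auto simp: a'_def b'_def\<close>)
  have sgn: "(-1) ^ N * ((-1) ^ N * x) = (x :: complex)" for x
    by (cases "even N") auto
  have P: "p * \<alpha> + p' * \<beta> = b N * P"
  proof -
    have \<beta>: "\<beta> = (-1) ^ N * (p * Q - q * P)" using b(2) sgn by simp
    have "p * \<alpha> + p' * \<beta> = (-1) ^ N * ((p * q' - q * p') * P)"
      unfolding \<alpha>_def \<beta> by (simp add: algebra_simps)
    then show ?thesis unfolding det(1) using sgn[of "b N * P"] by (simp add: mult.assoc)
  qed
  have Q: "q * \<alpha> + q' * \<beta> = b N * Q"
  proof -
    have \<beta>: "\<beta> = (-1) ^ N * (p * Q - q * P)" using b(2) sgn by simp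
    have "q * \<alpha> + q' * \<beta> = (-1) ^ N * ((p * q' - q * p') * Q)"
      unfolding \<alpha>_def \<beta> by (simp add: algebra_simps)
    then show ?thesis unfolding det(1) using sgn[of "b N * Q"] by (simp add: mult.assoc)
  qed
  have newM: "cf_mat a' b' (Suc N) $ 1 $ 1 = P" "cf_mat a' b' (Suc N) $ 2 $ 1 = Q"
     "cf_mat a' b' (Suc N) $ 1 $ 2 = p" "cf_mat a' b' (Suc N) $ 2 $ 2 = q"
    using P Q det(2) cong[of N] M
    by (simp_all add: vec2_mult a'_def b'_def add_divide_distrib[symmetric])
  have "\<alpha> \<in> \<O>"
  proof -
    have "(-1) ^ N = (of_int ((-1) ^ N) :: complex)" by simp
    then show ?thesis unfolding \<alpha>_def using ring by (simp only:) blast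
  qed
  define d where "d = (-1) ^ N * b N"
  have d: "cf_mat a b N $ 1 $ 1 * cf_mat a b N $ 2 $ 2 - cf_mat a b N $ 1 $ 2 * cf_mat a b N $ 2 $ 1 = d" "d \<noteq> 0"
    using det M by (simp_all add: d_def mult.commute)
  note inv = matrix_inv_2[OF d, unfolded M]
  have pole: "\<not> moebius_pole (matrix_inv (cf_mat a b N)) z"
    using e(1) d(2) unfolding moebius_pole_def inv by (simp add: field_simps)
  have act: "moebius_act (matrix_inv (cf_mat a b N)) z = (q' * z - p') / (p - q * z)"
    using d(2) unfolding moebius_act_def inv moebius_def
    by (simp add: diff_divide_distrib[symmetric] add_divide_distrib[symmetric])
  have "(\<alpha> - \<beta> * ((q' * z - p') / (p - q * z))) * (q * z - p) = b N * (Q * z - P)"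
  proof -
    have "(\<alpha> - \<beta> * ((q' * z - p') / (p - q * z))) * (q * z - p) = \<alpha> * (q * z - p) + \<beta> * (q' * z - p')"
      using e(1) by (simp add: field_simps)
    also have "\<dots> = (q * \<alpha> + q' * \<beta>) * z - (p * \<alpha> + p' * \<beta>)" by (simp add: algebra_simps)
    also have "\<dots> = b N * (Q * z - P)" unfolding P Q by (simp add: algebra_simps)
    finally show ?thesis .
  qed
  then have "cmod (\<alpha> - \<beta> * ((q' * z - p') / (p - q * z))) * cmod (q * z - p) = cmod (b N) * cmod (Q * z - P)"
    by (metis norm_mult)
  also have "\<dots> \<le> cmod (b N) * (\<epsilon> * cmod (q * z - p))" using e(2) by (intro mult_left_mono) auto
  finally have "cmod (\<alpha> - \<beta> * ((q' * z - p') / (p - q * z))) * cmod (q * z - p)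
      \<le> (\<epsilon> * cmod (b N)) * cmod (q * z - p)" by (simp add: algebra_simps)
  then have ball: "cmod (\<alpha> - \<beta> * ((q' * z - p') / (p - q * z))) \<le> \<epsilon> * cmod (b N)"
    using e(1) by simp
  have "cf_run \<Delta> B \<epsilon> z (Suc N) a' b'"
    unfolding cf_run_def
  proof (intro conjI allI impI)
    show "b' 0 = 1" using run by (simp add: cf_run_def b'_def)
  next
    fix n assume n: "n < Suc N"
    have old: "cf_mat a' b' n = cf_mat a b n" "b' n = b n" using n cong by (auto simp: b'_def)
    show "\<not> moebius_pole (matrix_inv (cf_mat a' b' n)) z"
      unfolding old using pole run n by (auto simp: cf_run_def less_Suc_eq)
    show "b' (Suc n) \<in> B" using run n b by (auto simp: cf_run_def less_Suc_eq b'_def)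
    show "a' (Suc n) \<in> \<O> \<inter> cball (b' (Suc n) * moebius_act (matrix_inv (cf_mat a' b' n)) z) (\<epsilon> * cmod (b' n))"
    proof (cases "n = N")
      case True
      then show ?thesis unfolding old using ball \<open>\<alpha> \<in> \<O>\<close> act
        by (simp add: a'_def b'_def dist_norm norm_minus_commute)
    next
      case False
      then have "n < N" using n by simp
      then show ?thesis unfolding old using run by (auto simp: cf_run_def a'_def b'_def)
    qed
    show "reduced_ideal \<Delta> (column_ideal \<Delta> (cf_mat a' b' (Suc n)))"
    proof (cases "n = N")
      case True
      then show ?thesis using red newM by (simp add: column_ideal_gen2)
    next
      case False
      then have "n < N" using n by simp
      then show ?thesis using run cong[of "Suc n"] by (auto simp: cf_run_def)
    qed
  qed
  then have "cf_state \<Delta> B \<epsilon> z (Suc N) a' b' P Q p q" unfolding cf_state_def using newM by simp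
  moreover have "b' (Suc N) = \<beta>" by (simp add: b'_def)
  ultimately show ?thesis using cong that by blast
qed

lemma finite_cosets:
  assumes "submodule \<Delta> J" "J \<noteq> {0}" "J \<subseteq> \<O>"
  shows "finite ((\<lambda>x. (+) x ` J) ` \<O>)"
proof -
  have "0 \<in> J" using assms(1) unfolding submodule_def by blast
  then obtain y where y: "y \<in> J" "y \<noteq> 0" using assms(2) by auto
  then obtain u where u: "y = elt \<Delta> u" using assms(3) by (meson ringE subsetD)
  define m where "m = qnorm \<Delta> u"
  have m: "m > 0" unfolding m_def using y u by (intro qnorm_pos) simp
  have mJ: "of_int m \<in> J"
  proof -
    have "cnj y * y \<in> J" using assms y by (intro submodule_mult) auto
    then show ?thesis unfolding m_def elt_norm u by (simp add: mult.commute)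
  qed
  have eq: "(+) x ` J = (+) y ` J \<longleftrightarrow> x - y \<in> J" for x y
    using coset_eq_iff[of J x y] \<open>0 \<in> J\<close> submodule_diff[OF assms(1)] by blast
  have "(\<lambda>x. (+) x ` J) ` \<O> \<subseteq> (\<lambda>x. (+) (elt \<Delta> x) ` J) ` ({0..<m} \<times> {0..<m})"
  proof
    fix C assume "C \<in> (\<lambda>x. (+) x ` J) ` \<O>"
    then obtain a b where C: "C = (+) (elt \<Delta> (a, b)) ` J" by (auto elim!: ringE)
    have "elt \<Delta> (a, b) - elt \<Delta> (a mod m, b mod m) = elt \<Delta> (a div m, b div m) * of_int m"
    proof -
      have "a - a mod m = a div m * m" "b - b mod m = b div m * m" by (simp_all add: minus_mod_eq_div_mult)
      then have "elt \<Delta> (a, b) - elt \<Delta> (a mod m, b mod m) = elt \<Delta> (a div m * m, b div m * m)"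
        by (simp only: elt_diff[symmetric] diff_Pair)
      then show ?thesis by (simp add: algebra_simps)
    qed
    also have "\<dots> \<in> J" by (rule submodule_mult[OF assms(1) ring_elt mJ])
    finally have "C = (+) (elt \<Delta> (a mod m, b mod m)) ` J" unfolding C eq .
    then show "C \<in> (\<lambda>x. (+) (elt \<Delta> x) ` J) ` ({0..<m} \<times> {0..<m})"
      using m by (intro image_eqI[of _ _ "(a mod m, b mod m)"]) auto
  qed
  then show ?thesis by (rule finite_subset) simp
qed

lemma not_reduced_multiple:
  assumes J: "reduced_ideal \<Delta> J" and g: "\<And>y. y \<in> J \<Longrightarrow> \<exists>x\<in>\<O>. y = of_int g * x" and "g > 0"
  shows "g = 1"
proof (rule ccontr)
  assume "g \<noteq> 1"
  then have "g \<ge> 2" using \<open>g > 0\<close> by simp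
  then have g0: "(of_int g :: complex) \<noteq> 0" by simp
  have sub: "submodule \<Delta> J" and "J \<noteq> {0}" and int: "J \<subseteq> \<O>"
    using J unfolding reduced_ideal_def integral_ideal_def fractional_ideal_def by auto
  define I where "I = (*) (1 / of_int g) ` J"
  have I_iff: "x \<in> I \<longleftrightarrow> of_int g * x \<in> J" for x
    unfolding I_def using g0 by (auto simp: image_iff field_simps)
  have subI: "submodule \<Delta> I"
    unfolding submodule_def
  proof (intro conjI ballI)
    show "0 \<in> I" using sub unfolding I_iff submodule_def by simp
  next
    fix x y assume "x \<in> I" "y \<in> I"
    then show "x + y \<in> I" unfolding I_iff distrib_left by (rule submodule_add[OF sub])
  next
    fix r x assume "r \<in> \<O>" "x \<in> I"
    then show "r * x \<in> I" unfolding I_iff mult.left_commute[of "of_int g"] by (rule submodule_mult[OF sub])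
  qed
  have intI: "I \<subseteq> \<O>"
  proof
    fix x assume "x \<in> I"
    then obtain y where "y \<in> \<O>" "of_int g * x = of_int g * y" using g I_iff by blast
    then show "x \<in> \<O>" using g0 by simp
  qed
  have nzI: "I \<noteq> {0}"
  proof
    assume "I = {0}"
    moreover obtain y where "y \<in> J" "y \<noteq> 0" using \<open>J \<noteq> {0}\<close> sub unfolding submodule_def by auto
    ultimately show False using I_iff[of "y / of_int g"] g0 by simp
  qed
  have "integral_ideal \<Delta> I"
    unfolding integral_ideal_def fractional_ideal_def using subI intI nzI by (intro conjI bexI[of _ 1]) auto
  moreover have "1 / of_int g \<in> quad_field \<Delta>"
  proof -
    have "1 / of_int g = of_rat (1 / of_int g) + of_rat 0 * csqrt (of_int \<Delta>)" by (simp add: of_rat_divide)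
    then show ?thesis unfolding quad_field_def by blast
  qed
  then have "same_class \<Delta> J I" unfolding same_class_def I_def using g0 by (intro bexI[of _ "1 / of_int g"]) auto
  ultimately have le: "ideal_norm \<Delta> J \<le> ideal_norm \<Delta> I" using J unfolding reduced_ideal_def by blast
  let ?CI = "(\<lambda>x. (+) x ` I) ` \<O>" and ?CJ = "(\<lambda>x. (+) x ` J) ` \<O>"
  have eqJ: "(+) x ` J = (+) y ` J \<longleftrightarrow> x - y \<in> J" for x y
    using coset_eq_iff[of J x y] submodule_diff[OF sub] sub unfolding submodule_def by blast
  have eqI: "(+) x ` I = (+) y ` I \<longleftrightarrow> x - y \<in> I" for x y
    using coset_eq_iff[of I x y] submodule_diff[OF subI] subI unfolding submodule_def by blast
  define \<phi> where "\<phi> C = (+) (of_int g * (SOME x. x \<in> \<O> \<and> C = (+) x ` I)) ` J" for C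
  have \<phi>: "\<phi> ((+) x ` I) = (+) (of_int g * x) ` J" if "x \<in> \<O>" for x
  proof -
    define y where "y = (SOME y. y \<in> \<O> \<and> (+) x ` I = (+) y ` I)"
    have "y \<in> \<O> \<and> (+) x ` I = (+) y ` I" unfolding y_def by (rule someI[of _ x]) (use that in simp)
    then have "y - x \<in> I" using eqI[of y x] by simp
    then have "of_int g * y - of_int g * x \<in> J" unfolding I_iff by (simp add: algebra_simps)
    then show ?thesis unfolding \<phi>_def y_def[symmetric] eqJ .
  qed
  have "inj_on \<phi> ?CI"
  proof (rule inj_onI)
    fix C C' assume "C \<in> ?CI" "C' \<in> ?CI" and eq: "\<phi> C = \<phi> C'"
    then obtain x y where x: "x \<in> \<O>" "C = (+) x ` I" and y: "y \<in> \<O>" "C' = (+) y ` I" by blast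
    have "of_int g * x - of_int g * y \<in> J" using eq unfolding x(2) y(2) \<phi>[OF x(1)] \<phi>[OF y(1)] eqJ .
    then have "x - y \<in> I" unfolding I_iff by (simp add: right_diff_distrib)
    then show "C = C'" unfolding x(2) y(2) eqI .
  qed
  moreover have "\<phi> ` ?CI \<subseteq> ?CJ - {(+) 1 ` J}"
  proof (intro subsetI)
    fix C assume "C \<in> \<phi> ` ?CI"
    then obtain x where x: "x \<in> \<O>" "C = (+) (of_int g * x) ` J" by (auto simp: \<phi>)
    have "of_int g * x - 1 \<notin> J"
    proof
      assume "of_int g * x - 1 \<in> J"
      then obtain y where y: "y \<in> \<O>" "of_int g * x - 1 = of_int g * y" using g by blast
      then obtain u v where uv: "x - y = elt \<Delta> (u, v)" using x by (auto elim!: ringE simp: elt_diff[symmetric] simp del: elt.simps)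
      have "of_int g * (x - y) = 1" using y by (simp add: algebra_simps)
      then have "elt \<Delta> (g * u, g * v) = elt \<Delta> (1, 0)" unfolding uv by (simp add: algebra_simps)
      then have "g * u = 1" by (simp only: elt_inj) simp
      then show False using \<open>g \<ge> 2\<close> zmult_eq_1_iff by auto
    qed
    then show "C \<in> ?CJ - {(+) 1 ` J}" using x eqJ by auto
  qed
  moreover have fin: "finite ?CJ" using finite_cosets[OF sub \<open>J \<noteq> {0}\<close> int] .
  ultimately have "card ?CI \<le> card (?CJ - {(+) 1 ` J})" by (meson card_inj_on_le finite_Diff)
  also have "\<dots> < card ?CJ" using fin by (intro psubset_card_mono) auto
  finally show False using le unfolding ideal_norm_def by simp
qed

lemma ring_reduced: "reduced_ideal \<Delta> \<O>"
proof -
  define h where "h = - (\<Delta> div 2)"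
  have eq: "std 1 h = \<O>"
  proof
    show "\<O> \<subseteq> std 1 h"
    proof
      fix x assume "x \<in> \<O>"
      then obtain u v where "x = elt \<Delta> (u, v)" by (auto elim!: ringE)
      then show "x \<in> std 1 h" using std_mem[of u v 1 h] by simp
    qed
  qed (rule std_subset)
  then have sub: "submodule \<Delta> (std 1 h)" using ring_submodule by simp
  have "\<bar>2 * h + \<Delta>\<bar> \<le> 1" unfolding h_def by presburger
  moreover have "1 \<le> conorm 1 h" using conorm_pos[OF sub] by simp
  ultimately show ?thesis using reduced_std_iff[OF sub] unfolding eq by simp
qed

lemma reduced_step_exists:
  assumes adm: "admissible \<Delta> B \<epsilon>" and pq: "p \<in> \<O>" "q \<in> \<O>"
    and red: "reduced_ideal \<Delta> (gen2 p q)" and B: "gen2 p q \<inter> B \<noteq> {}"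
    and e: "q * z - p \<noteq> 0" and \<sigma>: "\<sigma> = 1 \<or> \<sigma> = (-1 :: complex)"
  obtains P Q \<beta> where "P \<in> \<O>" "Q \<in> \<O>" "\<beta> \<in> B" "p * Q - q * P = \<sigma> * \<beta>" "reduced_ideal \<Delta> (gen2 P Q)"
    "cmod (Q * z - P) \<le> \<epsilon> * cmod (q * z - p)"
proof -
  let ?J = "gen2 p q" and ?I = "ideal_inverse \<Delta> (gen2 p q)"
  have invI: "r * t \<in> ?I" if "r \<in> \<O>" "t \<in> ?I" for r t
    using that unfolding ideal_inverse_def by (auto simp: mult.assoc)
  have addI: "s + t \<in> ?I" if "s \<in> ?I" "t \<in> ?I" for s t
    using that unfolding ideal_inverse_def by (auto simp: distrib_right)
  have zeroI: "0 \<in> ?I" unfolding ideal_inverse_def by simp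
  let ?S = "{p * s + q * t | s t. s \<in> ?I \<and> t \<in> ?I}"
  have subS: "submodule \<Delta> ?S"
    unfolding submodule_def
  proof (intro conjI ballI)
    show "0 \<in> ?S" using zeroI by force
  next
    fix x y assume "x \<in> ?S" "y \<in> ?S"
    then obtain s t s' t' where *: "s \<in> ?I" "t \<in> ?I" "s' \<in> ?I" "t' \<in> ?I" and "x = p * s + q * t" "y = p * s' + q * t'"
      by blast
    then have "x + y = p * (s + s') + q * (t + t')" by (simp add: algebra_simps)
    then show "x + y \<in> ?S" using * addI by blast
  next
    fix r x assume r: "r \<in> \<O>" and "x \<in> ?S"
    then obtain s t where *: "s \<in> ?I" "t \<in> ?I" and "x = p * s + q * t" by blast
    then have "r * x = p * (r * s) + q * (r * t)" by (simp add: algebra_simps)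
    then show "r * x \<in> ?S" using * invI r by blast
  qed
  have "{x * y | x y. x \<in> ?J \<and> y \<in> ?I} \<subseteq> ?S"
  proof
    fix w assume "w \<in> {x * y | x y. x \<in> ?J \<and> y \<in> ?I}"
    then obtain x y where "w = x * y" "x \<in> ?J" "y \<in> ?I" by blast
    moreover then obtain a b where "a \<in> \<O>" "b \<in> \<O>" "x = a * p + b * q" unfolding gen2_def by blast
    ultimately have "w = p * (a * y) + q * (b * y)" "a * y \<in> ?I" "b * y \<in> ?I"
      using invI by (auto simp: algebra_simps)
    then show "w \<in> ?S" by blast
  qed
  then have "ideal_product \<Delta> ?J ?I \<subseteq> ?S" unfolding ideal_product_def by (rule hull_minimal) (rule subS)
  moreover have "ideal_product \<Delta> ?J ?I = \<O>" using red unfolding reduced_ideal_def invertible_ideal_def by simp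
  ultimately have "1 \<in> ?S" by blast
  then obtain s t where st: "1 = p * s + q * t" "s \<in> ?I" "t \<in> ?I" by blast
  define r1 where "r1 = - \<sigma> * t"
  define r2 where "r2 = \<sigma> * s"
  have \<sigma>2: "\<sigma> * \<sigma> = 1" and \<sigma>O: "\<sigma> \<in> \<O>" using \<sigma> by auto
  have r: "r1 \<in> ?I" "r2 \<in> ?I" unfolding r1_def r2_def by (intro invI st ring_uminus \<sigma>O)+
  have pr: "p * r2 - q * r1 = \<sigma>"
  proof -
    have "p * r2 - q * r1 = \<sigma> * (p * s + q * t)" unfolding r1_def r2_def by (simp add: algebra_simps)
    then show ?thesis using st(1) by simp
  qed
  let ?\<zeta> = "- (r2 * z - r1) / (q * z - p)"
  have "?\<zeta> \<in> (\<Union>(a, b) \<in> {(a, b). a \<in> ?I \<and> b \<in> ?J \<inter> B \<and>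
             reduced_ideal \<Delta> (submodule \<Delta> hull ((*) a ` ?J \<union> (*) b ` ?I))}. cball (a / b) (\<epsilon> / cmod b))"
    using adm red B unfolding admissible_def by simp
  then obtain a b where ab: "a \<in> ?I" "b \<in> ?J" "b \<in> B" "reduced_ideal \<Delta> (submodule \<Delta> hull ((*) a ` ?J \<union> (*) b ` ?I))"
    "?\<zeta> \<in> cball (a / b) (\<epsilon> / cmod b)" by auto
  have b0: "b \<noteq> 0" using ab adm unfolding admissible_def by auto
  define P where "P = a * p + b * r1"
  define Q where "Q = a * q + b * r2"
  have mem: "x * y \<in> \<O>" if "x \<in> ?I" "y \<in> ?J" for x y using that unfolding ideal_inverse_def by auto
  have "P \<in> \<O>" "Q \<in> \<O>"
    unfolding P_def Q_def using ab r mem gen2_left gen2_right by (auto simp: mult.commute[of b])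
  moreover have "p * Q - q * P = \<sigma> * b"
  proof -
    have "p * Q - q * P = b * (p * r2 - q * r1)" unfolding P_def Q_def by (simp add: algebra_simps)
    then show ?thesis by (simp add: pr mult.commute)
  qed
  moreover have "submodule \<Delta> hull ((*) a ` ?J \<union> (*) b ` ?I) = gen2 P Q"
  proof (rule hull_unique)
    show "submodule \<Delta> (gen2 P Q)" by (rule gen2_submodule)
    show "(*) a ` ?J \<union> (*) b ` ?I \<subseteq> gen2 P Q"
    proof (intro Un_least subsetI)
      fix w assume "w \<in> (*) a ` ?J"
      then obtain y where y: "y \<in> ?J" "w = a * y" by blast
      have "\<sigma> * (r2 * y) \<in> \<O>" "\<sigma> * (- r1 * y) \<in> \<O>" using mem[OF r(1) y(1)] mem[OF r(2) y(1)] \<sigma>O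
        by (auto intro!: ring_mult ring_uminus)
      moreover have "w = (\<sigma> * (r2 * y)) * P + (\<sigma> * (- r1 * y)) * Q"
      proof -
        have "(\<sigma> * (r2 * y)) * P + (\<sigma> * (- r1 * y)) * Q = \<sigma> * (p * r2 - q * r1) * (a * y)"
          unfolding P_def Q_def by (simp add: algebra_simps)
        then show ?thesis unfolding pr y \<sigma>2 by simp
      qed
      ultimately show "w \<in> gen2 P Q" by (rule gen2I)
    next
      fix w assume "w \<in> (*) b ` ?I"
      then obtain y where y: "y \<in> ?I" "w = b * y" by blast
      have "\<sigma> * - (y * q) \<in> \<O>" "\<sigma> * (y * p) \<in> \<O>" using mem[OF y(1) gen2_left] mem[OF y(1) gen2_right] \<sigma>O
        by (auto intro!: ring_mult ring_uminus)
      moreover have "w = (\<sigma> * - (y * q)) * P + (\<sigma> * (y * p)) * Q"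
      proof -
        have "(\<sigma> * - (y * q)) * P + (\<sigma> * (y * p)) * Q = \<sigma> * (p * r2 - q * r1) * (b * y)"
          unfolding P_def Q_def by (simp add: algebra_simps)
        then show ?thesis unfolding pr y \<sigma>2 by simp
      qed
      ultimately show "w \<in> gen2 P Q" by (rule gen2I)
    qed
  next
    fix T assume T: "(*) a ` ?J \<union> (*) b ` ?I \<subseteq> T" "submodule \<Delta> T"
    have aT: "a * x \<in> T" if "x \<in> ?J" for x using T(1) that by blast
    have bT: "b * x \<in> T" if "x \<in> ?I" for x using T(1) that by blast
    have "P \<in> T" "Q \<in> T" unfolding P_def Q_def
      by (intro submodule_add[OF T(2)] aT bT gen2_left gen2_right r)+
    then show "gen2 P Q \<subseteq> T" by (rule gen2_least[OF T(2)])
  qed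
  moreover have "cmod (Q * z - P) \<le> \<epsilon> * cmod (q * z - p)"
  proof -
    have "Q * z - P = (q * z - p) * (b * (a / b - ?\<zeta>))"
      unfolding P_def Q_def using b0 e by (simp add: field_simps)
    then have "cmod (Q * z - P) = cmod (q * z - p) * (cmod b * cmod (a / b - ?\<zeta>))"
      by (simp only: norm_mult)
    also have "\<dots> \<le> cmod (q * z - p) * (cmod b * (\<epsilon> / cmod b))"
      using ab(5) by (intro mult_left_mono) (auto simp: dist_norm)
    finally show ?thesis using b0 by (simp add: mult.commute)
  qed
  ultimately show ?thesis using that ab by simp
qed

end

section \<open>Reasoning about programs\<close>

definition vn :: "nat \<Rightarrow> string" where
  "vn n = replicate n (CHR ''x'')"

lemma vn_eq [simp]: "vn i = vn j \<longleftrightarrow> i = j"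
  unfolding vn_def by (metis length_replicate)

abbreviation (input) V :: "nat \<Rightarrow> expr" where "V n \<equiv> Var (vn n)"
abbreviation (input) asg :: "nat \<Rightarrow> expr \<Rightarrow> prog" where "asg n \<equiv> Assign (vn n)"

primrec seqs :: "prog list \<Rightarrow> prog" where
  "seqs [] = Skip"
| "seqs (c # cs) = Seq c (seqs cs)"

primrec small_consts :: "expr \<Rightarrow> bool" where
  "small_consts (Const c) \<longleftrightarrow> \<bar>c\<bar> \<le> 10"
| "small_consts (Var x) \<longleftrightarrow> True"
| "small_consts (Input e) \<longleftrightarrow> small_consts e"
| "small_consts (Add e f) \<longleftrightarrow> small_consts e \<and> small_consts f"
| "small_consts (Sub e f) \<longleftrightarrow> small_consts e \<and> small_consts f"
| "small_consts (Mul e f) \<longleftrightarrow> small_consts e \<and> small_consts f"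
| "small_consts (Div e f) \<longleftrightarrow> small_consts e \<and> small_consts f"

primrec loop_free :: "prog \<Rightarrow> bool" where
  "loop_free Skip \<longleftrightarrow> True"
| "loop_free (Assign x e) \<longleftrightarrow> small_consts e"
| "loop_free (Output e) \<longleftrightarrow> False"
| "loop_free (Seq c d) \<longleftrightarrow> loop_free c \<and> loop_free d"
| "loop_free (IfLe e f c d) \<longleftrightarrow> small_consts e \<and> small_consts f \<and> loop_free c \<and> loop_free d"
| "loop_free (WhileLe e f c) \<longleftrightarrow> False"

text \<open>If all variables are bounded by \<open>X\<close> and no loop is executed more than once, then afterwards they
  are bounded by \<open>X ^ growth c\<close>.\<close>

primrec growth :: "prog \<Rightarrow> nat" where
  "growth Skip = 1"
| "growth (Assign x e) = expr_cost e"
| "growth (Output e) = expr_cost e"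
| "growth (Seq c d) = growth c * growth d"
| "growth (IfLe e f c d) = expr_cost e * expr_cost f * growth c * growth d"
| "growth (WhileLe e f c) = expr_cost e * expr_cost f * growth c"

primrec pass_cost :: "prog \<Rightarrow> nat" where
  "pass_cost Skip = 1"
| "pass_cost (Assign x e) = 1 + expr_cost e"
| "pass_cost (Output e) = 1 + expr_cost e"
| "pass_cost (Seq c d) = pass_cost c + pass_cost d"
| "pass_cost (IfLe e f c d) = 1 + expr_cost e + expr_cost f + pass_cost c + pass_cost d"
| "pass_cost (WhileLe e f c) = 1 + expr_cost e + expr_cost f + pass_cost c"

primrec sem :: "int list \<Rightarrow> prog \<Rightarrow> store \<Rightarrow> store" where
  "sem inp Skip s = s"
| "sem inp (Assign x e) s = s(x := eval_expr inp s e)"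
| "sem inp (Output e) s = s"
| "sem inp (Seq c d) s = sem inp d (sem inp c s)"
| "sem inp (IfLe e f c d) s = (if eval_expr inp s e \<le> eval_expr inp s f then sem inp c s else sem inp d s)"
| "sem inp (WhileLe e f c) s = s"

primrec writes :: "prog \<Rightarrow> string set" where
  "writes Skip = {}"
| "writes (Assign x e) = {x}"
| "writes (Output e) = {}"
| "writes (Seq c d) = writes c \<union> writes d"
| "writes (IfLe e f c d) = writes c \<union> writes d"
| "writes (WhileLe e f c) = writes c"

lemma exec_frame: "exec L inp c s k out t \<Longrightarrow> x \<notin> writes c \<Longrightarrow> t x = s x"
  by (induction rule: exec.induct) auto

lemma expr_cost_pos: "expr_cost e \<ge> 1"
  by (cases e) auto

lemma growth_pos: "growth c \<ge> 1"
proof -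
  have "0 < expr_cost e" for e using expr_cost_pos[of e] by simp
  then have "0 < growth c" by (induction c) auto
  then show ?thesis by simp
qed

definition bnd :: "int \<Rightarrow> store \<Rightarrow> bool" where
  "bnd X s \<longleftrightarrow> (\<forall>x. \<bar>s x\<bar> \<le> X)"

definition fits :: "real \<Rightarrow> int \<Rightarrow> bool" where
  "fits L X \<longleftrightarrow> (\<forall>v. \<bar>v\<bar> \<le> X \<longrightarrow> real (int_length v) \<le> L)"

definition input_bnd :: "int list \<Rightarrow> int \<Rightarrow> bool" where
  "input_bnd inp X \<longleftrightarrow> (\<forall>i. \<bar>read_input inp i\<bar> \<le> X)"

lemma bnd_mono: "bnd X s \<Longrightarrow> X \<le> Y \<Longrightarrow> bnd Y s"
  unfolding bnd_def by (meson order_trans)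

lemma fits_mono: "fits L Y \<Longrightarrow> X \<le> Y \<Longrightarrow> fits L X"
  unfolding fits_def by (meson order_trans)

lemma input_bnd_mono: "input_bnd inp X \<Longrightarrow> X \<le> Y \<Longrightarrow> input_bnd inp Y"
  unfolding input_bnd_def by (meson order_trans)

lemma pow_ge_self: "(1::int) \<le> X \<Longrightarrow> 1 \<le> n \<Longrightarrow> X \<le> X ^ n"
  using power_increasing[of 1 n X] by simp

lemma abs_div_le: "\<bar>x div (y::int)\<bar> \<le> \<bar>x\<bar>"
proof (cases "y = 0")
  case False
  have pos: "\<bar>x div y\<bar> \<le> \<bar>x\<bar>" if "y > 0" for x y :: int
  proof (cases "x \<ge> 0")
    case True
    have "x div y \<le> x div 1" by (rule zdiv_mono2) (use True that in auto)
    then show ?thesis using True that pos_imp_zdiv_nonneg_iff[of y x] by simp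
  next
    case False
    have "x div 1 \<le> x div y" by (rule zdiv_mono2_neg) (use False that in auto)
    moreover have "x div y < 0" using False that by (simp add: neg_imp_zdiv_neg_iff pos_imp_zdiv_neg_iff)
    ultimately show ?thesis using False by simp
  qed
  show ?thesis
  proof (cases "y > 0")
    case True then show ?thesis by (rule pos)
  next
    case F: False
    then have "\<bar>(- x) div (- y)\<bar> \<le> \<bar>- x\<bar>" using False by (intro pos) auto
    then show ?thesis by simp
  qed
qed simp

lemma eval_bound:
  assumes "small_consts e" "10 \<le> X" "input_bnd inp X" "bnd X s"
  shows "\<bar>eval_expr inp s e\<bar> \<le> X ^ expr_cost e"
  using assms(1)
proof (induction e)
  case (Input e)
  have "\<bar>eval_expr inp s (Input e)\<bar> \<le> X" using assms(3) by (simp add: input_bnd_def)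
  also have "\<dots> \<le> X ^ expr_cost (Input e)" using assms(2) expr_cost_pos by (intro pow_ge_self) auto
  finally show ?case .
next
  case (Mul e f)
  then have "\<bar>eval_expr inp s e\<bar> * \<bar>eval_expr inp s f\<bar> \<le> X ^ expr_cost e * X ^ expr_cost f"
    using assms(2) by (intro mult_mono) auto
  also have "\<dots> = X ^ (expr_cost e + expr_cost f)" by (simp add: power_add)
  also have "\<dots> \<le> X ^ expr_cost (Mul e f)" using assms(2) by (intro power_increasing) auto
  finally show ?case by (simp add: abs_mult)
next
  case (Div e f)
  then have "\<bar>eval_expr inp s e\<bar> \<le> X ^ expr_cost e" by simp
  also have "\<dots> \<le> X ^ expr_cost (Div e f)" using assms(2) by (intro power_increasing) auto
  finally show ?case using abs_div_le[of "eval_expr inp s e" "eval_expr inp s f"] by simp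
next
  case (Add e f)
  let ?m = "max (expr_cost e) (expr_cost f)"
  have "X ^ expr_cost e \<le> X ^ ?m" "X ^ expr_cost f \<le> X ^ ?m" using assms(2) by (auto intro!: power_increasing)
  then have "\<bar>eval_expr inp s e + eval_expr inp s f\<bar> \<le> 2 * X ^ ?m" using Add by fastforce
  also have "\<dots> \<le> X * X ^ ?m" using assms(2) by (intro mult_right_mono) auto
  also have "\<dots> = X ^ Suc ?m" by simp
  also have "\<dots> \<le> X ^ expr_cost (Add e f)" using assms(2) by (intro power_increasing) auto
  finally show ?case by simp
next
  case (Sub e f)
  let ?m = "max (expr_cost e) (expr_cost f)"
  have "X ^ expr_cost e \<le> X ^ ?m" "X ^ expr_cost f \<le> X ^ ?m" using assms(2) by (auto intro!: power_increasing)
  then have "\<bar>eval_expr inp s e - eval_expr inp s f\<bar> \<le> 2 * X ^ ?m" using Sub by fastforce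
  also have "\<dots> \<le> X * X ^ ?m" using assms(2) by (intro mult_right_mono) auto
  also have "\<dots> = X ^ Suc ?m" by simp
  also have "\<dots> \<le> X ^ expr_cost (Sub e f)" using assms(2) by (intro power_increasing) auto
  finally show ?case by simp
qed (use assms in \<open>auto simp: bnd_def\<close>)

lemma subexprs_cost: "f \<in> subexprs e \<Longrightarrow> expr_cost f \<le> expr_cost e"
  by (induction e) auto

lemma subexprs_small: "f \<in> subexprs e \<Longrightarrow> small_consts e \<Longrightarrow> small_consts f"
  by (induction e) auto

lemma within_length_growth:
  assumes "small_consts e" "10 \<le> X" "input_bnd inp X" "bnd X s" "fits L (X ^ expr_cost e)"
  shows "within_length L inp s e"
  unfolding within_length_def
proof
  fix f assume f: "f \<in> subexprs e"
  have "\<bar>eval_expr inp s f\<bar> \<le> X ^ expr_cost f"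
    using eval_bound[OF subexprs_small[OF f assms(1)] assms(2,3,4)] .
  also have "\<dots> \<le> X ^ expr_cost e" using assms(2) subexprs_cost[OF f] by (intro power_increasing) auto
  finally show "real (int_length (eval_expr inp s f)) \<le> L" using assms(5) unfolding fits_def by blast
qed

text \<open>The factor \<open>F\<close> bounds how often loops are run through; \<open>2 ^ J\<close> bounds the smaller argument of
  Euclid's algorithm.\<close>

locale machine =
  fixes L :: real and inp :: "int list" and F J :: nat
  assumes F: "2 * J + 2 \<le> F"
begin

definition ok :: "prog \<Rightarrow> int \<Rightarrow> store \<Rightarrow> bool" where
  "ok c X s \<longleftrightarrow> 10 \<le> X \<and> input_bnd inp X \<and> fits L (X ^ growth c) \<and> bnd X s"

definition ht :: "int \<Rightarrow> prog \<Rightarrow> store \<Rightarrow> (store \<Rightarrow> bool) \<Rightarrow> bool" where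
  "ht X c s Q \<longleftrightarrow> (\<exists>k t. exec L inp c s k [] t \<and> k \<le> F * pass_cost c \<and> bnd (X ^ growth c) t \<and> Q t)"

lemma ok_within:
  "10 \<le> X \<Longrightarrow> input_bnd inp X \<Longrightarrow> bnd X s \<Longrightarrow> fits L (X ^ m) \<Longrightarrow> small_consts e \<Longrightarrow> expr_cost e \<le> m \<Longrightarrow>
    within_length L inp s e"
  by (rule within_length_growth) (auto elim!: fits_mono intro!: power_increasing)

lemma ok_Seq1: "ok (Seq c d) X s \<Longrightarrow> ok c X s"
  unfolding ok_def using growth_pos[of d] by (auto elim!: fits_mono intro!: power_increasing)

lemma ok_Seq2: "ok (Seq c d) X s \<Longrightarrow> bnd (X ^ growth c) t \<Longrightarrow> ok d (X ^ growth c) t"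
  unfolding ok_def using growth_pos[of c] pow_ge_self[of X "growth c"]
  by (auto simp: power_mult[symmetric] elim!: input_bnd_mono)

lemma loop_free_exec:
  "loop_free c \<Longrightarrow> ok c X s \<Longrightarrow>
    \<exists>k. exec L inp c s k [] (sem inp c s) \<and> k \<le> pass_cost c \<and> bnd (X ^ growth c) (sem inp c s)"
proof (induction c arbitrary: X s)
  case Skip
  then show ?case by (auto simp: ok_def intro!: exec.Skip exI[of _ 1])
next
  case (Assign x e)
  then have w: "within_length L inp s e" by (intro ok_within) (auto simp: ok_def)
  have "\<bar>eval_expr inp s e\<bar> \<le> X ^ expr_cost e" using Assign by (intro eval_bound) (auto simp: ok_def)
  moreover have "bnd (X ^ expr_cost e) s" using Assign expr_cost_pos[of e]
    by (auto simp: ok_def intro: bnd_mono[OF _ pow_ge_self])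
  ultimately have "bnd (X ^ expr_cost e) (s(x := eval_expr inp s e))" by (auto simp: bnd_def)
  then show ?case using exec.Assign[OF w, of x] by (metis order_refl growth.simps(2) pass_cost.simps(2) sem.simps(2))
next
  case (Seq c d)
  obtain k where k: "exec L inp c s k [] (sem inp c s)" "k \<le> pass_cost c" "bnd (X ^ growth c) (sem inp c s)"
    using Seq.IH(1)[of X s] Seq.prems ok_Seq1 by auto
  obtain k' where k': "exec L inp d (sem inp c s) k' [] (sem inp d (sem inp c s))" "k' \<le> pass_cost d"
    "bnd ((X ^ growth c) ^ growth d) (sem inp d (sem inp c s))"
    using Seq.IH(2)[of "X ^ growth c" "sem inp c s"] Seq.prems ok_Seq2[OF _ k(3)] by auto
  show ?case using exec.Seq[OF k(1) k'(1)] k(2) k'(2,3) by (auto simp: power_mult[symmetric])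
next
  case (IfLe e f c d)
  have ok: "10 \<le> X" "input_bnd inp X" "bnd X s"
    "fits L (X ^ (expr_cost e * expr_cost f * growth c * growth d))" using IfLe.prems by (auto simp: ok_def)
  have pos: "1 \<le> expr_cost e" "1 \<le> expr_cost f" "1 \<le> growth c" "1 \<le> growth d"
    using expr_cost_pos growth_pos by blast+
  have le: "expr_cost e \<le> expr_cost e * expr_cost f * growth c * growth d"
    "expr_cost f \<le> expr_cost e * expr_cost f * growth c * growth d"
    "growth c \<le> expr_cost e * expr_cost f * growth c * growth d"
    "growth d \<le> expr_cost e * expr_cost f * growth c * growth d"
    using pos by (simp_all add: mult_le_mono)
  have w: "within_length L inp s e" "within_length L inp s f"
    using IfLe.prems le by (auto intro!: ok_within[OF ok])
  have okc: "ok c X s" and okd: "ok d X s" using ok le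
    by (auto simp: ok_def elim!: fits_mono intro!: power_increasing)
  show ?case
  proof (cases "eval_expr inp s e \<le> eval_expr inp s f")
    case True
    obtain k where k: "exec L inp c s k [] (sem inp c s)" "k \<le> pass_cost c" "bnd (X ^ growth c) (sem inp c s)"
      using IfLe.IH(1)[OF _ okc] IfLe.prems by auto
    have "bnd (X ^ growth (IfLe e f c d)) (sem inp c s)"
      using bnd_mono[OF k(3)] ok le by (simp add: power_increasing)
    then show ?thesis using exec.IfTrue[OF w True k(1), of d] k(2) True by auto
  next
    case False
    obtain k where k: "exec L inp d s k [] (sem inp d s)" "k \<le> pass_cost d" "bnd (X ^ growth d) (sem inp d s)"
      using IfLe.IH(2)[OF _ okd] IfLe.prems by auto
    have "bnd (X ^ growth (IfLe e f c d)) (sem inp d s)"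
      using bnd_mono[OF k(3)] ok le by (simp add: power_increasing)
    then show ?thesis using exec.IfFalse[OF w False k(1), of c] k(2) False by auto
  qed
qed auto

lemma ht_loop_free: "loop_free c \<Longrightarrow> ok c X s \<Longrightarrow> Q (sem inp c s) \<Longrightarrow> ht X c s Q"
proof -
  assume "loop_free c" "ok c X s" "Q (sem inp c s)"
  moreover have "1 * pass_cost c \<le> F * pass_cost c" by (rule mult_le_mono1) (use F in simp)
  ultimately show ?thesis using loop_free_exec[of c X s] unfolding ht_def by (metis le_trans nat_mult_1)
qed

lemma ht_conseq: "ht X c s Q \<Longrightarrow> (\<And>t. Q t \<Longrightarrow> Q' t) \<Longrightarrow> ht X c s Q'"
  unfolding ht_def by blast

lemma ht_Seq:
  assumes "ok (Seq c d) X s" "ok c X s \<Longrightarrow> ht X c s Q1"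
    and "\<And>t. Q1 t \<Longrightarrow> ok d (X ^ growth c) t \<Longrightarrow> ht (X ^ growth c) d t Q"
  shows "ht X (Seq c d) s Q"
proof -
  obtain k t where kt: "exec L inp c s k [] t" "k \<le> F * pass_cost c" "bnd (X ^ growth c) t" "Q1 t"
    using assms(2)[OF ok_Seq1[OF assms(1)]] unfolding ht_def by blast
  obtain k' u where u: "exec L inp d t k' [] u" "k' \<le> F * pass_cost d" "bnd ((X ^ growth c) ^ growth d) u" "Q u"
    using assms(3)[OF kt(4) ok_Seq2[OF assms(1) kt(3)]] unfolding ht_def by blast
  have "exec L inp (Seq c d) s (k + k') [] u" using exec.Seq[OF kt(1) u(1)] by simp
  moreover have "k + k' \<le> F * pass_cost (Seq c d)" using kt(2) u(2) by (simp add: distrib_left)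
  moreover have "bnd (X ^ growth (Seq c d)) u" using u(3) by (simp add: power_mult)
  ultimately show ?thesis using u(4) unfolding ht_def by blast
qed

lemma ht_IfLe:
  assumes "ok (IfLe e f c d) X s" "small_consts e" "small_consts f"
    and "eval_expr inp s e \<le> eval_expr inp s f \<Longrightarrow> ok c X s \<Longrightarrow> ht X c s Q"
    and "\<not> eval_expr inp s e \<le> eval_expr inp s f \<Longrightarrow> ok d X s \<Longrightarrow> ht X d s Q"
  shows "ht X (IfLe e f c d) s Q"
proof -
  have ok: "10 \<le> X" "input_bnd inp X" "bnd X s"
    "fits L (X ^ (expr_cost e * expr_cost f * growth c * growth d))" using assms(1) by (auto simp: ok_def)
  have pos: "1 \<le> expr_cost e" "1 \<le> expr_cost f" "1 \<le> growth c" "1 \<le> growth d"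
    using expr_cost_pos growth_pos by blast+
  have le: "expr_cost e \<le> expr_cost e * expr_cost f * growth c * growth d"
    "expr_cost f \<le> expr_cost e * expr_cost f * growth c * growth d"
    "growth c \<le> expr_cost e * expr_cost f * growth c * growth d"
    "growth d \<le> expr_cost e * expr_cost f * growth c * growth d"
    using pos by (simp_all add: mult_le_mono)
  have w: "within_length L inp s e" "within_length L inp s f"
    using assms le by (auto intro!: ok_within[OF ok])
  have okc: "ok c X s" and okd: "ok d X s" using ok le
    by (auto simp: ok_def elim!: fits_mono intro!: power_increasing)
  have add: "1 + expr_cost e + expr_cost f + k \<le> F * pass_cost (IfLe e f c d)"
    if "k \<le> F * pass_cost c \<or> k \<le> F * pass_cost d" for k
  proof -
    have "1 * (1 + expr_cost e + expr_cost f) \<le> F * (1 + expr_cost e + expr_cost f)"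
      by (rule mult_le_mono1) (use F in simp)
    then have "1 + expr_cost e + expr_cost f \<le> F * (1 + expr_cost e + expr_cost f)" by simp
    moreover have "k \<le> F * (pass_cost c + pass_cost d)" using that by (auto simp: distrib_left)
    ultimately have "1 + expr_cost e + expr_cost f + k
        \<le> F * (1 + expr_cost e + expr_cost f) + F * (pass_cost c + pass_cost d)" by (rule add_mono)
    then show ?thesis by (simp only: pass_cost.simps distrib_left add.assoc)
  qed
  show ?thesis
  proof (cases "eval_expr inp s e \<le> eval_expr inp s f")
    case True
    obtain k t where k: "exec L inp c s k [] t" "k \<le> F * pass_cost c" "bnd (X ^ growth c) t" "Q t"
      using assms(4)[OF True okc] unfolding ht_def by blast
    have "bnd (X ^ growth (IfLe e f c d)) t"
      using bnd_mono[OF k(3)] ok le by (simp add: power_increasing)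
    then show ?thesis unfolding ht_def using exec.IfTrue[OF w True k(1), of d] k add by blast
  next
    case False
    obtain k t where k: "exec L inp d s k [] t" "k \<le> F * pass_cost d" "bnd (X ^ growth d) t" "Q t"
      using assms(5)[OF False okd] unfolding ht_def by blast
    have "bnd (X ^ growth (IfLe e f c d)) t"
      using bnd_mono[OF k(3)] ok le by (simp add: power_increasing)
    then show ?thesis unfolding ht_def using exec.IfFalse[OF w False k(1), of c] k add by blast
  qed
qed

end

subsection \<open>Euclid's algorithm on rows\<close>

definition mod_expr :: "expr \<Rightarrow> expr \<Rightarrow> expr" where
  "mod_expr e m = Sub e (Mul m (Div e m))"

lemma eval_mod_expr [simp]: "eval_expr inp s (mod_expr e m) = eval_expr inp s e mod eval_expr inp s m"
  by (simp add: mod_expr_def minus_mult_div_eq_mod)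

lemma small_consts_mod_expr [simp]: "small_consts (mod_expr e m) \<longleftrightarrow> small_consts e \<and> small_consts m"
  by (auto simp: mod_expr_def)

text \<open>The rows are \<open>150, 152, 154, 156\<close> and \<open>151, 153, 155, 157\<close>; all entries but the leading ones are
  taken modulo the variable \<open>130\<close>.\<close>

definition euclid_body :: prog where
  "euclid_body = seqs [
     asg 158 (Div (V 150) (V 151)),
     asg 159 (Sub (V 150) (Mul (V 158) (V 151))), asg 150 (V 151), asg 151 (V 159),
     asg 159 (Sub (V 152) (Mul (V 158) (V 153))), asg 152 (V 153), asg 153 (mod_expr (V 159) (V 130)),
     asg 159 (Sub (V 154) (Mul (V 158) (V 155))), asg 154 (V 155), asg 155 (mod_expr (V 159) (V 130)),
     asg 159 (Sub (V 156) (Mul (V 158) (V 157))), asg 156 (V 157), asg 157 (mod_expr (V 159) (V 130)),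
     asg 158 (Const 0), asg 159 (Const 0)]"

definition euclid_prog :: prog where
  "euclid_prog = WhileLe (Const 1) (V 151) euclid_body"

definition row_closed :: "int \<Rightarrow> (int \<Rightarrow> int \<Rightarrow> int \<Rightarrow> int \<Rightarrow> bool) \<Rightarrow> bool" where
  "row_closed m \<Phi> \<longleftrightarrow>
     (\<forall>x y u v x' y' u' v' t. \<Phi> x y u v \<longrightarrow> \<Phi> x' y' u' v' \<longrightarrow>
        \<Phi> (x - t * x') (y - t * y') (u - t * u') (v - t * v')) \<and>
     (\<forall>x y u v i j k. \<Phi> x y u v \<longrightarrow> \<Phi> x (y + m * i) (u + m * j) (v + m * k))"

lemma row_closed_sub: "row_closed m \<Phi> \<Longrightarrow> \<Phi> x y u v \<Longrightarrow> \<Phi> x' y' u' v' \<Longrightarrow>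
    \<Phi> (x - t * x') (y - t * y') (u - t * u') (v - t * v')"
  unfolding row_closed_def by blast

lemma row_closed_mod_iff:
  assumes "row_closed m \<Phi>"
  shows "\<Phi> x (y mod m) (u mod m) (v mod m) \<longleftrightarrow> \<Phi> x y u v"
proof
  assume "\<Phi> x (y mod m) (u mod m) (v mod m)"
  then have "\<Phi> x (y mod m + m * (y div m)) (u mod m + m * (u div m)) (v mod m + m * (v div m))"
    using assms unfolding row_closed_def by blast
  then show "\<Phi> x y u v" by simp
next
  assume "\<Phi> x y u v"
  then have "\<Phi> x (y + m * (- (y div m))) (u + m * (- (u div m))) (v + m * (- (v div m)))"
    using assms unfolding row_closed_def by blast
  then show "\<Phi> x (y mod m) (u mod m) (v mod m)" by (simp add: minus_mult_div_eq_mod)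
qed

definition euclid_rel :: "store \<Rightarrow> store \<Rightarrow> bool" where
  "euclid_rel s t \<longleftrightarrow>
     (\<forall>x. x \<notin> vn ` {150..159} \<longrightarrow> t x = s x) \<and>
     gcd (t (vn 150)) (t (vn 151)) = gcd (s (vn 150)) (s (vn 151)) \<and>
     0 \<le> t (vn 150) \<and> 0 \<le> t (vn 151) \<and>
     (\<forall>\<Phi>. row_closed (s (vn 130)) \<Phi> \<longrightarrow>
        (\<Phi> (t (vn 150)) (t (vn 152)) (t (vn 154)) (t (vn 156)) \<and> \<Phi> (t (vn 151)) (t (vn 153)) (t (vn 155)) (t (vn 157))) =
        (\<Phi> (s (vn 150)) (s (vn 152)) (s (vn 154)) (s (vn 156)) \<and> \<Phi> (s (vn 151)) (s (vn 153)) (s (vn 155)) (s (vn 157)))) \<and>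
     (\<forall>i\<in>{152..157}. (\<forall>j\<in>{152..157}. s (vn j) \<in> {0..<s (vn 130)}) \<longrightarrow> t (vn i) \<in> {0..<s (vn 130)})"

lemma euclid_rel_refl: "0 \<le> s (vn 150) \<Longrightarrow> 0 \<le> s (vn 151) \<Longrightarrow> euclid_rel s s"
  unfolding euclid_rel_def by auto

lemma vn_image [simp]: "vn i \<in> vn ` S \<longleftrightarrow> i \<in> S"
  by (auto simp: image_iff)

lemma euclid_rel_trans:
  assumes "euclid_rel s t" "euclid_rel t u"
  shows "euclid_rel s u"
proof -
  have m: "t (vn 130) = s (vn 130)" using assms(1) unfolding euclid_rel_def by auto
  note a = assms(1)[unfolded euclid_rel_def]
  note a1 = a[THEN conjunct1] and a2 = a[THEN conjunct2, THEN conjunct1]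
    and a5 = a[THEN conjunct2, THEN conjunct2, THEN conjunct2, THEN conjunct2, THEN conjunct1]
    and a6 = a[THEN conjunct2, THEN conjunct2, THEN conjunct2, THEN conjunct2, THEN conjunct2]
  note b = assms(2)[unfolded euclid_rel_def m]
  note b1 = b[THEN conjunct1] and b2 = b[THEN conjunct2, THEN conjunct1]
    and b3 = b[THEN conjunct2, THEN conjunct2, THEN conjunct1]
    and b4 = b[THEN conjunct2, THEN conjunct2, THEN conjunct2, THEN conjunct1]
    and b5 = b[THEN conjunct2, THEN conjunct2, THEN conjunct2, THEN conjunct2, THEN conjunct1]
    and b6 = b[THEN conjunct2, THEN conjunct2, THEN conjunct2, THEN conjunct2, THEN conjunct2]
  show ?thesis
    unfolding euclid_rel_def
  proof (intro conjI)
    show "\<forall>x. x \<notin> vn ` {150..159} \<longrightarrow> u x = s x" using a1 b1 by simp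
    show "gcd (u (vn 150)) (u (vn 151)) = gcd (s (vn 150)) (s (vn 151))" using a2 b2 by (rule trans[rotated])
    show "0 \<le> u (vn 150)" "0 \<le> u (vn 151)" by (fact b3, fact b4)
  next
    show "\<forall>\<Phi>. row_closed (s (vn 130)) \<Phi> \<longrightarrow>
        (\<Phi> (u (vn 150)) (u (vn 152)) (u (vn 154)) (u (vn 156)) \<and> \<Phi> (u (vn 151)) (u (vn 153)) (u (vn 155)) (u (vn 157))) =
        (\<Phi> (s (vn 150)) (s (vn 152)) (s (vn 154)) (s (vn 156)) \<and> \<Phi> (s (vn 151)) (s (vn 153)) (s (vn 155)) (s (vn 157)))"
      by (intro allI impI trans[OF b5[rule_format] a5[rule_format]])
  next
    show "\<forall>i\<in>{152..157}. (\<forall>j\<in>{152..157}. s (vn j) \<in> {0..<s (vn 130)}) \<longrightarrow> u (vn i) \<in> {0..<s (vn 130)}"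
      by (intro ballI impI b6[rule_format, OF _ a6[rule_format]]) (assumption | blast)+
  qed
qed

lemma euclid_body_sem:
  assumes "0 \<le> s (vn 150)" "1 \<le> s (vn 151)" "0 < s (vn 130)"
  shows "euclid_rel s (sem inp euclid_body s)"
    and "sem inp euclid_body s (vn 150) = s (vn 151)"
    and "sem inp euclid_body s (vn 151) = s (vn 150) mod s (vn 151)"
    and "bnd X s \<Longrightarrow> bnd X (sem inp euclid_body s)"
proof -
  define x1 y1 u1 v1 where 1: "x1 = s (vn 150)" "y1 = s (vn 152)" "u1 = s (vn 154)" "v1 = s (vn 156)"
  define x2 y2 u2 v2 where 2: "x2 = s (vn 151)" "y2 = s (vn 153)" "u2 = s (vn 155)" "v2 = s (vn 157)"
  define m where "m = s (vn 130)"
  define t where "t = sem inp euclid_body s"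
  define d where "d = x1 div x2"
  have t: "t = s(vn 150 := x2, vn 151 := x1 - d * x2, vn 152 := y2, vn 153 := (y1 - d * y2) mod m,
      vn 154 := u2, vn 155 := (u1 - d * u2) mod m, vn 156 := v2, vn 157 := (v1 - d * v2) mod m,
      vn 158 := 0, vn 159 := 0)"
    unfolding t_def euclid_body_def 1 2 m_def d_def by (rule ext) simp
  have pos: "0 \<le> x1" "1 \<le> x2" "0 < m" using assms unfolding 1 2 m_def by auto
  have r: "x1 - d * x2 = x1 mod x2" unfolding d_def by (simp add: minus_div_mult_eq_mod)
  have iff: "(\<Phi> x2 y2 u2 v2 \<and> \<Phi> (x1 - d * x2) ((y1 - d * y2) mod m) ((u1 - d * u2) mod m) ((v1 - d * v2) mod m))
      = (\<Phi> x1 y1 u1 v1 \<and> \<Phi> x2 y2 u2 v2)" if c: "row_closed m \<Phi>" for \<Phi>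
    unfolding row_closed_mod_iff[OF c]
    using row_closed_sub[OF c, of x1 y1 u1 v1 x2 y2 u2 v2 d]
      row_closed_sub[OF c, of "x1 - d * x2" "y1 - d * y2" "u1 - d * u2" "v1 - d * v2" x2 y2 u2 v2 "- d"] by auto
  have g: "gcd x2 (x1 mod x2) = gcd x1 x2" by (rule gcd_red_int[symmetric])
  have "euclid_rel s t"
    unfolding euclid_rel_def
  proof (intro conjI allI impI ballI)
    fix x assume "x \<notin> vn ` {150..159}"
    then have "x \<noteq> vn i" if "i \<in> {150..159}" for i using that by auto
    then show "t x = s x" unfolding t by simp
  next
    show "gcd (t (vn 150)) (t (vn 151)) = gcd (s (vn 150)) (s (vn 151))"
      using g r unfolding t by (simp add: 1 2)
  next
    fix \<Phi> assume "row_closed (s (vn 130)) \<Phi>"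
    then show "(\<Phi> (t (vn 150)) (t (vn 152)) (t (vn 154)) (t (vn 156)) \<and> \<Phi> (t (vn 151)) (t (vn 153)) (t (vn 155)) (t (vn 157))) =
        (\<Phi> (s (vn 150)) (s (vn 152)) (s (vn 154)) (s (vn 156)) \<and> \<Phi> (s (vn 151)) (s (vn 153)) (s (vn 155)) (s (vn 157)))"
      using iff[of \<Phi>] unfolding t by (simp add: 1 2 m_def)
  next
    fix i :: nat assume "i \<in> {152..157}" and *: "\<forall>j\<in>{152..157}. s (vn j) \<in> {0..<s (vn 130)}"
    then consider "i = 152" | "i = 153" | "i = 154" | "i = 155" | "i = 156" | "i = 157" by fastforce
    then show "t (vn i) \<in> {0..<s (vn 130)}"
      by cases (use * pos in \<open>auto simp: t 1 2 m_def\<close>)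
  qed (use pos r in \<open>auto simp: t\<close>)
  then show "euclid_rel s (sem inp euclid_body s)" unfolding t_def .
  show "sem inp euclid_body s (vn 150) = s (vn 151)" unfolding t_def[symmetric] t by (simp add: 2)
  show "sem inp euclid_body s (vn 151) = s (vn 150) mod s (vn 151)"
    unfolding t_def[symmetric] t using r by (simp add: 1 2)
  assume b: "bnd X s"
  have X: "x1 \<le> X" "x2 \<le> X" "m \<le> X" "\<bar>y2\<bar> \<le> X" "\<bar>u2\<bar> \<le> X" "\<bar>v2\<bar> \<le> X"
    using b pos unfolding bnd_def 1 2 m_def by (auto simp: abs_le_iff)
  have mm: "\<bar>a mod m\<bar> \<le> X" for a using pos X(3) pos_mod_bound[of m a] pos_mod_sign[of m a] by linarith
  have "0 \<le> x1 mod x2" "x1 mod x2 < x2" using pos by auto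
  then have "\<bar>x1 - d * x2\<bar> \<le> X" unfolding r using X by linarith
  then have "bnd X t" unfolding t using b X pos mm by (auto simp: bnd_def)
  then show "bnd X (sem inp euclid_body s)" unfolding t_def .
qed

context machine
begin

lemma euclid_exit:
  assumes "10 \<le> X" "input_bnd inp X" "fits L (X ^ growth euclid_prog)" "bnd X s"
  shows "within_length L inp s (Const 1)" "within_length L inp s (V 151)"
    and "\<not> 1 \<le> s (vn 151) \<Longrightarrow> exec L inp euclid_prog s 3 [] s"
proof -
  show w: "within_length L inp s (Const 1)" "within_length L inp s (V 151)"
    by (rule ok_within[of X _ "growth euclid_prog"]; use assms growth_pos in simp)+
  show "exec L inp euclid_prog s 3 [] s" if "\<not> 1 \<le> s (vn 151)"
    unfolding euclid_prog_def using exec.WhileFalse[OF w, of euclid_body] that by (simp add: numeral_3_eq_3)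
qed

lemma euclid_ordered:
  assumes "10 \<le> X" "input_bnd inp X" "fits L (X ^ growth euclid_prog)" "bnd X s" "0 < s (vn 130)"
    and "0 \<le> s (vn 151)" "s (vn 151) \<le> s (vn 150)" "s (vn 150) * s (vn 151) < 2 ^ n"
  shows "\<exists>k t. exec L inp euclid_prog s k [] t \<and> k \<le> (n + 1) * pass_cost euclid_prog \<and> bnd X t \<and>
      euclid_rel s t \<and> t (vn 151) = 0"
  using assms(4-)
proof (induction n arbitrary: s)
  case (0 s)
  have "s (vn 151) = 0"
  proof (rule ccontr)
    assume "s (vn 151) \<noteq> 0"
    then have "0 < s (vn 150) * s (vn 151)" using 0 by (intro mult_pos_pos) auto
    then show False using 0 by simp
  qed
  then have "exec L inp euclid_prog s 3 [] s" using 0 by (intro euclid_exit(3)[OF assms(1-3)]) auto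
  then show ?case using 0 \<open>s (vn 151) = 0\<close> by (intro exI[of _ 3] exI[of _ s]) (auto simp: euclid_prog_def euclid_rel_refl)
next
  case (Suc n s)
  note w = euclid_exit[OF assms(1-3) Suc.prems(1)]
  show ?case
  proof (cases "1 \<le> s (vn 151)")
    case False
    then have "s (vn 151) = 0" using Suc by simp
    have "exec L inp euclid_prog s 3 [] s" using w(3) False by blast
    then show ?thesis using Suc \<open>s (vn 151) = 0\<close>
      by (intro exI[of _ 3] exI[of _ s]) (auto simp: euclid_prog_def euclid_rel_refl)
  next
    case True
    let ?t = "sem inp euclid_body s"
    have lf: "loop_free euclid_body" unfolding euclid_body_def by simp
    have ok: "ok euclid_body X s" using assms(1-3) Suc.prems unfolding ok_def by (simp add: euclid_prog_def)
    obtain k where k: "exec L inp euclid_body s k [] ?t" "k \<le> pass_cost euclid_body"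
      using loop_free_exec[OF lf ok] by blast
    have nn: "0 \<le> s (vn 150)" using Suc.prems by linarith
    note sem = euclid_body_sem[OF nn True Suc.prems(2), where inp = inp]
    have m: "?t (vn 130) = s (vn 130)" using sem(1) unfolding euclid_rel_def by auto
    have "2 * (s (vn 151) * (s (vn 150) mod s (vn 151))) \<le> s (vn 150) * s (vn 151)"
    proof -
      let ?a = "s (vn 150)" and ?b = "s (vn 151)"
      have "1 \<le> ?a div ?b" using Suc.prems True by (simp add: int_one_le_iff_zero_less pos_imp_zdiv_pos_iff)
      then have "?b \<le> (?a div ?b) * ?b" using True by simp
      moreover have "?a mod ?b < ?b" using True by simp
      ultimately have "2 * (?a mod ?b) \<le> ?a" using div_mult_mod_eq[of ?a ?b] by linarith
      then have "?b * (2 * (?a mod ?b)) \<le> ?b * ?a" using True by (intro mult_left_mono) auto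
      then show ?thesis by (simp add: algebra_simps)
    qed
    then have prod: "?t (vn 150) * ?t (vn 151) < 2 ^ n" unfolding sem(2,3) using Suc.prems by simp
    have "\<exists>k' u. exec L inp euclid_prog ?t k' [] u \<and> k' \<le> (n + 1) * pass_cost euclid_prog \<and> bnd X u \<and>
      euclid_rel ?t u \<and> u (vn 151) = 0"
      by (rule Suc.IH) (use sem m prod Suc.prems True in \<open>auto simp: less_imp_le\<close>)
    then obtain k' u where u: "exec L inp euclid_prog ?t k' [] u" "k' \<le> (n + 1) * pass_cost euclid_prog" "bnd X u"
      "euclid_rel ?t u" "u (vn 151) = 0" by blast
    have "exec L inp euclid_prog s (3 + k + k') [] u"
      using exec.WhileTrue[OF w(1,2) _ k(1) u(1)[unfolded euclid_prog_def]] True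
      unfolding euclid_prog_def by (simp add: numeral_3_eq_3)
    moreover have "3 + k + k' \<le> (Suc n + 1) * pass_cost euclid_prog"
      using k(2) u(2) by (simp add: euclid_prog_def)
    ultimately show ?thesis using u euclid_rel_trans[OF sem(1) u(4)] by blast
  qed
qed

lemma euclid_ht:
  assumes "ok euclid_prog X s" "0 < s (vn 130)" "0 \<le> s (vn 150)" "0 \<le> s (vn 151)" "s (vn 151) < 2 ^ J"
  shows "ht X euclid_prog s (\<lambda>t. euclid_rel s t \<and> t (vn 151) = 0)"
proof -
  have a: "10 \<le> X" "input_bnd inp X" "fits L (X ^ growth euclid_prog)" "bnd X s" using assms(1) unfolding ok_def by auto
  have bX: "bnd (X ^ growth euclid_prog) t" if "bnd X t" for t
    using that a(1) growth_pos[of euclid_prog] by (intro bnd_mono[OF that pow_ge_self]) auto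
  note w = euclid_exit[OF a]
  show ?thesis
  proof (cases "1 \<le> s (vn 151)")
    case False
    then have z: "s (vn 151) = 0" using assms by simp
    have "exec L inp euclid_prog s 3 [] s" using w(3) False by blast
    moreover have "3 \<le> F * pass_cost euclid_prog" using F by (simp add: euclid_prog_def trans_le_add1)
    ultimately show ?thesis unfolding ht_def using bX[OF a(4)] euclid_rel_refl[of s] assms z by blast
  next
    case True
    let ?t = "sem inp euclid_body s"
    have lf: "loop_free euclid_body" unfolding euclid_body_def by simp
    have ok: "ok euclid_body X s" using a unfolding ok_def by (simp add: euclid_prog_def)
    obtain k where k: "exec L inp euclid_body s k [] ?t" "k \<le> pass_cost euclid_body"
      using loop_free_exec[OF lf ok] by blast
    note sem = euclid_body_sem[OF assms(3) True assms(2), where inp = inp]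
    have m: "?t (vn 130) = s (vn 130)" using sem(1) unfolding euclid_rel_def by auto
    have "s (vn 150) mod s (vn 151) \<le> s (vn 151)" using True by (simp add: less_imp_le)
    then have "s (vn 151) * (s (vn 150) mod s (vn 151)) \<le> s (vn 151) * s (vn 151)"
      using True by (intro mult_left_mono) auto
    also have "\<dots> < 2 ^ J * 2 ^ J" using assms True by (intro mult_strict_mono) auto
    also have "\<dots> = 2 ^ (2 * J)" by (simp add: power_add[symmetric] mult_2)
    finally have prod: "?t (vn 150) * ?t (vn 151) < 2 ^ (2 * J)" unfolding sem(2,3) .
    have "\<exists>k' u. exec L inp euclid_prog ?t k' [] u \<and> k' \<le> (2 * J + 1) * pass_cost euclid_prog \<and> bnd X u \<and>
      euclid_rel ?t u \<and> u (vn 151) = 0"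
      by (rule euclid_ordered) (use sem m prod True a assms in \<open>auto simp: less_imp_le\<close>)
    then obtain k' u where u: "exec L inp euclid_prog ?t k' [] u" "k' \<le> (2 * J + 1) * pass_cost euclid_prog" "bnd X u"
      "euclid_rel ?t u" "u (vn 151) = 0" by blast
    have "exec L inp euclid_prog s (3 + k + k') [] u"
      using exec.WhileTrue[OF w(1,2) _ k(1) u(1)[unfolded euclid_prog_def]] True
      unfolding euclid_prog_def by (simp add: numeral_3_eq_3)
    moreover have "3 + k + k' \<le> (2 * J + 2) * pass_cost euclid_prog"
      using k(2) u(2) by (simp add: euclid_prog_def)
    then have "3 + k + k' \<le> F * pass_cost euclid_prog" using F by (meson le_trans mult_le_mono1)
    ultimately show ?thesis unfolding ht_def using u bX euclid_rel_trans[OF sem(1) u(4)] by blast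
  qed
qed

end

subsection \<open>Expressions for pairs\<close>

type_synonym pexpr = "expr \<times> expr"

definition gp :: "store \<Rightarrow> nat \<Rightarrow> int \<times> int" where
  "gp s k = (s (vn k), s (vn (Suc k)))"

definition upd2 :: "nat \<Rightarrow> int \<times> int \<Rightarrow> store \<Rightarrow> store" where
  "upd2 k v s = s(vn k := fst v, vn (Suc k) := snd v)"

lemma gp_upd2 [simp]: "gp (upd2 k v s) k = v"
  by (simp add: gp_def upd2_def)

lemma gp_upd2_other [simp]: "j \<noteq> k \<Longrightarrow> j \<noteq> Suc k \<Longrightarrow> Suc j \<noteq> k \<Longrightarrow> gp (upd2 k v s) j = gp s j"
  by (simp add: gp_def upd2_def)

lemma upd2_other [simp]: "j \<noteq> k \<Longrightarrow> j \<noteq> Suc k \<Longrightarrow> upd2 k v s (vn j) = s (vn j)"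
  by (simp add: upd2_def)

lemma gp_fun_upd [simp]: "i \<noteq> j \<Longrightarrow> i \<noteq> Suc j \<Longrightarrow> gp (s(vn i := x)) j = gp s j"
  by (simp add: gp_def)

definition peval :: "int list \<Rightarrow> store \<Rightarrow> pexpr \<Rightarrow> int \<times> int" where
  "peval inp s p = (eval_expr inp s (fst p), eval_expr inp s (snd p))"

definition pv :: "nat \<Rightarrow> pexpr" where "pv k = (V k, V (Suc k))"
definition pconst :: "int \<Rightarrow> int \<Rightarrow> pexpr" where "pconst a b = (Const a, Const b)"
definition padd :: "pexpr \<Rightarrow> pexpr \<Rightarrow> pexpr" where
  "padd p q = (Add (fst p) (fst q), Add (snd p) (snd q))"
definition psub :: "pexpr \<Rightarrow> pexpr \<Rightarrow> pexpr" where
  "psub p q = (Sub (fst p) (fst q), Sub (snd p) (snd q))"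
definition pscale :: "expr \<Rightarrow> pexpr \<Rightarrow> pexpr" where
  "pscale e p = (Mul e (fst p), Mul e (snd p))"
definition pdiv :: "pexpr \<Rightarrow> expr \<Rightarrow> pexpr" where
  "pdiv p e = (Div (fst p) e, Div (snd p) e)"
definition pmod :: "pexpr \<Rightarrow> expr \<Rightarrow> pexpr" where
  "pmod p e = (mod_expr (fst p) e, mod_expr (snd p) e)"

text \<open>Variables \<open>0\<close> and \<open>1\<close> hold the discriminant and the norm of \<open>\<tau>\<close>.\<close>

definition pmul :: "pexpr \<Rightarrow> pexpr \<Rightarrow> pexpr" where
  "pmul p q =
    (Sub (Mul (fst p) (fst q)) (Mul (Mul (snd p) (snd q)) (V 1)),
     Add (Add (Mul (fst p) (snd q)) (Mul (snd p) (fst q))) (Mul (Mul (snd p) (snd q)) (V 0)))"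
definition pconj :: "pexpr \<Rightarrow> pexpr" where
  "pconj p = (Add (fst p) (Mul (snd p) (V 0)), Sub (Const 0) (snd p))"
definition pnorm :: "pexpr \<Rightarrow> expr" where
  "pnorm p = Add (Add (Mul (fst p) (fst p)) (Mul (Mul (fst p) (snd p)) (V 0))) (Mul (Mul (snd p) (snd p)) (V 1))"

lemma peval_simps [simp]:
  "peval inp s (pv k) = gp s k"
  "peval inp s (pconst a b) = (a, b)"
  "peval inp s (padd p q) = peval inp s p + peval inp s q"
  "peval inp s (psub p q) = peval inp s p - peval inp s q"
  "peval inp s (pscale e p) = qsc (eval_expr inp s e) (peval inp s p)"
  "peval inp s (pdiv p e) = qdiv (peval inp s p) (eval_expr inp s e)"
  by (simp_all add: peval_def pv_def gp_def pconst_def padd_def psub_def pscale_def pdiv_def)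

lemma peval_pmod [simp]:
  "peval inp s (pmod p e) = (fst (peval inp s p) mod eval_expr inp s e, snd (peval inp s p) mod eval_expr inp s e)"
  by (simp add: peval_def pmod_def)

lemma peval_pmul [simp]:
  "s (vn 1) = tau_norm (s (vn 0)) \<Longrightarrow> peval inp s (pmul p q) = qmul (s (vn 0)) (peval inp s p) (peval inp s q)"
  by (simp add: peval_def pmul_def)

lemma peval_pconj [simp]: "peval inp s (pconj p) = qconj (s (vn 0)) (peval inp s p)"
  by (simp add: peval_def pconj_def)

lemma eval_pnorm [simp]:
  "s (vn 1) = tau_norm (s (vn 0)) \<Longrightarrow> eval_expr inp s (pnorm p) = qnorm (s (vn 0)) (peval inp s p)"
  by (simp add: peval_def pnorm_def)

primrec evars :: "expr \<Rightarrow> string set" where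
  "evars (Const c) = {}"
| "evars (Var x) = {x}"
| "evars (Input e) = evars e"
| "evars (Add e f) = evars e \<union> evars f"
| "evars (Sub e f) = evars e \<union> evars f"
| "evars (Mul e f) = evars e \<union> evars f"
| "evars (Div e f) = evars e \<union> evars f"

lemma eval_expr_cong: "(\<And>x. x \<in> evars e \<Longrightarrow> s x = t x) \<Longrightarrow> eval_expr inp s e = eval_expr inp t e"
  by (induction e) auto

definition pvars :: "pexpr \<Rightarrow> string set" where
  "pvars p = evars (fst p) \<union> evars (snd p)"

definition psmall :: "pexpr \<Rightarrow> bool" where
  "psmall p \<longleftrightarrow> small_consts (fst p) \<and> small_consts (snd p)"

lemma pvars_simps [simp]:
  "pvars (pv k) = {vn k, vn (Suc k)}"
  "pvars (pconst a b) = {}"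
  "pvars (padd p q) = pvars p \<union> pvars q"
  "pvars (psub p q) = pvars p \<union> pvars q"
  "pvars (pscale e p) = evars e \<union> pvars p"
  "pvars (pdiv p e) = evars e \<union> pvars p"
  "pvars (pmod p e) = evars e \<union> pvars p"
  "pvars (pmul p q) = pvars p \<union> pvars q \<union> {vn 0, vn 1}"
  "pvars (pconj p) = pvars p \<union> {vn 0}"
  "evars (pnorm p) = pvars p \<union> {vn 0, vn 1}"
  by (auto simp: pvars_def pv_def pconst_def padd_def psub_def pscale_def pdiv_def pmod_def mod_expr_def
      pmul_def pconj_def pnorm_def)

lemma psmall_simps [simp]:
  "psmall (pv k)"
  "psmall (pconst a b) \<longleftrightarrow> \<bar>a\<bar> \<le> 10 \<and> \<bar>b\<bar> \<le> 10"
  "psmall (padd p q) \<longleftrightarrow> psmall p \<and> psmall q"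
  "psmall (psub p q) \<longleftrightarrow> psmall p \<and> psmall q"
  "psmall (pscale e p) \<longleftrightarrow> small_consts e \<and> psmall p"
  "psmall (pdiv p e) \<longleftrightarrow> small_consts e \<and> psmall p"
  "psmall (pmod p e) \<longleftrightarrow> small_consts e \<and> psmall p"
  "psmall (pmul p q) \<longleftrightarrow> psmall p \<and> psmall q"
  "psmall (pconj p) \<longleftrightarrow> psmall p"
  "small_consts (pnorm p) \<longleftrightarrow> psmall p"
  by (auto simp: psmall_def pv_def pconst_def padd_def psub_def pscale_def pdiv_def pmod_def
      pmul_def pconj_def pnorm_def)

lemma peval_cong: "(\<And>x. x \<in> pvars p \<Longrightarrow> s x = t x) \<Longrightarrow> peval inp s p = peval inp t p"
  by (auto simp: pvars_def peval_def intro!: eval_expr_cong)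

definition asgp :: "nat \<Rightarrow> pexpr \<Rightarrow> prog" where
  "asgp k p = Seq (asg k (fst p)) (asg (Suc k) (snd p))"

lemma sem_asgp [simp]: "vn k \<notin> pvars p \<Longrightarrow> sem inp (asgp k p) s = upd2 k (peval inp s p) s"
proof -
  assume "vn k \<notin> pvars p"
  then have "eval_expr inp (s(vn k := x)) (snd p) = eval_expr inp s (snd p)" for x
    by (intro eval_expr_cong) (auto simp: pvars_def)
  then show ?thesis by (simp add: asgp_def upd2_def peval_def)
qed

lemma loop_free_asgp [simp]: "loop_free (asgp k p) \<longleftrightarrow> psmall p"
  by (simp add: asgp_def psmall_def)

lemma writes_asgp [simp]: "writes (asgp k p) = {vn k, vn (Suc k)}"
  by (auto simp: asgp_def)

subsection \<open>Adding a row to a basis\<close>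

text \<open>A row is a pair \<open>(u, v)\<close>, standing for \<open>u + v \<tau>\<close>, together with a second pair that follows the
  row operations. The basis consists of a row with leading entry \<open>v\<close> (variables \<open>132\<close> to \<open>135\<close>) and
  a row with \<open>v = 0\<close> (variables \<open>136, 138, 139\<close>); the row to be added is in \<open>140\<close> to \<open>143\<close>.\<close>

definition row_load1 :: prog where
  "row_load1 = seqs [asg 150 (V 133), asg 152 (V 132), asg 154 (V 134), asg 156 (V 135),
     asg 151 (V 141), asg 153 (V 140), asg 155 (V 142), asg 157 (V 143)]"

definition row_load2 :: prog where
  "row_load2 = seqs [asg 133 (V 150), asg 132 (V 152), asg 134 (V 154), asg 135 (V 156),
     asg 151 (V 153), asg 150 (V 136), asg 152 (Const 0), asg 153 (Const 0), asg 154 (V 138), asg 156 (V 139)]"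

definition row_store :: prog where
  "row_store = seqs [asg 136 (V 150), asg 138 (V 154), asg 139 (V 156)]"

definition add_row :: prog where
  "add_row = Seq row_load1 (Seq euclid_prog (Seq row_load2 (Seq euclid_prog row_store)))"

definition lattice_pred :: "int \<Rightarrow> (int \<Rightarrow> int \<Rightarrow> int \<Rightarrow> int \<Rightarrow> bool) \<Rightarrow> bool" where
  "lattice_pred m \<Psi> \<longleftrightarrow> \<Psi> 0 0 0 0 \<and>
     (\<forall>x y u v x' y' u' v' t. \<Psi> x y u v \<longrightarrow> \<Psi> x' y' u' v' \<longrightarrow>
        \<Psi> (x - t * x') (y - t * y') (u - t * u') (v - t * v')) \<and>
     (\<forall>x y u v h i j k. \<Psi> x y u v \<longrightarrow> \<Psi> (x + m * h) (y + m * i) (u + m * j) (v + m * k))"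

lemma lattice_pred_row_closed:
  assumes "lattice_pred m \<Psi>"
  shows "row_closed m \<Psi>" "row_closed m (\<lambda>x y. \<Psi> y x)"
proof -
  have a: "\<Psi> (x - t * x') (y - t * y') (u - t * u') (v - t * v')"
    if "\<Psi> x y u v" "\<Psi> x' y' u' v'" for x y u v x' y' u' v' t
    using assms that unfolding lattice_pred_def by blast
  have b: "\<Psi> (x + m * h) (y + m * i) (u + m * j) (v + m * k)" if "\<Psi> x y u v" for x y u v h i j k
    using assms that unfolding lattice_pred_def by blast
  show "row_closed m \<Psi>" "row_closed m (\<lambda>x y. \<Psi> y x)"
    unfolding row_closed_def using a b[where h = 0] b[where i = 0] by auto
qed

definition rowA :: "store \<Rightarrow> (int \<Rightarrow> int \<Rightarrow> int \<Rightarrow> int \<Rightarrow> bool) \<Rightarrow> bool" where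
  "rowA s \<Psi> = \<Psi> (s (vn 132)) (s (vn 133)) (s (vn 134)) (s (vn 135))"
definition rowZ :: "store \<Rightarrow> (int \<Rightarrow> int \<Rightarrow> int \<Rightarrow> int \<Rightarrow> bool) \<Rightarrow> bool" where
  "rowZ s \<Psi> = \<Psi> (s (vn 136)) 0 (s (vn 138)) (s (vn 139))"
definition rowR :: "store \<Rightarrow> (int \<Rightarrow> int \<Rightarrow> int \<Rightarrow> int \<Rightarrow> bool) \<Rightarrow> bool" where
  "rowR s \<Psi> = \<Psi> (s (vn 140)) (s (vn 141)) (s (vn 142)) (s (vn 143))"

definition basis_ok :: "store \<Rightarrow> bool" where
  "basis_ok s \<longleftrightarrow> 0 < s (vn 130) \<and> 0 < s (vn 133) \<and> 0 < s (vn 136) \<and>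
     (\<forall>i\<in>{132, 134, 135, 138, 139}. s (vn i) \<in> {0..<s (vn 130)})"

definition add_rel :: "store \<Rightarrow> store \<Rightarrow> bool" where
  "add_rel s t \<longleftrightarrow> basis_ok t \<and> (\<forall>x. x \<notin> vn ` {132..159} \<longrightarrow> t x = s x) \<and>
     t (vn 133) dvd s (vn 133) \<and> t (vn 136) dvd s (vn 136) \<and>
     (\<forall>\<Psi>. lattice_pred (s (vn 130)) \<Psi> \<longrightarrow>
        (rowA s \<Psi> \<and> rowZ s \<Psi> \<and> rowR s \<Psi> \<longrightarrow> rowA t \<Psi> \<and> rowZ t \<Psi>) \<and>
        ((\<forall>a b. \<Psi> 0 0 a b) \<and> rowA t \<Psi> \<and> rowZ t \<Psi> \<longrightarrow> rowA s \<Psi> \<and> rowZ s \<Psi> \<and> rowR s \<Psi>))"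

lemma euclid_relD:
  assumes "euclid_rel s t" "t (vn 151) = 0"
  shows "x \<notin> vn ` {150..159} \<Longrightarrow> t x = s x"
    and "t (vn 150) = gcd (s (vn 150)) (s (vn 151))"
    and "row_closed (s (vn 130)) \<Phi> \<Longrightarrow>
        (\<Phi> (t (vn 150)) (t (vn 152)) (t (vn 154)) (t (vn 156)) \<and> \<Phi> 0 (t (vn 153)) (t (vn 155)) (t (vn 157))) =
        (\<Phi> (s (vn 150)) (s (vn 152)) (s (vn 154)) (s (vn 156)) \<and> \<Phi> (s (vn 151)) (s (vn 153)) (s (vn 155)) (s (vn 157)))"
    and "(\<forall>j\<in>{152..157}. s (vn j) \<in> {0..<s (vn 130)}) \<Longrightarrow> i \<in> {152..157} \<Longrightarrow> t (vn i) \<in> {0..<s (vn 130)}"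
  using assms unfolding euclid_rel_def by (auto simp: gcd_0_int)

context machine
begin

lemma add_row_ht:
  assumes ok: "ok add_row X s" and bok: "basis_ok s" and m: "s (vn 130) \<le> 2 ^ J"
    and R: "\<And>i. i \<in> {140..143} \<Longrightarrow> s (vn i) \<in> {0..<s (vn 130)}"
  shows "ht X add_row s (add_rel s)"
  unfolding add_row_def
proof (rule ht_Seq[OF ok[unfolded add_row_def]])
  let ?s1 = "sem inp row_load1 s"
  define m where "m = s (vn 130)"
  have m0: "0 < m" using bok unfolding basis_ok_def m_def by simp
  have A: "s (vn i) \<in> {0..<m}" if "i \<in> {132, 134, 135, 138, 139}" for i
    using bok that unfolding basis_ok_def m_def by auto
  show "ht X row_load1 s (\<lambda>t. t = ?s1)" if "ok row_load1 X s"
    by (rule ht_loop_free[OF _ that]) (simp_all add: row_load1_def)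
  fix t1 assume t1: "t1 = ?s1" and ok1: "ok (Seq euclid_prog (Seq row_load2 (Seq euclid_prog row_store))) (X ^ growth row_load1) t1"
  have t1v: "t1 (vn 150) = s (vn 133)" "t1 (vn 152) = s (vn 132)" "t1 (vn 154) = s (vn 134)" "t1 (vn 156) = s (vn 135)"
    "t1 (vn 151) = s (vn 141)" "t1 (vn 153) = s (vn 140)" "t1 (vn 155) = s (vn 142)" "t1 (vn 157) = s (vn 143)"
    unfolding t1 row_load1_def by simp_all
  have fr1: "t1 x = s x" if "x \<notin> vn ` {132..159}" for x
  proof -
    have "x \<noteq> vn i" if "i \<in> {132..159}" for i using that \<open>x \<notin> vn ` {132..159}\<close> by auto
    then show ?thesis unfolding t1 row_load1_def by simp
  qed
  have fr1': "t1 (vn i) = s (vn i)" if "i < 150" for i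
    unfolding t1 row_load1_def using that by simp
  have rng1: "\<forall>j\<in>{152..157}. t1 (vn j) \<in> {0..<t1 (vn 130)}"
  proof
    fix j :: nat assume "j \<in> {152..157}"
    then consider "j = 152" | "j = 153" | "j = 154" | "j = 155" | "j = 156" | "j = 157" by fastforce
    then show "t1 (vn j) \<in> {0..<t1 (vn 130)}"
      by cases (use A R in \<open>auto simp: t1v fr1' m_def[symmetric]\<close>)
  qed
  show "ht (X ^ growth row_load1) (Seq euclid_prog (Seq row_load2 (Seq euclid_prog row_store))) t1 (add_rel s)"
  proof (rule ht_Seq[OF ok1])
    show "ht (X ^ growth row_load1) euclid_prog t1 (\<lambda>t. euclid_rel t1 t \<and> t (vn 151) = 0)"
      if "ok euclid_prog (X ^ growth row_load1) t1"
      by (rule euclid_ht[OF that])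
        (use bok R[of 141] m in \<open>auto simp: t1v fr1' basis_ok_def\<close>)
    fix t2 assume t2: "euclid_rel t1 t2 \<and> t2 (vn 151) = 0"
      and ok2: "ok (Seq row_load2 (Seq euclid_prog row_store)) ((X ^ growth row_load1) ^ growth euclid_prog) t2"
    note e2 = euclid_relD[OF conjunct1[OF t2] conjunct2[OF t2]]
    have fr2: "t2 (vn i) = s (vn i)" if "i < 150" for i using e2(1)[of "vn i"] fr1'[of i] that by auto
    let ?s3 = "sem inp row_load2 t2"
    show "ht ((X ^ growth row_load1) ^ growth euclid_prog) (Seq row_load2 (Seq euclid_prog row_store)) t2 (add_rel s)"
    proof (rule ht_Seq[OF ok2])
      show "ht ((X ^ growth row_load1) ^ growth euclid_prog) row_load2 t2 (\<lambda>t. t = ?s3)"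
        if "ok row_load2 ((X ^ growth row_load1) ^ growth euclid_prog) t2"
        by (rule ht_loop_free[OF _ that]) (simp_all add: row_load2_def)
      fix t3 assume t3: "t3 = ?s3" and ok3: "ok (Seq euclid_prog row_store) (((X ^ growth row_load1) ^ growth euclid_prog) ^ growth row_load2) t3"
      have t3v: "t3 (vn 133) = t2 (vn 150)" "t3 (vn 132) = t2 (vn 152)" "t3 (vn 134) = t2 (vn 154)" "t3 (vn 135) = t2 (vn 156)"
        "t3 (vn 151) = t2 (vn 153)" "t3 (vn 150) = t2 (vn 136)" "t3 (vn 152) = 0" "t3 (vn 153) = 0"
        "t3 (vn 154) = t2 (vn 138)" "t3 (vn 156) = t2 (vn 139)" "t3 (vn 155) = t2 (vn 155)" "t3 (vn 157) = t2 (vn 157)"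
        unfolding t3 row_load2_def by simp_all
      have fr3: "t3 x = s x" if "x \<notin> vn ` {132..159}" for x
      proof -
        have *: "x \<noteq> vn i" if "i \<in> {132..159}" for i using that \<open>x \<notin> vn ` {132..159}\<close> by auto
        then have "t3 x = t2 x" unfolding t3 row_load2_def by simp
        also have "\<dots> = t1 x" by (rule e2(1)) (use \<open>x \<notin> vn ` {132..159}\<close> in auto)
        finally show ?thesis using fr1[OF that] by simp
      qed
      have rng2: "t2 (vn i) \<in> {0..<m}" if "i \<in> {152..157}" for i
        using e2(4)[OF rng1 that] fr1'[of 130] by (simp add: m_def)
      have m3: "t3 (vn 130) = m" using fr3[of "vn 130"] by (simp add: m_def)
      have rng3: "\<forall>j\<in>{152..157}. t3 (vn j) \<in> {0..<t3 (vn 130)}"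
      proof
        fix j :: nat assume "j \<in> {152..157}"
        then consider "j = 152" | "j = 153" | "j = 154" | "j = 155" | "j = 156" | "j = 157" by fastforce
        then show "t3 (vn j) \<in> {0..<t3 (vn 130)}"
          by cases (use A rng2 m0 in \<open>auto simp: t3v fr2 m3\<close>)
      qed
      show "ht (((X ^ growth row_load1) ^ growth euclid_prog) ^ growth row_load2) (Seq euclid_prog row_store) t3 (add_rel s)"
      proof (rule ht_Seq[OF ok3])
        show "ht (((X ^ growth row_load1) ^ growth euclid_prog) ^ growth row_load2) euclid_prog t3
            (\<lambda>t. euclid_rel t3 t \<and> t (vn 151) = 0)"
          if "ok euclid_prog (((X ^ growth row_load1) ^ growth euclid_prog) ^ growth row_load2) t3"
          by (rule euclid_ht[OF that])
            (use bok rng2[of 153] m m0 in \<open>auto simp: t3v m3 fr2 basis_ok_def m_def\<close>)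
        fix t4 assume t4: "euclid_rel t3 t4 \<and> t4 (vn 151) = 0"
          and ok4: "ok row_store ((((X ^ growth row_load1) ^ growth euclid_prog) ^ growth row_load2) ^ growth euclid_prog) t4"
        note e4 = euclid_relD[OF conjunct1[OF t4] conjunct2[OF t4]]
        have fr4: "t4 (vn i) = t3 (vn i)" if "i < 150" for i using e4(1)[of "vn i"] that by auto
        have rng4: "t4 (vn i) \<in> {0..<m}" if "i \<in> {152..157}" for i
          using e4(4)[OF rng3 that] m3 by simp
        have "row_closed m (\<lambda>x y u v. y mod m = 0)"
          unfolding row_closed_def by (auto simp: mod_diff_eq[symmetric] mod_mult_right_eq[symmetric])
        then have y0: "t4 (vn 152) mod m = 0" "t4 (vn 153) mod m = 0"
          using e4(3)[unfolded m3, of "\<lambda>x y u v. y mod m = 0"] t3v by auto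
        have y: "t4 (vn 152) = 0" "t4 (vn 153) = 0" using y0 rng4[of 152] rng4[of 153] by auto
        let ?t = "sem inp row_store t4"
        define t where "t = ?t"
        have tv: "t (vn 136) = t4 (vn 150)" "t (vn 138) = t4 (vn 154)" "t (vn 139) = t4 (vn 156)"
          "t (vn 132) = t2 (vn 152)" "t (vn 133) = t2 (vn 150)" "t (vn 134) = t2 (vn 154)" "t (vn 135) = t2 (vn 156)"
          unfolding t_def row_store_def by (simp_all add: fr4 t3v)
        have frt: "t x = s x" if "x \<notin> vn ` {132..159}" for x
        proof -
          have *: "x \<noteq> vn i" if "i \<in> {132..159}" for i using that \<open>x \<notin> vn ` {132..159}\<close> by auto
          then have "t x = t4 x" unfolding t_def row_store_def by simp
          also have "\<dots> = t3 x" by (rule e4(1)) (use \<open>x \<notin> vn ` {132..159}\<close> in auto)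
          finally show ?thesis using fr3[OF that] by simp
        qed
        have mt: "t (vn 130) = m" using frt[of "vn 130"] by (simp add: m_def)
        have g1: "t (vn 133) = gcd (s (vn 133)) (s (vn 141))" using tv e2(2) t1v by simp
        have g2: "t (vn 136) = gcd (s (vn 136)) (t2 (vn 153))" using tv e4(2) t3v fr2 by simp
        have bt: "basis_ok t"
          unfolding basis_ok_def mt using m0 g1 g2 bok rng2 rng4
          by (auto simp: basis_ok_def tv gcd_pos_int)
        have rows: "(rowA s \<Psi> \<and> rowZ s \<Psi> \<and> rowR s \<Psi> \<longrightarrow> rowA t \<Psi> \<and> rowZ t \<Psi>) \<and>
            ((\<forall>a b. \<Psi> 0 0 a b) \<and> rowA t \<Psi> \<and> rowZ t \<Psi> \<longrightarrow> rowA s \<Psi> \<and> rowZ s \<Psi> \<and> rowR s \<Psi>)"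
          if \<Psi>: "lattice_pred (s (vn 130)) \<Psi>" for \<Psi>
        proof -
          have c: "row_closed m \<Psi>" "row_closed m (\<lambda>x y. \<Psi> y x)"
            using lattice_pred_row_closed[OF \<Psi>] unfolding m_def by auto
          have i1: "(rowA t \<Psi> \<and> \<Psi> (t2 (vn 153)) 0 (t2 (vn 155)) (t2 (vn 157))) = (rowA s \<Psi> \<and> rowR s \<Psi>)"
            using e2(3)[of "\<lambda>x y. \<Psi> y x"] c(2) fr1'[of 130] unfolding rowA_def rowR_def tv t1v by (simp add: m_def)
          have i2: "(rowZ t \<Psi> \<and> \<Psi> 0 0 (t4 (vn 155)) (t4 (vn 157)))
              = (rowZ s \<Psi> \<and> \<Psi> (t2 (vn 153)) 0 (t2 (vn 155)) (t2 (vn 157)))"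
            using e4(3)[of \<Psi>] c(1) unfolding rowZ_def tv t3v y m3 by (simp add: fr2)
          show ?thesis using i1 i2 by blast
        qed
        have dvd: "t (vn 133) dvd s (vn 133)" "t (vn 136) dvd s (vn 136)"
          unfolding g1 g2 by (rule gcd_dvd1)+
        have "add_rel s t"
          unfolding add_rel_def
          by (rule conjI[OF bt], rule conjI, intro allI impI, rule frt, assumption,
              rule conjI[OF dvd(1)], rule conjI[OF dvd(2)], intro allI impI, rule rows, assumption)
        then show "ht ((((X ^ growth row_load1) ^ growth euclid_prog) ^ growth row_load2) ^ growth euclid_prog)
            row_store t4 (add_rel s)"
          by (intro ht_loop_free[OF _ ok4]) (simp_all add: row_store_def t_def)
      qed
    qed
  qed
qed

end

definition row_prog :: "pexpr \<times> pexpr \<Rightarrow> prog" where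
  "row_prog r = Seq (Seq (asgp 140 (pmod (fst r) (V 130))) (asgp 142 (pmod (snd r) (V 130)))) add_row"

definition rows_prog :: "(pexpr \<times> pexpr) list \<Rightarrow> prog" where
  "rows_prog rs = seqs (map row_prog rs)"

definition row_pexpr_ok :: "pexpr \<times> pexpr \<Rightarrow> bool" where
  "row_pexpr_ok r \<longleftrightarrow> psmall (fst r) \<and> psmall (snd r) \<and> pvars (fst r) \<union> pvars (snd r) \<subseteq> vn ` {..<130}"

definition row_val :: "int list \<Rightarrow> (int \<Rightarrow> int \<Rightarrow> int \<Rightarrow> int \<Rightarrow> bool) \<Rightarrow> store \<Rightarrow> pexpr \<times> pexpr \<Rightarrow> bool" where
  "row_val inp \<Psi> s r = \<Psi> (fst (peval inp s (fst r))) (snd (peval inp s (fst r)))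
     (fst (peval inp s (snd r))) (snd (peval inp s (snd r)))"

definition rows_rel :: "int list \<Rightarrow> (pexpr \<times> pexpr) list \<Rightarrow> store \<Rightarrow> store \<Rightarrow> bool" where
  "rows_rel inp rs s t \<longleftrightarrow> basis_ok t \<and> (\<forall>x. x \<notin> vn ` {132..159} \<longrightarrow> t x = s x) \<and>
     t (vn 133) dvd s (vn 133) \<and> t (vn 136) dvd s (vn 136) \<and>
     (\<forall>\<Psi>. lattice_pred (s (vn 130)) \<Psi> \<longrightarrow>
        (rowA s \<Psi> \<and> rowZ s \<Psi> \<and> (\<forall>r\<in>set rs. row_val inp \<Psi> s r) \<longrightarrow> rowA t \<Psi> \<and> rowZ t \<Psi>) \<and>
        ((\<forall>a b. \<Psi> 0 0 a b) \<and> rowA t \<Psi> \<and> rowZ t \<Psi> \<longrightarrow>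
          rowA s \<Psi> \<and> rowZ s \<Psi> \<and> (\<forall>r\<in>set rs. row_val inp \<Psi> s r)))"

lemma rows_relD:
  assumes "rows_rel inp rs s t"
  shows "basis_ok t" "x \<notin> vn ` {132..159} \<Longrightarrow> t x = s x"
    "t (vn 133) dvd s (vn 133)" "t (vn 136) dvd s (vn 136)"
  using assms unfolding rows_rel_def by blast+

lemma add_relD:
  assumes "add_rel s t"
  shows "basis_ok t" "x \<notin> vn ` {132..159} \<Longrightarrow> t x = s x"
    "t (vn 133) dvd s (vn 133)" "t (vn 136) dvd s (vn 136)"
  using assms unfolding add_rel_def by blast+

lemma lattice_pred_mod_iff:
  assumes "lattice_pred m \<Psi>"
  shows "\<Psi> (x mod m) (y mod m) (u mod m) (v mod m) \<longleftrightarrow> \<Psi> x y u v"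
proof -
  have add: "\<Psi> (x + m * h) (y + m * i) (u + m * j) (v + m * k)" if "\<Psi> x y u v" for x y u v h i j k
    using assms that unfolding lattice_pred_def by blast
  show ?thesis
  proof
    assume "\<Psi> (x mod m) (y mod m) (u mod m) (v mod m)"
    from add[OF this, of "x div m" "y div m" "u div m" "v div m"] show "\<Psi> x y u v" by simp
  next
    assume "\<Psi> x y u v"
    from add[OF this, of "- (x div m)" "- (y div m)" "- (u div m)" "- (v div m)"]
    show "\<Psi> (x mod m) (y mod m) (u mod m) (v mod m)" by (simp add: minus_mult_div_eq_mod)
  qed
qed

context machine
begin

lemma row_prog_ht:
  assumes ok: "ok (row_prog r) X s" and bok: "basis_ok s" and m: "s (vn 130) \<le> 2 ^ J" and r: "row_pexpr_ok r"
  shows "ht X (row_prog r) s (rows_rel inp [r] s)"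
  unfolding row_prog_def
proof (rule ht_Seq[OF ok[unfolded row_prog_def]])
  let ?c = "Seq (asgp 140 (pmod (fst r) (V 130))) (asgp 142 (pmod (snd r) (V 130)))"
  have nv: "vn i \<notin> pvars (fst r)" "vn i \<notin> pvars (snd r)" if "i \<ge> 130" for i
    using r that unfolding row_pexpr_ok_def by (auto dest!: subsetD)
  define m where "m = s (vn 130)"
  define E where "E = peval inp s (fst r)"
  define F' where "F' = peval inp s (snd r)"
  define s1 where "s1 = upd2 142 (fst F' mod m, snd F' mod m) (upd2 140 (fst E mod m, snd E mod m) s)"
  have "peval inp (upd2 140 v s) (snd r) = F'" for v
    unfolding F'_def using nv[of 140] nv[of 141] by (intro peval_cong) (auto simp: upd2_def)
  then have s1: "sem inp ?c s = s1" unfolding s1_def using nv by (simp add: E_def F'_def m_def)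
  show "ht X ?c s (\<lambda>t. t = s1)" if "ok ?c X s"
    by (rule ht_loop_free[OF _ that]) (use r s1 in \<open>auto simp: row_pexpr_ok_def\<close>)
  fix t1 assume t1: "t1 = s1" and ok1: "ok add_row (X ^ growth ?c) t1"
  have m0: "m > 0" using bok by (simp add: basis_ok_def m_def)
  have v: "s1 (vn 140) = fst E mod m" "s1 (vn 141) = snd E mod m" "s1 (vn 142) = fst F' mod m" "s1 (vn 143) = snd F' mod m"
    unfolding s1_def by (simp_all add: upd2_def)
  have fr: "s1 x = s x" if "x \<notin> vn ` {140..143}" for x
  proof -
    have "x \<noteq> vn i" if "i \<in> {140..143}" for i using that \<open>x \<notin> vn ` {140..143}\<close> by auto
    then show ?thesis unfolding s1_def by (simp add: upd2_def)
  qed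
  have bok1: "basis_ok s1" using bok unfolding basis_ok_def by (simp add: fr)
  have "ht (X ^ growth ?c) add_row t1 (add_rel t1)"
  proof (rule add_row_ht[OF ok1])
    show "basis_ok t1" using bok1 t1 by simp
    show "t1 (vn 130) \<le> 2 ^ J" using m t1 by (simp add: fr)
    fix i :: nat assume "i \<in> {140..143}"
    then consider "i = 140" | "i = 141" | "i = 142" | "i = 143" by fastforce
    then show "t1 (vn i) \<in> {0..<t1 (vn 130)}"
      by cases (use m0 in \<open>auto simp: t1 v fr m_def[symmetric]\<close>)
  qed
  then show "ht (X ^ growth ?c) add_row t1 (rows_rel inp [r] s)"
  proof (rule ht_conseq)
    fix t assume a: "add_rel t1 t"
    have rw: "rowA s1 \<Psi> = rowA s \<Psi>" "rowZ s1 \<Psi> = rowZ s \<Psi>" for \<Psi>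
      unfolding rowA_def rowZ_def by (simp_all add: fr)
    have rr: "rowR s1 \<Psi> = row_val inp \<Psi> s r" if "lattice_pred m \<Psi>" for \<Psi>
      unfolding rowR_def row_val_def v lattice_pred_mod_iff[OF that] E_def F'_def ..
    have frt: "t x = s x" if "x \<notin> vn ` {132..159}" for x
    proof -
      have "t x = s1 x" using a t1 that unfolding add_rel_def by blast
      also have "\<dots> = s x" by (rule fr) (use that in auto)
      finally show ?thesis .
    qed
    have bok': "basis_ok t" by (rule add_relD[OF a])
    have dvd: "t (vn 133) dvd s (vn 133)" "t (vn 136) dvd s (vn 136)"
      using add_relD(3,4)[OF a] t1 by (simp_all add: fr)
    have P: "(rowA s \<Psi> \<and> rowZ s \<Psi> \<and> (\<forall>r\<in>set [r]. row_val inp \<Psi> s r) \<longrightarrow> rowA t \<Psi> \<and> rowZ t \<Psi>) \<and>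
        ((\<forall>a b. \<Psi> 0 0 a b) \<and> rowA t \<Psi> \<and> rowZ t \<Psi> \<longrightarrow>
          rowA s \<Psi> \<and> rowZ s \<Psi> \<and> (\<forall>r\<in>set [r]. row_val inp \<Psi> s r))"
      if l: "lattice_pred (s (vn 130)) \<Psi>" for \<Psi>
    proof -
      have eq: "(\<forall>r\<in>set [r]. row_val inp \<Psi> s r) = row_val inp \<Psi> s r" by simp
      have "s1 (vn 130) = s (vn 130)" by (rule fr) auto
      with l have "lattice_pred (s1 (vn 130)) \<Psi>" by simp
      then have "(rowA s1 \<Psi> \<and> rowZ s1 \<Psi> \<and> rowR s1 \<Psi> \<longrightarrow> rowA t \<Psi> \<and> rowZ t \<Psi>) \<and>
        ((\<forall>a b. \<Psi> 0 0 a b) \<and> rowA t \<Psi> \<and> rowZ t \<Psi> \<longrightarrow> rowA s1 \<Psi> \<and> rowZ s1 \<Psi> \<and> rowR s1 \<Psi>)"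
        using a unfolding add_rel_def t1 by blast
      then show ?thesis unfolding eq rw rr[OF l[folded m_def]] .
    qed
    show "rows_rel inp [r] s t" unfolding rows_rel_def
      by (rule conjI[OF bok'], rule conjI, intro allI impI, rule frt, assumption,
          rule conjI[OF dvd(1)], rule conjI[OF dvd(2)], intro allI impI, rule P, assumption)
  qed
qed

lemma rows_rel_Cons:
  assumes "rows_rel inp [r] s t" "rows_rel inp rs t u" "\<forall>r\<in>set rs. row_pexpr_ok r"
  shows "rows_rel inp (r # rs) s u"
proof -
  have fr: "t x = s x" if "x \<notin> vn ` {132..159}" for x using assms(1) that unfolding rows_rel_def by blast
  have m: "t (vn 130) = s (vn 130)" by (rule fr) auto
  have val: "row_val inp \<Psi> t r' = row_val inp \<Psi> s r'" if "r' \<in> set rs" for \<Psi> r'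
  proof -
    have "peval inp t (fst r') = peval inp s (fst r')" "peval inp t (snd r') = peval inp s (snd r')"
      using assms(3) that unfolding row_pexpr_ok_def by (auto intro!: peval_cong fr dest!: subsetD)
    then show ?thesis unfolding row_val_def by simp
  qed
  have P: "(rowA s \<Psi> \<and> rowZ s \<Psi> \<and> (\<forall>r\<in>set (r # rs). row_val inp \<Psi> s r) \<longrightarrow> rowA u \<Psi> \<and> rowZ u \<Psi>) \<and>
        ((\<forall>a b. \<Psi> 0 0 a b) \<and> rowA u \<Psi> \<and> rowZ u \<Psi> \<longrightarrow>
          rowA s \<Psi> \<and> rowZ s \<Psi> \<and> (\<forall>r\<in>set (r # rs). row_val inp \<Psi> s r))" if l: "lattice_pred (s (vn 130)) \<Psi>" for \<Psi>
  proof -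
    have 1: "(rowA s \<Psi> \<and> rowZ s \<Psi> \<and> row_val inp \<Psi> s r \<longrightarrow> rowA t \<Psi> \<and> rowZ t \<Psi>) \<and>
        ((\<forall>a b. \<Psi> 0 0 a b) \<and> rowA t \<Psi> \<and> rowZ t \<Psi> \<longrightarrow> rowA s \<Psi> \<and> rowZ s \<Psi> \<and> row_val inp \<Psi> s r)"
    proof -
      have h: "(rowA s \<Psi> \<and> rowZ s \<Psi> \<and> (\<forall>r\<in>set [r]. row_val inp \<Psi> s r) \<longrightarrow> rowA t \<Psi> \<and> rowZ t \<Psi>) \<and>
        ((\<forall>a b. \<Psi> 0 0 a b) \<and> rowA t \<Psi> \<and> rowZ t \<Psi> \<longrightarrow> rowA s \<Psi> \<and> rowZ s \<Psi> \<and> (\<forall>r\<in>set [r]. row_val inp \<Psi> s r))"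
        using assms(1) l unfolding rows_rel_def by blast
      have eq: "(\<forall>r\<in>set [r]. row_val inp \<Psi> s r) = row_val inp \<Psi> s r" by simp
      show ?thesis using h unfolding eq .
    qed
    have 2: "(rowA t \<Psi> \<and> rowZ t \<Psi> \<and> (\<forall>r\<in>set rs. row_val inp \<Psi> t r) \<longrightarrow> rowA u \<Psi> \<and> rowZ u \<Psi>) \<and>
        ((\<forall>a b. \<Psi> 0 0 a b) \<and> rowA u \<Psi> \<and> rowZ u \<Psi> \<longrightarrow>
          rowA t \<Psi> \<and> rowZ t \<Psi> \<and> (\<forall>r\<in>set rs. row_val inp \<Psi> t r))"
      using assms(2) l unfolding rows_rel_def m by blast
    have "(\<forall>r\<in>set rs. row_val inp \<Psi> t r) = (\<forall>r\<in>set rs. row_val inp \<Psi> s r)" using val by blast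
    moreover have "(\<forall>r\<in>set (r # rs). row_val inp \<Psi> s r) = (row_val inp \<Psi> s r \<and> (\<forall>r\<in>set rs. row_val inp \<Psi> s r))"
      by simp
    ultimately show ?thesis using 1 2 by blast
  qed
  have dvd: "u (vn 133) dvd s (vn 133)" "u (vn 136) dvd s (vn 136)"
    using rows_relD(3,4)[OF assms(1)] rows_relD(3,4)[OF assms(2)] by (auto intro: dvd_trans)
  have fru: "u x = s x" if "x \<notin> vn ` {132..159}" for x
    using rows_relD(2)[OF assms(2) that] fr[OF that] by simp
  have bok: "basis_ok u" by (rule rows_relD[OF assms(2)])
  show ?thesis unfolding rows_rel_def
    by (rule conjI[OF bok], rule conjI, intro allI impI, rule fru, assumption,
        rule conjI[OF dvd(1)], rule conjI[OF dvd(2)], intro allI impI, rule P, assumption)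
qed

lemma rows_prog_ht:
  assumes "ok (rows_prog rs) X s" "basis_ok s" "s (vn 130) \<le> 2 ^ J" "\<forall>r\<in>set rs. row_pexpr_ok r"
  shows "ht X (rows_prog rs) s (rows_rel inp rs s)"
  using assms
proof (induction rs arbitrary: X s)
  case Nil
  have "rows_rel inp [] s s" unfolding rows_rel_def using Nil by auto
  then show ?case using Nil unfolding rows_prog_def by (intro ht_loop_free) auto
next
  case (Cons r rs)
  have eq: "rows_prog (r # rs) = Seq (row_prog r) (rows_prog rs)" by (simp add: rows_prog_def)
  show ?case
    unfolding eq
  proof (rule ht_Seq[OF Cons.prems(1)[unfolded eq]])
    show "ht X (row_prog r) s (rows_rel inp [r] s)" if "ok (row_prog r) X s"
      by (rule row_prog_ht[OF that]) (use Cons.prems in auto)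
    fix t assume t: "rows_rel inp [r] s t" and okt: "ok (rows_prog rs) (X ^ growth (row_prog r)) t"
    have m: "t (vn 130) = s (vn 130)" and b: "basis_ok t"
      using rows_relD(1)[OF t] rows_relD(2)[OF t, of "vn 130"] by auto
    have "ht (X ^ growth (row_prog r)) (rows_prog rs) t (rows_rel inp rs t)"
      by (rule Cons.IH[OF okt b]) (use Cons.prems m in auto)
    then show "ht (X ^ growth (row_prog r)) (rows_prog rs) t (rows_rel inp (r # rs) s)"
      by (rule ht_conseq) (rule rows_rel_Cons[OF t], use Cons.prems in auto)
  qed
qed

end

subsection \<open>Deciding whether an ideal is reduced\<close>

text \<open>The input is \<open>p, q, p', q', b\<close> in \<open>120, 122, 124, 126, 128\<close>. A row \<open>(\<beta>; a)\<close> of the basis satisfies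
  \<open>a (p, q) + \<beta> (p', q') \<in> b \<O>\<^sup>2\<close>, and the entries \<open>\<beta>\<close> of all such rows form the ideal \<open>(p, q)\<close>.\<close>

definition ideal_rows :: "(pexpr \<times> pexpr) list" where
  "ideal_rows =
    [(pv 128, pconst 0 0),
     (pmul (pconst 0 1) (pv 128), pconst 0 0),
     (psub (pconst 0 0) (pv 122), pv 126),
     (pmul (pconst 0 1) (psub (pconst 0 0) (pv 122)), pmul (pconst 0 1) (pv 126)),
     (pv 120, psub (pconst 0 0) (pv 124)),
     (pmul (pconst 0 1) (pv 120), pmul (pconst 0 1) (psub (pconst 0 0) (pv 124)))]"

definition basis_init :: prog where
  "basis_init = seqs [asg 130 (pnorm (pv 128)), asg 132 (Const 0), asg 133 (V 130), asg 134 (Const 0), asg 135 (Const 0),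
     asg 136 (V 130), asg 138 (Const 0), asg 139 (Const 0)]"

definition basis_normalise :: prog where
  "basis_normalise = seqs [
     asg 150 (Div (Add (Add (Mul (Const 2) (V 132)) (V 0)) (V 136)) (Mul (Const 2) (V 136))),
     asg 132 (Sub (V 132) (Mul (V 150) (V 136))),
     asg 134 (Sub (V 134) (Mul (V 150) (V 138))),
     asg 135 (Sub (V 135) (Mul (V 150) (V 139)))]"

definition basis_prog :: prog where
  "basis_prog = Seq basis_init (Seq (rows_prog ideal_rows) basis_normalise)"

definition basis_rel :: "int list \<Rightarrow> store \<Rightarrow> store \<Rightarrow> bool" where
  "basis_rel inp s t \<longleftrightarrow> (\<forall>x. x \<notin> vn ` {130..159} \<longrightarrow> t x = s x) \<and>
     t (vn 130) = qnorm (s (vn 0)) (gp s 128) \<and>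
     0 < t (vn 133) \<and> 0 < t (vn 136) \<and>
     t (vn 133) dvd t (vn 130) \<and> t (vn 136) dvd t (vn 130) \<and>
     \<bar>2 * t (vn 132) + s (vn 0)\<bar> \<le> t (vn 136) \<and>
     (\<forall>\<Psi>. lattice_pred (t (vn 130)) \<Psi> \<longrightarrow>
        ((\<forall>r\<in>set ideal_rows. row_val inp \<Psi> s r) \<longrightarrow> rowA t \<Psi> \<and> rowZ t \<Psi>) \<and>
        ((\<forall>a b. \<Psi> 0 0 a b) \<and> rowA t \<Psi> \<and> rowZ t \<Psi> \<longrightarrow> (\<forall>r\<in>set ideal_rows. row_val inp \<Psi> s r)))"

lemma ideal_rows_ok: "\<forall>r\<in>set ideal_rows. row_pexpr_ok r"
  unfolding ideal_rows_def row_pexpr_ok_def by auto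

context machine
begin

lemma basis_prog_ht:
  assumes ok: "ok basis_prog X s" and N0: "s (vn 1) = tau_norm (s (vn 0))"
    and m: "0 < qnorm (s (vn 0)) (gp s 128)" "qnorm (s (vn 0)) (gp s 128) \<le> 2 ^ J"
  shows "ht X basis_prog s (basis_rel inp s)"
  unfolding basis_prog_def
proof (rule ht_Seq[OF ok[unfolded basis_prog_def]])
  define m where "m = qnorm (s (vn 0)) (gp s 128)"
  define s1 where "s1 = sem inp basis_init s"
  show "ht X basis_init s (\<lambda>t. t = s1)" if "ok basis_init X s"
    by (rule ht_loop_free[OF _ that]) (simp_all add: basis_init_def s1_def)
  fix t1 assume t1: "t1 = s1" and ok1: "ok (Seq (rows_prog ideal_rows) basis_normalise) (X ^ growth basis_init) t1"
  have v1: "s1 (vn 130) = m" "s1 (vn 132) = 0" "s1 (vn 133) = m" "s1 (vn 134) = 0" "s1 (vn 135) = 0"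
    "s1 (vn 136) = m" "s1 (vn 138) = 0" "s1 (vn 139) = 0"
    unfolding s1_def basis_init_def m_def using N0 by simp_all
  have fr1: "s1 x = s x" if "x \<notin> vn ` {130..159}" for x
  proof -
    have "x \<noteq> vn i" if "i \<in> {130..159}" for i using that \<open>x \<notin> vn ` {130..159}\<close> by auto
    then show ?thesis unfolding s1_def basis_init_def by simp
  qed
  have m0: "m > 0" using m(1) unfolding m_def .
  have b1: "basis_ok s1" unfolding basis_ok_def using m0 by (auto simp: v1)
  show "ht (X ^ growth basis_init) (Seq (rows_prog ideal_rows) basis_normalise) t1 (basis_rel inp s)"
  proof (rule ht_Seq[OF ok1])
    show "ht (X ^ growth basis_init) (rows_prog ideal_rows) t1 (rows_rel inp ideal_rows s1)"
      if "ok (rows_prog ideal_rows) (X ^ growth basis_init) t1"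
      unfolding t1 by (rule rows_prog_ht[OF that[unfolded t1] b1 _ ideal_rows_ok]) (use m in \<open>simp add: v1 m_def\<close>)
    fix t2 assume t2: "rows_rel inp ideal_rows s1 t2"
      and ok2: "ok basis_normalise ((X ^ growth basis_init) ^ growth (rows_prog ideal_rows)) t2"
    define c where "c = (2 * t2 (vn 132) + t2 (vn 0) + t2 (vn 136)) div (2 * t2 (vn 136))"
    define t where "t = sem inp basis_normalise t2"
    have tv: "t (vn 132) = t2 (vn 132) - c * t2 (vn 136)" "t (vn 134) = t2 (vn 134) - c * t2 (vn 138)"
      "t (vn 135) = t2 (vn 135) - c * t2 (vn 139)" "t (vn 133) = t2 (vn 133)" "t (vn 136) = t2 (vn 136)"
      "t (vn 138) = t2 (vn 138)" "t (vn 139) = t2 (vn 139)" "t (vn 130) = t2 (vn 130)"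
      unfolding t_def basis_normalise_def c_def by simp_all
    have fr2: "t2 x = s1 x" if "x \<notin> vn ` {132..159}" for x
      using t2 that unfolding rows_rel_def by blast
    have frt: "t x = s x" if "x \<notin> vn ` {130..159}" for x
    proof -
      have "x \<noteq> vn i" if "i \<in> {130..159}" for i using that \<open>x \<notin> vn ` {130..159}\<close> by auto
      then have "t x = t2 x" unfolding t_def basis_normalise_def by simp
      also have "\<dots> = s1 x" by (rule fr2) (use that in auto)
      finally show ?thesis using fr1[OF that] by simp
    qed
    have tm: "t (vn 130) = m" using tv fr2[of "vn 130"] v1 by simp
    have b2: "basis_ok t2" using t2 unfolding rows_rel_def by blast
    have pos: "0 < t (vn 133)" "0 < t (vn 136)" using b2 unfolding basis_ok_def tv by auto
    have dvd: "t (vn 133) dvd m" "t (vn 136) dvd m" using rows_relD(3,4)[OF t2] by (simp_all add: tv v1)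
    have D: "t2 (vn 0) = s (vn 0)" using fr2[of "vn 0"] fr1[of "vn 0"] by simp
    have norm: "\<bar>2 * t (vn 132) + s (vn 0)\<bar> \<le> t (vn 136)"
    proof -
      have "2 * t (vn 132) + s (vn 0) + t (vn 136) = (2 * t2 (vn 132) + s (vn 0) + t2 (vn 136)) mod (2 * t2 (vn 136))"
        unfolding tv c_def D by (simp add: minus_div_mult_eq_mod[symmetric] algebra_simps)
      moreover have "\<dots> \<ge> 0" "\<dots> < 2 * t2 (vn 136)" using pos by (simp_all add: tv)
      ultimately show ?thesis using tv(5) by (simp add: abs_le_iff)
    qed
    have rows: "((\<forall>r\<in>set ideal_rows. row_val inp \<Psi> s r) \<longrightarrow> rowA t \<Psi> \<and> rowZ t \<Psi>) \<and>
        ((\<forall>a b. \<Psi> 0 0 a b) \<and> rowA t \<Psi> \<and> rowZ t \<Psi> \<longrightarrow> (\<forall>r\<in>set ideal_rows. row_val inp \<Psi> s r))"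
      if l: "lattice_pred m \<Psi>" for \<Psi>
    proof -
      have val: "row_val inp \<Psi> s1 r = row_val inp \<Psi> s r" if "r \<in> set ideal_rows" for r
      proof -
        have "peval inp s1 (fst r) = peval inp s (fst r)" "peval inp s1 (snd r) = peval inp s (snd r)"
          using ideal_rows_ok that unfolding row_pexpr_ok_def by (auto intro!: peval_cong fr1 dest!: subsetD)
        then show ?thesis unfolding row_val_def by simp
      qed
      have z: "\<Psi> 0 0 0 0" using l unfolding lattice_pred_def by blast
      have add: "\<Psi> (x + m * h) (y + m * i) (u + m * j) (v + m * k)" if "\<Psi> x y u v" for x y u v h i j k
        using l that unfolding lattice_pred_def by blast
      have sub: "\<Psi> (x - t * x') (y - t * y') (u - t * u') (v - t * v')"
        if "\<Psi> x y u v" "\<Psi> x' y' u' v'" for x y u v x' y' u' v' t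
        using l that unfolding lattice_pred_def by blast
      have init: "rowA s1 \<Psi>" "rowZ s1 \<Psi>"
        unfolding rowA_def rowZ_def v1 using add[OF z, of 0 1 0 0] add[OF z, of 1 0 0 0] by simp_all
      have A: "rowA t \<Psi> = rowA t2 \<Psi>" if "rowZ t2 \<Psi>"
      proof
        assume "rowA t2 \<Psi>"
        then show "rowA t \<Psi>"
          using sub[OF \<open>rowA t2 \<Psi>\<close>[unfolded rowA_def] that[unfolded rowZ_def], of c] unfolding rowA_def tv by simp
      next
        assume "rowA t \<Psi>"
        then show "rowA t2 \<Psi>"
          using sub[OF \<open>rowA t \<Psi>\<close>[unfolded rowA_def] that[unfolded rowZ_def], of "- c"] unfolding rowA_def tv by simp
      qed
      have Z: "rowZ t \<Psi> = rowZ t2 \<Psi>" unfolding rowZ_def tv ..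
      have "(rowA s1 \<Psi> \<and> rowZ s1 \<Psi> \<and> (\<forall>r\<in>set ideal_rows. row_val inp \<Psi> s1 r) \<longrightarrow> rowA t2 \<Psi> \<and> rowZ t2 \<Psi>) \<and>
        ((\<forall>a b. \<Psi> 0 0 a b) \<and> rowA t2 \<Psi> \<and> rowZ t2 \<Psi> \<longrightarrow>
          rowA s1 \<Psi> \<and> rowZ s1 \<Psi> \<and> (\<forall>r\<in>set ideal_rows. row_val inp \<Psi> s1 r))"
        using t2 l unfolding rows_rel_def v1 by blast
      moreover have "(\<forall>r\<in>set ideal_rows. row_val inp \<Psi> s1 r) = (\<forall>r\<in>set ideal_rows. row_val inp \<Psi> s r)"
        using val by blast
      ultimately show ?thesis using init A Z by blast
    qed
    have "basis_rel inp s t"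
      unfolding basis_rel_def tm
      by (rule conjI, intro allI impI, rule frt, assumption, rule conjI[OF m_def],
          rule conjI[OF pos(1)], rule conjI[OF pos(2)], rule conjI[OF dvd(1)], rule conjI[OF dvd(2)],
          rule conjI[OF norm], intro allI impI, rule rows, assumption)
    then show "ht ((X ^ growth basis_init) ^ growth (rows_prog ideal_rows)) basis_normalise t2 (basis_rel inp s)"
      by (intro ht_loop_free[OF _ ok2]) (simp_all add: basis_normalise_def t_def)
  qed
qed

end

definition test_init :: prog where
  "test_init = seqs [asg 171 (Add (Mul (Const 2) (V 132)) (V 0)),
     asg 172 (Div (pnorm (V 132, Const 1)) (V 136)),
     asg 150 (V 136), asg 151 (mod_expr (V 171) (V 136)), asg 152 (Const 0), asg 153 (Const 0),
     asg 154 (Const 0), asg 155 (Const 0), asg 156 (Const 0), asg 157 (Const 0)]"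

definition test_mid :: prog where
  "test_mid = seqs [asg 151 (V 150), asg 150 (V 172)]"

definition test_final :: prog where
  "test_final = IfLe (V 133) (Const 1)
     (IfLe (V 136) (V 172) (IfLe (V 150) (Const 1) (asg 170 (Const 1)) (asg 170 (Const 0))) (asg 170 (Const 0)))
     (asg 170 (Const 0))"

definition test_prog :: prog where
  "test_prog = Seq test_init (Seq euclid_prog (Seq test_mid (Seq euclid_prog test_final)))"

context machine
begin

lemma test_prog_ht:
  assumes ok: "ok test_prog X s" and N0: "s (vn 1) = tau_norm (s (vn 0))"
    and pos: "0 < s (vn 130)" "0 < s (vn 136)" "s (vn 136) < 2 ^ J" "0 \<le> qnorm (s (vn 0)) (s (vn 132), 1)"
  shows "ht X test_prog s (\<lambda>t. (\<forall>x. x \<notin> vn ` {150..179} \<longrightarrow> t x = s x) \<and>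
    t (vn 170) = (if s (vn 133) \<le> 1 \<and> s (vn 136) \<le> qnorm (s (vn 0)) (s (vn 132), 1) div s (vn 136) \<and>
      gcd (s (vn 136)) (gcd (2 * s (vn 132) + s (vn 0)) (qnorm (s (vn 0)) (s (vn 132), 1) div s (vn 136))) = 1 then 1 else 0))"
    (is "ht X _ s ?Q")
  unfolding test_prog_def
proof (rule ht_Seq[OF ok[unfolded test_prog_def]])
  define \<gamma> where "\<gamma> = qnorm (s (vn 0)) (s (vn 132), 1) div s (vn 136)"
  define b where "b = 2 * s (vn 132) + s (vn 0)"
  define \<alpha> where "\<alpha> = s (vn 136)"
  define s1 where "s1 = sem inp test_init s"
  have lf: "loop_free test_init"
    by (simp add: test_init_def psmall_def)
  show "ht X test_init s (\<lambda>t. t = s1)" if "ok test_init X s"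
    by (rule ht_loop_free[OF lf that]) (simp add: s1_def)
  have v1: "s1 (vn 150) = \<alpha>" "s1 (vn 151) = b mod \<alpha>" "s1 (vn 172) = \<gamma>" "s1 (vn 130) = s (vn 130)"
    unfolding s1_def test_init_def \<gamma>_def b_def \<alpha>_def using N0 by (simp_all add: peval_def)
  have fr1: "s1 x = s x" if "x \<notin> vn ` {150..179}" for x
  proof -
    have "x \<noteq> vn i" if "i \<in> {150..179}" for i using that \<open>x \<notin> vn ` {150..179}\<close> by auto
    then show ?thesis unfolding s1_def test_init_def by simp
  qed
  have \<gamma>0: "\<gamma> \<ge> 0" unfolding \<gamma>_def using pos by (simp add: pos_imp_zdiv_nonneg_iff)
  have \<alpha>0: "\<alpha> > 0" "\<alpha> < 2 ^ J" using pos unfolding \<alpha>_def by auto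
  fix t1 assume t1: "t1 = s1" and ok1: "ok (Seq euclid_prog (Seq test_mid (Seq euclid_prog test_final))) (X ^ growth test_init) t1"
  show "ht (X ^ growth test_init) (Seq euclid_prog (Seq test_mid (Seq euclid_prog test_final))) t1 ?Q"
  proof (rule ht_Seq[OF ok1])
    have "b mod \<alpha> < \<alpha>" "0 \<le> b mod \<alpha>" using \<alpha>0 by auto
    then have bm: "b mod \<alpha> < 2 ^ J" "0 \<le> b mod \<alpha>" using \<alpha>0 by linarith+
    show "ht (X ^ growth test_init) euclid_prog t1 (\<lambda>t. euclid_rel t1 t \<and> t (vn 151) = 0)"
      if "ok euclid_prog (X ^ growth test_init) t1"
      by (rule euclid_ht[OF that]) (use bm \<alpha>0(1) pos(1) in \<open>simp_all add: t1 v1\<close>)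
    fix t2 assume t2: "euclid_rel t1 t2 \<and> t2 (vn 151) = 0"
      and ok2: "ok (Seq test_mid (Seq euclid_prog test_final)) ((X ^ growth test_init) ^ growth euclid_prog) t2"
    note e2 = euclid_relD[OF conjunct1[OF t2] conjunct2[OF t2]]
    have g2: "t2 (vn 150) = gcd \<alpha> b" using e2(2) by (simp add: t1 v1) (metis gcd_red_int gcd.commute)
    have fr2: "t2 x = s1 x" if "x \<notin> vn ` {150..159}" for x using e2(1)[OF that] t1 by simp
    define s3 where "s3 = sem inp test_mid t2"
    show "ht ((X ^ growth test_init) ^ growth euclid_prog) (Seq test_mid (Seq euclid_prog test_final)) t2 ?Q"
    proof (rule ht_Seq[OF ok2])
      show "ht ((X ^ growth test_init) ^ growth euclid_prog) test_mid t2 (\<lambda>t. t = s3)"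
        if "ok test_mid ((X ^ growth test_init) ^ growth euclid_prog) t2"
        by (rule ht_loop_free[OF _ that]) (simp_all add: test_mid_def s3_def)
      have v3: "s3 (vn 151) = gcd \<alpha> b" "s3 (vn 150) = \<gamma>" "s3 (vn 130) = s (vn 130)"
        unfolding s3_def test_mid_def using g2 fr2[of "vn 172"] fr2[of "vn 130"] v1 by simp_all
      have fr3: "s3 x = s1 x" if "x \<notin> vn ` {150..159}" for x
      proof -
        have "x \<noteq> vn i" if "i \<in> {150..159}" for i using that \<open>x \<notin> vn ` {150..159}\<close> by auto
        then show ?thesis unfolding s3_def test_mid_def using fr2[OF that] by simp
      qed
      fix t3 assume t3: "t3 = s3" and ok3: "ok (Seq euclid_prog test_final) (((X ^ growth test_init) ^ growth euclid_prog) ^ growth test_mid) t3"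
      show "ht (((X ^ growth test_init) ^ growth euclid_prog) ^ growth test_mid) (Seq euclid_prog test_final) t3 ?Q"
      proof (rule ht_Seq[OF ok3])
        have "gcd \<alpha> b \<le> \<alpha>" using \<alpha>0 by (intro zdvd_imp_le) auto
        then have gm: "gcd \<alpha> b < 2 ^ J" using \<alpha>0 by linarith
        show "ht (((X ^ growth test_init) ^ growth euclid_prog) ^ growth test_mid) euclid_prog t3
            (\<lambda>t. euclid_rel t3 t \<and> t (vn 151) = 0)"
          if "ok euclid_prog (((X ^ growth test_init) ^ growth euclid_prog) ^ growth test_mid) t3"
          by (rule euclid_ht[OF that]) (use gm \<gamma>0 pos(1) in \<open>simp_all add: t3 v3\<close>)
        fix t4 assume t4: "euclid_rel t3 t4 \<and> t4 (vn 151) = 0"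
          and ok4: "ok test_final ((((X ^ growth test_init) ^ growth euclid_prog) ^ growth test_mid) ^ growth euclid_prog) t4"
        note e4 = euclid_relD[OF conjunct1[OF t4] conjunct2[OF t4]]
        have g4: "t4 (vn 150) = gcd \<alpha> (gcd b \<gamma>)"
          using e4(2) by (simp add: t3 v3) (metis gcd.commute gcd.assoc)
        have fr4: "t4 x = s1 x" if "x \<notin> vn ` {150..159}" for x using e4(1)[OF that] t3 fr3[OF that] by simp
        have v4: "t4 (vn 133) = s (vn 133)" "t4 (vn 136) = \<alpha>" "t4 (vn 172) = \<gamma>"
          using fr4[of "vn 133"] fr4[of "vn 136"] fr4[of "vn 172"] fr1[of "vn 133"] fr1[of "vn 136"] v1
          by (simp_all add: \<alpha>_def)
        have g1: "(gcd \<alpha> (gcd b \<gamma>) \<le> 1) = (gcd \<alpha> (gcd b \<gamma>) = 1)"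
          using gcd_pos_int[of \<alpha> "gcd b \<gamma>"] \<alpha>0 by linarith
        have "sem inp test_final t4 = t4(vn 170 := if s (vn 133) \<le> 1 \<and> \<alpha> \<le> \<gamma> \<and> gcd \<alpha> (gcd b \<gamma>) = 1 then 1 else 0)"
          unfolding test_final_def using v4 g4 g1 by simp
        moreover have "t4 x = s x" if "x \<notin> vn ` {150..179}" for x
        proof -
          have "t4 x = s1 x" by (rule fr4) (use that in auto)
          then show ?thesis using fr1[OF that] by simp
        qed
        ultimately have "?Q (sem inp test_final t4)"
          unfolding \<gamma>_def \<alpha>_def b_def by auto
        then show "ht ((((X ^ growth test_init) ^ growth euclid_prog) ^ growth test_mid) ^ growth euclid_prog) test_final t4 ?Q"
          by (intro ht_loop_free[OF _ ok4]) (simp_all add: test_final_def)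
      qed
    qed
  qed
qed

end

definition check_prog :: prog where
  "check_prog = Seq basis_prog test_prog"

context imag_quad
begin

definition lift :: "complex \<Rightarrow> complex \<Rightarrow> complex \<Rightarrow> complex \<Rightarrow> complex \<Rightarrow> complex \<Rightarrow> complex \<Rightarrow> bool" where
  "lift p q p' q' b \<beta> a \<longleftrightarrow> (\<exists>x\<in>\<O>. a * p + \<beta> * p' = b * x) \<and> (\<exists>y\<in>\<O>. a * q + \<beta> * q' = b * y)"

lemma lift_diff:
  assumes "lift p q p' q' b \<beta> a" "lift p q p' q' b \<beta>' a'" "r \<in> \<O>"
  shows "lift p q p' q' b (\<beta> - r * \<beta>') (a - r * a')"
proof -
  obtain x y x' y' where "x \<in> \<O>" "y \<in> \<O>" "x' \<in> \<O>" "y' \<in> \<O>"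
    "a * p + \<beta> * p' = b * x" "a * q + \<beta> * q' = b * y" "a' * p + \<beta>' * p' = b * x'" "a' * q + \<beta>' * q' = b * y'"
    using assms(1,2) unfolding lift_def by blast
  moreover have "(a - r * a') * p + (\<beta> - r * \<beta>') * p' = (a * p + \<beta> * p') - r * (a' * p + \<beta>' * p')"
    "(a - r * a') * q + (\<beta> - r * \<beta>') * q' = (a * q + \<beta> * q') - r * (a' * q + \<beta>' * q')"
    by (simp_all add: algebra_simps)
  ultimately have "(a - r * a') * p + (\<beta> - r * \<beta>') * p' = b * (x - r * x')"
    "(a - r * a') * q + (\<beta> - r * \<beta>') * q' = b * (y - r * y')" "x - r * x' \<in> \<O>" "y - r * y' \<in> \<O>"
    using assms(3) by (auto simp: algebra_simps)
  then show ?thesis unfolding lift_def by blast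
qed

lemma lift_0: "lift p q p' q' b 0 0"
  unfolding lift_def by (auto intro!: bexI[of _ 0])

lemma lift_mult: "lift p q p' q' b \<beta> a \<Longrightarrow> r \<in> \<O> \<Longrightarrow> lift p q p' q' b (r * \<beta>) (r * a)"
  using lift_diff[OF lift_0, of p q p' q' b \<beta> a "- r"] by auto

lemma lift_add: "lift p q p' q' b \<beta> a \<Longrightarrow> lift p q p' q' b \<beta>' a' \<Longrightarrow> lift p q p' q' b (\<beta> + \<beta>') (a + a')"
  using lift_diff[of p q p' q' b \<beta> a \<beta>' a' "- 1"] by auto

lemma lift_multiple:
  assumes "p \<in> \<O>" "q \<in> \<O>" "p' \<in> \<O>" "q' \<in> \<O>" "\<beta> \<in> \<O>" "a \<in> \<O>"
  shows "lift p q p' q' b (b * \<beta>) (b * a)"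
  unfolding lift_def
  by (intro conjI bexI[of _ "a * p + \<beta> * p'"] bexI[of _ "a * q + \<beta> * q'"])
    (use assms in \<open>auto simp: algebra_simps\<close>)

definition ideal_data :: "complex \<Rightarrow> complex \<Rightarrow> complex \<Rightarrow> complex \<Rightarrow> complex \<Rightarrow> int \<Rightarrow> int \<Rightarrow> int \<times> int \<Rightarrow> int \<times> int \<Rightarrow> bool" where
  "ideal_data p q p' q' b \<alpha> h aA aZ \<longleftrightarrow> gen2 p q = std \<alpha> h \<and> 0 < \<alpha> \<and> \<bar>2 * h + \<Delta>\<bar> \<le> \<alpha> \<and> \<alpha> \<le> conorm \<alpha> h \<and>
     gcd \<alpha> (gcd (2 * h + \<Delta>) (conorm \<alpha> h)) = 1 \<and>
     lift p q p' q' b (of_int h + \<tau>) (elt \<Delta> aA) \<and> lift p q p' q' b (of_int \<alpha>) (elt \<Delta> aZ)"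

lemma basis_rel_ideal:
  assumes rel: "basis_rel inp s t" and N0: "s (vn 1) = tau_norm (s (vn 0))" and D: "s (vn 0) = \<Delta>"
    and p: "p = elt \<Delta> (gp s 120)" and q: "q = elt \<Delta> (gp s 122)"
    and p': "p' = elt \<Delta> (gp s 124)" and q': "q' = elt \<Delta> (gp s 126)" and b: "b = elt \<Delta> (gp s 128)" "b \<noteq> 0"
    and \<sigma>: "\<sigma> = 1 \<or> \<sigma> = -1" and det: "p * q' - q * p' = \<sigma> * b"
  shows "lift p q p' q' b (elt \<Delta> (t (vn 132), t (vn 133))) (elt \<Delta> (t (vn 134), t (vn 135)))"
    and "lift p q p' q' b (elt \<Delta> (t (vn 136), 0)) (elt \<Delta> (t (vn 138), t (vn 139)))"
    and "t (vn 133) = 1 \<Longrightarrow> gen2 p q = std (t (vn 136)) (t (vn 132))"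
    and "reduced_ideal \<Delta> (gen2 p q) \<Longrightarrow> t (vn 133) = 1"
proof -
  define m where "m = t (vn 130)"
  have tm: "m = qnorm \<Delta> (gp s 128)" using rel D unfolding basis_rel_def m_def by blast
  have mb: "of_int m = b * cnj b" unfolding tm elt_norm b(1) ..
  have pos: "0 < t (vn 133)" "0 < t (vn 136)" "t (vn 133) dvd m" "t (vn 136) dvd m"
    using rel unfolding basis_rel_def m_def by blast+
  have rows: "((\<forall>r\<in>set ideal_rows. row_val inp \<Psi> s r) \<longrightarrow> rowA t \<Psi> \<and> rowZ t \<Psi>) \<and>
        ((\<forall>a b. \<Psi> 0 0 a b) \<and> rowA t \<Psi> \<and> rowZ t \<Psi> \<longrightarrow> (\<forall>r\<in>set ideal_rows. row_val inp \<Psi> s r))"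
    if "lattice_pred m \<Psi>" for \<Psi>
    using rel that unfolding basis_rel_def m_def by blast
  define \<Theta> where "\<Theta> \<Psi> \<beta> a = \<Psi> (fst \<beta>) (snd \<beta>) (fst a) (snd a)" for \<Psi> :: "int \<Rightarrow> int \<Rightarrow> int \<Rightarrow> int \<Rightarrow> bool" and \<beta> a :: "int \<times> int"
  let ?P = "gp s 120" and ?Q = "gp s 122" and ?P' = "gp s 124" and ?Q' = "gp s 126" and ?B = "gp s 128"
  let ?m = "qmul \<Delta> (0, 1)"
  have vals: "(\<forall>r\<in>set ideal_rows. row_val inp \<Psi> s r) \<longleftrightarrow>
     \<Theta> \<Psi> ?B (0, 0) \<and> \<Theta> \<Psi> (?m ?B) (0, 0) \<and> \<Theta> \<Psi> ((0, 0) - ?Q) ?Q' \<and> \<Theta> \<Psi> (?m ((0, 0) - ?Q)) (?m ?Q') \<and>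
     \<Theta> \<Psi> ?P ((0, 0) - ?P') \<and> \<Theta> \<Psi> (?m ?P) (?m ((0, 0) - ?P'))" for \<Psi>
    unfolding ideal_rows_def row_val_def \<Theta>_def using N0 D by (simp del: qmul.simps)
  have tau: "elt \<Delta> (?m x) = \<tau> * elt \<Delta> x" for x using elt_mul[of "(0, 1)" x] by simp
  have neg: "elt \<Delta> ((0, 0) - x) = - elt \<Delta> x" for x using elt_diff[of "(0, 0)" x] by simp
  have ring: "p \<in> \<O>" "q \<in> \<O>" "p' \<in> \<O>" "q' \<in> \<O>" "b \<in> \<O>" unfolding p q p' q' b by auto

  define \<Psi> where "\<Psi> u v a c = lift p q p' q' b (elt \<Delta> (u, v)) (elt \<Delta> (a, c))" for u v a c
  have lat: "lattice_pred m \<Psi>"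
    unfolding lattice_pred_def
  proof (intro conjI allI impI)
    show "\<Psi> 0 0 0 0" unfolding \<Psi>_def using lift_0 by simp
  next
    fix x y u v x' y' u' v' t assume "\<Psi> x y u v" "\<Psi> x' y' u' v'"
    then have "lift p q p' q' b (elt \<Delta> (x, y) - of_int t * elt \<Delta> (x', y')) (elt \<Delta> (u, v) - of_int t * elt \<Delta> (u', v'))"
      unfolding \<Psi>_def by (intro lift_diff) auto
    then show "\<Psi> (x - t * x') (y - t * y') (u - t * u') (v - t * v')"
      unfolding \<Psi>_def by (simp add: algebra_simps)
  next
    fix x y u v h i j k assume a: "\<Psi> x y u v"
    have "lift p q p' q' b (b * (cnj b * elt \<Delta> (h, i))) (b * (cnj b * elt \<Delta> (j, k)))"
      by (intro lift_multiple ring ring_mult ring_cnj ring_elt)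
    then have "lift p q p' q' b (of_int m * elt \<Delta> (h, i)) (of_int m * elt \<Delta> (j, k))"
      unfolding mb by (simp only: mult.assoc)
    with a have "lift p q p' q' b (elt \<Delta> (x, y) + of_int m * elt \<Delta> (h, i)) (elt \<Delta> (u, v) + of_int m * elt \<Delta> (j, k))"
      unfolding \<Psi>_def by (rule lift_add)
    then show "\<Psi> (x + m * h) (y + m * i) (u + m * j) (v + m * k)" unfolding \<Psi>_def by (simp add: algebra_simps)
  qed
  have T: "\<Theta> \<Psi> \<beta> a = lift p q p' q' b (elt \<Delta> \<beta>) (elt \<Delta> a)" for \<beta> a unfolding \<Theta>_def \<Psi>_def by simp
  have \<sigma>O: "\<sigma> \<in> \<O>" using \<sigma> by auto
  have l1: "lift p q p' q' b b 0" using lift_multiple[OF ring(1-4), of 1 0 b] by auto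
  have l2: "lift p q p' q' b (- q) q'"
    unfolding lift_def using det \<sigma>O by (intro conjI bexI[of _ \<sigma>] bexI[of _ 0]) (auto simp: algebra_simps)
  have l3: "lift p q p' q' b p (- p')"
    unfolding lift_def using det \<sigma>O by (intro conjI bexI[of _ 0] bexI[of _ \<sigma>]) (auto simp: algebra_simps)
  have "\<forall>r\<in>set ideal_rows. row_val inp \<Psi> s r"
    unfolding vals T tau neg p[symmetric] q[symmetric] p'[symmetric] q'[symmetric] b(1)[symmetric]
    using l1 l2 l3 lift_mult[OF l1 ring_tau] lift_mult[OF l2 ring_tau] lift_mult[OF l3 ring_tau] by simp
  then have AZ: "rowA t \<Psi>" "rowZ t \<Psi>" using rows[OF lat] by blast+
  show lA: "lift p q p' q' b (elt \<Delta> (t (vn 132), t (vn 133))) (elt \<Delta> (t (vn 134), t (vn 135)))"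
    and lZ: "lift p q p' q' b (elt \<Delta> (t (vn 136), 0)) (elt \<Delta> (t (vn 138), t (vn 139)))"
    using AZ unfolding rowA_def rowZ_def \<Psi>_def by blast+
  have lift_mem: "\<beta> \<in> gen2 p q" if "lift p q p' q' b \<beta> a" for \<beta> a
  proof -
    obtain x y where xy: "x \<in> \<O>" "y \<in> \<O>" "a * p + \<beta> * p' = b * x" "a * q + \<beta> * q' = b * y"
      using \<open>lift p q p' q' b \<beta> a\<close> unfolding lift_def by blast
    have "b * (\<sigma> * \<beta>) = \<beta> * (p * q' - q * p')" unfolding det by (simp add: algebra_simps)
    also have "\<dots> = p * (a * q + \<beta> * q') - q * (a * p + \<beta> * p')" by (simp add: algebra_simps)
    also have "\<dots> = b * (y * p - x * q)" unfolding xy by (simp add: algebra_simps)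
    finally have "\<sigma> * \<beta> = y * p - x * q" using b(2) by simp
    then have "\<beta> = (\<sigma> * y) * p + (- \<sigma> * x) * q" using \<sigma> by (auto simp: algebra_simps)
    then show ?thesis using xy \<sigma>O by (intro gen2I[of "\<sigma> * y" "- \<sigma> * x"]) (auto intro!: ring_mult ring_uminus)
  qed

  { assume g: "t (vn 133) = 1"
    define \<alpha> h where ah: "\<alpha> = t (vn 136)" "h = t (vn 132)"
    have "elt \<Delta> (h, 1) \<in> gen2 p q" "elt \<Delta> (\<alpha>, 0) \<in> gen2 p q"
      using lift_mem[OF lA] lift_mem[OF lZ] g unfolding ah by auto
    then have sub1: "std \<alpha> h \<subseteq> gen2 p q" by (intro submodule_zspan[OF gen2_submodule]) auto
    define \<Psi>2 where "\<Psi>2 u v a c \<longleftrightarrow> \<alpha> dvd u - v * h" for u v a c :: int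
    have am: "\<alpha> dvd m" using pos ah by simp
    have lat2: "lattice_pred m \<Psi>2"
      unfolding lattice_pred_def \<Psi>2_def
    proof (intro conjI allI impI)
      fix x y x' y' t :: int assume "\<alpha> dvd x - y * h" "\<alpha> dvd x' - y' * h"
      then have "\<alpha> dvd (x - y * h) - t * (x' - y' * h)" by simp
      then show "\<alpha> dvd x - t * x' - (y - t * y') * h" by (simp add: algebra_simps)
    next
      fix x y i j :: int assume "\<alpha> dvd x - y * h"
      then have "\<alpha> dvd (x - y * h) + m * (i - j * h)" using am by simp
      then show "\<alpha> dvd x + m * i - (y + m * j) * h" by (simp add: algebra_simps)
    qed simp
    have "\<forall>a b. \<Psi>2 0 0 a b" "rowA t \<Psi>2" "rowZ t \<Psi>2"
      unfolding \<Psi>2_def rowA_def rowZ_def using g ah by auto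
    then have v2: "\<forall>r\<in>set ideal_rows. row_val inp \<Psi>2 s r" using rows[OF lat2] by blast
    have T2: "\<Theta> \<Psi>2 \<beta> a = (elt \<Delta> \<beta> \<in> std \<alpha> h)" for \<beta> a
      unfolding \<Theta>_def \<Psi>2_def using std_mem[of "fst \<beta>" "snd \<beta>" \<alpha> h] by (simp del: elt.simps)
    have mem: "- q \<in> std \<alpha> h" "\<tau> * - q \<in> std \<alpha> h" "p \<in> std \<alpha> h" "\<tau> * p \<in> std \<alpha> h"
      using v2 unfolding vals T2 tau neg p[symmetric] q[symmetric] by blast+
    have mem': "q \<in> std \<alpha> h" "\<tau> * q \<in> std \<alpha> h"
      using zspan_scale[OF mem(1), of "-1"] zspan_scale[OF mem(2), of "-1"] by simp_all
    have mult: "x * y \<in> std \<alpha> h" if "x \<in> \<O>" "y \<in> std \<alpha> h" "\<tau> * y \<in> std \<alpha> h" for x y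
    proof -
      obtain u v where x: "x = elt \<Delta> (u, v)" using \<open>x \<in> \<O>\<close> by (auto elim!: ringE)
      have "x * y = of_int u * y + of_int v * (\<tau> * y)" unfolding x by (simp add: algebra_simps)
      also have "\<dots> \<in> std \<alpha> h" using that(2,3) by (intro zspan_add zspan_scale)
      finally show ?thesis .
    qed
    have "gen2 p q \<subseteq> std \<alpha> h"
      unfolding gen2_def using mult mem mem' zspan_add by auto
    with sub1 show "gen2 p q = std (t (vn 136)) (t (vn 132))" unfolding ah by blast }

  { assume red: "reduced_ideal \<Delta> (gen2 p q)"
    define g where "g = t (vn 133)"
    define \<Psi>3 where "\<Psi>3 u v a c \<longleftrightarrow> g dvd v" for u v a c :: int
    have gm: "g dvd m" using pos unfolding g_def by simp
    have lat3: "lattice_pred m \<Psi>3" unfolding lattice_pred_def \<Psi>3_def using gm by auto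
    have "\<forall>a b. \<Psi>3 0 0 a b" "rowA t \<Psi>3" "rowZ t \<Psi>3" unfolding \<Psi>3_def rowA_def rowZ_def g_def by auto
    then have "\<forall>r\<in>set ideal_rows. row_val inp \<Psi>3 s r" using rows[OF lat3] by blast
    then have d: "g dvd snd ((0, 0) - ?Q)" "g dvd snd (?m ((0, 0) - ?Q))" "g dvd snd ?P" "g dvd snd (?m ?P)"
      unfolding vals \<Theta>_def \<Psi>3_def by blast+
    have both: "\<exists>z\<in>\<O>. elt \<Delta> x = of_int g * z" if "g dvd snd x" "g dvd snd (?m x)" for x
    proof -
      obtain u v where x: "x = (u, v)" by (cases x)
      have "g dvd v" "g dvd u + v * \<Delta>" using that unfolding x by auto
      then have "g dvd v" "g dvd u" by (simp_all add: dvd_add_left_iff)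
      then obtain u' v' where "u = g * u'" "v = g * v'" by (auto elim!: dvdE)
      then have "elt \<Delta> x = of_int g * elt \<Delta> (u', v')" unfolding x by (simp add: algebra_simps)
      then show ?thesis by blast
    qed
    obtain z1 where z1: "z1 \<in> \<O>" "p = of_int g * z1" using both[OF d(3,4)] unfolding p by blast
    obtain z2 where z2: "z2 \<in> \<O>" "- q = of_int g * z2" using both[OF d(1,2)] unfolding neg q[symmetric] by blast
    have "\<exists>x\<in>\<O>. y = of_int g * x" if y: "y \<in> gen2 p q" for y
    proof -
      obtain x x' where x: "x \<in> \<O>" "x' \<in> \<O>" "y = x * p + x' * q" using y unfolding gen2_def by blast
      have "y = x * p - x' * (- q)" using x(3) by simp
      also have "\<dots> = of_int g * (x * z1 - x' * z2)" unfolding z2(2) by (subst z1(2)) (simp add: algebra_simps)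
      finally have "y = of_int g * (x * z1 - x' * z2)" .
      moreover have "x * z1 - x' * z2 \<in> \<O>" using x z1(1) z2(1) by (intro ring_diff ring_mult)
      ultimately show ?thesis by blast
    qed
    then show "t (vn 133) = 1" using not_reduced_multiple[OF red, of g] pos unfolding g_def by blast }
qed

lemma omega_times_ring:
  assumes "ideal_data p q p' q' b \<alpha> h aA aZ" "x \<in> gen2 p q"
  shows "omega \<alpha> h * x \<in> \<O>"
proof -
  have eq: "gen2 p q = std \<alpha> h" and "\<alpha> > 0" using assms(1) unfolding ideal_data_def by auto
  have "submodule \<Delta> (std \<alpha> h)" using gen2_submodule[of p q] unfolding eq .
  from omega_inverse[OF this \<open>\<alpha> > 0\<close>] show ?thesis using assms(2) unfolding eq ideal_inverse_def by blast
qed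

lemma lift_ideal_element:
  assumes "ideal_data p q p' q' b \<alpha> h aA aZ" "\<alpha> dvd u - v * h"
  shows "lift p q p' q' b (elt \<Delta> (u, v)) (elt \<Delta> (qsc ((u - v * h) div \<alpha>) aZ + qsc v aA))"
proof -
  have l: "lift p q p' q' b (of_int h + \<tau>) (elt \<Delta> aA)" "lift p q p' q' b (of_int \<alpha>) (elt \<Delta> aZ)"
    using assms(1) unfolding ideal_data_def by auto
  let ?r = "(u - v * h) div \<alpha>"
  have "lift p q p' q' b (of_int ?r * of_int \<alpha> + of_int v * (of_int h + \<tau>)) (of_int ?r * elt \<Delta> aZ + of_int v * elt \<Delta> aA)"
    by (intro lift_add lift_mult l ring_of_int)
  moreover have "of_int ?r * of_int \<alpha> + of_int v * (of_int h + \<tau>) = elt \<Delta> (u, v)"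
  proof -
    have "?r * \<alpha> = u - v * h" using assms(2) by simp
    then have "(of_int ?r * of_int \<alpha> :: complex) = of_int (u - v * h)" by (metis of_int_mult)
    then show ?thesis by (simp add: algebra_simps)
  qed
  ultimately show ?thesis by (simp only: elt_add elt_sc)
qed

lemma reduced_enumeration:
  assumes data: "ideal_data p q p' q' b \<alpha> h aA aZ"
    and ring: "P0 \<in> \<O>" "Q0 \<in> \<O>" "P \<in> \<O>" "Q \<in> \<O>"
    and det: "p * Q - q * P = p * Q0 - q * P0"
    and e: "q * \<zeta> - p * w = elt \<Delta> e" "elt \<Delta> e \<noteq> 0" and e0: "Q0 * \<zeta> - P0 * w = elt \<Delta> e0"
    and lt: "cmod (Q * \<zeta> - P * w) < cmod (elt \<Delta> e)"
    and XY: "(X, Y) = qmul \<Delta> (qconj \<Delta> e0) e" and n: "n = qnorm \<Delta> e"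
  obtains k l where "k \<in> {(h * Y - X) div n - 1..(h * Y - X) div n + 2}"
    "l \<in> {(- (\<alpha> * Y)) div n - 1..(- (\<alpha> * Y)) div n + 2}"
    "P = P0 + of_int k * p + of_int l * (omega \<alpha> h * p)" "Q = Q0 + of_int k * q + of_int l * (omega \<alpha> h * q)"
proof -
  have eq: "gen2 p q = std \<alpha> h" and \<alpha>: "\<alpha> > 0" and B: "\<bar>2 * h + \<Delta>\<bar> \<le> \<alpha>" "\<alpha> \<le> conorm \<alpha> h"
    and g: "gcd \<alpha> (gcd (2 * h + \<Delta>) (conorm \<alpha> h)) = 1"
    using data unfolding ideal_data_def by auto
  have sub: "submodule \<Delta> (std \<alpha> h)" using gen2_submodule[of p q] unfolding eq .
  have "\<exists>x. P - P0 = x * p \<and> Q - Q0 = x * q"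
  proof (cases "p = 0")
    case False
    then show ?thesis using det by (intro exI[of _ "(P - P0) / p"]) (simp add: field_simps)
  next
    case True
    then have "q \<noteq> 0" using e by auto
    then show ?thesis using det True by (intro exI[of _ "(Q - Q0) / q"]) (simp add: field_simps)
  qed
  then obtain x where x: "P - P0 = x * p" "Q - Q0 = x * q" by blast
  have "x \<in> ideal_inverse \<Delta> (std \<alpha> h)"
    unfolding ideal_inverse_def eq[symmetric]
  proof (intro CollectI ballI)
    fix y assume "y \<in> gen2 p q"
    then obtain a c where "a \<in> \<O>" "c \<in> \<O>" "y = a * p + c * q" unfolding gen2_def by blast
    moreover have "x * (a * p + c * q) = a * (P - P0) + c * (Q - Q0)" unfolding x by (simp add: algebra_simps)
    ultimately show "x * y \<in> \<O>" using ring by auto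
  qed
  then obtain k l where kl: "x = of_int k + of_int l * omega \<alpha> h"
    using inverse_omega_form[OF sub \<alpha> g] by metis
  have n0: "n > 0" unfolding n using e(2) by (rule qnorm_pos)
  define s where "s = real_of_int (X - h * Y) / of_int n"
  define t where "t = real_of_int (\<alpha> * Y) / of_int n"
  have st: "of_real s + of_real t * omega \<alpha> h = elt \<Delta> e0 / elt \<Delta> e"
  proof -
    have w: "of_int \<alpha> * omega \<alpha> h = of_int h + cnj \<tau>" by (rule omega_mult[OF sub \<alpha>])
    have "(of_real s + of_real t * omega \<alpha> h) * of_int n = of_int (X - h * Y) + of_int Y * (of_int \<alpha> * omega \<alpha> h)"
      unfolding s_def t_def using n0 by (simp add: field_simps)
    also have "\<dots> = of_int X + of_int Y * cnj \<tau>" unfolding w by (simp add: algebra_simps)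
    also have "\<dots> = cnj (elt \<Delta> (X, Y))" by simp
    also have "\<dots> = elt \<Delta> e0 * cnj (elt \<Delta> e)" unfolding XY elt_mul elt_conj by simp
    finally have 1: "(of_real s + of_real t * omega \<alpha> h) * of_int n = elt \<Delta> e0 * cnj (elt \<Delta> e)" .
    have "(of_real s + of_real t * omega \<alpha> h) * elt \<Delta> e * cnj (elt \<Delta> e) = elt \<Delta> e0 * cnj (elt \<Delta> e)"
      using 1 unfolding n elt_norm by (simp only: mult.assoc)
    then have "(of_real s + of_real t * omega \<alpha> h) * elt \<Delta> e = elt \<Delta> e0" using e(2) by simp
    then show ?thesis using e(2) by (simp add: field_simps)
  qed
  have "Q * \<zeta> - P * w = elt \<Delta> e0 + x * elt \<Delta> e"
  proof -
    have "Q * \<zeta> - P * w = (Q0 * \<zeta> - P0 * w) + ((Q - Q0) * \<zeta> - (P - P0) * w)" by (simp add: algebra_simps)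
    also have "(Q - Q0) * \<zeta> - (P - P0) * w = x * (q * \<zeta> - p * w)" unfolding x by (simp add: algebra_simps)
    finally show ?thesis unfolding e e0 .
  qed
  also have "\<dots> = (of_real s + of_real t * omega \<alpha> h + x) * elt \<Delta> e"
    unfolding st using e(2) by (simp add: field_simps)
  finally have "cmod (of_real s + of_real t * omega \<alpha> h + x) * cmod (elt \<Delta> e) < 1 * cmod (elt \<Delta> e)"
    using lt by (simp only: norm_mult mult_1_left)
  then have "cmod (of_real s + of_real t * omega \<alpha> h + x) < 1" using e(2) by (simp only: mult_less_cancel_right) auto
  note bounds = reduced_enumeration_bounds[OF sub \<alpha> B this[unfolded kl]]
  have fl: "(h * Y - X) div n = \<lfloor>- s\<rfloor>" "(- (\<alpha> * Y)) div n = \<lfloor>- t\<rfloor>"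
  proof -
    have "- s = real_of_int (h * Y - X) / of_int n" "- t = real_of_int (- (\<alpha> * Y)) / of_int n"
      unfolding s_def t_def by (simp_all only: minus_divide_left of_int_minus[symmetric] minus_diff_eq)
    then show "(h * Y - X) div n = \<lfloor>- s\<rfloor>" "(- (\<alpha> * Y)) div n = \<lfloor>- t\<rfloor>"
      by (simp_all only: floor_divide_of_int_eq)
  qed
  have range: "j \<in> {\<lfloor>- r\<rfloor> - 1..\<lfloor>- r\<rfloor> + 2}" if "\<bar>r + of_int j\<bar> < 2" for r :: real and j :: int
    using that floor_correct[of "- r"] by (auto simp: abs_less_iff) linarith+
  show ?thesis
  proof (rule that)
    show "k \<in> {(h * Y - X) div n - 1..(h * Y - X) div n + 2}"
      "l \<in> {(- (\<alpha> * Y)) div n - 1..(- (\<alpha> * Y)) div n + 2}"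
      unfolding fl by (rule range, fact)+
    show "P = P0 + of_int k * p + of_int l * (omega \<alpha> h * p)" "Q = Q0 + of_int k * q + of_int l * (omega \<alpha> h * q)"
      using x unfolding kl by (simp_all add: algebra_simps)
  qed
qed

end

locale cf_machine = machine L inp F J + imag_quad \<Delta> for L inp F J \<Delta>
begin

lemma check_prog_ht:
  assumes ok: "ok check_prog X s" and N0: "s (vn 1) = tau_norm \<Delta>" and D: "s (vn 0) = \<Delta>"
    and p: "p = elt \<Delta> (gp s 120)" and q: "q = elt \<Delta> (gp s 122)"
    and p': "p' = elt \<Delta> (gp s 124)" and q': "q' = elt \<Delta> (gp s 126)" and b: "b = elt \<Delta> (gp s 128)" "b \<noteq> 0"
    and m: "qnorm \<Delta> (gp s 128) < 2 ^ J"
    and \<sigma>: "\<sigma> = 1 \<or> \<sigma> = -1" and det: "p * q' - q * p' = \<sigma> * b"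
  shows "ht X check_prog s (\<lambda>t. (\<forall>x. x \<notin> vn ` {130..179} \<longrightarrow> t x = s x) \<and>
    (1 \<le> t (vn 170) \<longleftrightarrow> reduced_ideal \<Delta> (gen2 p q)) \<and>
    (reduced_ideal \<Delta> (gen2 p q) \<longrightarrow>
      ideal_data p q p' q' b (t (vn 136)) (t (vn 132)) (t (vn 134), t (vn 135)) (t (vn 138), t (vn 139))))"
    (is "ht X _ s ?Q")
  unfolding check_prog_def
proof (rule ht_Seq[OF ok[unfolded check_prog_def]])
  have N0': "s (vn 1) = tau_norm (s (vn 0))" using N0 D by simp
  have m0: "0 < qnorm (s (vn 0)) (gp s 128)" unfolding D using b by (intro qnorm_pos) auto
  show "ht X basis_prog s (basis_rel inp s)" if "ok basis_prog X s"
    by (rule basis_prog_ht[OF that N0' m0]) (use m D in simp)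
  fix t1 assume t1: "basis_rel inp s t1" and ok1: "ok test_prog (X ^ growth basis_prog) t1"
  have fr1: "t1 x = s x" if "x \<notin> vn ` {130..159}" for x using t1 that unfolding basis_rel_def by blast
  have D1: "t1 (vn 0) = \<Delta>" "t1 (vn 1) = tau_norm \<Delta>" using fr1[of "vn 0"] fr1[of "vn 1"] D N0 by auto
  have pos: "0 < t1 (vn 133)" "0 < t1 (vn 136)" "t1 (vn 136) dvd t1 (vn 130)"
     "t1 (vn 130) = qnorm (s (vn 0)) (gp s 128)" "\<bar>2 * t1 (vn 132) + s (vn 0)\<bar> \<le> t1 (vn 136)"
    using t1 unfolding basis_rel_def by blast+
  define \<alpha> h where ah: "\<alpha> = t1 (vn 136)" "h = t1 (vn 132)"
  have "\<alpha> \<le> t1 (vn 130)" unfolding ah using pos m0 by (intro zdvd_imp_le) auto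
  then have \<alpha>J: "\<alpha> < 2 ^ J" using pos m D by simp
  note math = basis_rel_ideal[OF t1 N0' D p q p' q' b \<sigma> det]
  define v where "v \<longleftrightarrow> t1 (vn 133) \<le> 1 \<and> \<alpha> \<le> qnorm \<Delta> (h, 1) div \<alpha> \<and>
      gcd \<alpha> (gcd (2 * h + \<Delta>) (qnorm \<Delta> (h, 1) div \<alpha>)) = 1"
  have "ht (X ^ growth basis_prog) test_prog t1 (\<lambda>t. (\<forall>x. x \<notin> vn ` {150..179} \<longrightarrow> t x = t1 x) \<and>
    t (vn 170) = (if t1 (vn 133) \<le> 1 \<and> t1 (vn 136) \<le> qnorm (t1 (vn 0)) (t1 (vn 132), 1) div t1 (vn 136) \<and>
      gcd (t1 (vn 136)) (gcd (2 * t1 (vn 132) + t1 (vn 0)) (qnorm (t1 (vn 0)) (t1 (vn 132), 1) div t1 (vn 136))) = 1 then 1 else 0))"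
    by (rule test_prog_ht[OF ok1])
      (use D1 pos \<alpha>J m0 qnorm_nonneg[of "(t1 (vn 132), 1)"] in \<open>simp_all add: ah del: qnorm.simps\<close>)
  then show "ht (X ^ growth basis_prog) test_prog t1 ?Q"
  proof (rule ht_conseq)
    fix t assume "(\<forall>x. x \<notin> vn ` {150..179} \<longrightarrow> t x = t1 x) \<and>
    t (vn 170) = (if t1 (vn 133) \<le> 1 \<and> t1 (vn 136) \<le> qnorm (t1 (vn 0)) (t1 (vn 132), 1) div t1 (vn 136) \<and>
      gcd (t1 (vn 136)) (gcd (2 * t1 (vn 132) + t1 (vn 0)) (qnorm (t1 (vn 0)) (t1 (vn 132), 1) div t1 (vn 136))) = 1 then 1 else 0)"
    note t = this
    have fr: "t x = t1 x" if "x \<notin> vn ` {150..179}" for x using t that by blast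
    have fl: "t (vn 170) = (if v then 1 else 0)" using t unfolding v_def ah D1 by blast
    have tv: "t (vn 136) = \<alpha>" "t (vn 132) = h" "t (vn 134) = t1 (vn 134)" "t (vn 135) = t1 (vn 135)"
      "t (vn 138) = t1 (vn 138)" "t (vn 139) = t1 (vn 139)"
      unfolding ah using fr[of "vn 136"] fr[of "vn 132"] fr[of "vn 134"] fr[of "vn 135"] fr[of "vn 138"] fr[of "vn 139"] by auto
    have \<alpha>0: "\<alpha> > 0" and B: "\<bar>2 * h + \<Delta>\<bar> \<le> \<alpha>" using pos D unfolding ah by auto
    have iff: "v \<longleftrightarrow> reduced_ideal \<Delta> (gen2 p q)"
    proof (cases "t1 (vn 133) = 1")
      case True
      then have eq: "gen2 p q = std \<alpha> h" using math(3) unfolding ah by simp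
      have sub: "submodule \<Delta> (std \<alpha> h)" using gen2_submodule[of p q] unfolding eq .
      show ?thesis unfolding eq reduced_std_iff[OF sub \<alpha>0 B] unfolding v_def conorm_def using True by simp
    next
      case False
      then show ?thesis using math(4) pos(1) unfolding v_def by auto
    qed
    have dat: "ideal_data p q p' q' b \<alpha> h (t1 (vn 134), t1 (vn 135)) (t1 (vn 138), t1 (vn 139))"
      if "reduced_ideal \<Delta> (gen2 p q)"
    proof -
      have g: "t1 (vn 133) = 1" by (rule math(4)[OF that])
      have eq: "gen2 p q = std \<alpha> h" using math(3)[OF g] unfolding ah .
      have v using that iff by simp
      then show ?thesis unfolding ideal_data_def conorm_def
        using eq \<alpha>0 B math(1,2) g unfolding v_def by (simp add: ah)
    qed
    have frt: "t x = s x" if "x \<notin> vn ` {130..179}" for x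
    proof -
      have "t x = t1 x" by (rule fr) (use that in auto)
      also have "\<dots> = s x" by (rule fr1) (use that in auto)
      finally show ?thesis .
    qed
    show "?Q t" unfolding tv using frt fl iff dat by simp
  qed
qed

end

section \<open>One step of the algorithm\<close>

definition zero_range :: "nat \<Rightarrow> nat \<Rightarrow> prog" where
  "zero_range a b = seqs (map (\<lambda>i. asg i (Const 0)) [a..<b])"

lemma sem_zero_range: "sem inp (zero_range a b) s x = (if x \<in> vn ` {a..<b} then 0 else s x)"
proof -
  have "sem inp (seqs (map (\<lambda>i. asg i (Const 0)) is)) s x = (if x \<in> vn ` set is then 0 else s x)" for "is" s
    by (induction "is" arbitrary: s) auto
  then show ?thesis unfolding zero_range_def by simp
qed

lemma loop_free_zero_range: "loop_free (zero_range a b)"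
proof -
  have "loop_free (seqs (map (\<lambda>i. asg i (Const 0)) is))" for "is"
    by (induction "is") auto
  then show ?thesis unfolding zero_range_def .
qed

definition perr :: "int \<Rightarrow> int \<times> int \<Rightarrow> int \<Rightarrow> int \<times> int \<Rightarrow> int \<times> int \<Rightarrow> int \<times> int" where
  "perr D z w P Q = qmul D Q z - qsc w P"

text \<open>Memory layout: \<open>2\<close> and \<open>4\<close> hold \<open>w z\<close> and \<open>w\<close>, then \<open>p, q, p', q', b\<close> in \<open>8, 10, 12, 14, 16\<close> and
  \<open>w (q z - p)\<close> in \<open>18\<close>; \<open>40\<close> to \<open>53\<close> describe the ideal \<open>(p, q)\<close>; \<open>54\<close> to \<open>63\<close> hold the best successor
  found so far, \<open>54\<close> being the norm of its error.\<close>

definition cand_init :: "int \<Rightarrow> int \<Rightarrow> prog" where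
  "cand_init i j = seqs [asg 100 (Add (V 84) (Const i)), asg 101 (Add (V 85) (Const j)),
     asgp 102 (padd (pv 76) (padd (pscale (V 100) (pv 8)) (pscale (V 101) (pv 46)))),
     asgp 104 (padd (pv 78) (padd (pscale (V 100) (pv 10)) (pscale (V 101) (pv 48)))),
     asgp 106 (psub (pmul (pv 104) (pv 2)) (pscale (V 4) (pv 102))),
     asg 108 (pnorm (pv 106))]"

definition cand_copy :: prog where
  "cand_copy = seqs [asgp 120 (pv 102), asgp 122 (pv 104), asgp 124 (pv 8), asgp 126 (pv 10), asgp 128 (pv 70)]"

definition cand_update :: prog where
  "cand_update = IfLe (Const 1) (V 170)
     (seqs [asgp 56 (pv 102), asgp 58 (pv 104), asgp 60 (pv 70), asgp 62 (pv 106), asg 54 (V 108)]) Skip"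

definition cand_test :: prog where
  "cand_test = IfLe (Add (V 108) (Const 1)) (V 54) (Seq cand_copy (Seq check_prog cand_update)) Skip"

definition cand_prog :: "int \<Rightarrow> int \<Rightarrow> prog" where
  "cand_prog i j = Seq (cand_init i j) (Seq cand_test (zero_range 100 180))"

definition cands_prog :: "(int \<times> int) list \<Rightarrow> prog" where
  "cands_prog ijs = seqs (map (\<lambda>(i, j). cand_prog i j) ijs)"

definition offsets :: "(int \<times> int) list" where
  "offsets = List.product [-1, 0, 1, 2] [-1, 0, 1, 2]"

definition den_read :: prog where
  "den_read = seqs [asgp 70 (Input (Add (Const 6) (Mul (Const 2) (V 64))), Input (Add (Const 7) (Mul (Const 2) (V 64)))),
     asg 72 (Sub (V 70) (Mul (V 71) (V 41)))]"

definition den_lift :: prog where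
  "den_lift = seqs [
     asgp 74 (padd (pscale (Div (V 72) (V 40)) (pv 44)) (pscale (V 71) (pv 42))),
     asgp 76 (pdiv (pmul (pconj (pv 16)) (padd (pmul (pv 74) (pv 8)) (pmul (pv 70) (pv 12)))) (V 53)),
     asgp 78 (pdiv (pmul (pconj (pv 16)) (padd (pmul (pv 74) (pv 10)) (pmul (pv 70) (pv 14)))) (V 53)),
     asgp 80 (psub (pmul (pv 78) (pv 2)) (pscale (V 4) (pv 76))),
     asgp 82 (pmul (pconj (pv 80)) (pv 18)),
     asg 84 (Div (Sub (Mul (V 41) (V 83)) (V 82)) (V 52)),
     asg 85 (Div (Sub (Const 0) (Mul (V 40) (V 83))) (V 52))]"

definition den_body :: prog where
  "den_body = Seq den_read (Seq
     (IfLe (mod_expr (V 72) (V 40)) (Const 0) (Seq den_lift (cands_prog offsets)) Skip)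
     (Seq (zero_range 70 100) (asg 64 (Add (V 64) (Const 1)))))"

definition den_loop :: prog where
  "den_loop = WhileLe (Add (V 64) (Const 1)) (V 6) den_body"

context machine
begin

lemma ht_Seq_reset:
  assumes ok: "ok (Seq c d) X s" and c: "ok c X s \<Longrightarrow> ht X c s Q1"
    and d: "\<And>t. Q1 t \<Longrightarrow> bnd X t" "\<And>t. Q1 t \<Longrightarrow> ok d X t \<Longrightarrow> ht X d t Q"
  shows "ht X (Seq c d) s Q"
proof -
  have X: "10 \<le> X" using ok by (simp add: ok_def)
  have gr: "growth d \<le> growth (Seq c d)" using growth_pos[of c] by simp
  obtain k t where kt: "exec L inp c s k [] t" "k \<le> F * pass_cost c" "Q1 t"
    using c[OF ok_Seq1[OF ok]] unfolding ht_def by blast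
  have "ok d X t" using ok d(1)[OF kt(3)] gr X
    unfolding ok_def by (auto elim!: fits_mono intro!: power_increasing)
  then obtain k' u where u: "exec L inp d t k' [] u" "k' \<le> F * pass_cost d" "bnd (X ^ growth d) u" "Q u"
    using d(2)[OF kt(3)] unfolding ht_def by blast
  have "exec L inp (Seq c d) s (k + k') [] u" using exec.Seq[OF kt(1) u(1)] by simp
  moreover have "k + k' \<le> F * pass_cost (Seq c d)" using kt(2) u(2) by (simp add: distrib_left)
  moreover have "bnd (X ^ growth (Seq c d)) u"
    by (rule bnd_mono[OF u(3)]) (use X gr in \<open>intro power_increasing, auto\<close>)
  ultimately show ?thesis using u(4) unfolding ht_def by blast
qed

end

locale cf_step = cf_machine L inp F J \<Delta> for L inp F J \<Delta> +
  fixes bs :: "(int \<times> int) list" and s0 :: store and \<sigma> :: complex and G :: int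
  assumes D0: "s0 (vn 0) = \<Delta>" and N00: "s0 (vn 1) = tau_norm \<Delta>" and sgn: "\<sigma> = 1 \<or> \<sigma> = -1"
    and det: "elt \<Delta> (gp s0 8) * elt \<Delta> (gp s0 14) - elt \<Delta> (gp s0 10) * elt \<Delta> (gp s0 12) = \<sigma> * elt \<Delta> (gp s0 16)"
    and b_nz: "elt \<Delta> (gp s0 16) \<noteq> 0"
    and err0: "gp s0 18 = perr \<Delta> (gp s0 2) (s0 (vn 4)) (gp s0 8) (gp s0 10)" and err_nz: "elt \<Delta> (gp s0 18) \<noteq> 0"
    and data: "ideal_data (elt \<Delta> (gp s0 8)) (elt \<Delta> (gp s0 10)) (elt \<Delta> (gp s0 12)) (elt \<Delta> (gp s0 14))
      (elt \<Delta> (gp s0 16)) (s0 (vn 40)) (s0 (vn 41)) (gp s0 42) (gp s0 44)"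
    and F2: "elt \<Delta> (gp s0 46) = omega (s0 (vn 40)) (s0 (vn 41)) * elt \<Delta> (gp s0 8)"
      "elt \<Delta> (gp s0 48) = omega (s0 (vn 40)) (s0 (vn 41)) * elt \<Delta> (gp s0 10)"
    and norms: "s0 (vn 52) = qnorm \<Delta> (gp s0 18)" "s0 (vn 53) = qnorm \<Delta> (gp s0 16)"
    and inp_bs: "\<And>i. i < length bs \<Longrightarrow> read_input inp (6 + 2 * int i) = fst (bs ! i)"
      "\<And>i. i < length bs \<Longrightarrow> read_input inp (7 + 2 * int i) = snd (bs ! i)"
    and nb: "s0 (vn 6) = int (length bs)"
    and bs: "\<And>\<beta>. \<beta> \<in> set bs \<Longrightarrow> elt \<Delta> \<beta> \<noteq> 0" "\<And>\<beta>. \<beta> \<in> set bs \<Longrightarrow> qnorm \<Delta> \<beta> < 2 ^ J"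
    and small: "\<And>P Q \<beta>. \<beta> \<in> set bs \<Longrightarrow>
      elt \<Delta> (gp s0 8) * elt \<Delta> Q - elt \<Delta> (gp s0 10) * elt \<Delta> P = \<sigma> * elt \<Delta> \<beta> \<Longrightarrow>
      qnorm \<Delta> (perr \<Delta> (gp s0 2) (s0 (vn 4)) P Q) < qnorm \<Delta> (gp s0 18) \<Longrightarrow>
      \<forall>v\<in>{P, Q, \<beta>, perr \<Delta> (gp s0 2) (s0 (vn 4)) P Q, (qnorm \<Delta> (perr \<Delta> (gp s0 2) (s0 (vn 4)) P Q), 0)}.
        \<bar>fst v\<bar> \<le> G \<and> \<bar>snd v\<bar> \<le> G"
begin

abbreviation "pp \<equiv> elt \<Delta> (gp s0 8)"
abbreviation "qq \<equiv> elt \<Delta> (gp s0 10)"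
abbreviation "err \<equiv> perr \<Delta> (gp s0 2) (s0 (vn 4))"
abbreviation "nrm P Q \<equiv> qnorm \<Delta> (err P Q)"

definition good :: "int \<times> int \<Rightarrow> int \<times> int \<Rightarrow> int \<times> int \<Rightarrow> bool" where
  "good P Q \<beta> \<longleftrightarrow> \<beta> \<in> set bs \<and> pp * elt \<Delta> Q - qq * elt \<Delta> P = \<sigma> * elt \<Delta> \<beta> \<and>
     reduced_ideal \<Delta> (gen2 (elt \<Delta> P) (elt \<Delta> Q))"

definition base :: "store \<Rightarrow> bool" where
  "base s \<longleftrightarrow> (\<forall>k<54. s (vn k) = s0 (vn k))"

definition best :: "store \<Rightarrow> bool" where
  "best s \<longleftrightarrow> s (vn 54) \<le> s0 (vn 52) \<and> (s (vn 54) < s0 (vn 52) \<longrightarrow> good (gp s 56) (gp s 58) (gp s 60) \<and>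
     s (vn 54) = nrm (gp s 56) (gp s 58) \<and> gp s 62 = err (gp s 56) (gp s 58))"

definition best_bnd :: "int \<Rightarrow> store \<Rightarrow> bool" where
  "best_bnd Z s \<longleftrightarrow> (\<forall>k\<in>{54..63}. \<bar>s (vn k)\<bar> \<le> Z)"

lemma base_gp: "base s \<Longrightarrow> k < 53 \<Longrightarrow> gp s k = gp s0 k"
  unfolding base_def gp_def by simp

definition cand_post :: "store \<Rightarrow> int \<times> int \<Rightarrow> int \<times> int \<Rightarrow> int \<times> int \<Rightarrow> store \<Rightarrow> bool" where
  "cand_post s P Q \<beta> t \<longleftrightarrow> (\<forall>x. x \<notin> vn ` ({54..63} \<union> {100..179}) \<longrightarrow> t x = s x) \<and>
    (if nrm P Q + 1 \<le> s (vn 54) \<and> reduced_ideal \<Delta> (gen2 (elt \<Delta> P) (elt \<Delta> Q))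
     then t (vn 54) = nrm P Q \<and> t (vn 55) = s (vn 55) \<and> gp t 56 = P \<and> gp t 58 = Q \<and> gp t 60 = \<beta> \<and> gp t 62 = err P Q
     else (\<forall>k\<in>{54..63}. t (vn k) = s (vn k)))"

lemma cand_test_ht:
  assumes ok: "ok cand_test X s1" and base1: "base s1"
    and fr1: "\<And>x. x \<notin> vn ` {100..109} \<Longrightarrow> s1 x = s x"
    and \<beta>: "gp s1 70 = \<beta>" "\<beta> \<in> set bs"
    and v1: "gp s1 102 = P" "gp s1 104 = Q" "gp s1 106 = err P Q" "s1 (vn 108) = nrm P Q"
    and detPQ: "pp * elt \<Delta> Q - qq * elt \<Delta> P = \<sigma> * elt \<Delta> \<beta>"
  shows "ht X cand_test s1 (cand_post s P Q \<beta>)"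
  unfolding cand_test_def
proof (rule ht_IfLe[OF ok[unfolded cand_test_def]])
  have s54: "s1 (vn k) = s (vn k)" if "k \<in> {54..63}" for k using that by (intro fr1) auto
  assume "\<not> eval_expr inp s1 (Add (V 108) (Const 1)) \<le> eval_expr inp s1 (V 54)" and "ok Skip X s1"
  then have "\<not> nrm P Q + 1 \<le> s (vn 54)" using v1 s54[of 54] by simp
  moreover have "s1 x = s x" if "x \<notin> vn ` ({54..63} \<union> {100..179})" for x
    by (rule fr1) (use that in auto)
  ultimately have "cand_post s P Q \<beta> s1" unfolding cand_post_def using s54 by auto
  then show "ht X Skip s1 (cand_post s P Q \<beta>)" using \<open>ok Skip X s1\<close> by (intro ht_loop_free) auto
next
  have s54: "s1 (vn k) = s (vn k)" if "k \<in> {54..63}" for k using that by (intro fr1) auto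
  assume "eval_expr inp s1 (Add (V 108) (Const 1)) \<le> eval_expr inp s1 (V 54)"
    and ok1: "ok (Seq cand_copy (Seq check_prog cand_update)) X s1"
  then have less: "nrm P Q + 1 \<le> s (vn 54)" using v1 s54[of 54] by simp
  show "ht X (Seq cand_copy (Seq check_prog cand_update)) s1 (cand_post s P Q \<beta>)"
  proof (rule ht_Seq[OF ok1])
    define s2 where "s2 = sem inp cand_copy s1"
    show "ht X cand_copy s1 (\<lambda>t. t = s2)" if "ok cand_copy X s1"
      by (rule ht_loop_free[OF _ that]) (simp_all add: cand_copy_def s2_def)
    have v2: "gp s2 120 = P" "gp s2 122 = Q" "gp s2 124 = gp s0 8" "gp s2 126 = gp s0 10" "gp s2 128 = \<beta>"
      unfolding s2_def cand_copy_def using v1 \<beta> base_gp[OF base1] by simp_all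
    have fr2: "s2 x = s1 x" if "x \<notin> vn ` {120..129}" for x
    proof -
      have "x \<noteq> vn i" if "i \<in> {120..129}" for i using that \<open>x \<notin> vn ` {120..129}\<close> by auto
      then show ?thesis unfolding s2_def cand_copy_def by (simp add: upd2_def)
    qed
    have D2: "s2 (vn 0) = \<Delta>" "s2 (vn 1) = tau_norm \<Delta>"
      using fr2[of "vn 0"] fr2[of "vn 1"] base1 D0 N00 unfolding base_def by auto
    fix t2 assume t2: "t2 = s2" and ok2: "ok (Seq check_prog cand_update) (X ^ growth cand_copy) t2"
    show "ht (X ^ growth cand_copy) (Seq check_prog cand_update) t2 (cand_post s P Q \<beta>)"
    proof (rule ht_Seq[OF ok2])
      let ?Q = "\<lambda>t. (\<forall>x. x \<notin> vn ` {130..179} \<longrightarrow> t x = s2 x) \<and>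
        (1 \<le> t (vn 170) \<longleftrightarrow> reduced_ideal \<Delta> (gen2 (elt \<Delta> P) (elt \<Delta> Q)))"
      have sg: "- \<sigma> = 1 \<or> - \<sigma> = -1" using sgn by auto
      have d: "elt \<Delta> P * qq - elt \<Delta> Q * pp = - \<sigma> * elt \<Delta> \<beta>" using detPQ by (simp add: algebra_simps)
      show "ht (X ^ growth cand_copy) check_prog t2 ?Q" if "ok check_prog (X ^ growth cand_copy) t2"
        unfolding t2
        by (rule ht_conseq[OF check_prog_ht[OF that[unfolded t2] D2(2) D2(1) refl refl refl refl refl _ _ sg]])
          (use v2 bs \<beta> d in \<open>auto simp: less_imp_le\<close>)
      fix t3 assume t3: "?Q t3" and ok3: "ok cand_update ((X ^ growth cand_copy) ^ growth check_prog) t3"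
      have fr3: "t3 x = s1 x" if "x \<notin> vn ` {120..179}" for x
      proof -
        have "x \<notin> vn ` {130..179}" using that by auto
        then have "t3 x = s2 x" using t3 by blast
        also have "\<dots> = s1 x" by (rule fr2) (use that in auto)
        finally show ?thesis .
      qed
      have g3: "gp t3 k = gp s1 k" if "k < 119" for k
        unfolding gp_def using fr3[of "vn k"] fr3[of "vn (Suc k)"] that by auto
      define t where "t = sem inp cand_update t3"
      have "cand_post s P Q \<beta> t"
      proof (cases "reduced_ideal \<Delta> (gen2 (elt \<Delta> P) (elt \<Delta> Q))")
        case True
        then have "1 \<le> t3 (vn 170)" using t3 by blast
        then have t: "t = (upd2 62 (gp t3 106) (upd2 60 (gp t3 70) (upd2 58 (gp t3 104) (upd2 56 (gp t3 102) t3))))(vn 54 := t3 (vn 108))"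
          unfolding t_def cand_update_def by simp
        have frt: "t x = s x" if "x \<notin> vn ` ({54..63} \<union> {100..179})" for x
        proof -
          have ne: "x \<noteq> vn i" if "i \<in> {54..63} \<union> {100..179}" for i
            using that \<open>x \<notin> vn ` ({54..63} \<union> {100..179})\<close> by auto
          have "t x = t3 x" unfolding t using ne by (simp add: upd2_def)
          also have "\<dots> = s1 x" by (rule fr3) (use that in auto)
          also have "\<dots> = s x" by (rule fr1) (use that in auto)
          finally show ?thesis .
        qed
        have "t (vn 55) = s (vn 55)" unfolding t using fr3[of "vn 55"] s54[of 55] by (simp add: upd2_def image_iff)
        moreover have "t (vn 54) = nrm P Q" unfolding t using fr3[of "vn 108"] v1 by (simp add: image_iff)
        moreover have "gp t 56 = P" "gp t 58 = Q" "gp t 60 = \<beta>" "gp t 62 = err P Q"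
          unfolding t using g3 v1 \<beta> by simp_all
        ultimately show ?thesis unfolding cand_post_def using frt less True by simp
      next
        case False
        then have t: "t = t3" using t3 unfolding t_def cand_update_def by auto
        have frt: "t x = s x" if "x \<notin> vn ` ({100..179})" for x
        proof -
          have "t x = s1 x" unfolding t by (rule fr3) (use that in auto)
          also have "\<dots> = s x" by (rule fr1) (use that in auto)
          finally show ?thesis .
        qed
        show ?thesis unfolding cand_post_def using frt False by auto
      qed
      then show "ht ((X ^ growth cand_copy) ^ growth check_prog) cand_update t3 (cand_post s P Q \<beta>)"
        by (intro ht_loop_free[OF _ ok3]) (simp_all add: cand_update_def t_def)
    qed
  qed
qed simp_all

definition den_ok :: "store \<Rightarrow> int \<times> int \<Rightarrow> bool" where
  "den_ok s \<beta> \<longleftrightarrow> gp s 70 = \<beta> \<and> \<beta> \<in> set bs \<and> pp * elt \<Delta> (gp s 78) - qq * elt \<Delta> (gp s 76) = \<sigma> * elt \<Delta> \<beta>"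

definition candP :: "store \<Rightarrow> int \<Rightarrow> int \<Rightarrow> int \<times> int" where
  "candP s i j = gp s 76 + (qsc (s (vn 84) + i) (gp s0 8) + qsc (s (vn 85) + j) (gp s0 46))"

definition candQ :: "store \<Rightarrow> int \<Rightarrow> int \<Rightarrow> int \<times> int" where
  "candQ s i j = gp s 78 + (qsc (s (vn 84) + i) (gp s0 10) + qsc (s (vn 85) + j) (gp s0 48))"

definition cands_post :: "int \<Rightarrow> int \<Rightarrow> store \<Rightarrow> int \<times> int \<Rightarrow> (int \<times> int) list \<Rightarrow> store \<Rightarrow> bool" where
  "cands_post Y Z s \<beta> ijs t \<longleftrightarrow> (\<forall>x. x \<notin> vn ` ({54..63} \<union> {100..179}) \<longrightarrow> t x = s x) \<and>
     (\<forall>k\<in>{100..179}. t (vn k) = 0 \<or> t (vn k) = s (vn k)) \<and>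
     bnd Y t \<and> best_bnd Z t \<and> best t \<and> t (vn 54) \<le> s (vn 54) \<and>
     (\<forall>(i, j)\<in>set ijs. good (candP s i j) (candQ s i j) \<beta> \<longrightarrow> t (vn 54) \<le> nrm (candP s i j) (candQ s i j))"

lemma cand_prog_ht:
  assumes ok: "ok (cand_prog i j) Y s" and GY: "G \<le> Y" "G \<le> Z" and base: "base s" and den: "den_ok s \<beta>"
    and best: "best s" "best_bnd Z s" and ij: "\<bar>i\<bar> \<le> 10" "\<bar>j\<bar> \<le> 10"
  shows "ht Y (cand_prog i j) s (cands_post Y Z s \<beta> [(i, j)])"
  unfolding cand_prog_def
proof (rule ht_Seq[OF ok[unfolded cand_prog_def]])
  define P where "P = candP s i j"
  define Q where "Q = candQ s i j"
  define s1 where "s1 = sem inp (cand_init i j) s"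
  have \<beta>: "gp s 70 = \<beta>" "\<beta> \<in> set bs" using den by (auto simp: den_ok_def)
  show "ht Y (cand_init i j) s (\<lambda>t. t = s1)" if "ok (cand_init i j) Y s"
    by (rule ht_loop_free[OF _ that]) (use ij in \<open>simp_all add: cand_init_def s1_def\<close>)
  have Ds: "s (vn 0) = \<Delta>" "s (vn 1) = tau_norm \<Delta>" "s (vn 4) = s0 (vn 4)"
    using base D0 N00 unfolding base_def by auto
  have s1: "s1 = (upd2 106 (err P Q) (upd2 104 Q (upd2 102 P (s(vn 100 := s (vn 84) + i, vn 101 := s (vn 85) + j)))))(vn 108 := nrm P Q)"
    unfolding s1_def cand_init_def using base_gp[OF base] Ds
    by (simp add: P_def Q_def candP_def candQ_def perr_def)
  have v1: "gp s1 102 = P" "gp s1 104 = Q" "gp s1 106 = err P Q" "s1 (vn 108) = nrm P Q" "gp s1 70 = \<beta>"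
    unfolding s1 using \<beta> by simp_all
  have fr1: "s1 x = s x" if "x \<notin> vn ` {100..109}" for x
  proof -
    have "x \<noteq> vn i" if "i \<in> {100..109}" for i using that \<open>x \<notin> vn ` {100..109}\<close> by auto
    then show ?thesis unfolding s1 by (simp add: upd2_def)
  qed
  have base1: "base s1" using base fr1 unfolding base_def by auto
  have detPQ: "pp * elt \<Delta> Q - qq * elt \<Delta> P = \<sigma> * elt \<Delta> \<beta>"
  proof -
    have "pp * elt \<Delta> Q - qq * elt \<Delta> P = pp * elt \<Delta> (gp s 78) - qq * elt \<Delta> (gp s 76)"
      unfolding P_def Q_def candP_def candQ_def elt_add elt_sc F2 by (simp add: algebra_simps)
    then show ?thesis using den by (simp add: den_ok_def)
  qed
  fix t1 assume t1: "t1 = s1" and ok1: "ok (Seq cand_test (zero_range 100 180)) (Y ^ growth (cand_init i j)) t1"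
  show "ht (Y ^ growth (cand_init i j)) (Seq cand_test (zero_range 100 180)) t1 (cands_post Y Z s \<beta> [(i, j)])"
  proof (rule ht_Seq[OF ok1])
    show "ht (Y ^ growth (cand_init i j)) cand_test t1 (cand_post s P Q \<beta>)"
      if "ok cand_test (Y ^ growth (cand_init i j)) t1"
      unfolding t1 by (rule cand_test_ht[OF that[unfolded t1] base1 fr1 v1(5) \<beta>(2) v1(1-4) detPQ])
    fix t2 assume t2: "cand_post s P Q \<beta> t2"
      and ok2: "ok (zero_range 100 180) ((Y ^ growth (cand_init i j)) ^ growth cand_test) t2"
    define t where "t = sem inp (zero_range 100 180) t2"
    have tz: "t (vn k) = 0" if "k \<in> {100..179}" for k unfolding t_def sem_zero_range using that by auto
    have tx: "t x = t2 x" if "x \<notin> vn ` {100..179}" for x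
      unfolding t_def sem_zero_range using that by (auto simp: image_iff)
    have frt: "t x = s x" if "x \<notin> vn ` ({54..63} \<union> {100..179})" for x
    proof -
      have "t x = t2 x" by (rule tx) (use that in auto)
      also have "\<dots> = s x" using t2 that unfolding cand_post_def by blast
      finally show ?thesis .
    qed
    have tk: "t (vn k) = t2 (vn k)" if "k < 100" for k by (rule tx) (use that in auto)
    have tg: "gp t k = gp t2 k" if "k < 99" for k unfolding gp_def using that by (simp add: tk)
    define acc where "acc \<longleftrightarrow> nrm P Q + 1 \<le> s (vn 54) \<and> reduced_ideal \<Delta> (gen2 (elt \<Delta> P) (elt \<Delta> Q))"
    have "best t \<and> best_bnd Z t \<and> best_bnd Y t \<and> t (vn 54) \<le> s (vn 54) \<and> (good P Q \<beta> \<longrightarrow> t (vn 54) \<le> nrm P Q)"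
    proof (cases acc)
      case True
      have v: "t (vn 54) = nrm P Q" "t (vn 55) = s (vn 55)" "gp t 56 = P" "gp t 58 = Q" "gp t 60 = \<beta>" "gp t 62 = err P Q"
        using t2 True unfolding cand_post_def acc_def[symmetric] by (simp_all add: tk tg)
      have n52: "s (vn 54) \<le> s0 (vn 52)" using best unfolding best_def by blast
      have lt: "nrm P Q < s0 (vn 52)" using True n52 unfolding acc_def by linarith
      have gd: "good P Q \<beta>" unfolding good_def using \<beta> detPQ True unfolding acc_def by blast
      have sm: "\<forall>v\<in>{P, Q, \<beta>, err P Q, (nrm P Q, 0)}. \<bar>fst v\<bar> \<le> G \<and> \<bar>snd v\<bar> \<le> G"
        by (rule small[OF \<beta>(2) detPQ]) (use lt norms in simp)
      have gpv: "t (vn 56) = fst P" "t (vn 57) = snd P" "t (vn 58) = fst Q" "t (vn 59) = snd Q"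
        "t (vn 60) = fst \<beta>" "t (vn 61) = snd \<beta>" "t (vn 62) = fst (err P Q)" "t (vn 63) = snd (err P Q)"
        using v(3-6)[THEN arg_cong, of fst] v(3-6)[THEN arg_cong, of snd] by (simp_all add: gp_def[of t])
      have bb: "best_bnd W t" if W: "G \<le> W" "\<bar>s (vn 55)\<bar> \<le> W" for W
        unfolding best_bnd_def
      proof
        fix k :: nat assume "k \<in> {54..63}"
        then have "k = 54 \<or> k = 55 \<or> k = 56 \<or> k = 57 \<or> k = 58 \<or> k = 59 \<or> k = 60 \<or> k = 61 \<or> k = 62 \<or> k = 63"
          by (simp, arith)
        then have "\<bar>t (vn k)\<bar> \<le> G \<or> \<bar>t (vn k)\<bar> \<le> W"
          by (elim disjE) (use sm gpv v W in simp_all)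
        then show "\<bar>t (vn k)\<bar> \<le> W" using W by auto
      qed
      have "bnd Y s" using ok by (simp add: ok_def)
      then have "\<bar>s (vn 55)\<bar> \<le> Y" by (simp add: bnd_def)
      moreover have "\<bar>s (vn 55)\<bar> \<le> Z" using best(2) by (simp add: best_bnd_def)
      ultimately have "best_bnd Y t" "best_bnd Z t" using bb GY by auto
      then show ?thesis using v gd lt True unfolding best_def acc_def by simp
    next
      case False
      have v: "t (vn k) = s (vn k)" if "k \<in> {54..63}" for k
      proof -
        have "t2 (vn k) = s (vn k)" using t2 False that unfolding cand_post_def acc_def[symmetric] by simp
        then show ?thesis using that by (simp add: tk)
      qed
      have gv: "gp t 56 = gp s 56" "gp t 58 = gp s 58" "gp t 60 = gp s 60" "gp t 62 = gp s 62"
        unfolding gp_def by (simp_all add: v)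
      have "bnd Y s" using ok by (simp add: ok_def)
      then have "best_bnd Y t" unfolding best_bnd_def using v by (simp add: bnd_def)
      moreover have "best_bnd Z t" using best(2) v unfolding best_bnd_def by simp
      moreover have "best t" using best(1) v[of 54] unfolding best_def gv by simp
      ultimately show ?thesis using False v[of 54] unfolding acc_def good_def by auto
    qed
    moreover have "bnd Y t"
      unfolding bnd_def
    proof
      fix x
      have Y: "bnd Y s" "0 \<le> Y" using ok by (auto simp: ok_def)
      show "\<bar>t x\<bar> \<le> Y"
      proof (cases "x \<in> vn ` ({54..63} \<union> {100..179})")
        case False
        then show ?thesis using frt Y by (simp add: bnd_def)
      next
        case True
        then obtain k where "x = vn k" "k \<in> {54..63} \<or> k \<in> {100..179}" by auto
        then show ?thesis using calculation tz Y unfolding best_bnd_def by auto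
      qed
    qed
    ultimately have "cands_post Y Z s \<beta> [(i, j)] t"
      unfolding cands_post_def P_def[symmetric] Q_def[symmetric] using frt tz
      by (simp add: P_def Q_def)
    then show "ht ((Y ^ growth (cand_init i j)) ^ growth cand_test) (zero_range 100 180) t2 (cands_post Y Z s \<beta> [(i, j)])"
      by (intro ht_loop_free[OF _ ok2]) (simp_all add: loop_free_zero_range t_def)
  qed
qed

lemma cands_prog_ht:
  assumes "ok (cands_prog ijs) Y s" "G \<le> Y" "G \<le> Z" "base s" "den_ok s \<beta>" "best s" "best_bnd Z s"
    and "\<forall>(i, j)\<in>set ijs. \<bar>i\<bar> \<le> 10 \<and> \<bar>j\<bar> \<le> 10"
  shows "ht Y (cands_prog ijs) s (cands_post Y Z s \<beta> ijs)"
  using assms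
proof (induction ijs arbitrary: s)
  case Nil
  have "cands_post Y Z s \<beta> [] s" unfolding cands_post_def using Nil by (auto simp: ok_def)
  then show ?case using Nil unfolding cands_prog_def by (intro ht_loop_free) auto
next
  case (Cons ij ijs)
  obtain i j where ij: "ij = (i, j)" by (cases ij)
  have eq: "cands_prog (ij # ijs) = Seq (cand_prog i j) (cands_prog ijs)" by (simp add: cands_prog_def ij)
  show ?case
    unfolding eq
  proof (rule ht_Seq_reset[OF Cons.prems(1)[unfolded eq]])
    show "ht Y (cand_prog i j) s (cands_post Y Z s \<beta> [(i, j)])" if "ok (cand_prog i j) Y s"
      by (rule cand_prog_ht[OF that]) (use Cons.prems ij in auto)
    fix t assume t: "cands_post Y Z s \<beta> [(i, j)] t"
    then show "bnd Y t" unfolding cands_post_def by blast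
    assume okt: "ok (cands_prog ijs) Y t"
    have frt: "t x = s x" if "x \<notin> vn ` ({54..63} \<union> {100..179})" for x
      using t that unfolding cands_post_def by blast
    have frk: "t (vn k) = s (vn k)" if "k < 54 \<or> (64 \<le> k \<and> k < 100)" for k
      by (rule frt) (use that in auto)
    have frg: "gp t k = gp s k" if "k < 53 \<or> (64 \<le> k \<and> k < 99)" for k
      unfolding gp_def using frk[of k] frk[of "Suc k"] that by auto
    have base: "base t" using Cons.prems(4) frk unfolding base_def by auto
    have den: "den_ok t \<beta>" using Cons.prems(5) frg unfolding den_ok_def by simp
    have cnd: "candP t i j = candP s i j" "candQ t i j = candQ s i j" for i j
      unfolding candP_def candQ_def by (simp_all add: frg frk)
    have "ht Y (cands_prog ijs) t (cands_post Y Z t \<beta> ijs)"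
      by (rule Cons.IH[OF okt Cons.prems(2,3) base den]) (use t Cons.prems in \<open>auto simp: cands_post_def\<close>)
    then show "ht Y (cands_prog ijs) t (cands_post Y Z s \<beta> (ij # ijs))"
    proof (rule ht_conseq)
      fix u assume u: "cands_post Y Z t \<beta> ijs u"
      have "u x = s x" if "x \<notin> vn ` ({54..63} \<union> {100..179})" for x
        using u frt that unfolding cands_post_def by metis
      moreover have "u (vn k) = 0 \<or> u (vn k) = s (vn k)" if "k \<in> {100..179}" for k
        using u t that unfolding cands_post_def by metis
      moreover have "u (vn 54) \<le> t (vn 54)" "t (vn 54) \<le> s (vn 54)" "bnd Y u" "best_bnd Z u" "best u"
        using u t unfolding cands_post_def by blast+
      moreover have "u (vn 54) \<le> nrm (candP s i' j') (candQ s i' j')"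
        if "(i', j') \<in> set ijs" "good (candP s i' j') (candQ s i' j') \<beta>" for i' j'
        using u that unfolding cands_post_def cnd by blast
      moreover have "t (vn 54) \<le> nrm (candP s i j) (candQ s i j)" if "good (candP s i j) (candQ s i j) \<beta>"
        using t that unfolding cands_post_def by auto
      ultimately show "cands_post Y Z s \<beta> (ij # ijs) u"
        unfolding cands_post_def ij by fastforce
    qed
  qed
qed


lemma den_lift_sem:
  assumes base: "base s" and \<beta>: "gp s 70 = \<beta>" "\<beta> \<in> set bs" and r: "s (vn 72) = fst \<beta> - snd \<beta> * s0 (vn 41)"
    and dvd: "s0 (vn 40) dvd s (vn 72)"
  defines "t \<equiv> sem inp den_lift s"
  shows "den_ok t \<beta>"
    and "x \<notin> vn ` {70..99} \<Longrightarrow> t x = s x"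
    and "good P Q \<beta> \<Longrightarrow> nrm P Q < s0 (vn 52) \<Longrightarrow> \<exists>(i, j)\<in>set offsets. P = candP t i j \<and> Q = candQ t i j"
proof -
  define \<alpha> h where ah: "\<alpha> = s0 (vn 40)" "h = s0 (vn 41)"
  define u v where uv: "u = fst \<beta>" "v = snd \<beta>"
  have \<beta>uv: "\<beta> = (u, v)" unfolding uv by simp
  define a0 where "a0 = qsc ((u - v * h) div \<alpha>) (gp s0 44) + qsc v (gp s0 42)"
  define P0 where "P0 = qdiv (qmul \<Delta> (qconj \<Delta> (gp s0 16)) (qmul \<Delta> a0 (gp s0 8) + qmul \<Delta> \<beta> (gp s0 12))) (s0 (vn 53))"
  define Q0 where "Q0 = qdiv (qmul \<Delta> (qconj \<Delta> (gp s0 16)) (qmul \<Delta> a0 (gp s0 10) + qmul \<Delta> \<beta> (gp s0 14))) (s0 (vn 53))"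
  define UV where "UV = qmul \<Delta> (qconj \<Delta> (err P0 Q0)) (gp s0 18)"
  define n where "n = s0 (vn 52)"
  define k0 where "k0 = (h * snd UV - fst UV) div n"
  define l0 where "l0 = (- (\<alpha> * snd UV)) div n"
  have sv: "s (vn k) = s0 (vn k)" if "k < 54" for k using base that unfolding base_def by simp
  have Ds: "s (vn 0) = \<Delta>" "s (vn 1) = tau_norm \<Delta>" using sv D0 N00 by auto
  have s4: "s (vn 4) = s0 (vn 4)" "s (vn 40) = s0 (vn 40)" "s (vn 41) = s0 (vn 41)" "s (vn 52) = s0 (vn 52)" "s (vn 53) = s0 (vn 53)"
    using sv by auto
  have s71: "s (vn 71) = v" using \<beta>(1) unfolding uv gp_def by auto
  have snd_upd: "upd2 82 y f (vn 83) = snd y" "upd2 82 y f (vn 82) = fst y" for y f by (simp_all add: upd2_def)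
  have t: "t = (upd2 82 UV (upd2 80 (err P0 Q0) (upd2 78 Q0 (upd2 76 P0 (upd2 74 a0 s)))))(vn 84 := k0, vn 85 := l0)"
    unfolding t_def den_lift_def
    using Ds s4
    by (simp add: base_gp[OF base] \<beta> r s71 snd_upd
        a0_def P0_def Q0_def UV_def k0_def l0_def n_def ah uv perr_def del: qmul.simps qconj.simps qdiv.simps qnorm.simps)
  have tv: "gp t 70 = \<beta>" "gp t 76 = P0" "gp t 78 = Q0" "t (vn 84) = k0" "t (vn 85) = l0"
    unfolding t using \<beta> by simp_all
  show fr: "t x = s x" if "x \<notin> vn ` {70..99}" for x
  proof -
    have "x \<noteq> vn i" if "i \<in> {70..99}" for i using that \<open>x \<notin> vn ` {70..99}\<close> by auto
    then show ?thesis unfolding t by (simp add: upd2_def)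
  qed
  let ?b = "elt \<Delta> (gp s0 16)" let ?p' = "elt \<Delta> (gp s0 12)" and ?q' = "elt \<Delta> (gp s0 14)"
  have "\<alpha> dvd u - v * h" using dvd r unfolding ah uv by simp
  then have "lift pp qq ?p' ?q' ?b (elt \<Delta> \<beta>) (elt \<Delta> a0)"
    unfolding \<beta>uv a0_def using lift_ideal_element[OF data, of u v] unfolding ah by blast
  then obtain x y where xy: "x \<in> \<O>" "y \<in> \<O>" "elt \<Delta> a0 * pp + elt \<Delta> \<beta> * ?p' = ?b * x"
    "elt \<Delta> a0 * qq + elt \<Delta> \<beta> * ?q' = ?b * y" unfolding lift_def by blast
  have m: "of_int (s0 (vn 53)) = ?b * cnj ?b" unfolding norms elt_norm ..
  have m0: "s0 (vn 53) \<noteq> 0" using qnorm_pos[OF b_nz] norms by simp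
  have P0: "elt \<Delta> P0 = x"
    unfolding P0_def
    by (rule elt_qdiv[OF _ xy(1) m0]) (simp only: elt_mul elt_add elt_conj xy(3) m mult_ac)
  have Q0: "elt \<Delta> Q0 = y"
    unfolding Q0_def
    by (rule elt_qdiv[OF _ xy(2) m0]) (simp only: elt_mul elt_add elt_conj xy(4) m mult_ac)
  have det0: "pp * elt \<Delta> Q0 - qq * elt \<Delta> P0 = \<sigma> * elt \<Delta> \<beta>"
  proof -
    have "?b * (pp * y - qq * x) = pp * (elt \<Delta> a0 * qq + elt \<Delta> \<beta> * ?q') - qq * (elt \<Delta> a0 * pp + elt \<Delta> \<beta> * ?p')"
      unfolding xy by (simp add: algebra_simps)
    also have "\<dots> = elt \<Delta> \<beta> * (pp * ?q' - qq * ?p')" by (simp add: algebra_simps)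
    also have "\<dots> = ?b * (\<sigma> * elt \<Delta> \<beta>)" unfolding det by (simp add: algebra_simps)
    finally show ?thesis unfolding P0 Q0 using b_nz by simp
  qed
  show "den_ok t \<beta>" unfolding den_ok_def tv using \<beta> det0 by simp
  assume gd: "good P Q \<beta>" and lt: "nrm P Q < s0 (vn 52)"
  have errc: "elt \<Delta> (err P Q) = elt \<Delta> Q * elt \<Delta> (gp s0 2) - elt \<Delta> P * of_int (s0 (vn 4))" for P Q
    unfolding perr_def elt_diff elt_mul elt_sc by (simp add: mult.commute)
  have "cmod (elt \<Delta> (err P Q)) ^ 2 < cmod (elt \<Delta> (gp s0 18)) ^ 2"
    unfolding cmod_elt_sq using lt norms by simp
  then have less: "cmod (elt \<Delta> Q * elt \<Delta> (gp s0 2) - elt \<Delta> P * of_int (s0 (vn 4))) < cmod (elt \<Delta> (gp s0 18))"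
    unfolding errc using power_less_imp_less_base norm_ge_zero by blast
  have dd: "pp * elt \<Delta> Q - qq * elt \<Delta> P = pp * elt \<Delta> Q0 - qq * elt \<Delta> P0"
    using gd det0 unfolding good_def by simp
  have UV': "(fst UV, snd UV) = qmul \<Delta> (qconj \<Delta> (err P0 Q0)) (gp s0 18)" unfolding UV_def by simp
  have n': "n = qnorm \<Delta> (gp s0 18)" unfolding n_def norms ..
  have e1: "qq * elt \<Delta> (gp s0 2) - pp * of_int (s0 (vn 4)) = elt \<Delta> (gp s0 18)" unfolding err0 errc ..
  obtain k l where kl: "k \<in> {k0 - 1..k0 + 2}" "l \<in> {l0 - 1..l0 + 2}"
    "elt \<Delta> P = elt \<Delta> P0 + of_int k * pp + of_int l * (omega \<alpha> h * pp)"
    "elt \<Delta> Q = elt \<Delta> Q0 + of_int k * qq + of_int l * (omega \<alpha> h * qq)"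
    using reduced_enumeration[OF data ring_elt ring_elt ring_elt ring_elt dd e1 err_nz errc[symmetric] less UV' n']
    unfolding k0_def l0_def ah by metis
  have "elt \<Delta> P = elt \<Delta> (candP t (k - k0) (l - l0))" "elt \<Delta> Q = elt \<Delta> (candQ t (k - k0) (l - l0))"
    unfolding candP_def candQ_def tv elt_add elt_sc F2 kl(3,4) ah by (simp_all add: algebra_simps)
  then have "P = candP t (k - k0) (l - l0)" "Q = candQ t (k - k0) (l - l0)" unfolding elt_inj .
  moreover have "(k - k0, l - l0) \<in> set offsets"
  proof -
    have "k - k0 \<in> {-1, 0, 1, 2}" "l - l0 \<in> {-1, 0, 1, 2}" using kl(1,2) by auto
    then show ?thesis unfolding offsets_def by auto
  qed
  ultimately show "\<exists>(i, j)\<in>set offsets. P = candP t i j \<and> Q = candQ t i j" by blast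
qed

definition den_inv :: "int \<Rightarrow> nat \<Rightarrow> store \<Rightarrow> bool" where
  "den_inv Y i s \<longleftrightarrow> base s \<and> best s \<and> bnd Y s \<and> s (vn 64) = int i \<and>
     (\<forall>k<i. \<forall>P Q. good P Q (bs ! k) \<longrightarrow> s (vn 54) \<le> nrm P Q)"

lemma good_mem_ideal:
  assumes "good P Q \<beta>"
  shows "s0 (vn 40) dvd fst \<beta> - snd \<beta> * s0 (vn 41)"
proof -
  have s: "\<sigma> * elt \<Delta> \<beta> = pp * elt \<Delta> Q - qq * elt \<Delta> P" using assms unfolding good_def by simp
  have "elt \<Delta> \<beta> = \<sigma> * (\<sigma> * elt \<Delta> \<beta>)" using sgn by auto
  also have "\<dots> = (\<sigma> * elt \<Delta> Q) * pp + (- \<sigma> * elt \<Delta> P) * qq" unfolding s by (simp add: algebra_simps)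
  also have "\<dots> \<in> gen2 pp qq"
    using sgn by (intro gen2I[OF _ _ refl] ring_mult ring_uminus ring_elt) auto
  also have "gen2 pp qq = std (s0 (vn 40)) (s0 (vn 41))" using data unfolding ideal_data_def by blast
  finally have "elt \<Delta> (fst \<beta>, snd \<beta>) \<in> std (s0 (vn 40)) (s0 (vn 41))" by simp
  then show ?thesis unfolding std_mem .
qed

lemma den_body_ht:
  assumes ok: "ok den_body Y s" and GY: "G \<le> Y" and inv: "den_inv Y i s" and i: "i < length bs"
  shows "ht Y den_body s (den_inv Y (Suc i))"
  unfolding den_body_def
proof (rule ht_Seq[OF ok[unfolded den_body_def]])
  define \<beta> where "\<beta> = bs ! i"
  have \<beta>: "\<beta> \<in> set bs" unfolding \<beta>_def using i by simp
  have base: "base s" and best: "best s" and bnd: "bnd Y s" and s64: "s (vn 64) = int i"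
    using inv unfolding den_inv_def by auto
  let ?c1 = "IfLe (mod_expr (V 72) (V 40)) (Const 0) (Seq den_lift (cands_prog offsets)) Skip"
  let ?c2 = "Seq (zero_range 70 100) (asg 64 (Add (V 64) (Const 1)))"
  define s1 where "s1 = sem inp den_read s"
  have s41: "s (vn 41) = s0 (vn 41)" using base unfolding base_def by simp
  have s1: "s1 = (upd2 70 \<beta> s)(vn 72 := fst \<beta> - snd \<beta> * s0 (vn 41))"
  proof -
    have "peval inp s (Input (Add (Const 6) (Mul (Const 2) (V 64))), Input (Add (Const 7) (Mul (Const 2) (V 64)))) = \<beta>"
      unfolding peval_def \<beta>_def using inp_bs[OF i] s64 by (simp add: mult.commute)
    moreover have "upd2 70 \<beta> s (vn 70) = fst \<beta>" "upd2 70 \<beta> s (vn 71) = snd \<beta>" by (simp_all add: upd2_def)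
    ultimately show ?thesis unfolding s1_def den_read_def by (simp add: pvars_def s41)
  qed
  show "ht Y den_read s (\<lambda>t. t = s1)" if "ok den_read Y s"
    by (rule ht_loop_free[OF _ that]) (simp_all add: den_read_def s1_def psmall_def)
  have fr1: "s1 x = s x" if "x \<notin> vn ` {70..99}" for x
  proof -
    have "x \<noteq> vn i" if "i \<in> {70..99}" for i using that \<open>x \<notin> vn ` {70..99}\<close> by auto
    then show ?thesis unfolding s1 by (simp add: upd2_def)
  qed
  have fr1k: "s1 (vn k) = s (vn k)" if "k < 70" for k by (rule fr1) (use that in auto)
  have base1: "base s1" using base fr1k unfolding base_def by simp
  have v1: "gp s1 70 = \<beta>" "s1 (vn 72) = fst \<beta> - snd \<beta> * s0 (vn 41)" unfolding s1 by simp_all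
  have best1: "best s1" using best unfolding best_def gp_def by (simp add: fr1k)
  have bb1: "best_bnd Y s1" using bnd unfolding best_bnd_def bnd_def by (simp add: fr1k)
  let ?R = "\<lambda>t. (\<forall>x. x \<notin> vn ` ({54..63} \<union> {70..179}) \<longrightarrow> t x = s x) \<and>
      (\<forall>k\<in>{100..179}. t (vn k) = 0 \<or> t (vn k) = s (vn k)) \<and>
      best_bnd Y t \<and> best t \<and> t (vn 54) \<le> s (vn 54) \<and> (\<forall>P Q. good P Q \<beta> \<longrightarrow> t (vn 54) \<le> nrm P Q)"
  fix t1 assume t1: "t1 = s1" and ok1: "ok (Seq ?c1 ?c2) (Y ^ growth den_read) t1"
  show "ht (Y ^ growth den_read) (Seq ?c1 ?c2) t1 (den_inv Y (Suc i))"
  proof (rule ht_Seq[OF ok1])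
    have \<alpha>: "s0 (vn 40) > 0" using data unfolding ideal_data_def by blast
    have ev: "eval_expr inp t1 (mod_expr (V 72) (V 40)) = (fst \<beta> - snd \<beta> * s0 (vn 41)) mod s0 (vn 40)"
      using base1 v1 unfolding t1 base_def by simp
    show "ht (Y ^ growth den_read) ?c1 t1 ?R" if okc: "ok ?c1 (Y ^ growth den_read) t1"
    proof (rule ht_IfLe[OF okc])
      assume "\<not> eval_expr inp t1 (mod_expr (V 72) (V 40)) \<le> eval_expr inp t1 (Const 0)" and okS: "ok Skip (Y ^ growth den_read) t1"
      then have "\<not> s0 (vn 40) dvd fst \<beta> - snd \<beta> * s0 (vn 41)" unfolding ev by auto
      then have "\<not> good P Q \<beta>" for P Q using good_mem_ideal by blast
      moreover have "s1 x = s x" if "x \<notin> vn ` ({54..63} \<union> {70..179})" for x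
        by (rule fr1) (use that in auto)
      moreover have "s1 (vn k) = s (vn k)" if "k \<in> {100..179}" for k by (rule fr1) (use that in auto)
      ultimately have "?R t1" unfolding t1 using best1 bb1 fr1k[of 54] by simp
      then show "ht (Y ^ growth den_read) Skip t1 ?R" using okS by (intro ht_loop_free) auto
    next
      assume "eval_expr inp t1 (mod_expr (V 72) (V 40)) \<le> eval_expr inp t1 (Const 0)"
        and ok2: "ok (Seq den_lift (cands_prog offsets)) (Y ^ growth den_read) t1"
      then have "(fst \<beta> - snd \<beta> * s0 (vn 41)) mod s0 (vn 40) \<le> 0" unfolding ev by simp
      moreover have "0 \<le> (fst \<beta> - snd \<beta> * s0 (vn 41)) mod s0 (vn 40)" using \<alpha> by (rule pos_mod_sign)
      ultimately have "(fst \<beta> - snd \<beta> * s0 (vn 41)) mod s0 (vn 40) = 0" by (rule antisym)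
      then have dvd: "s0 (vn 40) dvd s1 (vn 72)" unfolding v1 by (rule mod_0_imp_dvd)
      note lft = den_lift_sem[OF base1 v1(1) \<beta> v1(2) dvd]
      let ?Y1 = "Y ^ growth den_read"
      show "ht ?Y1 (Seq den_lift (cands_prog offsets)) t1 ?R"
      proof (rule ht_Seq[OF ok2])
        define s2 where "s2 = sem inp den_lift s1"
        note lf2 = lft[folded s2_def]
        show "ht ?Y1 den_lift t1 (\<lambda>t. t = s2)" if "ok den_lift ?Y1 t1"
          by (rule ht_loop_free[OF _ that]) (simp_all add: den_lift_def s2_def t1)
        fix t2 assume t2: "t2 = s2" and ok3: "ok (cands_prog offsets) (?Y1 ^ growth den_lift) t2"
        have fr2: "s2 (vn k) = s (vn k)" if "k < 70 \<or> k \<ge> 100" for k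
        proof -
          have "s2 (vn k) = s1 (vn k)" by (rule lf2(2)) (use that in auto)
          also have "\<dots> = s (vn k)" by (rule fr1) (use that in auto)
          finally show ?thesis .
        qed
        have Y10: "10 \<le> Y" using ok unfolding ok_def by simp
        have "Y \<le> ?Y1" using Y10 growth_pos by (intro pow_ge_self) auto
        moreover have "?Y1 \<le> ?Y1 ^ growth den_lift" using \<open>Y \<le> ?Y1\<close> Y10 growth_pos[of den_lift] by (intro pow_ge_self) auto
        ultimately have GY2: "G \<le> ?Y1 ^ growth den_lift" using GY by linarith
        have base2: "base s2" using base fr2 unfolding base_def by simp
        have best2: "best s2" using best unfolding best_def gp_def by (simp add: fr2)
        have bb2: "best_bnd Y s2" using bnd unfolding best_bnd_def bnd_def by (simp add: fr2)
        have "ht (?Y1 ^ growth den_lift) (cands_prog offsets) s2 (cands_post (?Y1 ^ growth den_lift) Y s2 \<beta> offsets)"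
          by (rule cands_prog_ht[OF ok3[unfolded t2] GY2 GY base2 lf2(1) best2 bb2]) (auto simp: offsets_def)
        then show "ht (?Y1 ^ growth den_lift) (cands_prog offsets) t2 ?R"
          unfolding t2
        proof (rule ht_conseq)
          fix t assume t: "cands_post (?Y1 ^ growth den_lift) Y s2 \<beta> offsets t"
          have f: "t x = s x" if "x \<notin> vn ` ({54..63} \<union> {70..179})" for x
          proof -
            have "x \<notin> vn ` ({54..63} \<union> {100..179})" using that by auto
            then have "t x = s2 x" using t unfolding cands_post_def by blast
            also have "\<dots> = s1 x" by (rule lf2(2)) (use that in auto)
            also have "\<dots> = s x" by (rule fr1) (use that in auto)
            finally show ?thesis .
          qed
          have z: "t (vn k) = 0 \<or> t (vn k) = s (vn k)" if "k \<in> {100..179}" for k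
            using t that fr2[of k] unfolding cands_post_def by auto
          have le: "t (vn 54) \<le> s (vn 54)" "best_bnd Y t" "best t"
            using t fr2[of 54] unfolding cands_post_def by auto
          have cov: "t (vn 54) \<le> nrm P Q" if gd: "good P Q \<beta>" for P Q
          proof (cases "nrm P Q < s0 (vn 52)")
            case True
            from lf2(3)[OF gd True] obtain i' j' where ij: "(i', j') \<in> set offsets" "P = candP s2 i' j'" "Q = candQ s2 i' j'"
              by blast
            then show ?thesis using t gd unfolding cands_post_def by blast
          next
            case False
            then show ?thesis using le(3) unfolding best_def by linarith
          qed
          show "?R t" using f z le cov by blast
        qed
      qed
    qed simp_all
    fix t2 assume t2: "?R t2" and ok2: "ok ?c2 ((Y ^ growth den_read) ^ growth ?c1) t2"
    define t where "t = sem inp ?c2 t2"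
    have f2: "t2 x = s x" if "x \<notin> vn ` ({54..63} \<union> {70..179})" for x using t2 that by blast
    have t64: "t (vn 64) = int (Suc i)"
      using f2[of "vn 64"] s64 unfolding t_def by (simp add: sem_zero_range)
    have tx: "t x = (if x \<in> vn ` {70..<100} then 0 else t2 x)" if "x \<noteq> vn 64" for x
      unfolding t_def using that by (simp add: sem_zero_range)
    have tk: "t (vn k) = t2 (vn k)" if "k < 64" for k using tx[of "vn k"] that by simp
    have "base t" using base f2 tk unfolding base_def by auto
    moreover have "best t" using t2 unfolding best_def gp_def by (simp add: tk)
    moreover have "bnd Y t"
      unfolding bnd_def
    proof
      fix x
      have Y: "10 \<le> Y" using ok by (simp add: ok_def)
      consider "x = vn 64" | "x \<noteq> vn 64" "x \<in> vn ` {70..<100}" | "x \<in> vn ` {54..63}" | "x \<in> vn ` {100..179}"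
        | "x \<noteq> vn 64" "x \<notin> vn ` ({54..63} \<union> {70..179})" by fastforce
      then show "\<bar>t x\<bar> \<le> Y"
      proof cases
        case 1
        have "\<bar>s (vn 6)\<bar> \<le> Y" using bnd by (simp add: bnd_def)
        moreover have "s (vn 6) = int (length bs)" using base nb unfolding base_def by simp
        ultimately show ?thesis using 1 t64 i by simp
      next
        case 2 then show ?thesis using tx[of x] Y by simp
      next
        case 3
        then obtain k where "x = vn k" "k \<in> {54..63}" by auto
        then show ?thesis using t2 tk[of k] unfolding best_bnd_def by auto
      next
        case 4
        then obtain k where k: "x = vn k" "k \<in> {100..179}" by auto
        then have "t x = t2 x" using tx[of x] by auto
        moreover have "t2 (vn k) = 0 \<or> t2 (vn k) = s (vn k)" using t2 k by blast
        ultimately show ?thesis using bnd Y k unfolding bnd_def by auto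
      next
        case 5
        then have "t x = 0 \<or> t x = t2 x" using tx[of x] by auto
        then show ?thesis using f2[OF 5(2)] bnd Y unfolding bnd_def by auto
      qed
    qed
    moreover have "t (vn 54) \<le> nrm P Q" if "k < Suc i" "good P Q (bs ! k)" for k P Q
    proof (cases "k = i")
      case True
      then have "good P Q \<beta>" using that(2) unfolding \<beta>_def by simp
      then have "t2 (vn 54) \<le> nrm P Q" using t2 by blast
      then show ?thesis using tk[of 54] by simp
    next
      case False
      then have "k < i" using that(1) by simp
      then have "s (vn 54) \<le> nrm P Q" using inv that(2) unfolding den_inv_def by blast
      moreover have "t2 (vn 54) \<le> s (vn 54)" using t2 by blast
      ultimately show ?thesis using tk[of 54] by simp
    qed
    ultimately have "den_inv Y (Suc i) t" unfolding den_inv_def using t64 by blast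
    then show "ht ((Y ^ growth den_read) ^ growth ?c1) ?c2 t2 (den_inv Y (Suc i))"
      by (intro ht_loop_free[OF _ ok2]) (simp_all add: loop_free_zero_range t_def)
  qed
qed

lemma den_loop_exec:
  assumes "10 \<le> Y" "input_bnd inp Y" "fits L (Y ^ growth den_loop)" "G \<le> Y" "den_inv Y i s" "i \<le> length bs"
  shows "\<exists>k t. exec L inp den_loop s k [] t \<and> k \<le> (length bs - i + 1) * (F * pass_cost den_loop) \<and>
    den_inv Y (length bs) t"
  using assms(5,6)
proof (induction "length bs - i" arbitrary: i s)
  case 0
  have b: "bnd Y s" "s (vn 64) = int i" "s (vn 6) = int (length bs)"
    using 0 nb unfolding den_inv_def base_def by auto
  have w: "within_length L inp s (Add (V 64) (Const 1))" "within_length L inp s (V 6)"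
    by (rule ok_within[OF assms(1,2) b(1) assms(3)]; use growth_pos[of den_body] in \<open>simp add: den_loop_def\<close>)+
  have "exec L inp den_loop s 5 [] s"
    unfolding den_loop_def using exec.WhileFalse[OF w, of den_body] b 0 by (simp add: numeral_eq_Suc)
  moreover have "5 \<le> F * pass_cost den_loop"
  proof -
    have "1 * 5 \<le> F * pass_cost den_loop" by (rule mult_le_mono) (use F in \<open>auto simp: den_loop_def\<close>)
    then show ?thesis by simp
  qed
  moreover have "i = length bs" using 0 by simp
  ultimately show ?case using 0 by (intro exI[of _ 5] exI[of _ s]) auto
next
  case (Suc n)
  have i: "i < length bs" using Suc by simp
  have b: "bnd Y s" "s (vn 64) = int i" "s (vn 6) = int (length bs)"
    using Suc nb unfolding den_inv_def base_def by auto
  have w: "within_length L inp s (Add (V 64) (Const 1))" "within_length L inp s (V 6)"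
    by (rule ok_within[OF assms(1,2) b(1) assms(3)]; use growth_pos[of den_body] in \<open>simp add: den_loop_def\<close>)+
  have "growth den_body \<le> growth den_loop" by (simp add: den_loop_def)
  then have "fits L (Y ^ growth den_body)"
    using assms(1) by (intro fits_mono[OF assms(3)] power_increasing) auto
  then have "ok den_body Y s" unfolding ok_def using assms b by simp
  from den_body_ht[OF this assms(4) Suc.prems(1) i]
  obtain k t where t: "exec L inp den_body s k [] t" "k \<le> F * pass_cost den_body" "den_inv Y (Suc i) t"
    unfolding ht_def by blast
  obtain k' u where u: "exec L inp den_loop t k' [] u" "k' \<le> (length bs - Suc i + 1) * (F * pass_cost den_loop)" "den_inv Y (length bs) u"
  proof -
    have "n = length bs - Suc i" "Suc i \<le> length bs" using Suc.hyps(2) i by auto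
    from Suc.hyps(1)[OF this(1) t(3) this(2)] show ?thesis using that by blast
  qed
  have "exec L inp den_loop s (5 + k + k') [] u"
    using exec.WhileTrue[OF w _ t(1) u(1)[unfolded den_loop_def]] b i unfolding den_loop_def by (simp add: numeral_eq_Suc)
  moreover have "5 + k \<le> F * pass_cost den_loop"
  proof -
    have "5 \<le> F * 5" using F by simp
    then have "5 + k \<le> F * 5 + F * pass_cost den_body" using t(2) by linarith
    also have "\<dots> = F * pass_cost den_loop" by (simp add: den_loop_def distrib_left)
    finally show ?thesis .
  qed
  moreover have "length bs - i + 1 = Suc (length bs - Suc i + 1)" using i by simp
  ultimately show ?case using u by (intro exI[of _ "5 + k + k'"] exI[of _ u]) auto
qed

end

section \<open>The whole algorithm\<close>

definition step_copy :: prog where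
  "step_copy = seqs [asgp 120 (pv 8), asgp 122 (pv 10), asgp 124 (pv 12), asgp 126 (pv 14), asgp 128 (pv 16)]"

definition step_init :: prog where
  "step_init = seqs [asg 40 (V 136), asg 41 (V 132), asgp 42 (pv 134), asgp 44 (pv 138),
     asgp 46 (pdiv (pmul (pconj (V 132, Const 1)) (pv 8)) (V 136)),
     asgp 48 (pdiv (pmul (pconj (V 132, Const 1)) (pv 10)) (V 136)),
     asg 52 (pnorm (pv 18)), asg 53 (pnorm (pv 16)), asg 54 (V 52), asg 64 (Const 0)]"

definition step_pre :: prog where
  "step_pre = Seq step_copy (Seq check_prog step_init)"

definition step_post :: prog where
  "step_post = Seq (seqs [asgp 12 (pv 8), asgp 14 (pv 10), asgp 8 (pv 56), asgp 10 (pv 58), asgp 16 (pv 60), asgp 18 (pv 62)])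
     (zero_range 40 180)"

definition step_out :: prog where
  "step_out = Seq (Output (V 8)) (Seq (Output (V 9)) (Seq (Output (V 10)) (Output (V 11))))"

definition step_prog :: prog where
  "step_prog = Seq step_pre (Seq den_loop (Seq step_post step_out))"

definition main_loop :: prog where
  "main_loop = WhileLe (Add (Mul (V 4) (V 4)) (Const 1)) (Mul (Mul (V 5) (V 5)) (pnorm (pv 18))) step_prog"

definition main_init :: prog where
  "main_init = seqs [asg 0 (Input (Const 0)), asg 1 (Div (Sub (Mul (V 0) (V 0)) (V 0)) (Const 4)),
     asgp 2 (Sub (Input (Const 1)) (Mul (Input (Const 2)) (V 0)), Mul (Const 2) (Input (Const 2))),
     asg 4 (Input (Const 3)), asg 5 (Input (Const 4)), asg 6 (Input (Const 5)),
     asg 8 (Const 1), asg 14 (Const 1), asg 16 (Const 1), asg 18 (Sub (Const 0) (V 4))]"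

definition cf_prog :: prog where
  "cf_prog = Seq main_init main_loop"

lemma flatten_append: "flatten (xs @ ys) = flatten xs @ flatten ys"
  by (simp add: flatten_def)

lemma length_flatten: "length (flatten xs) = 2 * length xs"
  by (induction xs) (auto simp: flatten_def)

lemma nth_flatten: "i < length xs \<Longrightarrow> flatten xs ! (2 * i) = fst (xs ! i) \<and> flatten xs ! (2 * i + 1) = snd (xs ! i)"
proof (induction xs arbitrary: i)
  case (Cons x xs)
  have "flatten (x # xs) = [fst x, snd x] @ flatten xs" by (cases x) (simp add: flatten_def)
  then show ?case using Cons by (cases i) auto
qed simp

lemma read_cf_input:
  "read_input (cf_input \<Delta> bs x y w \<delta>) 0 = \<Delta>" "read_input (cf_input \<Delta> bs x y w \<delta>) 1 = x"
  "read_input (cf_input \<Delta> bs x y w \<delta>) 2 = y" "read_input (cf_input \<Delta> bs x y w \<delta>) 3 = w"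
  "read_input (cf_input \<Delta> bs x y w \<delta>) 4 = \<lceil>\<delta>\<rceil>" "read_input (cf_input \<Delta> bs x y w \<delta>) 5 = int (length bs)"
  "i < length bs \<Longrightarrow> read_input (cf_input \<Delta> bs x y w \<delta>) (6 + 2 * int i) = fst (bs ! i)"
  "i < length bs \<Longrightarrow> read_input (cf_input \<Delta> bs x y w \<delta>) (7 + 2 * int i) = snd (bs ! i)"
proof -
  show "i < length bs \<Longrightarrow> read_input (cf_input \<Delta> bs x y w \<delta>) (6 + 2 * int i) = fst (bs ! i)"
    "i < length bs \<Longrightarrow> read_input (cf_input \<Delta> bs x y w \<delta>) (7 + 2 * int i) = snd (bs ! i)"
    using nth_flatten[of i bs]
    by (auto simp: read_input_def cf_input_def length_flatten nat_add_distrib nat_mult_distrib nth_append)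
qed (simp_all add: read_input_def cf_input_def)

lemma norm_sign_le:
  assumes "e * Q = e' * q - s * \<beta>" "s = 1 \<or> s = (-1 :: complex)"
  shows "cmod e * cmod Q \<le> cmod e' * cmod q + cmod \<beta>"
proof -
  have "cmod e * cmod Q = cmod (e' * q - s * \<beta>)" by (simp only: assms(1)[symmetric] norm_mult)
  also have "\<dots> \<le> cmod (e' * q) + cmod (s * \<beta>)" by (rule norm_triangle_ineq4)
  also have "\<dots> = cmod e' * cmod q + cmod \<beta>" using assms(2) by (auto simp: norm_mult)
  finally show ?thesis .
qed

locale cf_global = cf_machine L inp F J \<Delta> for L inp F J \<Delta> +
  fixes B :: "complex set" and \<epsilon> :: real and bs :: "(int \<times> int) list" and z :: complex and x y w :: int
    and \<delta> :: real and \<mu> M :: real and X :: int and K :: nat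
  assumes inp: "inp = cf_input \<Delta> bs x y w \<delta>"
    and adm: "admissible \<Delta> B \<epsilon>" and B: "elt \<Delta> ` set bs = B"
    and w: "w \<noteq> 0" and z: "z = (of_int x + of_int y * csqrt (of_int \<Delta>)) / of_int w" and \<delta>: "2 \<le> \<delta>"
    and J: "\<And>\<beta>. \<beta> \<in> set bs \<Longrightarrow> qnorm \<Delta> \<beta> < 2 ^ J" "0 < J"
    and \<mu>: "\<And>\<beta>. \<beta> \<in> set bs \<Longrightarrow> cmod (elt \<Delta> \<beta>) \<le> \<mu>"
    and X: "10 \<le> X" "input_bnd inp X" "\<And>v. cmod (elt \<Delta> v) \<le> M \<Longrightarrow> \<bar>fst v\<bar> \<le> X \<and> \<bar>snd v\<bar> \<le> X" "w * w \<le> X"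
    and M: "(\<mu> + \<mu> / (1 - \<epsilon>)) * of_int \<lceil>\<delta>\<rceil> * (1 + cmod z) + 1 \<le> M" "\<mu> \<le> M" "\<bar>of_int w\<bar> \<le> M"
    and fits: "fits L (X ^ growth cf_prog)"
    and K: "\<epsilon> ^ K * of_int \<lceil>\<delta>\<rceil> \<le> 1"
begin

definition G :: int where "G = X ^ growth main_init"

abbreviation "zeta \<equiv> (x - y * \<Delta>, 2 * y)"

lemma eps: "0 < \<epsilon>" "\<epsilon> < 1" using adm by (auto simp: admissible_def)

lemma XG: "X \<le> G" unfolding G_def using X(1) growth_pos by (intro pow_ge_self) auto

lemma elt_zeta: "elt \<Delta> zeta = of_int w * z"
proof -
  have "of_int w * z = of_int x + of_int y * (2 * \<tau> - of_int \<Delta>)" using w unfolding z csqrt_eq by simp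
  then show ?thesis by (simp add: algebra_simps)
qed

lemma elt_perr: "elt \<Delta> (perr \<Delta> zeta w P Q) = of_int w * (elt \<Delta> Q * z - elt \<Delta> P)"
  unfolding perr_def elt_diff elt_mul elt_sc elt_zeta by (simp add: algebra_simps)

lemma qnorm_perr: "of_int (qnorm \<Delta> (perr \<Delta> zeta w P Q)) = (of_int w)\<^sup>2 * (cmod (elt \<Delta> Q * z - elt \<Delta> P))\<^sup>2"
  unfolding cmod_elt_sq[symmetric] elt_perr by (simp add: norm_mult power_mult_distrib)

lemma bs_B: "\<beta> \<in> set bs \<Longrightarrow> elt \<Delta> \<beta> \<in> B" "0 \<notin> B"
  using B adm by (auto simp: admissible_def)

lemma mu_nonneg: "0 \<le> \<mu>"
proof -
  have "B \<noteq> {}" using adm by (simp add: admissible_def)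
  then have "set bs \<noteq> {}" using B by blast
  then obtain \<beta> where "\<beta> \<in> set bs" by (meson all_not_in_conv)
  then show ?thesis using \<mu>[of \<beta>] norm_ge_zero order_trans by blast
qed

lemma norm_less_iff:
  "qnorm \<Delta> (perr \<Delta> zeta w P Q) < qnorm \<Delta> (perr \<Delta> zeta w P' Q') \<longleftrightarrow>
    cmod (elt \<Delta> Q * z - elt \<Delta> P) < cmod (elt \<Delta> Q' * z - elt \<Delta> P')"
proof -
  have "qnorm \<Delta> (perr \<Delta> zeta w P Q) < qnorm \<Delta> (perr \<Delta> zeta w P' Q') \<longleftrightarrow>
      real_of_int (qnorm \<Delta> (perr \<Delta> zeta w P Q)) < real_of_int (qnorm \<Delta> (perr \<Delta> zeta w P' Q'))" by simp
  also have "\<dots> \<longleftrightarrow> (cmod (elt \<Delta> Q * z - elt \<Delta> P))\<^sup>2 < (cmod (elt \<Delta> Q' * z - elt \<Delta> P'))\<^sup>2"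
    unfolding qnorm_perr using w by simp
  also have "\<dots> \<longleftrightarrow> cmod (elt \<Delta> Q * z - elt \<Delta> P) < cmod (elt \<Delta> Q' * z - elt \<Delta> P')"
    by (meson norm_ge_zero power_mono_iff power2_less_imp_less power_strict_mono zero_less_numeral)
  finally show ?thesis .
qed

lemma elt_bound: "cmod (elt \<Delta> v) \<le> M \<Longrightarrow> \<bar>fst v\<bar> \<le> G \<and> \<bar>snd v\<bar> \<le> G"
  using X(3)[of v] XG by linarith

definition inv0 :: "nat \<Rightarrow> store \<Rightarrow> (int \<times> int) list \<Rightarrow> (nat \<Rightarrow> complex) \<Rightarrow> (nat \<Rightarrow> complex) \<Rightarrow> bool" where
  "inv0 N s out a b \<longleftrightarrow> bnd G s \<and> s (vn 0) = \<Delta> \<and> s (vn 1) = tau_norm \<Delta> \<and> gp s 2 = zeta \<and> s (vn 4) = w \<and>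
     s (vn 5) = \<lceil>\<delta>\<rceil> \<and> s (vn 6) = int (length bs) \<and>
     gp s 18 = perr \<Delta> zeta w (gp s 8) (gp s 10) \<and> qnorm \<Delta> (gp s 16) < 2 ^ J \<and>
     cf_state \<Delta> B \<epsilon> z N a b (elt \<Delta> (gp s 8)) (elt \<Delta> (gp s 10)) (elt \<Delta> (gp s 12)) (elt \<Delta> (gp s 14)) \<and>
     b N = elt \<Delta> (gp s 16) \<and>
     map (elt \<Delta>) out = concat (map (\<lambda>n. [cf_p a b n, cf_q a b n]) [1..<Suc N]) \<and>
     reduced_ideal \<Delta> (gen2 (elt \<Delta> (gp s 8)) (elt \<Delta> (gp s 10))) \<and>
     gen2 (elt \<Delta> (gp s 8)) (elt \<Delta> (gp s 10)) \<inter> B \<noteq> {} \<and>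
     cmod (elt \<Delta> (gp s 10) * z - elt \<Delta> (gp s 8)) \<le> \<epsilon> ^ N \<and>
     cmod (elt \<Delta> (gp s 10)) * cmod (elt \<Delta> (gp s 10) * z - elt \<Delta> (gp s 8)) \<le> \<mu> / (1 - \<epsilon>)"

definition guard :: "store \<Rightarrow> bool" where
  "guard s \<longleftrightarrow> s (vn 4) * s (vn 4) + 1 \<le> s (vn 5) * s (vn 5) * qnorm \<Delta> (gp s 18)"

lemma ceil_delta: "2 \<le> \<lceil>\<delta>\<rceil>" "\<delta> \<le> of_int \<lceil>\<delta>\<rceil>"
  using \<delta> by linarith+

lemma guard_iff:
  assumes "inv0 N s out a b"
  shows "guard s \<longleftrightarrow> 1 < of_int \<lceil>\<delta>\<rceil> * cmod (elt \<Delta> (gp s 10) * z - elt \<Delta> (gp s 8))"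
proof -
  let ?e = "cmod (elt \<Delta> (gp s 10) * z - elt \<Delta> (gp s 8))" and ?d = "\<lceil>\<delta>\<rceil>"
  have s: "s (vn 4) = w" "s (vn 5) = ?d" "gp s 18 = perr \<Delta> zeta w (gp s 8) (gp s 10)"
    using assms unfolding inv0_def by auto
  have "guard s \<longleftrightarrow> w * w < ?d * ?d * qnorm \<Delta> (gp s 18)" unfolding guard_def s by linarith
  also have "\<dots> \<longleftrightarrow> real_of_int (w * w) < real_of_int (?d * ?d * qnorm \<Delta> (gp s 18))" by (simp only: of_int_less_iff)
  also have "\<dots> \<longleftrightarrow> (of_int w)\<^sup>2 * 1 < (of_int w)\<^sup>2 * (of_int ?d * ?e)\<^sup>2"
    unfolding s of_int_mult[of "?d * ?d"] qnorm_perr by (simp add: power2_eq_square algebra_simps)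
  also have "\<dots> \<longleftrightarrow> 1 < (of_int ?d * ?e)\<^sup>2"
    using w by (subst mult_less_cancel_left_pos) auto
  also have "\<dots> \<longleftrightarrow> 1 < of_int ?d * ?e"
  proof -
    have "0 \<le> of_int ?d * ?e" using ceil_delta by simp
    then show ?thesis using power_less_imp_less_base[of 1 2 "of_int ?d * ?e"] one_less_power[of "of_int ?d * ?e" 2] by auto
  qed
  finally show ?thesis .
qed

lemma step_pre_ht:
  assumes ok: "ok step_pre G s" and inv: "inv0 N s out a b" and guard: "guard s"
  shows "ht G step_pre s (\<lambda>t. cf_step inp F J \<Delta> bs t ((-1) ^ N) G \<and> (\<forall>k<40. t (vn k) = s (vn k)) \<and>
     t (vn 54) = t (vn 52) \<and> t (vn 64) = 0)" (is "ht G step_pre s ?Q")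
  unfolding step_pre_def
proof (rule ht_Seq[OF ok[unfolded step_pre_def]])
  let ?p = "elt \<Delta> (gp s 8)" and ?q = "elt \<Delta> (gp s 10)" and ?p' = "elt \<Delta> (gp s 12)" and ?q' = "elt \<Delta> (gp s 14)"
  let ?b = "elt \<Delta> (gp s 16)"
  have i: "bnd G s" "s (vn 0) = \<Delta>" "s (vn 1) = tau_norm \<Delta>" "gp s 2 = zeta" "s (vn 4) = w"
     "s (vn 5) = \<lceil>\<delta>\<rceil>" "s (vn 6) = int (length bs)"
     "gp s 18 = perr \<Delta> zeta w (gp s 8) (gp s 10)" "qnorm \<Delta> (gp s 16) < 2 ^ J"
     "cf_state \<Delta> B \<epsilon> z N a b ?p ?q ?p' ?q'" "b N = ?b" "reduced_ideal \<Delta> (gen2 ?p ?q)"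
     "cmod (?q * z - ?p) \<le> \<epsilon> ^ N" "cmod ?q * cmod (?q * z - ?p) \<le> \<mu> / (1 - \<epsilon>)"
    using inv unfolding inv0_def by auto
  have det: "?p * ?q' - ?q * ?p' = (-1) ^ N * ?b" and bnz: "?b \<noteq> 0"
    using cf_state_det[OF i(10) bs_B(2)] i(11) by auto
  have sg: "(-1) ^ N = (1::complex) \<or> (-1) ^ N = (-1::complex)" by (cases "even N") auto
  define s1 where "s1 = sem inp step_copy s"
  show "ht G step_copy s (\<lambda>t. t = s1)" if "ok step_copy G s"
    by (rule ht_loop_free[OF _ that]) (simp_all add: step_copy_def s1_def)
  have v1: "gp s1 120 = gp s 8" "gp s1 122 = gp s 10" "gp s1 124 = gp s 12" "gp s1 126 = gp s 14" "gp s1 128 = gp s 16"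
    unfolding s1_def step_copy_def by simp_all
  have fr1: "s1 (vn k) = s (vn k)" if "k < 120" for k
    unfolding s1_def step_copy_def using that by simp
  have D1: "s1 (vn 0) = \<Delta>" "s1 (vn 1) = tau_norm \<Delta>" using fr1 i by auto
  fix t1 assume t1: "t1 = s1" and ok1: "ok (Seq check_prog step_init) (G ^ growth step_copy) t1"
  show "ht (G ^ growth step_copy) (Seq check_prog step_init) t1 ?Q"
  proof (rule ht_Seq[OF ok1])
    let ?R = "\<lambda>t. (\<forall>x. x \<notin> vn ` {130..179} \<longrightarrow> t x = s1 x) \<and>
      ideal_data ?p ?q ?p' ?q' ?b (t (vn 136)) (t (vn 132)) (t (vn 134), t (vn 135)) (t (vn 138), t (vn 139))"
    show "ht (G ^ growth step_copy) check_prog t1 ?R" if "ok check_prog (G ^ growth step_copy) t1"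
      unfolding t1
      by (rule ht_conseq[OF check_prog_ht[OF that[unfolded t1] D1(2) D1(1) refl refl refl refl refl _ _ sg]])
        (use v1 bnz det i in auto)
    fix t2 assume t2: "?R t2" and ok2: "ok step_init ((G ^ growth step_copy) ^ growth check_prog) t2"
    define \<alpha> h where ah: "\<alpha> = t2 (vn 136)" "h = t2 (vn 132)"
    have dat: "ideal_data ?p ?q ?p' ?q' ?b \<alpha> h (gp t2 134) (gp t2 138)" using t2 unfolding ah gp_def by simp
    have fr2: "t2 (vn k) = s (vn k)" if "k < 120" for k
    proof -
      have "vn k \<notin> vn ` {130..179}" using that by auto
      then have "t2 (vn k) = s1 (vn k)" using t2 by blast
      then show ?thesis using fr1[OF that] by simp
    qed
    have g2: "gp t2 k = gp s k" if "k < 119" for k using that unfolding gp_def by (simp add: fr2)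
    have D2: "t2 (vn 0) = \<Delta>" "t2 (vn 1) = tau_norm \<Delta>" using fr2 i by auto
    define t where "t = sem inp step_init t2"
    let ?F = "\<lambda>v. qdiv (qmul \<Delta> (qconj \<Delta> (h, 1)) v) \<alpha>"
    have peh: "peval inp f (V 132, Const 1) = (f (vn 132), 1)" for f by (simp add: peval_def)
    have pvh: "pvars (V 132, Const 1) = {vn 132}" by (simp add: pvars_def)
    have psh: "psmall (V 132, Const 1)" by (simp add: psmall_def)
    have t: "t = (upd2 48 (?F (gp s 10)) (upd2 46 (?F (gp s 8)) (upd2 44 (gp t2 138) (upd2 42 (gp t2 134)
        (t2(vn 40 := \<alpha>, vn 41 := h))))))(vn 52 := qnorm \<Delta> (gp s 18), vn 53 := qnorm \<Delta> (gp s 16),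
        vn 54 := qnorm \<Delta> (gp s 18), vn 64 := 0)"
      unfolding t_def step_init_def using D2
      by (simp add: g2 ah peh pvh del: qmul.simps qconj.simps qdiv.simps qnorm.simps)
    have frt: "t (vn k) = s (vn k)" if "k < 40" for k unfolding t using that by (simp add: fr2)
    have gt: "gp t k = gp s k" if "k < 39" for k using that unfolding gp_def by (simp add: frt)
    have tv: "t (vn 40) = \<alpha>" "t (vn 41) = h" "gp t 42 = gp t2 134" "gp t 44 = gp t2 138" "gp t 46 = ?F (gp s 8)"
      "gp t 48 = ?F (gp s 10)" "t (vn 52) = qnorm \<Delta> (gp s 18)" "t (vn 53) = qnorm \<Delta> (gp s 16)" "t (vn 54) = qnorm \<Delta> (gp s 18)"
      "t (vn 64) = 0"
      unfolding t by simp_all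
    have \<alpha>0: "\<alpha> > 0" using dat unfolding ideal_data_def by blast
    have F: "elt \<Delta> (?F v) = omega \<alpha> h * elt \<Delta> v" if "elt \<Delta> v \<in> gen2 ?p ?q" for v
    proof (rule elt_qdiv)
      show "elt \<Delta> (qmul \<Delta> (qconj \<Delta> (h, 1)) v) = of_int \<alpha> * (omega \<alpha> h * elt \<Delta> v)"
        unfolding elt_mul elt_conj omega_def using \<alpha>0 by simp
      show "omega \<alpha> h * elt \<Delta> v \<in> \<O>" by (rule omega_times_ring[OF dat that])
    qed (use \<alpha>0 in simp)
    have e1: "1 < of_int \<lceil>\<delta>\<rceil> * cmod (?q * z - ?p)" using guard guard_iff[OF inv] by simp
    then have enz: "?q * z - ?p \<noteq> 0" by auto
    have small: "\<forall>v\<in>{P, Q, \<beta>, perr \<Delta> zeta w P Q, (qnorm \<Delta> (perr \<Delta> zeta w P Q), 0)}. \<bar>fst v\<bar> \<le> G \<and> \<bar>snd v\<bar> \<le> G"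
      if \<beta>: "\<beta> \<in> set bs" and d: "?p * elt \<Delta> Q - ?q * elt \<Delta> P = (-1) ^ N * elt \<Delta> \<beta>"
        and lt: "qnorm \<Delta> (perr \<Delta> zeta w P Q) < qnorm \<Delta> (perr \<Delta> zeta w (gp s 8) (gp s 10))" for P Q \<beta>
    proof -
      let ?e = "?q * z - ?p" and ?e' = "elt \<Delta> Q * z - elt \<Delta> P" and ?d = "of_int \<lceil>\<delta>\<rceil> :: real"
      have lt': "cmod ?e' < cmod ?e" using lt unfolding norm_less_iff .
      have "\<epsilon> ^ N \<le> 1" using eps by (intro power_le_one) auto
      then have e'1: "cmod ?e' \<le> 1" using lt' i(13) by linarith
      have "?e * elt \<Delta> Q = ?e' * ?q - (-1) ^ N * elt \<Delta> \<beta>" unfolding d[symmetric] by (simp add: algebra_simps)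
      then have "cmod ?e * cmod (elt \<Delta> Q) \<le> cmod ?e' * cmod ?q + cmod (elt \<Delta> \<beta>)"
        by (rule norm_sign_le[OF _ sg])
      also have "\<dots> \<le> cmod ?e * cmod ?q + \<mu>" using lt' \<mu>[OF \<beta>] by (intro add_mono mult_right_mono) auto
      also have "\<dots> \<le> \<mu> / (1 - \<epsilon>) + \<mu>" using i(14) by (simp add: mult.commute)
      finally have "cmod ?e * cmod (elt \<Delta> Q) \<le> \<mu> / (1 - \<epsilon>) + \<mu>" .
      then have "?d * (cmod ?e * cmod (elt \<Delta> Q)) \<le> ?d * (\<mu> + \<mu> / (1 - \<epsilon>))"
        using ceil_delta by (intro mult_left_mono) auto
      moreover have "1 * cmod (elt \<Delta> Q) \<le> (?d * cmod ?e) * cmod (elt \<Delta> Q)"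
        using e1 by (intro mult_right_mono) auto
      ultimately have Qb: "cmod (elt \<Delta> Q) \<le> (\<mu> + \<mu> / (1 - \<epsilon>)) * ?d" by (simp add: algebra_simps)
      have nn: "0 \<le> (\<mu> + \<mu> / (1 - \<epsilon>)) * ?d" using mu_nonneg eps ceil_delta by simp
      have "elt \<Delta> P = elt \<Delta> Q * z - ?e'" by simp
      then have "cmod (elt \<Delta> P) \<le> cmod (elt \<Delta> Q) * cmod z + cmod ?e'"
        using norm_triangle_ineq4[of "elt \<Delta> Q * z" ?e'] by (simp add: norm_mult)
      also have "\<dots> \<le> (\<mu> + \<mu> / (1 - \<epsilon>)) * ?d * cmod z + 1" using Qb e'1 by (intro add_mono mult_right_mono) auto
      also have "\<dots> \<le> (\<mu> + \<mu> / (1 - \<epsilon>)) * ?d * (1 + cmod z) + 1" using nn by (simp add: distrib_left)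
      finally have P: "cmod (elt \<Delta> P) \<le> M" using M(1) by simp
      have "(\<mu> + \<mu> / (1 - \<epsilon>)) * ?d * 1 \<le> (\<mu> + \<mu> / (1 - \<epsilon>)) * ?d * (1 + cmod z)" using nn by (intro mult_left_mono) auto
      then have Q: "cmod (elt \<Delta> Q) \<le> M" using Qb M(1) by linarith
      have "cmod (elt \<Delta> (perr \<Delta> zeta w P Q)) = \<bar>of_int w\<bar> * cmod ?e'" unfolding elt_perr by (simp add: norm_mult)
      also have "\<dots> \<le> \<bar>of_int w\<bar> * 1" using e'1 by (intro mult_left_mono) auto
      finally have Ew: "cmod (elt \<Delta> (perr \<Delta> zeta w P Q)) \<le> \<bar>of_int w\<bar>" by simp
      have "(cmod ?e')\<^sup>2 \<le> 1\<^sup>2" using e'1 by (intro power_mono) auto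
      then have "(of_int w)\<^sup>2 * (cmod ?e')\<^sup>2 \<le> (of_int w)\<^sup>2 * 1" by (intro mult_left_mono) auto
      then have "real_of_int (qnorm \<Delta> (perr \<Delta> zeta w P Q)) \<le> of_int (w * w)" unfolding qnorm_perr by (simp add: power2_eq_square)
      then have "qnorm \<Delta> (perr \<Delta> zeta w P Q) \<le> w * w" by (simp only: of_int_le_iff)
      then have "\<bar>qnorm \<Delta> (perr \<Delta> zeta w P Q)\<bar> \<le> G" using qnorm_nonneg[of "perr \<Delta> zeta w P Q"] X(4) XG by linarith
      moreover have "0 \<le> G" using XG X(1) by linarith
      ultimately show ?thesis
        using elt_bound[OF P] elt_bound[OF Q] elt_bound[of \<beta>] elt_bound[of "perr \<Delta> zeta w P Q"] \<mu>[OF \<beta>] M(2,3) Ew by simp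
    qed
    have bsnz: "elt \<Delta> \<beta> \<noteq> 0" if "\<beta> \<in> set bs" for \<beta> using bs_B(1)[OF that] bs_B(2) by metis
    have "elt \<Delta> (gp s 18) \<noteq> 0" unfolding i(8) elt_perr using enz w by simp
    then have "cf_step inp F J \<Delta> bs t ((-1) ^ N) G"
      using D2 i det bnz dat sg small bsnz J(1) F[OF gen2_left] F[OF gen2_right]
      by unfold_locales (simp_all add: frt gt tv inp read_cf_input)
    then have "?Q t" using frt tv by simp
    then show "ht ((G ^ growth step_copy) ^ growth check_prog) step_init t2 ?Q"
      by (intro ht_loop_free[OF _ ok2]) (simp_all add: step_init_def t_def psh)
  qed
qed


lemma writes_zero_range: "writes (zero_range a b) = vn ` {a..<b}"
proof -
  have "writes (seqs (map (\<lambda>i. asg i (Const 0)) is)) = vn ` set is" for "is" by (induction "is") auto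
  then show ?thesis unfolding zero_range_def by simp
qed

lemma writes_check: "writes check_prog \<subseteq> vn ` {40..<180}"
proof -
  have e: "writes euclid_prog \<subseteq> vn ` {40..<180}"
    unfolding euclid_prog_def euclid_body_def by simp
  have "writes add_row \<subseteq> vn ` {40..<180}"
    unfolding add_row_def row_load1_def row_load2_def row_store_def using e by simp
  then have "writes (row_prog r) \<subseteq> vn ` {40..<180}" for r unfolding row_prog_def by simp
  then have "writes (rows_prog rs) \<subseteq> vn ` {40..<180}" for rs unfolding rows_prog_def by (induction rs) auto
  then show ?thesis
    unfolding check_prog_def basis_prog_def test_prog_def basis_init_def basis_normalise_def test_init_def test_mid_def test_final_def
    using e by simp
qed

lemma writes_step_pre: "writes step_pre \<subseteq> vn ` {40..<180}"
  unfolding step_pre_def step_copy_def step_init_def using writes_check by simp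

lemma writes_den_loop: "writes den_loop \<subseteq> vn ` {40..<180}"
proof -
  have *: "writes (cand_prog i j) \<subseteq> vn ` {40..<180}" for i j
    unfolding cand_prog_def cand_init_def cand_test_def cand_copy_def cand_update_def
    using writes_check by (auto simp: writes_zero_range)
  have "writes (cands_prog ijs) \<subseteq> vn ` {40..<180}" for ijs
    unfolding cands_prog_def by (induction ijs) (simp_all add: split_def *)
  then show ?thesis unfolding den_loop_def den_body_def den_read_def den_lift_def
    by (auto simp: writes_zero_range)
qed

lemma fits_step: "fits L (G ^ growth step_prog)"
proof -
  have "growth step_prog \<le> growth main_loop" unfolding main_loop_def using expr_cost_pos by (simp add: Suc_le_eq)
  then have "G ^ growth step_prog \<le> G ^ growth main_loop" using XG X(1) by (intro power_increasing) auto
  also have "\<dots> = X ^ growth cf_prog" unfolding G_def cf_prog_def by (simp add: power_mult)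
  finally show ?thesis by (rule fits_mono[OF fits])
qed

lemma step_exec:
  assumes inv: "inv0 N s out a b" and guard: "guard s"
  shows "\<exists>k t a' b'. exec L inp step_prog s k (flatten [gp t 8, gp t 10]) t \<and>
    k \<le> (length bs + 1) * (F * pass_cost step_prog) \<and> inv0 (Suc N) t (out @ [gp t 8, gp t 10]) a' b'"
proof -
  let ?p = "elt \<Delta> (gp s 8)" and ?q = "elt \<Delta> (gp s 10)" and ?p' = "elt \<Delta> (gp s 12)" and ?q' = "elt \<Delta> (gp s 14)"
  let ?b = "elt \<Delta> (gp s 16)" let ?\<sigma> = "(-1) ^ N :: complex"
  have i: "bnd G s" "s (vn 0) = \<Delta>" "s (vn 1) = tau_norm \<Delta>" "gp s 2 = zeta" "s (vn 4) = w"
     "s (vn 5) = \<lceil>\<delta>\<rceil>" "s (vn 6) = int (length bs)"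
     "gp s 18 = perr \<Delta> zeta w (gp s 8) (gp s 10)" "qnorm \<Delta> (gp s 16) < 2 ^ J"
     "cf_state \<Delta> B \<epsilon> z N a b ?p ?q ?p' ?q'" "b N = ?b" "reduced_ideal \<Delta> (gen2 ?p ?q)"
     "cmod (?q * z - ?p) \<le> \<epsilon> ^ N" "cmod ?q * cmod (?q * z - ?p) \<le> \<mu> / (1 - \<epsilon>)" "gen2 ?p ?q \<inter> B \<noteq> {}"
     "map (elt \<Delta>) out = concat (map (\<lambda>n. [cf_p a b n, cf_q a b n]) [1..<Suc N])"
    using inv unfolding inv0_def by auto
  have sg: "?\<sigma> = 1 \<or> ?\<sigma> = -1" by (cases "even N") auto
  have G10: "10 \<le> G" and Gin: "input_bnd inp G" using XG X(1,2) input_bnd_mono by auto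
  have gpos: "1 \<le> growth step_pre" "1 \<le> growth den_loop" "1 \<le> growth step_post" "1 \<le> growth step_out"
    by (rule growth_pos)+
  define Y where "Y = G ^ growth step_pre"
  have GY: "G \<le> Y" unfolding Y_def using G10 gpos by (intro pow_ge_self) auto
  have gs: "growth step_prog = growth step_pre * (growth den_loop * (growth step_post * growth step_out))"
    by (simp add: step_prog_def)
  have fY: "fits L (Y ^ m)" if "m \<le> growth den_loop * (growth step_post * growth step_out)" for m
  proof -
    have "Y ^ m = G ^ (growth step_pre * m)" unfolding Y_def by (simp add: power_mult)
    also have "\<dots> \<le> G ^ growth step_prog" unfolding gs using G10 that by (intro power_increasing mult_le_mono2) auto
    finally show ?thesis by (rule fits_mono[OF fits_step])
  qed
  have "growth step_pre * 1 \<le> growth step_prog" unfolding gs using gpos by (intro mult_le_mono2) (simp add: Suc_le_eq)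
  then have "G ^ growth step_pre \<le> G ^ growth step_prog" using G10 by (intro power_increasing) auto
  then have "fits L (G ^ growth step_pre)" by (rule fits_mono[OF fits_step])
  then have "ok step_pre G s" unfolding ok_def using G10 Gin i(1) by simp
  from step_pre_ht[OF this inv guard] obtain k1 s1 where s1: "exec L inp step_pre s k1 [] s1" "k1 \<le> F * pass_cost step_pre"
      "bnd Y s1" "cf_step inp F J \<Delta> bs s1 ?\<sigma> G" and fr1: "\<And>k. k < 40 \<Longrightarrow> s1 (vn k) = s (vn k)"
      and s54: "s1 (vn 54) = s1 (vn 52)" "s1 (vn 64) = 0"
    unfolding ht_def Y_def by blast
  interpret S: cf_step L inp F J \<Delta> bs s1 ?\<sigma> G by (rule s1(4))
  have g1: "gp s1 k = gp s k" if "k < 39" for k using that unfolding gp_def by (simp add: fr1)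
  have S1: "gp s1 2 = zeta" "s1 (vn 4) = w" "gp s1 8 = gp s 8" "gp s1 10 = gp s 10" "gp s1 18 = perr \<Delta> zeta w (gp s 8) (gp s 10)"
    using i fr1 g1 by auto
  have inv0: "S.den_inv Y 0 s1" unfolding S.den_inv_def S.base_def S.best_def using s1 s54 by simp
  have Y10: "10 \<le> Y" "input_bnd inp Y" using G10 GY Gin input_bnd_mono by auto
  have "fits L (Y ^ growth den_loop)" by (rule fY) (use gpos in \<open>simp add: Suc_le_eq\<close>)
  from S.den_loop_exec[OF Y10 this GY inv0]
  obtain k2 s2 where s2: "exec L inp den_loop s1 k2 [] s2" "k2 \<le> (length bs + 1) * (F * pass_cost den_loop)"
    and inv2: "S.den_inv Y (length bs) s2" by auto
  have e1: "1 < of_int \<lceil>\<delta>\<rceil> * cmod (?q * z - ?p)" using guard guard_iff[OF inv] by simp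
  then have enz: "?q * z - ?p \<noteq> 0" by auto
  obtain P Q \<beta> where PQ: "P \<in> \<O>" "Q \<in> \<O>" "\<beta> \<in> B" "?p * Q - ?q * P = ?\<sigma> * \<beta>" "reduced_ideal \<Delta> (gen2 P Q)"
    "cmod (Q * z - P) \<le> \<epsilon> * cmod (?q * z - ?p)"
    using reduced_step_exists[OF adm ring_elt ring_elt i(12) i(15) enz sg] by metis
  obtain P0 where P0: "P = elt \<Delta> P0" using PQ(1) by (rule ringE)
  obtain Q0 where Q0: "Q = elt \<Delta> Q0" using PQ(2) by (rule ringE)
  obtain \<beta>0 where \<beta>0: "\<beta> = elt \<Delta> \<beta>0" "\<beta>0 \<in> set bs" using PQ(3) B by blast
  have gd0: "S.good P0 Q0 \<beta>0" unfolding S.good_def S1 using PQ P0 Q0 \<beta>0 by simp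
  obtain j where j: "j < length bs" "bs ! j = \<beta>0" using \<beta>0(2) by (meson in_set_conv_nth)
  define n where "n = s1 (vn 52)"
  have nn: "n = qnorm \<Delta> (perr \<Delta> zeta w (gp s 8) (gp s 10))" unfolding n_def S.norms S1 ..
  let ?E = "cmod (?q * z - ?p)"
  have nr: "real_of_int n = (of_int w)\<^sup>2 * ?E\<^sup>2" unfolding nn qnorm_perr ..
  have le0: "s2 (vn 54) \<le> qnorm \<Delta> (perr \<Delta> zeta w P0 Q0)"
    using inv2 gd0 j unfolding S.den_inv_def S1 by blast
  have "real_of_int (s2 (vn 54)) \<le> of_int (qnorm \<Delta> (perr \<Delta> zeta w P0 Q0))" using le0 by simp
  also have "\<dots> \<le> (of_int w)\<^sup>2 * (\<epsilon> * ?E)\<^sup>2"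
    unfolding qnorm_perr using PQ(6) P0 Q0 by (intro mult_left_mono power_mono) auto
  finally have le1: "real_of_int (s2 (vn 54)) \<le> (of_int w)\<^sup>2 * (\<epsilon> * ?E)\<^sup>2" .
  also have "\<dots> < (of_int w)\<^sup>2 * ?E\<^sup>2"
  proof -
    have "\<epsilon> * ?E < 1 * ?E" using eps enz by (intro mult_strict_right_mono) auto
    then have "(\<epsilon> * ?E)\<^sup>2 < ?E\<^sup>2" using eps by (intro power_strict_mono) auto
    then show ?thesis using w by simp
  qed
  finally have lt: "s2 (vn 54) < n" unfolding nr[symmetric] by (simp only: of_int_less_iff)
  define P1 Q1 \<beta>1 where new: "P1 = gp s2 56" "Q1 = gp s2 58" "\<beta>1 = gp s2 60"
  have bst: "S.good P1 Q1 \<beta>1" "s2 (vn 54) = qnorm \<Delta> (perr \<Delta> zeta w P1 Q1)" "gp s2 62 = perr \<Delta> zeta w P1 Q1"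
    using inv2 lt unfolding S.den_inv_def S.best_def n_def new S1 by blast+
  have gd1: "\<beta>1 \<in> set bs" "?p * elt \<Delta> Q1 - ?q * elt \<Delta> P1 = ?\<sigma> * elt \<Delta> \<beta>1" "reduced_ideal \<Delta> (gen2 (elt \<Delta> P1) (elt \<Delta> Q1))"
    using bst(1) unfolding S.good_def S1 by blast+
  have small1: "\<forall>v\<in>{P1, Q1, \<beta>1, perr \<Delta> zeta w P1 Q1, (qnorm \<Delta> (perr \<Delta> zeta w P1 Q1), 0)}. \<bar>fst v\<bar> \<le> G \<and> \<bar>snd v\<bar> \<le> G"
    using S.small[of \<beta>1 Q1 P1] gd1 lt unfolding S1 bst(2) nn by blast
  let ?E1 = "cmod (elt \<Delta> Q1 * z - elt \<Delta> P1)"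
  have E1: "?E1 \<le> \<epsilon> * ?E"
  proof -
    have "(of_int w)\<^sup>2 * ?E1\<^sup>2 \<le> (of_int w)\<^sup>2 * (\<epsilon> * ?E)\<^sup>2" using le1 unfolding bst(2) qnorm_perr .
    then have "?E1\<^sup>2 \<le> (\<epsilon> * ?E)\<^sup>2" using w by simp
    then show ?thesis by (rule power2_le_imp_le) (use eps in simp)
  qed
  have base2: "s2 (vn k) = s1 (vn k)" if "k < 54" for k using inv2 that unfolding S.den_inv_def S.base_def by blast
  have fr2: "s2 (vn k) = s (vn k)" if "k < 40" for k using base2 fr1 that by simp
  have g2: "gp s2 k = gp s k" if "k < 39" for k using that unfolding gp_def by (simp add: fr2)
  have fr2': "s2 x = s x" if "x \<notin> vn ` {40..<180}" for x
    using exec_frame[OF s1(1)] exec_frame[OF s2(1)] writes_step_pre writes_den_loop that by (metis subsetD)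
  define t where "t = sem inp step_post s2"
  have okp: "ok step_post Y s2"
    unfolding ok_def using Y10 inv2 fY[of "growth step_post"] gpos unfolding S.den_inv_def
    by (auto simp: Suc_le_eq)
  have lfp: "loop_free step_post" by (simp add: step_post_def loop_free_zero_range)
  obtain k3 where k3: "exec L inp step_post s2 k3 [] t" "k3 \<le> pass_cost step_post"
    using loop_free_exec[OF lfp okp] unfolding t_def by blast
  define s3 where "s3 = upd2 18 (perr \<Delta> zeta w P1 Q1) (upd2 16 \<beta>1 (upd2 10 Q1 (upd2 8 P1 (upd2 14 (gp s 10) (upd2 12 (gp s 8) s2)))))"
  have t: "t x = (if x \<in> vn ` {40..<180} then 0 else s3 x)" for x
    unfolding t_def step_post_def s3_def by (simp add: sem_zero_range g2 new bst(3))
  have tk: "t (vn k) = s3 (vn k)"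
    if "k < 40" for k unfolding t using that by simp
  have tg: "gp t k = gp s3 k" if "k < 39" for k
    unfolding gp_def[of t] gp_def[of s3] using that by (simp add: tk)
  have tv: "gp t 8 = P1" "gp t 10 = Q1" "gp t 12 = gp s 8" "gp t 14 = gp s 10" "gp t 16 = \<beta>1" "gp t 18 = perr \<Delta> zeta w P1 Q1"
    "gp t 2 = zeta" "t (vn 0) = \<Delta>" "t (vn 1) = tau_norm \<Delta>" "t (vn 4) = w" "t (vn 5) = \<lceil>\<delta>\<rceil>" "t (vn 6) = int (length bs)"
    using i fr2 g2 by (simp_all add: tg tk s3_def)
  have bt: "bnd G t"
    unfolding bnd_def
  proof
    fix x
    have sG: "\<bar>s x\<bar> \<le> G" "\<bar>s (vn k)\<bar> \<le> G" for x k using i(1) by (auto simp: bnd_def)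
    show "\<bar>t x\<bar> \<le> G"
    proof (cases "x \<in> vn ` {40..<180}")
      case True then show ?thesis using G10 by (simp add: t)
    next
      case False
      then show ?thesis using small1 sG fr2'[OF False] by (simp add: t s3_def upd2_def gp_def)
    qed
  qed
  have w4: "within_length L inp t (V 8)" "within_length L inp t (V 9)" "within_length L inp t (V 10)" "within_length L inp t (V 11)"
    by (rule ok_within[OF G10 Gin bt fits_step]; use growth_pos in simp)+
  have ex4: "exec L inp step_out t 8 (flatten [gp t 8, gp t 10]) t"
  proof -
    have "exec L inp step_out t ((1 + expr_cost (V 8)) + ((1 + expr_cost (V 9)) + ((1 + expr_cost (V 10)) + (1 + expr_cost (V 11)))))
      ([eval_expr inp t (V 8)] @ ([eval_expr inp t (V 9)] @ ([eval_expr inp t (V 10)] @ [eval_expr inp t (V 11)]))) t"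
      unfolding step_out_def
      by (rule exec.Seq[OF exec.Output[OF w4(1)] exec.Seq[OF exec.Output[OF w4(2)]
            exec.Seq[OF exec.Output[OF w4(3)] exec.Output[OF w4(4)]]]])
    then show ?thesis by (simp add: flatten_def gp_def numeral_eq_Suc)
  qed
  have ex: "exec L inp step_prog s (k1 + (k2 + (k3 + 8))) (flatten [gp t 8, gp t 10]) t"
    unfolding step_prog_def using exec.Seq[OF s1(1) exec.Seq[OF s2(1) exec.Seq[OF k3(1) ex4]]] by simp
  have cost: "k1 + (k2 + (k3 + 8)) \<le> (length bs + 1) * (F * pass_cost step_prog)"
  proof -
    have "1 * pass_cost step_post \<le> F * pass_cost step_post" "1 * pass_cost step_out \<le> F * pass_cost step_out"
      by (rule mult_le_mono1, use F in simp)+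
    moreover have "pass_cost step_out = 8" by (simp add: step_out_def)
    ultimately have "k3 + 8 \<le> F * pass_cost step_post + F * pass_cost step_out" using k3(2) by linarith
    then have "k1 + (k2 + (k3 + 8)) \<le> F * pass_cost step_pre + ((length bs + 1) * (F * pass_cost den_loop) + (F * pass_cost step_post + F * pass_cost step_out))"
      using s1(2) s2(2) by linarith
    also have "\<dots> \<le> (length bs + 1) * (F * pass_cost step_pre) + ((length bs + 1) * (F * pass_cost den_loop) +
        ((length bs + 1) * (F * pass_cost step_post) + (length bs + 1) * (F * pass_cost step_out)))"
      by (intro add_mono order_refl) simp_all
    also have "\<dots> = (length bs + 1) * (F * pass_cost step_prog)"
      unfolding step_prog_def pass_cost.simps by (simp only: distrib_left)
    finally show ?thesis .
  qed
  obtain a' b' where st: "cf_state \<Delta> B \<epsilon> z (Suc N) a' b' (elt \<Delta> P1) (elt \<Delta> Q1) ?p ?q" "b' (Suc N) = elt \<Delta> \<beta>1"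
    and old: "\<And>n. n \<le> N \<Longrightarrow> cf_mat a' b' n = cf_mat a b n"
    using cf_state_step[OF i(10) bs_B(2) ring_elt ring_elt ring_elt ring_elt bs_B(1)[OF gd1(1)] gd1(2,3) enz E1] by metis
  have outs: "map (elt \<Delta>) (out @ [P1, Q1]) = concat (map (\<lambda>n. [cf_p a' b' n, cf_q a' b' n]) [1..<Suc (Suc N)])"
  proof -
    have me: "map (\<lambda>n. [cf_p a' b' n, cf_q a' b' n]) [1..<Suc N] = map (\<lambda>n. [cf_p a b n, cf_q a b n]) [1..<Suc N]"
      by (rule map_cong) (auto simp: cf_p_def cf_q_def old)
    have upt: "[1..<Suc (Suc N)] = [1..<Suc N] @ [Suc N]" by simp
    have "cf_p a' b' (Suc N) = elt \<Delta> P1" "cf_q a' b' (Suc N) = elt \<Delta> Q1"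
      using st(1) unfolding cf_state_def cf_p_def cf_q_def by auto
    then show ?thesis unfolding upt map_append me concat_append i(16) by simp
  qed
  have mem: "gen2 (elt \<Delta> P1) (elt \<Delta> Q1) \<inter> B \<noteq> {}"
  proof -
    have "elt \<Delta> \<beta>1 = ?\<sigma> * (?\<sigma> * elt \<Delta> \<beta>1)" using sg by auto
    also have "\<dots> = (- ?\<sigma> * ?q) * elt \<Delta> P1 + (?\<sigma> * ?p) * elt \<Delta> Q1" unfolding gd1(2)[symmetric] by (simp add: algebra_simps)
    also have "\<dots> \<in> gen2 (elt \<Delta> P1) (elt \<Delta> Q1)"
    proof -
      have "?\<sigma> \<in> \<O>" using sg ring_uminus[OF ring_1] ring_1 by (elim disjE) (simp_all only:)
      then show ?thesis by (intro gen2I[OF _ _ refl] ring_mult ring_uminus ring_elt)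
    qed
    finally show ?thesis using bs_B(1)[OF gd1(1)] by blast
  qed
  have err: "?E1 \<le> \<epsilon> ^ Suc N"
  proof -
    have "\<epsilon> * ?E \<le> \<epsilon> * \<epsilon> ^ N" using i(13) eps by (intro mult_left_mono) auto
    then show ?thesis using E1 by simp
  qed
  have qe: "cmod (elt \<Delta> Q1) * ?E1 \<le> \<mu> / (1 - \<epsilon>)"
  proof -
    let ?e = "?q * z - ?p" and ?e' = "elt \<Delta> Q1 * z - elt \<Delta> P1"
    have "?e * elt \<Delta> Q1 = ?e' * ?q - ?\<sigma> * elt \<Delta> \<beta>1" unfolding gd1(2)[symmetric] by (simp add: algebra_simps)
    then have "?E * cmod (elt \<Delta> Q1) \<le> ?E1 * cmod ?q + cmod (elt \<Delta> \<beta>1)"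
      by (rule norm_sign_le[OF _ sg])
    also have "\<dots> \<le> \<epsilon> * ?E * cmod ?q + \<mu>" using E1 \<mu>[OF gd1(1)] by (intro add_mono mult_right_mono) auto
    also have "\<dots> = \<epsilon> * (cmod ?q * ?E) + \<mu>" by (simp add: algebra_simps)
    also have "\<dots> \<le> \<epsilon> * (\<mu> / (1 - \<epsilon>)) + \<mu>" using i(14) eps by (intro add_mono mult_left_mono) auto
    also have "\<dots> = \<mu> / (1 - \<epsilon>)" using eps by (simp add: field_simps)
    finally have 1: "?E * cmod (elt \<Delta> Q1) \<le> \<mu> / (1 - \<epsilon>)" .
    have "\<epsilon> * ?E \<le> 1 * ?E" using eps by (intro mult_right_mono) auto
    then have "?E1 \<le> ?E" using E1 by simp
    then have "cmod (elt \<Delta> Q1) * ?E1 \<le> cmod (elt \<Delta> Q1) * ?E" by (intro mult_left_mono) auto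
    then show ?thesis using 1 by (simp add: mult.commute)
  qed
  have "inv0 (Suc N) t (out @ [gp t 8, gp t 10]) a' b'"
    unfolding inv0_def tv using bt st outs mem err qe gd1 J(1) by simp
  then show ?thesis using ex cost by blast
qed

lemma main_loop_exec:
  assumes "inv0 N s out a b" "N \<le> K"
  shows "\<exists>k t out' N' a' b'. exec L inp main_loop s k (flatten out') t \<and>
    k \<le> (K - N + 1) * ((length bs + 1) * (F * pass_cost main_loop)) \<and> inv0 N' t (out @ out') a' b' \<and> \<not> guard t"
  using assms
proof (induction "K - N" arbitrary: N s out a b rule: less_induct)
  case less
  define c where "c = 1 + expr_cost (Add (Mul (V 4) (V 4)) (Const 1)) + expr_cost (Mul (Mul (V 5) (V 5)) (pnorm (pv 18)))"
  have pc: "pass_cost main_loop = c + pass_cost step_prog" by (simp add: main_loop_def c_def)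
  have G10: "10 \<le> G" and Gin: "input_bnd inp G" using XG X(1,2) input_bnd_mono by auto
  have fm: "fits L (G ^ growth main_loop)" using fits unfolding G_def cf_prog_def by (simp add: power_mult)
  have bG: "bnd G s" using less.prems unfolding inv0_def by blast
  have le: "expr_cost (Add (Mul (V 4) (V 4)) (Const 1)) \<le> growth main_loop"
    "expr_cost (Mul (Mul (V 5) (V 5)) (pnorm (pv 18))) \<le> growth main_loop"
    unfolding main_loop_def using growth_pos[of step_prog] expr_cost_pos[of "Add (Mul (V 4) (V 4)) (Const 1)"]
      expr_cost_pos[of "Mul (Mul (V 5) (V 5)) (pnorm (pv 18))"] by (simp_all del: expr_cost.simps)
  have wl: "within_length L inp s (Add (Mul (V 4) (V 4)) (Const 1))" "within_length L inp s (Mul (Mul (V 5) (V 5)) (pnorm (pv 18)))"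
    by (rule ok_within[OF G10 Gin bG fm _ le(1)], simp) (rule ok_within[OF G10 Gin bG fm _ le(2)], simp)
  have D: "s (vn 0) = \<Delta>" "s (vn 1) = tau_norm \<Delta>" using less.prems unfolding inv0_def by auto
  have ev: "eval_expr inp s (Add (Mul (V 4) (V 4)) (Const 1)) \<le> eval_expr inp s (Mul (Mul (V 5) (V 5)) (pnorm (pv 18))) \<longleftrightarrow> guard s"
    unfolding guard_def using D by simp
  have cF: "c \<le> F * c"
  proof -
    have "1 * c \<le> F * c" by (rule mult_le_mono1) (use F in simp)
    then show ?thesis by simp
  qed
  show ?case
  proof (cases "guard s")
    case False
    have "exec L inp main_loop s c [] s"
      unfolding main_loop_def c_def by (rule exec.WhileFalse[OF wl]) (unfold ev, rule False)
    moreover have "c \<le> (K - N + 1) * ((length bs + 1) * (F * pass_cost main_loop))"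
    proof -
      have "c \<le> F * pass_cost main_loop" using cF unfolding pc by (simp add: distrib_left trans_le_add1)
      also have "\<dots> \<le> (length bs + 1) * (F * pass_cost main_loop)" by simp
      also have "\<dots> \<le> (K - N + 1) * ((length bs + 1) * (F * pass_cost main_loop))" by simp
      finally show ?thesis .
    qed
    ultimately show ?thesis using less.prems False
      by (intro exI[of _ c] exI[of _ s] exI[of _ "[]"] exI[of _ N] exI[of _ a] exI[of _ b]) (simp add: flatten_def)
  next
    case True
    have "N < K"
    proof (rule ccontr)
      assume "\<not> N < K"
      then have "N = K" using less.prems by simp
      then have "cmod (elt \<Delta> (gp s 10) * z - elt \<Delta> (gp s 8)) \<le> \<epsilon> ^ K" using less.prems unfolding inv0_def by blast
      then have "of_int \<lceil>\<delta>\<rceil> * cmod (elt \<Delta> (gp s 10) * z - elt \<Delta> (gp s 8)) \<le> of_int \<lceil>\<delta>\<rceil> * \<epsilon> ^ K"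
        using ceil_delta by (intro mult_left_mono) auto
      then show False using K True guard_iff[OF less.prems(1)] by (simp add: mult.commute)
    qed
    obtain k t a1 b1 where t: "exec L inp step_prog s k (flatten [gp t 8, gp t 10]) t"
      "k \<le> (length bs + 1) * (F * pass_cost step_prog)" "inv0 (Suc N) t (out @ [gp t 8, gp t 10]) a1 b1"
      using step_exec[OF less.prems(1) True] by blast
    obtain k' u out' N' a' b' where u: "exec L inp main_loop t k' (flatten out') u"
      "k' \<le> (K - Suc N + 1) * ((length bs + 1) * (F * pass_cost main_loop))"
      "inv0 N' u ((out @ [gp t 8, gp t 10]) @ out') a' b'" "\<not> guard u"
      using less.hyps[OF _ t(3)] \<open>N < K\<close> by (metis Suc_leI diff_less_mono2 lessI)
    have "exec L inp main_loop s (c + k + k') (flatten [gp t 8, gp t 10] @ flatten out') u"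
      unfolding main_loop_def c_def
      by (rule exec.WhileTrue[OF wl _ t(1) u(1)[unfolded main_loop_def]]) (unfold ev, rule True)
    then have "exec L inp main_loop s (c + k + k') (flatten ([gp t 8, gp t 10] @ out')) u" unfolding flatten_append .
    moreover have "c + k + k' \<le> (K - N + 1) * ((length bs + 1) * (F * pass_cost main_loop))"
    proof -
      have "c \<le> (length bs + 1) * (F * c)" using cF by (simp add: trans_le_add1)
      then have "c + k \<le> (length bs + 1) * (F * pass_cost main_loop)" using t(2) unfolding pc by (simp only: distrib_left)
      moreover have "K - N + 1 = Suc (K - Suc N + 1)" using \<open>N < K\<close> by simp
      ultimately show ?thesis using u(2) by simp
    qed
    moreover have "inv0 N' u (out @ ([gp t 8, gp t 10] @ out')) a' b'" using u(3) by simp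
    ultimately show ?thesis using u(4) by blast
  qed
qed

lemma main_init_inv:
  defines "s \<equiv> sem inp main_init (\<lambda>_. 0)"
  shows "inv0 0 s [] (\<lambda>_. 0) (\<lambda>_. 1)" "\<exists>k. exec L inp main_init (\<lambda>_. 0) k [] s \<and> k \<le> pass_cost main_init"
proof -
  have lf: "loop_free main_init" by (simp add: main_init_def psmall_def)
  have "growth main_init \<le> growth cf_prog" unfolding cf_prog_def using growth_pos[of main_loop] by simp
  then have "X ^ growth main_init \<le> X ^ growth cf_prog" using X(1) by (intro power_increasing) auto
  then have "ok main_init X (\<lambda>_. 0)" unfolding ok_def using X fits_mono[OF fits] by (auto simp: bnd_def)
  from loop_free_exec[OF lf this] have ex: "\<exists>k. exec L inp main_init (\<lambda>_. 0) k [] s \<and> k \<le> pass_cost main_init" and bG: "bnd G s"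
    unfolding s_def G_def by blast+
  then show "\<exists>k. exec L inp main_init (\<lambda>_. 0) k [] s \<and> k \<le> pass_cost main_init" by blast
  have pe: "peval (cf_input \<Delta> bs x y w \<delta>) f (Sub (Input (Const 1)) (Mul (Input (Const 2)) (V 0)), Mul (Const 2) (Input (Const 2))) = (x - y * f (vn 0), 2 * y)" for f
    by (simp add: peval_def read_cf_input)
  have s: "s = (upd2 2 zeta (\<lambda>_. 0))(vn 0 := \<Delta>, vn 1 := tau_norm \<Delta>, vn 4 := w, vn 5 := \<lceil>\<delta>\<rceil>, vn 6 := int (length bs),
      vn 8 := 1, vn 14 := 1, vn 16 := 1, vn 18 := - w)"
    unfolding s_def main_init_def
    by (rule ext) (simp add: pvars_def pe inp read_cf_input[simplified] tau_norm_def upd2_def)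
  have v: "gp s 2 = zeta" "gp s 8 = (1, 0)" "gp s 10 = (0, 0)" "gp s 12 = (0, 0)" "gp s 14 = (1, 0)" "gp s 16 = (1, 0)" "gp s 18 = (- w, 0)"
    "s (vn 0) = \<Delta>" "s (vn 1) = tau_norm \<Delta>" "s (vn 4) = w" "s (vn 5) = \<lceil>\<delta>\<rceil>" "s (vn 6) = int (length bs)"
    unfolding s by (simp_all add: gp_def upd2_def)
  have gen: "gen2 1 0 = \<O>"
    using gen2_integral[of 1 0] gen2I[of _ 0 _ 1 0] by auto
  have e: "elt \<Delta> (1, 0) = 1" "elt \<Delta> (0, 0) = 0" by simp_all
  have Bne: "\<O> \<inter> B \<noteq> {}" using adm unfolding admissible_def by auto
  have run: "cf_state \<Delta> B \<epsilon> z 0 (\<lambda>_. 0) (\<lambda>_. 1) 1 0 0 1"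
    unfolding cf_state_def cf_run_def by (simp add: mat_def)
  have J1: "(1::int) < 2 ^ J" using J(2) by simp
  show "inv0 0 s [] (\<lambda>_. 0) (\<lambda>_. 1)"
    unfolding inv0_def v e using bG run J1 gen Bne ring_reduced mu_nonneg eps by (simp add: perr_def)
qed

lemma cf_prog_exec:
  "\<exists>N a b k out t p q. cf_run \<Delta> B \<epsilon> z N a b \<and> exec L inp cf_prog (\<lambda>_. 0) k (flatten out) t \<and>
     k \<le> (K + 2) * ((length bs + 1) * (F * pass_cost cf_prog)) \<and>
     map (elt \<Delta>) out = concat (map (\<lambda>n. [cf_p a b n, cf_q a b n]) [1..<Suc N]) \<and>
     p = cf_p a b N \<and> q = cf_q a b N \<and> p \<in> \<O> \<and> q \<in> \<O> \<and> q \<noteq> 0 \<and> cmod (q * z - p) \<le> 1 / \<delta>"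
proof -
  obtain k1 where k1: "exec L inp main_init (\<lambda>_. 0) k1 [] (sem inp main_init (\<lambda>_. 0))" "k1 \<le> pass_cost main_init"
    using main_init_inv(2) by blast
  obtain k2 t out N a b where t: "exec L inp main_loop (sem inp main_init (\<lambda>_. 0)) k2 (flatten out) t"
    "k2 \<le> (K - 0 + 1) * ((length bs + 1) * (F * pass_cost main_loop))" "inv0 N t ([] @ out) a b" "\<not> guard t"
    using main_loop_exec[OF main_init_inv(1)] by blast
  let ?p = "elt \<Delta> (gp t 8)" and ?q = "elt \<Delta> (gp t 10)"
  have ex: "exec L inp cf_prog (\<lambda>_. 0) (k1 + k2) (flatten out) t"
    unfolding cf_prog_def using exec.Seq[OF k1(1) t(1)] by simp
  have cost: "k1 + k2 \<le> (K + 2) * ((length bs + 1) * (F * pass_cost cf_prog))"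
  proof -
    have "1 * pass_cost main_init \<le> ((length bs + 1) * F) * pass_cost main_init" by (rule mult_le_mono1) (use F in simp)
    then have "k1 \<le> ((length bs + 1) * F) * pass_cost main_init" using k1(2) by linarith
    then have "k1 \<le> (length bs + 1) * (F * pass_cost main_init)" by (simp only: mult.assoc)
    also have "\<dots> \<le> (length bs + 1) * (F * pass_cost cf_prog)" by (intro mult_le_mono2) (simp add: cf_prog_def)
    finally have 1: "k1 \<le> (length bs + 1) * (F * pass_cost cf_prog)" .
    have "k2 \<le> (K + 1) * ((length bs + 1) * (F * pass_cost main_loop))" using t(2) by simp
    also have "\<dots> \<le> (K + 1) * ((length bs + 1) * (F * pass_cost cf_prog))" by (intro mult_le_mono2) (simp add: cf_prog_def)
    finally show ?thesis using 1 by simp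
  qed
  have st: "cf_state \<Delta> B \<epsilon> z N a b ?p ?q (elt \<Delta> (gp t 12)) (elt \<Delta> (gp t 14))"
    and out: "map (elt \<Delta>) out = concat (map (\<lambda>n. [cf_p a b n, cf_q a b n]) [1..<Suc N])"
    using t(3) unfolding inv0_def by auto
  have pq: "cf_p a b N = ?p" "cf_q a b N = ?q" using st unfolding cf_state_def cf_p_def cf_q_def by auto
  have "of_int \<lceil>\<delta>\<rceil> * cmod (?q * z - ?p) \<le> 1" using guard_iff[OF t(3)] t(4) by simp
  moreover have "\<delta> * cmod (?q * z - ?p) \<le> of_int \<lceil>\<delta>\<rceil> * cmod (?q * z - ?p)" using ceil_delta by (intro mult_right_mono) auto
  ultimately have "\<delta> * cmod (?q * z - ?p) \<le> 1" by linarith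
  then have small: "cmod (?q * z - ?p) \<le> 1 / \<delta>" using \<delta> by (simp add: field_simps)
  have "?q \<noteq> 0"
  proof
    assume q0: "?q = 0"
    then have "cmod ?p \<le> 1 / \<delta>" using small by simp
    also have "\<dots> < 1" using \<delta> by simp
    finally have "?p = 0" by (intro ring_small_eq_0) auto
    then show False using cf_state_det[OF st bs_B(2)] q0 by simp
  qed
  then show ?thesis
    using st ex cost out pq small unfolding cf_state_def
    by (intro exI[of _ N] exI[of _ a] exI[of _ b] exI[of _ "k1 + k2"] exI[of _ out] exI[of _ t] exI[of _ ?p] exI[of _ ?q]) simp
qed

end

context imag_quad
begin

lemma elt_coord_bounds:
  assumes "cmod (elt \<Delta> (u, v)) \<le> r"
  shows "\<bar>of_int v\<bar> * sqrt \<bar>of_int \<Delta>\<bar> \<le> 2 * r" "\<bar>of_int (2 * u + v * \<Delta>)\<bar> \<le> 2 * r"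
proof -
  have "\<bar>Im (elt \<Delta> (u, v))\<bar> \<le> r" using abs_Im_le_cmod[of "elt \<Delta> (u, v)"] assms by linarith
  then show "\<bar>of_int v\<bar> * sqrt \<bar>of_int \<Delta>\<bar> \<le> 2 * r" by (simp add: Im_tau abs_mult)
  have Re: "\<bar>Re (elt \<Delta> (u, v))\<bar> \<le> r" using abs_Re_le_cmod[of "elt \<Delta> (u, v)"] assms by linarith
  have eq: "Re (elt \<Delta> (u, v)) = of_int (2 * u + v * \<Delta>) / 2" by (simp add: Re_tau)
  show "\<bar>of_int (2 * u + v * \<Delta>)\<bar> \<le> 2 * r" using Re unfolding eq abs_divide by simp
qed

lemma sqrt_disc: "1 \<le> sqrt \<bar>of_int \<Delta>\<bar>" "sqrt \<bar>of_int \<Delta>\<bar> \<le> \<bar>of_int \<Delta>\<bar>" "3 \<le> \<bar>real_of_int \<Delta>\<bar>"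
proof -
  show d: "3 \<le> \<bar>real_of_int \<Delta>\<bar>" using disc_le by linarith
  then show 1: "1 \<le> sqrt \<bar>of_int \<Delta>\<bar>" by simp
  have "sqrt \<bar>of_int \<Delta>\<bar> * 1 \<le> sqrt \<bar>of_int \<Delta>\<bar> * sqrt \<bar>of_int \<Delta>\<bar>" using 1 by (intro mult_left_mono) auto
  then show "sqrt \<bar>of_int \<Delta>\<bar> \<le> \<bar>of_int \<Delta>\<bar>" by simp
qed

lemma elt_coord_le:
  assumes "cmod (elt \<Delta> v) \<le> r"
  shows "\<bar>of_int (fst v)\<bar> \<le> r * (1 + \<bar>of_int \<Delta>\<bar>)" "\<bar>of_int (snd v)\<bar> \<le> r * (1 + \<bar>of_int \<Delta>\<bar>)"
proof -
  obtain a b where v: "v = (a, b)" by (cases v)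
  have r: "0 \<le> r" using assms norm_ge_zero order_trans by blast
  note c = elt_coord_bounds[OF assms[unfolded v]]
  have "\<bar>of_int b\<bar> * 1 \<le> \<bar>of_int b\<bar> * sqrt \<bar>of_int \<Delta>\<bar>" using sqrt_disc by (intro mult_left_mono) auto
  then have b: "\<bar>real_of_int b\<bar> \<le> 2 * r" using c(1) by linarith
  have "2 * r \<le> r * (1 + \<bar>of_int \<Delta>\<bar>)" using sqrt_disc(3) r mult_left_mono[of 2 "1 + \<bar>of_int \<Delta>\<bar>" r] by simp
  then show "\<bar>of_int (snd v)\<bar> \<le> r * (1 + \<bar>of_int \<Delta>\<bar>)" using b v by simp
  have "\<bar>real_of_int (b * \<Delta>)\<bar> \<le> 2 * r * \<bar>of_int \<Delta>\<bar>" using b by (simp add: abs_mult mult_right_mono)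
  moreover have "real_of_int (2 * a + b * \<Delta>) = 2 * of_int a + of_int (b * \<Delta>)" by simp
  ultimately have "2 * \<bar>real_of_int a\<bar> \<le> 2 * r + 2 * r * \<bar>of_int \<Delta>\<bar>" using c(2) by linarith
  then show "\<bar>of_int (fst v)\<bar> \<le> r * (1 + \<bar>of_int \<Delta>\<bar>)" using v by (simp add: algebra_simps)
qed

lemma card_short_vectors:
  assumes "distinct bs" "C > 0" "\<And>\<beta>. \<beta> \<in> set bs \<Longrightarrow> cmod (elt \<Delta> \<beta>) \<le> C * sqrt \<bar>of_int \<Delta>\<bar>"
  shows "real (length bs) \<le> (4 * C * sqrt \<bar>of_int \<Delta>\<bar> + 1) * (4 * C + 1)"
proof -
  let ?d = "sqrt \<bar>real_of_int \<Delta>\<bar>"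
  define a where "a = \<lfloor>2 * C * ?d\<rfloor>"
  define b where "b = \<lfloor>2 * C\<rfloor>"
  have ab: "0 \<le> a" "0 \<le> b" unfolding a_def b_def using assms(2) by auto
  define \<phi> where "\<phi> = (\<lambda>(u, v). (2 * u + v * \<Delta>, v))"
  have "inj_on \<phi> (set bs)" unfolding \<phi>_def by (auto intro!: inj_onI)
  moreover have "\<phi> ` set bs \<subseteq> {-a..a} \<times> {-b..b}"
  proof
    fix y assume "y \<in> \<phi> ` set bs"
    then obtain u v where uv: "(u, v) \<in> set bs" "y = (2 * u + v * \<Delta>, v)" unfolding \<phi>_def by auto
    note c = elt_coord_bounds[OF assms(3)[OF uv(1)]]
    have "\<bar>real_of_int v\<bar> * ?d \<le> (2 * C) * ?d" using c(1) by simp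
    then have "\<bar>real_of_int v\<bar> \<le> 2 * C" by (rule mult_right_le_imp_le) (use sqrt_disc(1) in linarith)
    then have "\<bar>v\<bar> \<le> b" unfolding b_def by (simp add: le_floor_iff)
    moreover have "real_of_int \<bar>2 * u + v * \<Delta>\<bar> \<le> 2 * C * ?d" using c(2) by simp
    then have "\<bar>2 * u + v * \<Delta>\<bar> \<le> a" unfolding a_def by (simp only: le_floor_iff)
    ultimately show "y \<in> {-a..a} \<times> {-b..b}" unfolding uv by auto
  qed
  ultimately have "card (set bs) \<le> card ({-a..a} \<times> {-b..b})" by (intro card_inj_on_le) auto
  then have "length bs \<le> nat (2 * a + 1) * nat (2 * b + 1)" using distinct_card[OF assms(1)] by simp
  then have "real (length bs) \<le> real (nat (2 * a + 1) * nat (2 * b + 1))" by (simp only: of_nat_le_iff)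
  also have "\<dots> = (2 * of_int a + 1) * (2 * of_int b + 1)" using ab by simp
  also have "\<dots> \<le> (4 * C * ?d + 1) * (4 * C + 1)"
  proof (rule mult_mono)
    show "2 * real_of_int a + 1 \<le> 4 * C * ?d + 1" unfolding a_def using of_int_floor_le[of "2 * C * ?d"] by linarith
    show "2 * real_of_int b + 1 \<le> 4 * C + 1" unfolding b_def using of_int_floor_le[of "2 * C"] by linarith
  qed (use assms(2) ab in auto)
  finally show ?thesis .
qed

end

lemma int_length_le:
  assumes "v \<noteq> 0"
  shows "real (int_length v) \<le> ln \<bar>of_int v\<bar> / ln 2 + 2"
proof -
  have "bitlen \<bar>v\<bar> = \<lfloor>log 2 \<bar>of_int v\<bar>\<rfloor> + 1" using assms by (simp add: bitlen_alt_def)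
  then have "real (nat (bitlen \<bar>v\<bar>)) \<le> log 2 \<bar>of_int v\<bar> + 1"
    using bitlen_nonneg[of "\<bar>v\<bar>"] of_int_floor_le[of "log 2 \<bar>of_int v\<bar>"] by simp
  then show ?thesis unfolding int_length_def by (simp add: log_def)
qed

lemma abs_less_two_power: "int_length v \<le> l \<Longrightarrow> \<bar>v\<bar> \<le> 2 ^ l"
proof (cases "v = 0")
  case False
  assume "int_length v \<le> l"
  then have "nat (bitlen \<bar>v\<bar>) \<le> l" unfolding int_length_def by simp
  then have "(2::int) ^ nat (bitlen \<bar>v\<bar>) \<le> 2 ^ l" by (intro power_increasing) auto
  moreover have "\<bar>v\<bar> < 2 ^ nat (bitlen \<bar>v\<bar>)" using bitlen_bounds[of "\<bar>v\<bar>"] False by simp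
  ultimately show ?thesis by linarith
qed simp

lemma fits_power:
  assumes "1 \<le> X" "real n * ln (of_int X) / ln 2 + 2 \<le> L"
  shows "fits L (X ^ n)"
  unfolding fits_def
proof (intro allI impI)
  fix v :: int assume v: "\<bar>v\<bar> \<le> X ^ n"
  have X: "0 \<le> real n * ln (of_int X) / ln 2" using assms(1) by simp
  show "real (int_length v) \<le> L"
  proof (cases "v = 0")
    case True
    then show ?thesis using assms(2) X by (simp add: int_length_def)
  next
    case False
    have "real_of_int \<bar>v\<bar> \<le> of_int (X ^ n)" using v by (simp only: of_int_le_iff)
    then have "\<bar>real_of_int v\<bar> \<le> of_int X ^ n" by simp
    then have "ln \<bar>real_of_int v\<bar> \<le> ln (of_int X ^ n)" using False by (intro ln_mono) auto
    also have "\<dots> = real n * ln (of_int X)" using assms(1) by (simp add: ln_realpow)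
    finally have "ln \<bar>real_of_int v\<bar> / ln 2 \<le> real n * ln (of_int X) / ln 2" by (intro divide_right_mono) auto
    then show ?thesis using int_length_le[OF False] assms(2) by linarith
  qed
qed

lemma ln_3_ge: "(1::real) \<le> ln 3"
proof -
  have "exp 1 \<le> (3::real)" by (rule exp_le)
  then show ?thesis by (simp add: ln_ge_iff)
qed

definition op_const :: "real \<Rightarrow> real \<Rightarrow> real" where
  "op_const \<epsilon> C = (2 / ln (1 / \<epsilon>) + 3 / ln 2) * ((4 * C + 1)\<^sup>2 + 1) * (2 * log 2 (C\<^sup>2 + 2) + 2 / ln 2 + 6) *
     real (pass_cost cf_prog)"

definition size_coeff :: "real \<Rightarrow> real \<Rightarrow> real" where
  "size_coeff \<epsilon> C = 2 * (6 * (C + C / (1 - \<epsilon>)) + 2 + C) + (4 * C + 1)\<^sup>2 + 10"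

definition length_const :: "real \<Rightarrow> real \<Rightarrow> real" where
  "length_const \<epsilon> C = real (growth cf_prog) * (ln (2 * size_coeff \<epsilon> C) + 4) / ln 2 + 2"

locale cf_input_data = imag_quad \<Delta> for \<Delta> +
  fixes \<epsilon> C :: real and B :: "complex set" and bs :: "(int \<times> int) list" and z :: complex and x y w :: int
    and l :: nat and \<delta> :: real
  assumes C: "0 < C" and adm: "admissible \<Delta> B \<epsilon>" and Max: "Max (cmod ` B) \<le> C * sqrt \<bar>of_int \<Delta>\<bar>"
    and bs: "distinct bs" "elt \<Delta> ` set bs = B"
    and w: "w \<noteq> 0" and z: "z = (of_int x + of_int y * csqrt (of_int \<Delta>)) / of_int w"
    and l: "l = int_length x + int_length y + int_length w" and \<delta>: "2 \<le> \<delta>"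
begin

abbreviation d :: real where "d \<equiv> \<bar>of_int \<Delta>\<bar>"
definition T :: real where "T = 2 ^ l * \<delta> * d"

abbreviation coef :: real where "coef \<equiv> size_coeff \<epsilon> C"

definition mu :: real where "mu = C * sqrt d"
definition Mb :: real where
  "Mb = (mu + mu / (1 - \<epsilon>)) * of_int \<lceil>\<delta>\<rceil> * (1 + cmod z) + 1 + mu + \<bar>of_int w\<bar>"
definition Xb :: int where "Xb = \<lceil>coef * T ^ 4\<rceil>"

lemma eps: "0 < \<epsilon>" "\<epsilon> < 1" using adm by (auto simp: admissible_def)

lemma bs_le: "\<beta> \<in> set bs \<Longrightarrow> cmod (elt \<Delta> \<beta>) \<le> mu"
proof -
  assume "\<beta> \<in> set bs"
  then have "elt \<Delta> \<beta> \<in> B" using bs by auto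
  moreover have "finite B" using adm by (simp add: admissible_def)
  ultimately have "cmod (elt \<Delta> \<beta>) \<le> Max (cmod ` B)" by (intro Max_ge) auto
  then show ?thesis using Max unfolding mu_def by linarith
qed

lemma T_bounds: "1 \<le> T" "2 ^ l \<le> T" "\<delta> \<le> T" "d \<le> T" "2 ^ l * d \<le> T"
proof -
  have p: "(1::real) \<le> 2 ^ l" by simp
  have d: "3 \<le> d" by (rule sqrt_disc)
  have a: "1 \<le> 2 ^ l * \<delta>" "2 ^ l \<le> 2 ^ l * \<delta>" "\<delta> \<le> 2 ^ l * \<delta>"
    using p \<delta> mult_mono[OF p, of 1 \<delta>] by auto
  have "v * 1 \<le> (2 ^ l * \<delta>) * d" if "v \<le> 2 ^ l * \<delta>" for v
    by (rule mult_mono) (use that d a(1) in linarith)+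
  then show "1 \<le> T" "2 ^ l \<le> T" "\<delta> \<le> T" unfolding T_def using a by force+
  show "d \<le> T" unfolding T_def using mult_right_mono[OF a(1), of d] d by simp
  show "2 ^ l * d \<le> T" unfolding T_def using mult_right_mono[OF a(2), of d] d by simp
qed

lemma T_pow: "1 \<le> T ^ n" "m \<le> n \<Longrightarrow> T ^ m \<le> T ^ n"
  using T_bounds(1) by (auto intro: one_le_power power_increasing)

lemma xyw: "\<bar>of_int x\<bar> \<le> (2::real) ^ l" "\<bar>of_int y\<bar> \<le> (2::real) ^ l" "\<bar>of_int w\<bar> \<le> (2::real) ^ l"
proof -
  have "\<bar>v\<bar> \<le> 2 ^ l \<Longrightarrow> \<bar>real_of_int v\<bar> \<le> 2 ^ l" for v
    by (metis of_int_abs of_int_le_iff of_int_numeral of_int_power)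
  then show "\<bar>of_int x\<bar> \<le> (2::real) ^ l" "\<bar>of_int y\<bar> \<le> (2::real) ^ l" "\<bar>of_int w\<bar> \<le> (2::real) ^ l"
    using abs_less_two_power[of _ l] unfolding l by auto
qed

lemma z_bound: "1 + cmod z \<le> 3 * T"
proof -
  have d: "3 \<le> d" by (rule sqrt_disc)
  have cs: "cmod (csqrt (of_int \<Delta>)) = sqrt d" by (simp add: norm_csqrt)
  have "cmod z = cmod (of_int x + of_int y * csqrt (of_int \<Delta>)) / \<bar>of_int w\<bar>" unfolding z by (simp add: norm_divide)
  also have "\<dots> \<le> cmod (of_int x + of_int y * csqrt (of_int \<Delta>)) / 1"
    using w by (intro divide_left_mono) auto
  also have "\<dots> \<le> \<bar>of_int x\<bar> + \<bar>of_int y\<bar> * sqrt d"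
    using norm_triangle_ineq[of "of_int x" "of_int y * csqrt (of_int \<Delta>)"] cs by (simp add: norm_mult)
  also have "\<dots> \<le> 2 ^ l + 2 ^ l * d"
    using xyw sqrt_disc by (intro add_mono mult_mono) auto
  also have "\<dots> \<le> T + T" using T_bounds by (intro add_mono) auto
  finally show ?thesis using T_bounds(1) by linarith
qed

lemma ceil_bound: "of_int \<lceil>\<delta>\<rceil> \<le> 2 * \<delta>" "0 < \<lceil>\<delta>\<rceil>"
  using \<delta> by linarith+

lemma mu_bound: "0 \<le> mu" "mu \<le> C * T"
  unfolding mu_def using C sqrt_disc T_bounds(4) by (auto intro!: mult_left_mono)

lemma Mb_bound: "0 \<le> Mb" "Mb \<le> (6 * (C + C / (1 - \<epsilon>)) + 2 + C) * T ^ 3"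
proof -
  have e: "0 < 1 - \<epsilon>" using eps by simp
  let ?A = "C + C / (1 - \<epsilon>)"
  have A: "0 \<le> ?A" using C e by simp
  have 1: "mu + mu / (1 - \<epsilon>) \<le> ?A * T"
  proof -
    have "mu / (1 - \<epsilon>) \<le> C * T / (1 - \<epsilon>)" using mu_bound e by (intro divide_right_mono) auto
    then show ?thesis using mu_bound by (simp add: algebra_simps)
  qed
  have 0: "0 \<le> mu + mu / (1 - \<epsilon>)" using mu_bound e by simp
  have 2: "of_int \<lceil>\<delta>\<rceil> \<le> 2 * T" using ceil_bound T_bounds by linarith
  have "(mu + mu / (1 - \<epsilon>)) * of_int \<lceil>\<delta>\<rceil> * (1 + cmod z) \<le> (?A * T) * (2 * T) * (3 * T)"
    using 0 1 2 z_bound A T_bounds ceil_bound by (intro mult_mono) auto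
  also have "\<dots> = 6 * ?A * T ^ 3" by (simp add: power3_eq_cube algebra_simps)
  finally have 3: "(mu + mu / (1 - \<epsilon>)) * of_int \<lceil>\<delta>\<rceil> * (1 + cmod z) \<le> 6 * ?A * T ^ 3" .
  have T3: "T \<le> T ^ 3" using T_pow(2)[of 1 3] by simp
  have "mu \<le> C * T ^ 3" using mu_bound T3 C mult_left_mono[of T "T ^ 3" C] by linarith
  moreover have "\<bar>of_int w\<bar> \<le> T ^ 3" using xyw(3) T_bounds(2) T3 by linarith
  ultimately have "Mb \<le> 6 * ?A * T ^ 3 + T ^ 3 + C * T ^ 3 + T ^ 3"
    unfolding Mb_def using 3 T_pow(1)[of 3] by linarith
  also have "\<dots> = (6 * ?A + 2 + C) * T ^ 3" by (simp add: algebra_simps)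
  finally show "Mb \<le> (6 * ?A + 2 + C) * T ^ 3" .
  show "0 \<le> Mb" unfolding Mb_def using mu_bound ceil_bound(2) e by (intro add_nonneg_nonneg mult_nonneg_nonneg) auto
qed

lemma coef_parts:
  assumes "v \<le> 2 * (6 * (C + C / (1 - \<epsilon>)) + 2 + C) * T ^ 4 \<or> v \<le> (4 * C + 1)\<^sup>2 * T ^ 4 \<or> v \<le> 10 * T ^ 4"
  shows "v \<le> of_int Xb"
proof -
  have e: "0 < 1 - \<epsilon>" using eps by simp
  have p: "0 \<le> 2 * (6 * (C + C / (1 - \<epsilon>)) + 2 + C) * T ^ 4" "0 \<le> (4 * C + 1)\<^sup>2 * T ^ 4" "0 \<le> 10 * T ^ 4"
    using C e T_pow(1)[of 4] by (auto intro!: mult_nonneg_nonneg add_nonneg_nonneg)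
  have "v \<le> 2 * (6 * (C + C / (1 - \<epsilon>)) + 2 + C) * T ^ 4 + (4 * C + 1)\<^sup>2 * T ^ 4 + 10 * T ^ 4" using assms p by linarith
  also have "\<dots> = coef * T ^ 4" unfolding size_coeff_def by (simp add: algebra_simps)
  also have "\<dots> \<le> of_int Xb" unfolding Xb_def by (rule le_of_int_ceiling)
  finally show ?thesis .
qed

lemma coord_X: "cmod (elt \<Delta> v) \<le> Mb \<Longrightarrow> \<bar>fst v\<bar> \<le> Xb \<and> \<bar>snd v\<bar> \<le> Xb"
proof -
  assume v: "cmod (elt \<Delta> v) \<le> Mb"
  have "1 + d \<le> 2 * T" using T_bounds by linarith
  then have "Mb * (1 + d) \<le> ((6 * (C + C / (1 - \<epsilon>)) + 2 + C) * T ^ 3) * (2 * T)"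
    using Mb_bound T_bounds by (intro mult_mono) auto
  also have "\<dots> = 2 * (6 * (C + C / (1 - \<epsilon>)) + 2 + C) * T ^ 4" by (simp add: power_def numeral_eq_Suc algebra_simps)
  finally have "Mb * (1 + d) \<le> of_int Xb" by (intro coef_parts) simp
  then have "\<bar>real_of_int (fst v)\<bar> \<le> of_int Xb" "\<bar>real_of_int (snd v)\<bar> \<le> of_int Xb"
    using elt_coord_le[OF v] by linarith+
  then show ?thesis by linarith
qed

lemma T_X: "v \<le> 10 * T \<Longrightarrow> v \<le> of_int Xb"
  using T_pow(2)[of 1 4] by (intro coef_parts) auto

lemma length_bs: "real (length bs) + 1 \<le> ((4 * C + 1)\<^sup>2 + 1) * sqrt d"
proof -
  have "real (length bs) \<le> (4 * C * sqrt d + 1) * (4 * C + 1)"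
    using bs_le unfolding mu_def by (intro card_short_vectors bs C)
  also have "\<dots> \<le> ((4 * C + 1) * sqrt d) * (4 * C + 1)"
    using C sqrt_disc(1) by (intro mult_right_mono) (auto simp: algebra_simps)
  finally have "real (length bs) \<le> ((4 * C + 1) * sqrt d) * (4 * C + 1)" .
  moreover have "((4 * C + 1)\<^sup>2 + 1) * sqrt d = ((4 * C + 1) * sqrt d) * (4 * C + 1) + sqrt d"
    by (simp add: power2_eq_square algebra_simps)
  ultimately show ?thesis using sqrt_disc(1) by linarith
qed

lemma input_Xb: "input_bnd (cf_input \<Delta> bs x y w \<delta>) Xb"
proof -
  have 0: "0 \<le> Xb" using coef_parts[of 0] T_pow(1)[of 4] by simp
  have mem: "\<bar>v\<bar> \<le> Xb" if "v \<in> set (cf_input \<Delta> bs x y w \<delta>)" for v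
  proof -
    have "v \<in> {\<Delta>, x, y, w, \<lceil>\<delta>\<rceil>, int (length bs)} \<or> (\<exists>\<beta>\<in>set bs. v = fst \<beta> \<or> v = snd \<beta>)"
      using that unfolding cf_input_def flatten_def by force
    moreover have "\<bar>v\<bar> \<le> Xb" if "\<beta> \<in> set bs" "v = fst \<beta> \<or> v = snd \<beta>" for \<beta>
    proof -
      have "0 \<le> (mu + mu / (1 - \<epsilon>)) * of_int \<lceil>\<delta>\<rceil> * (1 + cmod z)"
        using mu_bound eps ceil_bound(2) by (intro mult_nonneg_nonneg add_nonneg_nonneg) auto
      then have "mu \<le> Mb" unfolding Mb_def using mu_bound by linarith
      then show ?thesis using coord_X[of \<beta>] bs_le[OF that(1)] that(2) by auto
    qed
    moreover have "\<bar>v\<bar> \<le> Xb" if "v \<in> {\<Delta>, x, y, w, \<lceil>\<delta>\<rceil>}"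
    proof -
      have "\<bar>real_of_int v\<bar> \<le> 10 * T" using that xyw T_bounds ceil_bound by auto
      then have "\<bar>real_of_int v\<bar> \<le> of_int Xb" by (rule T_X)
      then show ?thesis by linarith
    qed
    moreover have "\<bar>int (length bs)\<bar> \<le> Xb"
    proof -
      have "real (length bs) \<le> (4 * C * sqrt d + 1) * (4 * C + 1)"
        using bs_le unfolding mu_def by (intro card_short_vectors bs C)
      also have "\<dots> \<le> ((4 * C + 1) * T ^ 4) * (4 * C + 1)"
      proof (rule mult_right_mono)
        have "sqrt d \<le> T ^ 4" using sqrt_disc(2) T_bounds(4) T_pow(2)[of 1 4] by simp
        then have "4 * C * sqrt d \<le> 4 * C * T ^ 4" using C by (intro mult_left_mono) auto
        then show "4 * C * sqrt d + 1 \<le> (4 * C + 1) * T ^ 4" using T_pow(1)[of 4] by (simp add: algebra_simps)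
      qed (use C in simp)
      also have "\<dots> = (4 * C + 1)\<^sup>2 * T ^ 4" by (simp add: power2_eq_square)
      finally have "real (length bs) \<le> of_int Xb" by (intro coef_parts) simp
      then show ?thesis by linarith
    qed
    ultimately show ?thesis by blast
  qed
  show ?thesis
    unfolding input_bnd_def read_input_def using mem 0 by (auto intro!: mem nth_mem)
qed

lemma coef_ge: "10 \<le> coef"
  unfolding size_coeff_def using C eps by simp

lemma lam: "1 \<le> ln (\<delta> * d)"
proof -
  have "3 \<le> \<delta> * d" using mult_mono[of 1 \<delta> 3 d] \<delta> sqrt_disc(3) by simp
  then have "ln 3 \<le> ln (\<delta> * d)" by (intro ln_mono) auto
  then show ?thesis using ln_3_ge by linarith
qed

lemma Xb_ge: "10 \<le> Xb"
proof -
  have "(10::real) \<le> of_int Xb" by (rule T_X) (use T_bounds(1) in linarith)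
  then show ?thesis by linarith
qed

lemma ln_Xb: "ln (of_int Xb) \<le> (ln (2 * coef) + 4) * (real l + ln (\<delta> * d))"
proof -
  have T: "0 < T" using T_bounds(1) by linarith
  have c1: "1 \<le> coef * T ^ 4" using mult_mono[of 1 coef 1 "T ^ 4"] coef_ge T_pow(1)[of 4] by simp
  have "of_int Xb \<le> coef * T ^ 4 + 1" unfolding Xb_def by linarith
  also have "\<dots> \<le> 2 * coef * T ^ 4" using c1 by simp
  finally have le: "of_int Xb \<le> 2 * coef * T ^ 4" .
  have X0: "0 < real_of_int Xb" using c1 le_of_int_ceiling[of "coef * T ^ 4"] unfolding Xb_def by linarith
  have "ln (of_int Xb) \<le> ln (2 * coef * T ^ 4)" using le X0 by (intro ln_mono) auto
  also have "\<dots> = ln (2 * coef) + 4 * ln T" using coef_ge T by (simp add: ln_mult ln_realpow)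
  also have "ln T = real l * ln 2 + ln (\<delta> * d)"
    unfolding T_def using \<delta> sqrt_disc(3) by (simp add: ln_mult ln_realpow)
  also have "ln (2 * coef) + 4 * (real l * ln 2 + ln (\<delta> * d)) \<le> ln (2 * coef) * (real l + ln (\<delta> * d)) + 4 * (real l + ln (\<delta> * d))"
  proof (rule add_mono)
    have "0 \<le> ln (2 * coef)" using coef_ge by simp
    then show "ln (2 * coef) \<le> ln (2 * coef) * (real l + ln (\<delta> * d))"
      using lam mult_left_mono[of 1 "real l + ln (\<delta> * d)" "ln (2 * coef)"] by simp
    have "real l * ln 2 \<le> real l * 1" using ln_2_less_1 by (intro mult_left_mono) auto
    then show "4 * (real l * ln 2 + ln (\<delta> * d)) \<le> 4 * (real l + ln (\<delta> * d))" by simp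
  qed
  finally show ?thesis by (simp add: distrib_right)
qed

definition Jb :: nat where "Jb = nat \<lceil>log 2 (C\<^sup>2 * d + 2)\<rceil> + 1"
definition Kb :: nat where "Kb = nat \<lceil>ln (2 * \<delta>) / ln (1 / \<epsilon>)\<rceil>"

lemma Jb_bounds: "C\<^sup>2 * d < 2 ^ Jb" "real (2 * Jb + 2) \<le> (2 * log 2 (C\<^sup>2 + 2) + 2 / ln 2 + 6) * ln d"
proof -
  let ?c = "C\<^sup>2 * d + 2"
  have c2: "2 \<le> ?c" by simp
  have lg: "1 \<le> log 2 ?c" by (subst le_log_iff) (use c2 in \<open>linarith | simp\<close>)+
  have c0: "0 < ?c" using c2 by linarith
  then have "?c = 2 powr (log 2 ?c)" by simp
  also have "\<dots> \<le> 2 powr (real Jb)"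
    unfolding Jb_def using lg by (intro powr_mono) (auto simp: le_nat_iff, linarith)
  also have "\<dots> = 2 ^ Jb" by (simp add: powr_realpow)
  finally show "C\<^sup>2 * d < 2 ^ Jb" by simp
  have "real Jb \<le> log 2 ?c + 2" unfolding Jb_def using lg by linarith
  moreover have "log 2 ?c \<le> log 2 ((C\<^sup>2 + 2) * d)"
  proof (rule log_mono[OF _ c0])
    show "?c \<le> (C\<^sup>2 + 2) * d" using sqrt_disc(3) by (simp add: distrib_right)
  qed simp
  moreover have "log 2 ((C\<^sup>2 + 2) * d) = log 2 (C\<^sup>2 + 2) + ln d / ln 2"
  proof -
    have "0 < C\<^sup>2 + 2" using zero_le_power2[of C] by linarith
    then show ?thesis using sqrt_disc(3) by (subst log_mult) (auto simp: log_def)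
  qed
  ultimately have "real (2 * Jb + 2) \<le> 2 * log 2 (C\<^sup>2 + 2) + 6 + 2 * (ln d / ln 2)" by simp
  also have "\<dots> \<le> (2 * log 2 (C\<^sup>2 + 2) + 6) * ln d + 2 / ln 2 * ln d"
  proof (rule add_mono)
    have "1 \<le> ln d" using ln_mono[of 3 d] ln_3_ge sqrt_disc(3) by linarith
    moreover have "0 \<le> log 2 (C\<^sup>2 + 2)"
      by (subst zero_le_log_cancel_iff) (use zero_le_power2[of C] in \<open>linarith | simp\<close>)+
    ultimately show "2 * log 2 (C\<^sup>2 + 2) + 6 \<le> (2 * log 2 (C\<^sup>2 + 2) + 6) * ln d"
      using mult_left_mono[of 1 "ln d" "2 * log 2 (C\<^sup>2 + 2) + 6"] by simp
  qed simp
  also have "\<dots> = (2 * log 2 (C\<^sup>2 + 2) + 2 / ln 2 + 6) * ln d" by (simp add: algebra_simps)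
  finally show "real (2 * Jb + 2) \<le> (2 * log 2 (C\<^sup>2 + 2) + 2 / ln 2 + 6) * ln d" .
qed

lemma Kb_bounds: "\<epsilon> ^ Kb * of_int \<lceil>\<delta>\<rceil> \<le> 1" "real (Kb + 2) \<le> (2 / ln (1 / \<epsilon>) + 3 / ln 2) * ln \<delta>"
proof -
  have le: "0 < ln (1 / \<epsilon>)" using eps by simp
  have l2: "0 < ln (2 * \<delta>)" using \<delta> by simp
  have "ln (2 * \<delta>) / ln (1 / \<epsilon>) \<le> real Kb" unfolding Kb_def by linarith
  then have "ln (2 * \<delta>) \<le> real Kb * ln (1 / \<epsilon>)" using le by (simp add: field_simps)
  also have "\<dots> = - ln (\<epsilon> ^ Kb)" using eps by (simp add: ln_realpow ln_div)
  finally have "ln (\<epsilon> ^ Kb * (2 * \<delta>)) \<le> 0" using eps \<delta> by (simp add: ln_mult)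
  then have "\<epsilon> ^ Kb * (2 * \<delta>) \<le> 1" using eps \<delta> by (simp add: ln_le_zero_iff)
  moreover have "\<epsilon> ^ Kb * of_int \<lceil>\<delta>\<rceil> \<le> \<epsilon> ^ Kb * (2 * \<delta>)" using eps ceil_bound by (intro mult_left_mono) auto
  ultimately show "\<epsilon> ^ Kb * of_int \<lceil>\<delta>\<rceil> \<le> 1" by linarith
  have "0 \<le> ln (2 * \<delta>) / ln (1 / \<epsilon>)" using le l2 by simp
  then have "real Kb \<le> ln (2 * \<delta>) / ln (1 / \<epsilon>) + 1" unfolding Kb_def by linarith
  moreover have "ln (2 * \<delta>) / ln (1 / \<epsilon>) \<le> 2 * ln \<delta> / ln (1 / \<epsilon>)"
  proof (rule divide_right_mono)
    have "ln 2 \<le> ln \<delta>" using \<delta> by (intro ln_mono) auto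
    then show "ln (2 * \<delta>) \<le> 2 * ln \<delta>" using \<delta> by (simp add: ln_mult)
  qed (use le in simp)
  moreover have "3 \<le> 3 / ln 2 * ln \<delta>"
  proof -
    have "ln 2 \<le> ln \<delta>" using \<delta> by (intro ln_mono) auto
    then show ?thesis by (simp add: field_simps)
  qed
  ultimately have "real (Kb + 2) \<le> 2 * ln \<delta> / ln (1 / \<epsilon>) + 3 / ln 2 * ln \<delta>" by simp
  also have "\<dots> = (2 / ln (1 / \<epsilon>) + 3 / ln 2) * ln \<delta>" by (simp add: algebra_simps)
  finally show "real (Kb + 2) \<le> (2 / ln (1 / \<epsilon>) + 3 / ln 2) * ln \<delta>" .
qed

lemma cf_global_instance:
  assumes "fits L (Xb ^ growth cf_prog)"
  shows "cf_global L (cf_input \<Delta> bs x y w \<delta>) (2 * Jb + 2) Jb \<Delta> B \<epsilon> bs z x y w \<delta> mu Mb Xb Kb"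
proof unfold_locales
  show "qnorm \<Delta> \<beta> < 2 ^ Jb" if "\<beta> \<in> set bs" for \<beta>
  proof -
    have "real_of_int (qnorm \<Delta> \<beta>) \<le> mu\<^sup>2"
      unfolding cmod_elt_sq[symmetric] using bs_le[OF that] by (intro power_mono) auto
    also have "\<dots> = C\<^sup>2 * d" unfolding mu_def by (simp add: power_mult_distrib)
    also have "\<dots> < 2 ^ Jb" by (rule Jb_bounds)
    finally have "real_of_int (qnorm \<Delta> \<beta>) < real_of_int (2 ^ Jb)" by simp
    then show ?thesis by (simp only: of_int_less_iff)
  qed
  show "w * w \<le> Xb"
  proof -
    have "\<bar>of_int w\<bar> * \<bar>of_int w\<bar> \<le> T * T" using xyw(3) T_bounds by (intro mult_mono) auto
    also have "\<dots> \<le> 10 * T ^ 4" using T_pow(2)[of 2 4] T_pow(1)[of 4] by (simp add: power2_eq_square)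
    finally have "real_of_int (w * w) \<le> of_int Xb" by (intro coef_parts) simp
    then show ?thesis by (simp only: of_int_le_iff)
  qed
  have nn: "0 \<le> (mu + mu / (1 - \<epsilon>)) * of_int \<lceil>\<delta>\<rceil> * (1 + cmod z)"
    using mu_bound eps ceil_bound(2) by (intro mult_nonneg_nonneg add_nonneg_nonneg) auto
  show "(mu + mu / (1 - \<epsilon>)) * of_int \<lceil>\<delta>\<rceil> * (1 + cmod z) + 1 \<le> Mb" "mu \<le> Mb" "\<bar>of_int w\<bar> \<le> Mb"
    unfolding Mb_def using nn mu_bound by linarith+
qed (use assms adm bs w z \<delta> bs_le Xb_ge input_Xb coord_X Kb_bounds in \<open>auto simp: Jb_def\<close>)

lemma cf_prog_correct:
  "\<exists>N a b k out t p q.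
     cf_run \<Delta> B \<epsilon> z N a b \<and>
     exec (length_const \<epsilon> C * (real l + ln (\<delta> * d))) (cf_input \<Delta> bs x y w \<delta>) cf_prog (\<lambda>_. 0) k (flatten out) t \<and>
     real k \<le> op_const \<epsilon> C * (sqrt d * ln d * ln \<delta>) \<and>
     map (elt \<Delta>) out = concat (map (\<lambda>n. [cf_p a b n, cf_q a b n]) [1..<Suc N]) \<and>
     p = cf_p a b N \<and> q = cf_q a b N \<and>
     p \<in> quad_ring \<Delta> \<and> q \<in> quad_ring \<Delta> \<and> q \<noteq> 0 \<and> cmod (q * z - p) \<le> 1 / \<delta>"
proof -
  let ?\<Lambda> = "real l + ln (\<delta> * d)"
  have "fits (length_const \<epsilon> C * ?\<Lambda>) (Xb ^ growth cf_prog)"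
  proof (rule fits_power)
    have "real (growth cf_prog) * ln (of_int Xb) / ln 2 \<le> real (growth cf_prog) * ((ln (2 * coef) + 4) * ?\<Lambda>) / ln 2"
      by (intro divide_right_mono mult_left_mono ln_Xb) auto
    then show "real (growth cf_prog) * ln (of_int Xb) / ln 2 + 2 \<le> length_const \<epsilon> C * ?\<Lambda>"
      unfolding length_const_def using lam by (simp add: distrib_right mult.assoc)
  qed (use Xb_ge in simp)
  from cf_global_instance[OF this]
  interpret R: cf_global "length_const \<epsilon> C * ?\<Lambda>" "cf_input \<Delta> bs x y w \<delta>" "2 * Jb + 2" Jb \<Delta> B \<epsilon> bs z x y w \<delta> mu Mb Xb Kb .
  have "real k \<le> op_const \<epsilon> C * (sqrt d * ln d * ln \<delta>)"
    if k: "k \<le> (Kb + 2) * ((length bs + 1) * ((2 * Jb + 2) * pass_cost cf_prog))" for k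
  proof -
    have "real k \<le> real ((Kb + 2) * ((length bs + 1) * ((2 * Jb + 2) * pass_cost cf_prog)))" using k by (simp only: of_nat_le_iff)
    also have "\<dots> = real (Kb + 2) * ((real (length bs) + 1) * (real (2 * Jb + 2) * real (pass_cost cf_prog)))"
      by (simp only: of_nat_mult of_nat_add of_nat_1)
    also have "\<dots> \<le> ((2 / ln (1 / \<epsilon>) + 3 / ln 2) * ln \<delta>) * ((((4 * C + 1)\<^sup>2 + 1) * sqrt d) *
        (((2 * log 2 (C\<^sup>2 + 2) + 2 / ln 2 + 6) * ln d) * real (pass_cost cf_prog)))"
      by (intro mult_mono Kb_bounds(2) length_bs Jb_bounds(2) order_refl order_trans[OF _ Kb_bounds(2)]
          order_trans[OF _ length_bs] mult_nonneg_nonneg order_trans[OF _ Jb_bounds(2)]) auto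
    also have "\<dots> = op_const \<epsilon> C * (sqrt d * ln d * ln \<delta>)" by (simp only: op_const_def mult_ac)
    finally show ?thesis .
  qed
  then show ?thesis using R.cf_prog_exec by blast
qed

end

theorem theorem5p4:
  shows "\<exists>alg :: prog. \<forall>(\<epsilon>::real) (C::real). 0 < \<epsilon> \<and> \<epsilon> < 1 \<and> 0 < C \<longrightarrow>
    (\<exists>(K\<^sub>1::real) (K\<^sub>2::real).
      \<forall>(\<Delta>::int) (B::complex set) (bs::(int \<times> int) list)
        (z::complex) (x::int) (y::int) (w::int) (l::nat) (\<delta>::real).
        imag_quad_discriminant \<Delta> \<and>
        admissible \<Delta> B \<epsilon> \<and> Max (cmod ` B) \<le> C * sqrt \<bar>of_int \<Delta>\<bar> \<and>
        distinct bs \<and> elt \<Delta> ` set bs = B \<and>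
        w \<noteq> 0 \<and> z = (of_int x + of_int y * csqrt (of_int \<Delta>)) / of_int w \<and>
        l = int_length x + int_length y + int_length w \<and>
        2 \<le> \<delta> \<longrightarrow>
        (\<exists>N a b k out t p q.
          cf_run \<Delta> B \<epsilon> z N a b \<and>
          exec (K\<^sub>2 * (real l + ln (\<delta> * \<bar>of_int \<Delta>\<bar>))) (cf_input \<Delta> bs x y w \<delta>)
            alg (\<lambda>_. 0) k (flatten out) t \<and>
          real k \<le> K\<^sub>1 * (sqrt \<bar>of_int \<Delta>\<bar> * ln \<bar>of_int \<Delta>\<bar> * ln \<delta>) \<and>
          map (elt \<Delta>) out = concat (map (\<lambda>n. [cf_p a b n, cf_q a b n]) [1..<Suc N]) \<and>
          p = cf_p a b N \<and> q = cf_q a b N \<and>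
          p \<in> quad_ring \<Delta> \<and> q \<in> quad_ring \<Delta> \<and> q \<noteq> 0 \<and> cmod (q * z - p) \<le> 1 / \<delta>))"
proof (intro exI[of _ cf_prog] allI impI, goal_cases)
  case (1 \<epsilon> C)
  show ?case
  proof (rule exI[of _ "op_const \<epsilon> C"], rule exI[of _ "length_const \<epsilon> C"], intro allI impI, goal_cases)
    case (1 \<Delta> B bs z x y w l \<delta>)
    interpret cf_input_data \<Delta> \<epsilon> C B bs z x y w l \<delta>
      by unfold_locales (use 1 \<open>0 < \<epsilon> \<and> \<epsilon> < 1 \<and> 0 < C\<close> in blast)+
    show ?case by (rule cf_prog_correct)
  qed
qed

end
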